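(* Let $X$ be a Banach space and let $E$ be a nonzero Banach lattice with a weak unit that does not contain any (isomorphic) copy of $c_0$. Represent $E$ as a function lattice on a probability space $(\Omega,\Sigma,\lambda)$ with $L^\infty(\lambda)\subset E\subset L^1(\lambda)$, and let $E(X)$ be the associated space of $X$-valued functions. Then $X$ has property (V$^*$) if and only if $E(X)$ has property (V$^*$).
   Context: A series $\sum x_n$ in a Banach space $Z$ is weakly unconditionally Cauchy (W.U.C.) if $\sum|z^*(x_n)|<\infty$ for every $z^*\in Z^*$. A subset $K$ of a Banach space $Z$ is a (V$^*$)-set if for every W.U.C. series $\sum_{n} z_n^*$ in $Z^*$ one has $\lim_{n\to\infty}\sup_{z\in K}|z_n^*(z)|=0$. A Banach space $Z$ has property (V$^*$) if every (V$^*$)-set in $Z$ is relatively weakly compact. Representation: by the classical representation theorem, a Banach lattice $E$ with weak unit containing no copy of $c_0$ can be identified (as a Banach lattice) with an order ideal of $L^1(\lambda)$ for some probability space $(\Omega,\Sigma,\lambda)$, such that $L^\infty(\lambda)\subset E\subset L^1(\lambda)$ with continuous inclusions. Fix such a representation. $E(X)$ is the space of (classes of $\lambda$-a.e. equal) strongly measurable maps $f:\Omega\to X$ such that the function $V(f)(\omega)=\|f(\omega)\|_X$ belongs to $E$, with the norm $\|f\|=\|V(f)\|_E$; it is a Banach space. For example, for $E=L^1(\lambda)$ this is the Bochner space $L^1(\lambda,X)$. *)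

theory Defs
  imports "HOL-Probability.Probability" "HOL-Library.Lattice_Algebras"
begin

text \<open>
  All spaces are real. The space \<open>E(X)\<close> depends on a measure and on a representation of \<open>E\<close>, so
  it is not a type; normed spaces are therefore records with an explicit carrier, and every
  Banach space notion below is defined once, for such records. All operations are meaningful
  on the carrier only.
\<close>

record 'a nspace =
  vcarrier :: "'a set"
  vzero :: 'a
  vadd :: "'a \<Rightarrow> 'a \<Rightarrow> 'a"
  vscale :: "real \<Rightarrow> 'a \<Rightarrow> 'a"
  vnorm :: "'a \<Rightarrow> real"

definition type_space :: "'a::real_normed_vector nspace" where
  "type_space = \<lparr>vcarrier = UNIV, vzero = 0, vadd = (+), vscale = (*\<^sub>R), vnorm = norm\<rparr>"

definition c0_space :: "(nat \<Rightarrow> real) nspace" where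
  "c0_space =
    \<lparr>vcarrier = {x. x \<longlonglongrightarrow> 0},
     vzero = (\<lambda>n. 0),
     vadd = (\<lambda>x y n. x n + y n),
     vscale = (\<lambda>c x n. c * x n),
     vnorm = (\<lambda>x. SUP n. \<bar>x n\<bar>)\<rparr>"

definition linear_between :: "'a nspace \<Rightarrow> 'b nspace \<Rightarrow> ('a \<Rightarrow> 'b) \<Rightarrow> bool" where
  "linear_between Y Z T \<longleftrightarrow>
     (\<forall>x\<in>vcarrier Y. T x \<in> vcarrier Z) \<and>
     (\<forall>x\<in>vcarrier Y. \<forall>y\<in>vcarrier Y. T (vadd Y x y) = vadd Z (T x) (T y)) \<and>
     (\<forall>c. \<forall>x\<in>vcarrier Y. T (vscale Y c x) = vscale Z c (T x))"

definition contains_copy_of :: "'a nspace \<Rightarrow> 'b nspace \<Rightarrow> bool" where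
  "contains_copy_of Z Y \<longleftrightarrow>
     (\<exists>T a b. 0 < a \<and> linear_between Y Z T \<and>
        (\<forall>y\<in>vcarrier Y. a * vnorm Y y \<le> vnorm Z (T y) \<and> vnorm Z (T y) \<le> b * vnorm Y y))"

text \<open>
  Functionals are normalised to be \<open>0\<close> outside the carrier, so that two functionals agreeing
  on the carrier are equal.
\<close>

definition dual :: "'a nspace \<Rightarrow> ('a \<Rightarrow> real) nspace" where
  "dual Z =
    \<lparr>vcarrier = {\<phi>. linear_between Z type_space \<phi> \<and>
                     (\<exists>C. \<forall>x\<in>vcarrier Z. \<bar>\<phi> x\<bar> \<le> C * vnorm Z x) \<and>
                     (\<forall>x. x \<notin> vcarrier Z \<longrightarrow> \<phi> x = 0)},
     vzero = (\<lambda>x. 0),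
     vadd = (\<lambda>\<phi> \<psi> x. \<phi> x + \<psi> x),
     vscale = (\<lambda>c \<phi> x. c * \<phi> x),
     vnorm = (\<lambda>\<phi>. SUP x\<in>{x \<in> vcarrier Z. vnorm Z x \<le> 1}. \<bar>\<phi> x\<bar>)\<rparr>"

definition weak_topology :: "'a nspace \<Rightarrow> 'a topology" where
  "weak_topology Z =
     topology_generated_by
       {{x \<in> vcarrier Z. \<phi> x \<in> U} | \<phi> U. \<phi> \<in> vcarrier (dual Z) \<and> open U}"

definition relatively_weakly_compact :: "'a nspace \<Rightarrow> 'a set \<Rightarrow> bool" where
  "relatively_weakly_compact Z K \<longleftrightarrow>
     K \<subseteq> vcarrier Z \<and> compactin (weak_topology Z) (weak_topology Z closure_of K)"

definition wuc :: "'a nspace \<Rightarrow> (nat \<Rightarrow> 'a) \<Rightarrow> bool" where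
  "wuc Z x \<longleftrightarrow>
     (\<forall>n. x n \<in> vcarrier Z) \<and> (\<forall>\<phi>\<in>vcarrier (dual Z). summable (\<lambda>n. \<bar>\<phi> (x n)\<bar>))"

text \<open>
  The supremum is taken in \<open>ennreal\<close>: it is \<open>\<infinity>\<close> if the functional is unbounded on \<open>K\<close>.
\<close>

definition Vstar_set :: "'a nspace \<Rightarrow> 'a set \<Rightarrow> bool" where
  "Vstar_set Z K \<longleftrightarrow>
     K \<subseteq> vcarrier Z \<and>
     (\<forall>\<zeta>. wuc (dual Z) \<zeta> \<longrightarrow> (\<lambda>n. SUP z\<in>K. ennreal \<bar>\<zeta> n z\<bar>) \<longlonglongrightarrow> 0)"

definition property_Vstar :: "'a nspace \<Rightarrow> bool" where
  "property_Vstar Z \<longleftrightarrow> (\<forall>K. Vstar_set Z K \<longrightarrow> relatively_weakly_compact Z K)"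

class banach_lattice = banach + ordered_real_vector + lattice_ab_group_add_abs +
  assumes lattice_norm: "\<bar>x\<bar> \<le> \<bar>y\<bar> \<Longrightarrow> norm x \<le> norm y"

definition weak_unit :: "'e::banach_lattice \<Rightarrow> bool" where
  "weak_unit e \<longleftrightarrow> 0 \<le> e \<and> (\<forall>x. inf e \<bar>x\<bar> = 0 \<longrightarrow> x = 0)"

text \<open>
  \<open>R\<close> identifies \<open>E\<close>, as a Banach lattice, with an order ideal of \<open>L\<^sup>1(M)\<close> such that
  \<open>L\<^sup>\<infinity>(M) \<subseteq> E \<subseteq> L\<^sup>1(M)\<close> with continuous inclusions: \<open>R u\<close> is a representative of the class
  corresponding to \<open>u\<close>, and the norm of that class in the function lattice is \<open>norm u\<close>.
\<close>

definition function_lattice_representation ::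
    "'w measure \<Rightarrow> ('e::banach_lattice \<Rightarrow> 'w \<Rightarrow> real) \<Rightarrow> bool" where
  "function_lattice_representation M R \<longleftrightarrow>
     (\<forall>u. integrable M (R u)) \<and>
     (\<forall>u v. AE \<omega> in M. R (u + v) \<omega> = R u \<omega> + R v \<omega>) \<and>
     (\<forall>c u. AE \<omega> in M. R (c *\<^sub>R u) \<omega> = c * R u \<omega>) \<and>
     (\<forall>u v. AE \<omega> in M. R (sup u v) \<omega> = max (R u \<omega>) (R v \<omega>)) \<and>
     (\<forall>u v. AE \<omega> in M. R (inf u v) \<omega> = min (R u \<omega>) (R v \<omega>)) \<and>
     (\<forall>u. (AE \<omega> in M. R u \<omega> = 0) \<longrightarrow> u = 0) \<and>
     (\<forall>u. \<forall>f\<in>borel_measurable M.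
        (AE \<omega> in M. \<bar>f \<omega>\<bar> \<le> \<bar>R u \<omega>\<bar>) \<longrightarrow> (\<exists>v. AE \<omega> in M. R v \<omega> = f \<omega>)) \<and>
     (\<forall>C. \<forall>f\<in>borel_measurable M.
        (AE \<omega> in M. \<bar>f \<omega>\<bar> \<le> C) \<longrightarrow> (\<exists>v. AE \<omega> in M. R v \<omega> = f \<omega>)) \<and>
     (\<exists>K. \<forall>u C. (AE \<omega> in M. \<bar>R u \<omega>\<bar> \<le> C) \<longrightarrow> norm u \<le> K * C) \<and>
     (\<exists>K. \<forall>u. (\<integral>\<omega>. \<bar>R u \<omega>\<bar> \<partial>M) \<le> K * norm u)"

text \<open>
  Bochner's strong measurability. The library's \<open>borel_measurable\<close> does not provide
  essentially separable range when the target space is not separable.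
\<close>

definition strongly_measurable ::
    "'w measure \<Rightarrow> ('w \<Rightarrow> 'x::real_normed_vector) \<Rightarrow> bool" where
  "strongly_measurable M f \<longleftrightarrow>
     (\<exists>s. (\<forall>n. simple_function M (s n)) \<and> (AE \<omega> in M. (\<lambda>n. s n \<omega>) \<longlonglongrightarrow> f \<omega>))"

definition ae_class :: "'w measure \<Rightarrow> ('w \<Rightarrow> 'x) \<Rightarrow> ('w \<Rightarrow> 'x) set" where
  "ae_class M f = {g. AE \<omega> in M. g \<omega> = f \<omega>}"

text \<open>
  \<open>E(X)\<close>, whose elements are a.e. classes. The witness \<open>u\<close> below is the element \<open>V(f)\<close> of \<open>E\<close>.
\<close>

definition vector_valued_space ::
    "'w measure \<Rightarrow> ('e::banach_lattice \<Rightarrow> 'w \<Rightarrow> real) \<Rightarrow>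
     ('w \<Rightarrow> 'x::real_normed_vector) set nspace" where
  "vector_valued_space M R =
    \<lparr>vcarrier = {ae_class M f | f.
                   strongly_measurable M f \<and> (\<exists>u. AE \<omega> in M. R u \<omega> = norm (f \<omega>))},
     vzero = ae_class M (\<lambda>\<omega>. 0),
     vadd = (\<lambda>A B. {h. \<exists>f\<in>A. \<exists>g\<in>B. AE \<omega> in M. h \<omega> = f \<omega> + g \<omega>}),
     vscale = (\<lambda>c A. {h. \<exists>f\<in>A. AE \<omega> in M. h \<omega> = c *\<^sub>R f \<omega>}),
     vnorm = (\<lambda>A. norm (THE u. \<exists>f\<in>A. AE \<omega> in M. R u \<omega> = norm (f \<omega>)))\<rparr>"

lemma vcarrier_dual_type_space:
  "vcarrier (dual (type_space :: 'a::real_normed_vector nspace)) = {\<phi>. bounded_linear \<phi>}"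
proof -
  have "(\<exists>C. \<forall>x. \<bar>\<phi> x\<bar> \<le> C * norm x) \<longleftrightarrow> (\<exists>C. \<forall>x. norm (\<phi> x) \<le> norm x * C)"
    for \<phi> :: "'a \<Rightarrow> real"
    by (simp add: mult.commute)
  then show ?thesis
    unfolding dual_def linear_between_def type_space_def
    by (auto simp: bounded_linear_def bounded_linear_axioms_def linear_iff)
qed

lemma vadd_ae_class:
  "vadd (vector_valued_space M R) (ae_class M f) (ae_class M g) = ae_class M (\<lambda>\<omega>. f \<omega> + g \<omega>)"
proof (intro set_eqI iffI)
  fix h assume "h \<in> vadd (vector_valued_space M R) (ae_class M f) (ae_class M g)"
  then obtain f' g' where "AE \<omega> in M. f' \<omega> = f \<omega>" "AE \<omega> in M. g' \<omega> = g \<omega>"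
      "AE \<omega> in M. h \<omega> = f' \<omega> + g' \<omega>"
    by (auto simp: vector_valued_space_def ae_class_def)
  then have "AE \<omega> in M. h \<omega> = f \<omega> + g \<omega>"
    by eventually_elim simp
  then show "h \<in> ae_class M (\<lambda>\<omega>. f \<omega> + g \<omega>)"
    by (simp add: ae_class_def)
next
  fix h assume "h \<in> ae_class M (\<lambda>\<omega>. f \<omega> + g \<omega>)"
  then show "h \<in> vadd (vector_valued_space M R) (ae_class M f) (ae_class M g)"
    unfolding vector_valued_space_def ae_class_def
    by (simp, intro exI[of _ f] exI[of _ g] conjI) simp_all
qed

lemma vscale_ae_class:
  "vscale (vector_valued_space M R) c (ae_class M f) = ae_class M (\<lambda>\<omega>. c *\<^sub>R f \<omega>)"
proof (intro set_eqI iffI)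
  fix h assume "h \<in> vscale (vector_valued_space M R) c (ae_class M f)"
  then obtain f' where "AE \<omega> in M. f' \<omega> = f \<omega>" "AE \<omega> in M. h \<omega> = c *\<^sub>R f' \<omega>"
    by (auto simp: vector_valued_space_def ae_class_def)
  then have "AE \<omega> in M. h \<omega> = c *\<^sub>R f \<omega>"
    by eventually_elim simp
  then show "h \<in> ae_class M (\<lambda>\<omega>. c *\<^sub>R f \<omega>)"
    by (simp add: ae_class_def)
next
  fix h assume "h \<in> ae_class M (\<lambda>\<omega>. c *\<^sub>R f \<omega>)"
  then show "h \<in> vscale (vector_valued_space M R) c (ae_class M f)"
    unfolding vector_valued_space_def ae_class_def
    by (simp, intro exI[of _ f] conjI) simp_all
qed

lemma vnorm_ae_class:
  assumes R: "function_lattice_representation M R"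
    and u: "AE \<omega> in M. R u \<omega> = norm (f \<omega>)"
  shows "vnorm (vector_valued_space M R) (ae_class M f) = norm u"
proof -
  have "(THE u. \<exists>g\<in>ae_class M f. AE \<omega> in M. R u \<omega> = norm (g \<omega>)) = u"
  proof (rule the_equality)
    show "\<exists>g\<in>ae_class M f. AE \<omega> in M. R u \<omega> = norm (g \<omega>)"
      using u by (intro bexI[of _ f]) (simp_all add: ae_class_def)
  next
    fix v assume "\<exists>g\<in>ae_class M f. AE \<omega> in M. R v \<omega> = norm (g \<omega>)"
    then obtain g where g: "AE \<omega> in M. g \<omega> = f \<omega>" and v: "AE \<omega> in M. R v \<omega> = norm (g \<omega>)"
      by (auto simp: ae_class_def)
    have add: "\<And>x y. AE \<omega> in M. R (x + y) \<omega> = R x \<omega> + R y \<omega>"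
      and scale: "\<And>c x. AE \<omega> in M. R (c *\<^sub>R x) \<omega> = c * R x \<omega>"
      and inj: "\<And>w. AE \<omega> in M. R w \<omega> = 0 \<Longrightarrow> w = 0"
      using R by (simp_all add: function_lattice_representation_def)
    have "AE \<omega> in M. R (v + (-1) *\<^sub>R u) \<omega> = 0"
      using add[of v "(-1) *\<^sub>R u"] scale[of "-1" u] g v u by eventually_elim simp
    from inj[OF this] show "v = u"
      by simp
  qed
  then show ?thesis
    by (simp add: vector_valued_space_def)
qed

end

theory Submission
  imports Defs "HOL-Library.Function_Algebras"
begin

text \<open>
  If \<open>X\<close> has property (\<open>V\<^sup>*\<close>) and \<open>K\<close> is a (\<open>V\<^sup>*\<close>)-set in \<open>E(X)\<close>, it suffices to find, for every
  sequence in \<open>K\<close>, convex blocks that converge in norm. A convexity argument first makes the norms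
  \<open>\<parallel>f n \<omega>\<parallel>\<close> converge almost everywhere, and after multiplication with a scalar function \<open>f n\<close> is
  uniformly bounded. Among all further blocks one chooses a sequence for which certain upper
  integrals are minimal. If its values failed to form a (\<open>V\<^sup>*\<close>)-set in \<open>X\<close> on a set of positive
  measure, then contractions \<open>X \<rightarrow> \<ell>\<^sup>1\<close> that depend on \<open>\<omega>\<close> would be large on a single sequence of
  blocks. This is impossible: by the Mazur-Orlicz theorem, the convex hull of the tensors
  \<open>e i \<otimes> h i\<close> contains elements of small projective norm if all \<open>h i\<close> are convex combinations from
  a (\<open>V\<^sup>*\<close>)-set, and such an estimate can be evaluated pointwise. Hence the values converge weakly almost everywhere, and
  a separation argument in \<open>L\<^sup>1(X)\<close> yields blocks that converge in norm almost everywhere. As \<open>E\<close>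
  contains no copy of \<open>c\<^sub>0\<close>, it satisfies Levi's theorem, so the limit lies in \<open>E(X)\<close>, and a gliding
  hump shows that the convergence is weak in \<open>E(X)\<close>; Mazur's theorem finishes the proof.
  Conversely, the constant functions form a closed copy of \<open>X\<close> in \<open>E(X)\<close>.
\<close>

section \<open>Hahn--Banach\<close>

text \<open>The contractions that witness a failure at \<open>\<omega>\<close> come from an
  existence statement and cannot be chosen measurably in \<open>\<omega>\<close>, and
  \<open>X\<close> may be non-separable. The proof therefore never selects them. It records only how
  large they can be (\<open>ext_val\<close>), replaces this possibly non-measurable function of
  \<open>\<omega>\<close> by a measurable envelope, and lets all vectors range over a countable set.
  This is why blocks are built from midpoints: the midpoint hull of a countable set is countable and
  still lies in the convex hull, so that countably many almost sure statements hold off one null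
  set. Tensors serve the same purpose: one tensor of small cost bounds every contraction at every
  \<open>\<omega>\<close> by the same measurable function
  \<open>\<Sum> \<parallel>v \<omega>\<parallel>\<close>. The absence of \<open>c\<^sub>0\<close>
  enters through Levi's theorem, from which absolute continuity of the norm, Fatou's lemma and
  completeness of \<open>E(X)\<close> are derived. Weak compactness is reduced to sequences by
  working in the product of the real lines indexed by all functionals, where Tychonoff's theorem
  applies.\<close>

instantiation "fun" :: (type, real_vector) real_vector
begin

text \<open>Elements of \<open>E(X)\<close> and tensors are handled as plain functions, so that the
  separation theorems for vector spaces apply to them directly.\<close>

definition scaleR_fun :: "real \<Rightarrow> ('a \<Rightarrow> 'b) \<Rightarrow> 'a \<Rightarrow> 'b"
  where "scaleR_fun c f = (\<lambda>x. c *\<^sub>R f x)"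

instance
  by standard (simp_all add: scaleR_fun_def fun_eq_iff scaleR_add_right scaleR_add_left)

end

lemma scaleR_fun_apply [simp]: "(c *\<^sub>R f) x = c *\<^sub>R f x"
  for f :: "'a \<Rightarrow> 'b::real_vector"
  by (simp add: scaleR_fun_def)

lemma sum_fun_apply: "(\<Sum>i\<in>I. f i) x = (\<Sum>i\<in>I. f i x)"
  for f :: "'i \<Rightarrow> 'a \<Rightarrow> 'b::real_vector"
  by (induction I rule: infinite_finite_induct) simp_all

definition sublinear_on :: "'v::real_vector set \<Rightarrow> ('v \<Rightarrow> real) \<Rightarrow> bool" where
  "sublinear_on S p \<longleftrightarrow>
     (\<forall>x\<in>S. \<forall>y\<in>S. p (x + y) \<le> p x + p y) \<and> (\<forall>x\<in>S. \<forall>t\<ge>0. p (t *\<^sub>R x) = t * p x)"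

lemma sublinear_onD:
  assumes "sublinear_on S p"
  shows "x \<in> S \<Longrightarrow> y \<in> S \<Longrightarrow> p (x + y) \<le> p x + p y"
    and "x \<in> S \<Longrightarrow> 0 \<le> t \<Longrightarrow> p (t *\<^sub>R x) = t * p x"
  using assms by (auto simp: sublinear_on_def)

text \<open>The missing inequality for \<open>t > 0\<close> is the assumed one for the factor
  \<open>inverse t\<close> at the point \<open>t *\<^sub>R x\<close>.\<close>

lemma sublinear_onI:
  assumes S: "subspace S"
    and sub: "\<And>x y. x \<in> S \<Longrightarrow> y \<in> S \<Longrightarrow> p (x + y) \<le> p x + p y"
    and hom: "\<And>t x. 0 < t \<Longrightarrow> x \<in> S \<Longrightarrow> p (t *\<^sub>R x) \<le> t * p x"
    and zero: "p 0 = 0"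
  shows "sublinear_on S p"
  unfolding sublinear_on_def
proof (intro conjI ballI allI impI)
  fix x and t :: real assume x: "x \<in> S" and t: "0 \<le> t"
  show "p (t *\<^sub>R x) = t * p x"
  proof (cases "t = 0")
    case False
    with t have t: "0 < t" by simp
    have "p (inverse t *\<^sub>R (t *\<^sub>R x)) \<le> inverse t * p (t *\<^sub>R x)"
      by (rule hom) (use t x S in \<open>auto intro: subspace_scale\<close>)
    then have "t * p x \<le> p (t *\<^sub>R x)"
      using t by (simp add: field_simps)
    then show ?thesis using hom[OF t x] by simp
  qed (simp add: zero)
qed (rule sub)

lemma sublinear_neg:
  assumes "sublinear_on UNIV p"
  shows "- p (- x) \<le> p (x::'v::real_vector)"
  using sublinear_onD(1)[OF assms, of x "- x"] sublinear_onD(2)[OF assms, of x 0] by simp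

text \<open>This is the lower bound that Zorn's lemma asks for. The infimum is finite because
  \<open>- q (- x) \<le> q x\<close> turns the common upper bound \<open>p\<close> into a lower one.
  Of two members of the chain one is the smaller, and this makes the infimum subadditive.\<close>

lemma sublinear_chain_Inf:
  fixes C :: "('v::real_vector \<Rightarrow> real) set"
  assumes C: "C \<noteq> {}" "\<And>q. q \<in> C \<Longrightarrow> sublinear_on UNIV q"
    and bd: "\<And>q x. q \<in> C \<Longrightarrow> q x \<le> p x"
    and chain: "\<And>q q'. q \<in> C \<Longrightarrow> q' \<in> C \<Longrightarrow> q \<le> q' \<or> q' \<le> q"
  shows "sublinear_on UNIV (\<lambda>x. INF q\<in>C. q x)"
    and "q \<in> C \<Longrightarrow> (INF q\<in>C. q x) \<le> q x"
proof -
  have bdd: "bdd_below ((\<lambda>q. q x) ` C)" for x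
  proof (rule bdd_belowI2)
    fix q assume "q \<in> C"
    then show "- p (- x) \<le> q x"
      using sublinear_neg[OF C(2), of q x] bd[of q "- x"] by simp
  qed
  show le: "q \<in> C \<Longrightarrow> (INF q\<in>C. q x) \<le> q x" for q x
    using bdd by (rule cINF_lower)
  have sub: "(INF q\<in>C. q (x + y)) \<le> (INF q\<in>C. q x) + (INF q\<in>C. q y)" for x y
  proof -
    have 1: "(INF q\<in>C. q (x + y)) \<le> q1 x + q2 y" if q: "q1 \<in> C" "q2 \<in> C" for q1 q2
    proof -
      obtain q where q: "q \<in> C" "q \<le> q1" "q \<le> q2"
        using chain[OF q] q by auto
      have "(INF q\<in>C. q (x + y)) \<le> q (x + y)"
        using le q(1) .
      also have "\<dots> \<le> q x + q y"
        using sublinear_onD(1)[OF C(2)[OF q(1)]] by simp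
      also have "\<dots> \<le> q1 x + q2 y"
        using q by (simp add: le_funD add_mono)
      finally show ?thesis .
    qed
    have "(INF q\<in>C. q (x + y)) - q1 x \<le> (INF q\<in>C. q y)" if "q1 \<in> C" for q1
      by (rule cINF_greatest) (use C(1) 1[OF that] in \<open>auto simp: algebra_simps\<close>)
    then have "(INF q\<in>C. q (x + y)) - (INF q\<in>C. q y) \<le> (INF q\<in>C. q x)"
      by (intro cINF_greatest C(1)) (auto simp: algebra_simps)
    then show ?thesis by simp
  qed
  have hom: "(INF q\<in>C. q (t *\<^sub>R x)) = t * (INF q\<in>C. q x)" if t: "0 \<le> t" for t x
  proof -
    have eq: "(INF q\<in>C. q (t *\<^sub>R x)) = (INF q\<in>C. t * q x)"
      using t by (intro INF_cong refl) (simp add: sublinear_onD(2)[OF C(2)])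
    show ?thesis
    proof (cases "t = 0")
      case True
      then show ?thesis using eq C(1) by simp
    next
      case False
      have "t * (INF q\<in>C. q x) \<le> (INF q\<in>C. t * q x)"
        by (rule cINF_greatest) (use C(1) le t in \<open>auto intro!: mult_left_mono\<close>)
      moreover have "(INF q\<in>C. t * q x) / t \<le> (INF q\<in>C. q x)"
      proof (rule cINF_greatest)
        fix q assume "q \<in> C"
        then have "(INF q\<in>C. q (t *\<^sub>R x)) \<le> q (t *\<^sub>R x)" by (rule le)
        with eq t False sublinear_onD(2)[OF C(2)[OF \<open>q \<in> C\<close>] _ t, of x]
        show "(INF q\<in>C. t * q x) / t \<le> q x"
          by (simp add: field_simps)
      qed (rule C(1))
      ultimately show ?thesis using eq t False by (simp add: field_simps)
    qed
  qed
  show "sublinear_on UNIV (\<lambda>x. INF q\<in>C. q x)"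
    unfolding sublinear_on_def using sub hom by auto
qed

text \<open>Lowering a sublinear \<open>m\<close> in a direction \<open>x\<close> keeps it sublinear, so a minimal one is linear.\<close>

lemma sublinear_lower:
  fixes m :: "'v::real_vector \<Rightarrow> real" and x :: 'v
  assumes m: "sublinear_on UNIV m"
  defines "m' \<equiv> \<lambda>y. INF t\<in>{0..}. m (y + t *\<^sub>R x) - t * m x"
  shows "sublinear_on UNIV m'" and "0 \<le> t \<Longrightarrow> m' y \<le> m (y + t *\<^sub>R x) - t * m x"
proof -
  have bdd: "bdd_below ((\<lambda>t. m (y + t *\<^sub>R x) - t * m x) ` {0..})" for y
  proof (rule bdd_belowI2)
    fix t :: real assume "t \<in> {0..}"
    then show "- m (- y) \<le> m (y + t *\<^sub>R x) - t * m x"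
      using sublinear_onD(1)[OF m, of "y + t *\<^sub>R x" "- y"] sublinear_onD(2)[OF m, of x t] by simp
  qed
  show le: "m' y \<le> m (y + t *\<^sub>R x) - t * m x" if "0 \<le> t" for t y
    unfolding m'_def using bdd by (rule cINF_lower) (use that in auto)
  have gr: "c \<le> m' y" if "\<And>t. 0 \<le> t \<Longrightarrow> c \<le> m (y + t *\<^sub>R x) - t * m x" for c y
    unfolding m'_def by (rule cINF_greatest) (use that in auto)
  have sub: "m' (y + z) \<le> m' y + m' z" for y z
  proof -
    have 1: "m' (y + z) \<le> (m (y + s *\<^sub>R x) - s * m x) + (m (z + t *\<^sub>R x) - t * m x)"
      if st: "0 \<le> s" "0 \<le> t" for s t
      using le[of "s + t" "y + z"] st sublinear_onD(1)[OF m, of "y + s *\<^sub>R x" "z + t *\<^sub>R x"]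
      by (simp add: algebra_simps)
    have "m' (y + z) - (m (y + s *\<^sub>R x) - s * m x) \<le> m' z" if "0 \<le> s" for s
      by (rule gr) (use 1[OF that] in \<open>auto simp: algebra_simps\<close>)
    then have "m' (y + z) - m' z \<le> m' y"
      by (intro gr) (auto simp: algebra_simps)
    then show ?thesis by simp
  qed
  have hom1: "m' (s *\<^sub>R y) \<le> s * m' y" if s: "0 < s" for s y
  proof -
    have "m' (s *\<^sub>R y) / s \<le> m' y"
    proof (rule gr)
      fix t :: real assume t: "0 \<le> t"
      have "m' (s *\<^sub>R y) \<le> m (s *\<^sub>R y + (s * t) *\<^sub>R x) - s * t * m x"
        by (rule le) (use s t in auto)
      also have "s *\<^sub>R y + (s * t) *\<^sub>R x = s *\<^sub>R (y + t *\<^sub>R x)"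
        by (simp add: scaleR_add_right)
      finally show "m' (s *\<^sub>R y) / s \<le> m (y + t *\<^sub>R x) - t * m x"
        using s sublinear_onD(2)[OF m, of "y + t *\<^sub>R x" s] by (simp add: field_simps)
    qed
    then show ?thesis using s by (simp add: field_simps)
  qed
  have "m 0 = 0" using sublinear_onD(2)[OF m, of 0 0] by simp
  then have "m' 0 \<le> 0" using le[of 0 0] by simp
  moreover have "0 \<le> m' 0"
    by (intro gr) (simp add: sublinear_onD(2)[OF m])
  ultimately have "m' 0 = 0" by simp
  then show "sublinear_on UNIV m'"
    by (intro sublinear_onI sub hom1) auto
qed

lemma hahn_banach_UNIV:
  fixes p :: "'v::real_vector \<Rightarrow> real"
  assumes p: "sublinear_on UNIV p"
  obtains L where "linear L" "\<And>x. L x \<le> p x"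
proof -
  define A where "A = {q. sublinear_on UNIV q \<and> q \<le> p}"
  let ?P = "\<lambda>a b::'v \<Rightarrow> real. b \<le> a"
  have "\<exists>m\<in>A. \<forall>a\<in>A. ?P m a \<longrightarrow> a = m"
  proof (rule predicate_Zorn)
    show "partial_order_on A (relation_of ?P A)"
      by (rule partial_order_on_relation_ofI) auto
    fix C assume "C \<in> Chains (relation_of ?P A)"
    then have C: "C \<subseteq> A" "\<And>q q'. q \<in> C \<Longrightarrow> q' \<in> C \<Longrightarrow> q \<le> q' \<or> q' \<le> q"
      unfolding Chains_def relation_of_def by auto
    show "\<exists>u\<in>A. \<forall>a\<in>C. ?P a u"
    proof (cases "C = {}")
      case True
      then show ?thesis using p by (auto simp: A_def)
    next
      case False
      have "sublinear_on UNIV (\<lambda>x. INF q\<in>C. q x)"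
        and le: "q \<in> C \<Longrightarrow> (INF q\<in>C. q x) \<le> q x" for q x
        using sublinear_chain_Inf[of C p] C False by (auto simp: A_def le_fun_def subset_iff)
      moreover have "(\<lambda>x. INF q\<in>C. q x) \<le> p"
      proof -
        obtain q where "q \<in> C" using False by auto
        then show ?thesis
          using C(1) le[OF \<open>q \<in> C\<close>] by (force simp: A_def le_fun_def subset_iff intro: order_trans)
      qed
      ultimately show ?thesis
        unfolding A_def by (intro bexI[of _ "\<lambda>x. INF q\<in>C. q x"]) (auto simp: le_fun_def)
    qed
  qed
  then obtain m where m: "sublinear_on UNIV m" "m \<le> p"
    and min: "\<And>a. sublinear_on UNIV a \<Longrightarrow> a \<le> m \<Longrightarrow> a = m"
    unfolding A_def by (auto intro: order_trans)
  \<comment> \<open>Minimality forces \<open>m\<close> to equal its lowering in direction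
    \<open>x\<close>; the value \<open>t = 1\<close> there is superadditivity.\<close>
  have add: "m (y + x) = m y + m x" for x y
  proof -
    let ?m = "\<lambda>y. INF t\<in>{0..}. m (y + t *\<^sub>R x) - t * m x"
    have "?m = m"
      using sublinear_lower(1)[OF m(1)] sublinear_lower(2)[OF m(1), of 0]
      by (intro min) (simp_all add: le_fun_def)
    then have "m y \<le> m (y + x) - m x"
      using sublinear_lower(2)[OF m(1), of 1 y x] by (simp add: fun_eq_iff)
    then show ?thesis
      using sublinear_onD(1)[OF m(1), of y x] by simp
  qed
  have "m 0 = 0" using sublinear_onD(2)[OF m(1), of 0 0] by simp
  then have neg: "m (- x) = - m x" for x
    using add[of x "- x"] by simp
  have "m (t *\<^sub>R x) = t *\<^sub>R m x" for t x
  proof (cases "0 \<le> t")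
    case True
    then show ?thesis by (simp add: sublinear_onD(2)[OF m(1)])
  next
    case False
    then show ?thesis
      using sublinear_onD(2)[OF m(1), of x "- t"] neg[of "t *\<^sub>R x"] by simp
  qed
  then have "linear m" by (intro linearI) (simp_all add: add)
  then show thesis using that m(2) by (auto simp: le_fun_def)
qed

text \<open>A linear projection \<open>g\<close> onto \<open>S\<close>, a left inverse of the
  inclusion, extends \<open>p\<close> to the sublinear function \<open>p (g x)\<close> on the whole
  space.\<close>

lemma hahn_banach:
  fixes p :: "'v::real_vector \<Rightarrow> real"
  assumes S: "subspace S" and p: "sublinear_on S p"
  obtains L where "linear L" "\<And>x. x \<in> S \<Longrightarrow> L x \<le> p x"
proof -
  obtain g where g: "range g \<subseteq> S" "linear g" "\<And>v. v \<in> S \<Longrightarrow> g v = v"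
    using linear_exists_left_inverse_on[of "\<lambda>x. x" S] S by (auto simp: module_hom_ident)
  have gS: "g x \<in> S" for x using g(1) by auto
  have "sublinear_on UNIV (\<lambda>x. p (g x))"
    unfolding sublinear_on_def
    using sublinear_onD[OF p] gS by (auto simp: linear_add[OF g(2)] linear_cmul[OF g(2)])
  then obtain L where "linear L" "\<And>x. L x \<le> p (g x)"
    using hahn_banach_UNIV by blast
  then show thesis using that g(3) by metis
qed

text \<open>\<open>Q\<close> lowers \<open>p\<close> along the whole cone over \<open>D\<close> at
  once. A linear functional below \<open>Q\<close> is below \<open>p\<close> (take
  \<open>t = 0\<close>) and at least \<open>\<delta>\<close> on \<open>D\<close> (evaluate at
  \<open>- d\<close> with \<open>t = 1\<close>). Convexity of \<open>D\<close> makes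
  \<open>Q\<close> subadditive: the sum of two points \<open>s *\<^sub>R d\<close> and
  \<open>t *\<^sub>R e\<close> of the cone is \<open>(s + t) *\<^sub>R f\<close> with
  \<open>f\<close> in \<open>D\<close>. The separation arguments below are instances.\<close>

lemma mazur_orlicz:
  fixes p :: "'v::real_vector \<Rightarrow> real"
  assumes S: "subspace S" and p: "sublinear_on S p"
    and D: "convex D" "D \<subseteq> S" and \<delta>: "\<And>d. d \<in> D \<Longrightarrow> \<delta> \<le> p d"
  obtains L where "linear L" "\<And>x. x \<in> S \<Longrightarrow> L x \<le> p x" "\<And>d. d \<in> D \<Longrightarrow> \<delta> \<le> L d"
proof (cases "D = {}")
  case True
  then show thesis using hahn_banach[OF S p] that by blast
next
  case False
  let ?I = "{0..} \<times> D"
  define Q where "Q z = (INF (t, d)\<in>?I. p (z + t *\<^sub>R d) - t * \<delta>)" for z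
  have p0: "p 0 = 0"
    using sublinear_onD(2)[OF p, of 0 0] S subspace_0 by auto
  have inS: "z + t *\<^sub>R d \<in> S" if "z \<in> S" "d \<in> D" for z t d
    using that S D(2) by (auto intro: subspace_add subspace_scale)
  have bdd: "bdd_below ((\<lambda>(t, d). p (z + t *\<^sub>R d) - t * \<delta>) ` ?I)" if z: "z \<in> S" for z
  proof (rule bdd_belowI2, clarsimp)
    fix t :: real and d assume t: "0 \<le> t" and d: "d \<in> D"
    have "t * \<delta> \<le> p (t *\<^sub>R d)"
      using sublinear_onD(2)[OF p subsetD[OF D(2) d] t] \<delta>[OF d] t by (simp add: mult_left_mono)
    also have "\<dots> = p ((z + t *\<^sub>R d) + (- z))" by simp
    also have "\<dots> \<le> p (z + t *\<^sub>R d) + p (- z)"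
      using inS[OF z d] z S by (intro sublinear_onD(1)[OF p]) (auto simp: subspace_neg)
    finally show "- p (- z) \<le> p (z + t *\<^sub>R d) - t * \<delta>" by simp
  qed
  have le: "Q z \<le> p (z + t *\<^sub>R d) - t * \<delta>" if "z \<in> S" "0 \<le> t" "d \<in> D" for z t d
    unfolding Q_def using cINF_lower[OF bdd[OF that(1)], of "(t, d)"] that by auto
  have gr: "c \<le> Q z" if "\<And>t d. 0 \<le> t \<Longrightarrow> d \<in> D \<Longrightarrow> c \<le> p (z + t *\<^sub>R d) - t * \<delta>" for c z
    unfolding Q_def by (rule cINF_greatest) (use that False in auto)
  have sub: "Q (y + z) \<le> Q y + Q z" if yz: "y \<in> S" "z \<in> S" for y z
  proof -
    have 1: "Q (y + z) \<le> (p (y + s *\<^sub>R d) - s * \<delta>) + (p (z + t *\<^sub>R e) - t * \<delta>)"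
      if st: "0 \<le> s" "0 \<le> t" and de: "d \<in> D" "e \<in> D" for s t d e
    proof -
      obtain f where f: "f \<in> D" "(s + t) *\<^sub>R f = s *\<^sub>R d + t *\<^sub>R e"
      proof (cases "s + t = 0")
        case True
        then have "s = 0" "t = 0" using st by auto
        then show ?thesis using that[of d] de by simp
      next
        case False
        have "(s / (s + t)) *\<^sub>R d + (t / (s + t)) *\<^sub>R e \<in> D"
          using D(1) de st False by (intro convexD) (auto simp: add_divide_distrib[symmetric])
        then show ?thesis
          using False by (intro that) (auto simp: scaleR_add_right)
      qed
      have "Q (y + z) \<le> p (y + z + (s + t) *\<^sub>R f) - (s + t) * \<delta>"
        using le[of "y + z" "s + t" f] st f(1) yz S by (auto intro: subspace_add)
      also have "y + z + (s + t) *\<^sub>R f = (y + s *\<^sub>R d) + (z + t *\<^sub>R e)"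
        by (simp add: f)
      also have "p \<dots> \<le> p (y + s *\<^sub>R d) + p (z + t *\<^sub>R e)"
        using yz de by (intro sublinear_onD(1)[OF p] inS)
      finally show ?thesis by (simp add: algebra_simps)
    qed
    have "Q (y + z) - (p (y + s *\<^sub>R d) - s * \<delta>) \<le> Q z" if sd: "0 \<le> s" "d \<in> D" for s d
    proof (rule gr)
      fix t :: real and e assume "0 \<le> t" "e \<in> D"
      then show "Q (y + z) - (p (y + s *\<^sub>R d) - s * \<delta>) \<le> p (z + t *\<^sub>R e) - t * \<delta>"
        using 1[OF sd(1) _ sd(2)] by fastforce
    qed
    then have "Q (y + z) - Q z \<le> Q y"
      by (intro gr) (auto simp: algebra_simps)
    then show ?thesis by simp
  qed
  have hom1: "Q (s *\<^sub>R y) \<le> s * Q y" if s: "0 < s" and y: "y \<in> S" for s y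
  proof -
    have "Q (s *\<^sub>R y) / s \<le> Q y"
    proof (rule gr)
      fix t :: real and d assume t: "0 \<le> t" and d: "d \<in> D"
      have "Q (s *\<^sub>R y) \<le> p (s *\<^sub>R y + (s * t) *\<^sub>R d) - s * t * \<delta>"
        using s t d y S by (intro le) (auto intro: subspace_scale)
      also have "s *\<^sub>R y + (s * t) *\<^sub>R d = s *\<^sub>R (y + t *\<^sub>R d)"
        by (simp add: scaleR_add_right)
      finally show "Q (s *\<^sub>R y) / s \<le> p (y + t *\<^sub>R d) - t * \<delta>"
        using s sublinear_onD(2)[OF p inS[OF y d], of s t] by (simp add: field_simps)
    qed
    then show ?thesis using s by (simp add: field_simps)
  qed
  have "0 \<le> Q 0"
  proof (rule gr)
    fix t :: real and d assume t: "0 \<le> t" and d: "d \<in> D"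
    then show "0 \<le> p (0 + t *\<^sub>R d) - t * \<delta>"
      using \<delta>[OF d] D(2) by (auto simp: sublinear_onD(2)[OF p] mult_left_mono)
  qed
  moreover obtain d where "d \<in> D" using False by auto
  then have "Q 0 \<le> 0" using le[of 0 0 d] p0 S by (auto intro: subspace_0)
  ultimately have "sublinear_on S Q"
    by (intro sublinear_onI S sub hom1) auto
  then obtain L where L: "linear L" "\<And>x. x \<in> S \<Longrightarrow> L x \<le> Q x"
    using hahn_banach[OF S] by blast
  obtain d0 where d0: "d0 \<in> D" using False by auto
  have "L x \<le> p x" if "x \<in> S" for x
    using L(2)[OF that] le[OF that, of 0 d0] d0 by simp
  moreover have "\<delta> \<le> L d" if "d \<in> D" for d
  proof -
    have "- d \<in> S" using that D(2) S by (auto intro: subspace_neg)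
    then have "L (- d) \<le> - \<delta>"
      using L(2)[of "- d"] le[of "- d" 1 d] that p0 by simp
    then show ?thesis using linear_neg[OF L(1), of d] by simp
  qed
  ultimately show thesis using that L(1) by blast
qed

section \<open>Property \<open>V\<^sup>*\<close> through representatives\<close>

lemma vcarrier_dual:
  "\<phi> \<in> vcarrier (dual Z) \<longleftrightarrow> linear_between Z type_space \<phi> \<and>
     (\<exists>C. \<forall>x\<in>vcarrier Z. \<bar>\<phi> x\<bar> \<le> C * vnorm Z x) \<and> (\<forall>x. x \<notin> vcarrier Z \<longrightarrow> \<phi> x = 0)"
  by (simp add: dual_def)

lemma dual_simps:
  "vadd (dual Z) = (\<lambda>\<phi> \<psi> x. \<phi> x + \<psi> x)" "vscale (dual Z) = (\<lambda>c \<phi> x. c * \<phi> x)"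
  "vzero (dual Z) = (\<lambda>x. 0)"
  "vnorm (dual Z) = (\<lambda>\<phi>. SUP x\<in>{x \<in> vcarrier Z. vnorm Z x \<le> 1}. \<bar>\<phi> x\<bar>)"
  by (simp_all add: dual_def)

lemma type_space_simps:
  "vcarrier type_space = UNIV" "vadd type_space = (+)" "vscale type_space = (*\<^sub>R)"
  "vnorm type_space = norm"
  by (simp_all add: type_space_def)

lemma dual_combination:
  assumes \<phi>: "\<phi> \<in> vcarrier (dual Z)" and \<psi>: "\<psi> \<in> vcarrier (dual Z)"
  shows "(\<lambda>x. a * \<phi> x + b * \<psi> x) \<in> vcarrier (dual Z)"
proof -
  obtain C D where C: "\<And>x. x \<in> vcarrier Z \<Longrightarrow> \<bar>\<phi> x\<bar> \<le> C * vnorm Z x"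
    and D: "\<And>x. x \<in> vcarrier Z \<Longrightarrow> \<bar>\<psi> x\<bar> \<le> D * vnorm Z x"
    using \<phi> \<psi> unfolding vcarrier_dual by blast
  have "\<bar>a * \<phi> x + b * \<psi> x\<bar> \<le> (\<bar>a\<bar> * C + \<bar>b\<bar> * D) * vnorm Z x" if x: "x \<in> vcarrier Z" for x
  proof -
    have "\<bar>a * \<phi> x + b * \<psi> x\<bar> \<le> \<bar>a\<bar> * \<bar>\<phi> x\<bar> + \<bar>b\<bar> * \<bar>\<psi> x\<bar>"
      by (simp add: abs_triangle_ineq abs_mult[symmetric])
    also have "\<dots> \<le> \<bar>a\<bar> * (C * vnorm Z x) + \<bar>b\<bar> * (D * vnorm Z x)"
      using C[OF x] D[OF x] by (intro add_mono mult_left_mono) auto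
    finally show ?thesis by (simp add: algebra_simps)
  qed
  then have "\<exists>C. \<forall>x\<in>vcarrier Z. \<bar>a * \<phi> x + b * \<psi> x\<bar> \<le> C * vnorm Z x" by blast
  moreover have "linear_between Z type_space (\<lambda>x. a * \<phi> x + b * \<psi> x)"
    using \<phi> \<psi> unfolding vcarrier_dual linear_between_def type_space_simps
    by (auto simp: algebra_simps)
  ultimately show ?thesis
    using \<phi> \<psi> unfolding vcarrier_dual by simp
qed

lemma dual_zero: "(\<lambda>x. 0) \<in> vcarrier (dual Z)"
  unfolding vcarrier_dual linear_between_def type_space_simps
  by (auto intro!: exI[of _ 0])

lemma dual_sum:
  fixes N :: nat
  assumes "\<And>i. i < N \<Longrightarrow> \<zeta> i \<in> vcarrier (dual Z)"
  shows "(\<lambda>x. \<Sum>i<N. s i * \<zeta> i x) \<in> vcarrier (dual Z)"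
  using assms
proof (induction N)
  case 0
  show ?case by (simp add: dual_zero)
next
  case (Suc N)
  then have "(\<lambda>x. 1 * (\<Sum>i<N. s i * \<zeta> i x) + s N * \<zeta> N x) \<in> vcarrier (dual Z)"
    by (intro dual_combination) auto
  then show ?case by simp
qed

lemma bidual_sum:
  fixes N :: nat
  assumes \<Phi>: "\<Phi> \<in> vcarrier (dual (dual Z))"
    and \<zeta>: "\<And>i. i < N \<Longrightarrow> \<zeta> i \<in> vcarrier (dual Z)"
  shows "\<Phi> (\<lambda>x. \<Sum>i<N. s i * \<zeta> i x) = (\<Sum>i<N. s i * \<Phi> (\<zeta> i))"
proof -
  have add: "\<Phi> (\<lambda>x. \<phi> x + \<psi> x) = \<Phi> \<phi> + \<Phi> \<psi>"
    if "\<phi> \<in> vcarrier (dual Z)" "\<psi> \<in> vcarrier (dual Z)" for \<phi> \<psi>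
    using \<Phi> that by (auto simp: vcarrier_dual[of \<Phi>] linear_between_def dual_simps type_space_simps)
  have scale: "\<Phi> (\<lambda>x. c * \<phi> x) = c * \<Phi> \<phi>" if "\<phi> \<in> vcarrier (dual Z)" for \<phi> c
    using \<Phi> that by (auto simp: vcarrier_dual[of \<Phi>] linear_between_def dual_simps type_space_simps)
  show ?thesis
    using \<zeta>
  proof (induction N)
    case 0
    then show ?case using scale[OF dual_zero, of 0] by simp
  next
    case (Suc N)
    have "\<Phi> (\<lambda>x. (\<Sum>i<N. s i * \<zeta> i x) + s N * \<zeta> N x)
        = \<Phi> (\<lambda>x. \<Sum>i<N. s i * \<zeta> i x) + \<Phi> (\<lambda>x. s N * \<zeta> N x)"
      using Suc.prems dual_combination[of "\<zeta> N" Z "\<zeta> N" "s N" 0] by (intro add dual_sum) auto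
    then show ?case using Suc scale by simp
  qed
qed

text \<open>
  Elements of \<open>E(X)\<close> are classes of functions. This locale handles a normed space \<open>Z\<close> through
  representatives of its elements in a seminormed subspace \<open>S\<close> of an honest vector space.
\<close>

locale space_rep =
  fixes S :: "'v::real_vector set" and q :: "'v \<Rightarrow> real" and rep :: "'v \<Rightarrow> 'a" and Z :: "'a nspace"
  assumes S: "subspace S"
    and q_add: "\<And>x y. x \<in> S \<Longrightarrow> y \<in> S \<Longrightarrow> q (x + y) \<le> q x + q y"
    and q_scale: "\<And>c x. x \<in> S \<Longrightarrow> q (c *\<^sub>R x) = \<bar>c\<bar> * q x"
    and carrier: "vcarrier Z = rep ` S"
    and rep_add: "\<And>x y. x \<in> S \<Longrightarrow> y \<in> S \<Longrightarrow> vadd Z (rep x) (rep y) = rep (x + y)"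
    and rep_scale: "\<And>c x. x \<in> S \<Longrightarrow> vscale Z c (rep x) = rep (c *\<^sub>R x)"
    and rep_norm: "\<And>x. x \<in> S \<Longrightarrow> vnorm Z (rep x) = q x"
    and rep_eqI: "\<And>x y. x \<in> S \<Longrightarrow> y \<in> S \<Longrightarrow> q (x - y) = 0 \<Longrightarrow> rep x = rep y"
begin

lemmas S_closed = subspace_0[OF S] subspace_add[OF S] subspace_scale[OF S] subspace_diff[OF S]
  subspace_neg[OF S]

lemma q_zero: "q 0 = 0"
  using q_scale[of 0 0] S_closed(1) by simp

lemma q_minus: "x \<in> S \<Longrightarrow> q (- x) = q x"
  using q_scale[of x "-1"] by simp

lemma q_nonneg: "x \<in> S \<Longrightarrow> 0 \<le> q x"
  using q_add[of x "- x"] q_minus[of x] q_zero S_closed(5) by simp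

lemma q_commute: "x \<in> S \<Longrightarrow> y \<in> S \<Longrightarrow> q (x - y) = q (y - x)"
  using q_minus[of "x - y"] S_closed(4) by simp

lemma q_triangle: "x \<in> S \<Longrightarrow> y \<in> S \<Longrightarrow> z \<in> S \<Longrightarrow> q (x - z) \<le> q (x - y) + q (y - z)"
  using q_add[of "x - y" "y - z"] S_closed(4) by simp

lemma q_sublinear: "sublinear_on S q"
  unfolding sublinear_on_def using q_add q_scale by auto

lemma rep_eqD:
  assumes "x \<in> S" "y \<in> S" "rep x = rep y"
  shows "q (x - y) = 0"
proof -
  have sub: "rep (u - v) = vadd Z (rep u) (vscale Z (-1) (rep v))" if "u \<in> S" "v \<in> S" for u v
    using that rep_add[of u "- v"] rep_scale[of v "-1"] S_closed(5) by simp
  have "rep (x - y) = rep (y - y)"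
    using sub[OF assms(1,2)] sub[OF assms(2,2)] assms(3) by simp
  then show ?thesis
    using rep_norm[of "x - y"] rep_norm[of "0"] q_zero assms S_closed by auto
qed

definition functional :: "('v \<Rightarrow> real) \<Rightarrow> real \<Rightarrow> bool" where
  "functional L C \<longleftrightarrow> (\<forall>x\<in>S. \<forall>y\<in>S. L (x + y) = L x + L y) \<and>
     (\<forall>c. \<forall>x\<in>S. L (c *\<^sub>R x) = c * L x) \<and> (\<forall>x\<in>S. \<bar>L x\<bar> \<le> C * q x)"

lemma functionalD:
  assumes "functional L C"
  shows "x \<in> S \<Longrightarrow> y \<in> S \<Longrightarrow> L (x + y) = L x + L y"
    and "x \<in> S \<Longrightarrow> L (c *\<^sub>R x) = c * L x"
    and "x \<in> S \<Longrightarrow> \<bar>L x\<bar> \<le> C * q x"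
    and "x \<in> S \<Longrightarrow> y \<in> S \<Longrightarrow> L (x - y) = L x - L y"
proof -
  show add: "x \<in> S \<Longrightarrow> y \<in> S \<Longrightarrow> L (x + y) = L x + L y" for x y
    using assms by (simp add: functional_def)
  show "x \<in> S \<Longrightarrow> y \<in> S \<Longrightarrow> L (x - y) = L x - L y"
    using add[of "x - y" y] S_closed(4) by simp
qed (use assms in \<open>simp_all add: functional_def\<close>)

lemma linear_functional:
  assumes L: "linear L" "\<And>x. x \<in> S \<Longrightarrow> L x \<le> q x"
  shows "functional L 1"
  unfolding functional_def
proof (intro conjI ballI allI)
  fix x assume "x \<in> S"
  then show "\<bar>L x\<bar> \<le> 1 * q x"
    using L(2)[of x] L(2)[of "- x"] q_minus[of x] S_closed(5) linear_neg[OF L(1), of x] by simp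
qed (use L(1) in \<open>simp_all add: linear_add linear_cmul\<close>)

text \<open>The choice of the representative is immaterial for bounded functionals, since these
  vanish wherever \<open>q\<close> does. The value \<open>0\<close> off the carrier is the
  normalisation that \<open>dual\<close> demands.\<close>

definition lift :: "('v \<Rightarrow> real) \<Rightarrow> 'a \<Rightarrow> real" where
  "lift L a = (if a \<in> vcarrier Z then L (SOME x. x \<in> S \<and> rep x = a) else 0)"

lemma lift_rep:
  assumes L: "functional L C" and x: "x \<in> S"
  shows "lift L (rep x) = L x"
proof -
  define y where "y = (SOME y. y \<in> S \<and> rep y = rep x)"
  have y: "y \<in> S \<and> rep y = rep x"
    unfolding y_def by (rule someI[of _ x]) (use x in simp)
  then have "L (y - x) = 0"
    using functionalD(3)[OF L, of "y - x"] rep_eqD[of y x] x S_closed by simp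
  then have "L y = L x"
    using functionalD(4)[OF L] x y by simp
  then show ?thesis
    using x by (auto simp: lift_def carrier y_def)
qed

lemma lift_dual:
  assumes L: "functional L C"
  shows "lift L \<in> vcarrier (dual Z)"
  unfolding vcarrier_dual
proof (intro conjI)
  show "linear_between Z type_space (lift L)"
    unfolding linear_between_def type_space_simps carrier
    using S_closed by (auto simp: lift_rep[OF L] rep_add rep_scale functionalD[OF L])
  show "\<exists>C. \<forall>x\<in>vcarrier Z. \<bar>lift L x\<bar> \<le> C * vnorm Z x"
    using functionalD(3)[OF L] by (auto simp: carrier lift_rep[OF L] rep_norm intro!: exI[of _ C])
qed (simp add: lift_def)

lemma dual_functional:
  assumes "\<phi> \<in> vcarrier (dual Z)"
  obtains C where "functional (\<lambda>x. \<phi> (rep x)) C" "0 < C"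
proof -
  obtain C where C: "\<And>x. x \<in> vcarrier Z \<Longrightarrow> \<bar>\<phi> x\<bar> \<le> C * vnorm Z x"
    using assms by (auto simp: vcarrier_dual)
  have "\<bar>\<phi> (rep x)\<bar> \<le> (\<bar>C\<bar> + 1) * q x" if "x \<in> S" for x
  proof -
    have "\<bar>\<phi> (rep x)\<bar> \<le> C * q x"
      using C[of "rep x"] that by (auto simp: carrier rep_norm)
    also have "\<dots> \<le> (\<bar>C\<bar> + 1) * q x"
      using q_nonneg[OF that] by (intro mult_right_mono) auto
    finally show ?thesis .
  qed
  then have "functional (\<lambda>x. \<phi> (rep x)) (\<bar>C\<bar> + 1)"
    unfolding functional_def using assms S_closed
    by (auto simp: vcarrier_dual linear_between_def type_space_simps carrier
        rep_add[symmetric] rep_scale[symmetric])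
  then show thesis using that by force
qed

text \<open>Mazur-Orlicz for the single point \<open>x\<close> and the bound
  \<open>\<delta> = q x\<close>.\<close>

lemma norming_functional:
  assumes x: "x \<in> S"
  obtains L where "linear L" "\<And>y. y \<in> S \<Longrightarrow> L y \<le> q y" "L x = q x"
proof -
  obtain L where L: "linear L" "\<And>y. y \<in> S \<Longrightarrow> L y \<le> q y" "\<And>d. d \<in> {x} \<Longrightarrow> q x \<le> L d"
    by (rule mazur_orlicz[OF S q_sublinear, of "{x}" "q x"]) (use x in auto)
  then show thesis using that[of L] x by (meson antisym singletonI)
qed

text \<open>The bound says that all signed partial sums of the \<open>\<zeta> i\<close> have dual
  norm at most \<open>\<bar>C\<bar>\<close>. A bidual element, applied to the partial sum that
  carries its own signs, gives the partial sums of the absolute values.\<close>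

lemma wuc_lift:
  assumes fn: "\<And>i. functional (\<zeta> i) (D i)"
    and bd: "\<And>x N. x \<in> S \<Longrightarrow> (\<Sum>i<N. \<bar>\<zeta> i x\<bar>) \<le> C * q x"
  shows "wuc (dual Z) (\<lambda>i. lift (\<zeta> i))"
  unfolding wuc_def
proof (intro conjI allI ballI)
  fix \<Phi> assume \<Phi>: "\<Phi> \<in> vcarrier (dual (dual Z))"
  then obtain B where B: "\<And>\<phi>. \<phi> \<in> vcarrier (dual Z) \<Longrightarrow> \<bar>\<Phi> \<phi>\<bar> \<le> B * vnorm (dual Z) \<phi>"
    unfolding vcarrier_dual[of \<Phi>] by auto
  show "summable (\<lambda>n. \<bar>\<Phi> (lift (\<zeta> n))\<bar>)"
  proof (rule summableI_nonneg_bounded)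
    fix N
    define s where "s i = sgn (\<Phi> (lift (\<zeta> i)))" for i
    define \<phi> where "\<phi> = (\<lambda>x. \<Sum>i<N. s i * lift (\<zeta> i) x)"
    have \<phi>: "\<phi> \<in> vcarrier (dual Z)"
      unfolding \<phi>_def using lift_dual[OF fn] by (intro dual_sum)
    have \<phi>le: "\<bar>\<phi> x\<bar> \<le> \<bar>C\<bar>" if x: "x \<in> vcarrier Z" "vnorm Z x \<le> 1" for x
    proof -
      obtain u where u: "u \<in> S" "x = rep u" using x(1) carrier by auto
      then have "q u \<le> 1" using x(2) rep_norm by simp
      have "\<bar>\<phi> x\<bar> \<le> (\<Sum>i<N. \<bar>s i * \<zeta> i u\<bar>)"
        unfolding \<phi>_def u(2) lift_rep[OF fn u(1)] by (rule sum_abs)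
      also have "\<dots> \<le> (\<Sum>i<N. \<bar>\<zeta> i u\<bar>)"
        by (intro sum_mono) (simp add: s_def abs_mult sgn_if)
      also have "\<dots> \<le> C * q u" using bd[OF u(1)] .
      also have "\<dots> \<le> \<bar>C\<bar> * q u"
        using q_nonneg[OF u(1)] by (intro mult_right_mono) auto
      also have "\<dots> \<le> \<bar>C\<bar>"
        using \<open>q u \<le> 1\<close> by (intro mult_left_le) auto
      finally show ?thesis .
    qed
    \<comment> \<open>Zero keeps the unit ball nonempty, so that the supremum defining the dual norm
      can be bounded from above and from below.\<close>
    have r0: "rep 0 \<in> {x \<in> vcarrier Z. vnorm Z x \<le> 1}"
      using S_closed(1) rep_norm[of 0] q_zero carrier by auto
    then have nrm: "vnorm (dual Z) \<phi> \<le> \<bar>C\<bar>"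
      unfolding dual_simps using \<phi>le by (intro cSUP_least) auto
    have "\<bar>\<phi> (rep 0)\<bar> \<le> vnorm (dual Z) \<phi>"
      unfolding dual_simps using \<phi>le r0 by (intro cSUP_upper bdd_aboveI2[of _ _ "\<bar>C\<bar>"]) auto
    then have nrm0: "0 \<le> vnorm (dual Z) \<phi>" by linarith
    have "(\<Sum>i<N. \<bar>\<Phi> (lift (\<zeta> i))\<bar>) = (\<Sum>i<N. s i * \<Phi> (lift (\<zeta> i)))"
      by (intro sum.cong refl) (simp add: s_def sgn_mult_self_eq sgn_if)
    also have "\<dots> = \<Phi> \<phi>"
      unfolding \<phi>_def by (rule bidual_sum[symmetric]) (use \<Phi> lift_dual[OF fn] in auto)
    also have "\<dots> \<le> B * vnorm (dual Z) \<phi>"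
      using B[OF \<phi>] by linarith
    also have "\<dots> \<le> \<bar>B\<bar> * \<bar>C\<bar>"
      using nrm nrm0 by (intro mult_mono) auto
    finally show "(\<Sum>i<N. \<bar>\<Phi> (lift (\<zeta> i))\<bar>) \<le> \<bar>B\<bar> * \<bar>C\<bar>" .
  qed simp
qed (use lift_dual[OF fn] in simp)

text \<open>The slab where \<open>\<bar>\<zeta> i x\<bar> < \<epsilon>\<close> is convex, so
  smallness on \<open>K\<close> passes to its convex hull, uniformly. The point \<open>h i\<close>
  may therefore vary with \<open>i\<close>; the defining condition is applied below in this
  form.\<close>

lemma Vstar_tendsto:
  assumes V: "Vstar_set Z (rep ` K)" and K: "K \<subseteq> S"
    and fn: "\<And>i. functional (\<zeta> i) (D i)"
    and bd: "\<And>x N. x \<in> S \<Longrightarrow> (\<Sum>i<N. \<bar>\<zeta> i x\<bar>) \<le> C * q x"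
    and h: "\<And>i. h i \<in> convex hull K" and \<epsilon>: "0 < \<epsilon>"
  shows "\<forall>\<^sub>F i in sequentially. \<bar>\<zeta> i (h i)\<bar> < \<epsilon>"
proof -
  have "(\<lambda>n. SUP z\<in>rep ` K. ennreal \<bar>lift (\<zeta> n) z\<bar>) \<longlonglongrightarrow> 0"
    using V wuc_lift[OF fn bd] by (simp add: Vstar_set_def)
  then have "\<forall>\<^sub>F n in sequentially. (SUP z\<in>rep ` K. ennreal \<bar>lift (\<zeta> n) z\<bar>) < ennreal \<epsilon>"
    by (rule order_tendstoD) (use \<epsilon> in simp)
  then show ?thesis
  proof eventually_elim
    case (elim i)
    have "\<bar>\<zeta> i x\<bar> < \<epsilon>" if x: "x \<in> K" for x
    proof -
      have "ennreal \<bar>lift (\<zeta> i) (rep x)\<bar> \<le> (SUP z\<in>rep ` K. ennreal \<bar>lift (\<zeta> i) z\<bar>)"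
        by (rule SUP_upper) (use x in simp)
      from this elim have "ennreal \<bar>lift (\<zeta> i) (rep x)\<bar> < ennreal \<epsilon>" by (rule le_less_trans)
      then show ?thesis using lift_rep[OF fn] x K \<epsilon> by (auto simp: ennreal_less_iff)
    qed
    then have "K \<subseteq> {x \<in> S. \<bar>\<zeta> i x\<bar> < \<epsilon>}" using K by auto
    moreover have "convex {x \<in> S. \<bar>\<zeta> i x\<bar> < \<epsilon>}"
    proof (rule convexI, clarsimp, intro conjI)
      fix x y and u v :: real
      assume xy: "x \<in> S" "y \<in> S" "\<bar>\<zeta> i x\<bar> < \<epsilon>" "\<bar>\<zeta> i y\<bar> < \<epsilon>" and uv: "0 \<le> u" "0 \<le> v" "u + v = 1"
      show "u *\<^sub>R x + v *\<^sub>R y \<in> S" using xy S_closed by auto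
      have "\<zeta> i (u *\<^sub>R x + v *\<^sub>R y) = u * \<zeta> i x + v * \<zeta> i y"
        using xy S_closed by (simp add: functionalD[OF fn])
      then show "\<bar>\<zeta> i (u *\<^sub>R x + v *\<^sub>R y)\<bar> < \<epsilon>"
        using convex_bound_lt[of "\<zeta> i x" \<epsilon> "\<zeta> i y" u v] convex_bound_lt[of "- \<zeta> i x" \<epsilon> "- \<zeta> i y" u v] xy uv
        by (simp add: abs_less_iff)
    qed
    ultimately show ?case using h[of i] hull_minimal[of K "{x \<in> S. \<bar>\<zeta> i x\<bar> < \<epsilon>}" convex] by auto
  qed
qed

text \<open>Otherwise some \<open>h i\<close> in \<open>K\<close> has norm above
  \<open>2 ^ Suc i\<close>. Functionals norming \<open>h i\<close>, with the weights
  \<open>(1/2) ^ Suc i\<close>, form a weakly unconditionally Cauchy series with values above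
  \<open>1\<close> at \<open>h i\<close>.\<close>

lemma Vstar_bounded:
  assumes V: "Vstar_set Z (rep ` K)" and K: "K \<subseteq> S"
  obtains B where "\<And>x. x \<in> K \<Longrightarrow> q x \<le> B"
proof (rule ccontr)
  assume *: "\<not> thesis"
  have "\<exists>x\<in>K. 2 ^ Suc i < q x" for i
    using * that by (meson not_le)
  then obtain h where h: "\<And>i. h i \<in> K" "\<And>i. 2 ^ Suc i < q (h i)" by metis
  have "\<exists>L. linear L \<and> (\<forall>y\<in>S. L y \<le> q y) \<and> L (h i) = q (h i)" for i
    by (rule norming_functional[of "h i"]) (use h(1) K in auto)
  then obtain L where "\<forall>i. linear (L i) \<and> (\<forall>y\<in>S. L i y \<le> q y) \<and> L i (h i) = q (h i)"
    using choice[of "\<lambda>i L. linear L \<and> (\<forall>y\<in>S. L y \<le> q y) \<and> L (h i) = q (h i)"] by blast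
  then have L: "linear (L i)" "\<And>y. y \<in> S \<Longrightarrow> L i y \<le> q y" "L i (h i) = q (h i)" for i
    by auto
  have fL: "functional (L i) 1" for i using linear_functional L by blast
  define \<zeta> where "\<zeta> i x = (1/2) ^ Suc i * L i x" for i x
  have fn: "functional (\<zeta> i) ((1/2) ^ Suc i)" for i
    using functionalD[OF fL] unfolding functional_def \<zeta>_def
    by (auto simp: algebra_simps abs_mult)
  have bd: "(\<Sum>i<N. \<bar>\<zeta> i x\<bar>) \<le> 1 * q x" if x: "x \<in> S" for x N
  proof -
    have "(\<Sum>i<N. \<bar>\<zeta> i x\<bar>) \<le> (\<Sum>i<N. (1/2) ^ Suc i * q x)"
      using functionalD(3)[OF fn x] by (intro sum_mono)
    also have "\<dots> = (\<Sum>i<N. (1/2) ^ Suc i) * q x" by (simp add: sum_distrib_right)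
    also have "(\<Sum>i<N. (1/2::real) ^ Suc i) = 1 - (1/2) ^ N"
      by (induction N) auto
    also have "(1 - (1/2) ^ N) * q x \<le> 1 * q x"
      using q_nonneg[OF x] by (intro mult_right_mono) auto
    finally show ?thesis .
  qed
  have "\<forall>\<^sub>F i in sequentially. \<bar>\<zeta> i (h i)\<bar> < 1"
    by (rule Vstar_tendsto[OF V K fn bd]) (use h(1) in \<open>auto intro: hull_inc\<close>)
  then obtain i where "\<bar>\<zeta> i (h i)\<bar> < 1" by (auto simp: eventually_sequentially)
  moreover have "\<zeta> i (h i) = (1/2) ^ Suc i * q (h i)" by (simp add: \<zeta>_def L)
  moreover have "(1/2) ^ Suc i * q (h i) > (1/2) ^ Suc i * 2 ^ Suc i"
    using h(2) by (intro mult_strict_left_mono) auto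
  ultimately show False by (simp add: power_mult_distrib[symmetric] del: power_Suc)
qed

end

section \<open>Projective tensors and separation\<close>

context space_rep
begin

text \<open>
  The pairs \<open>(c, v)\<close> of a list encode \<open>\<Sum> c \<otimes> v\<close> in the projective tensor product of \<open>c\<^sub>0\<close> with
  \<open>S\<close>, whose dual consists of the operators from \<open>S\<close> to \<open>\<ell>\<^sup>1\<close>; the infimum of the costs of a
  tensor is its projective norm.
\<close>

definition tensors :: "((nat \<Rightarrow> real) \<times> 'v) list set" where
  "tensors = {l. \<forall>(c, v)\<in>set l. v \<in> S \<and> (\<forall>i. \<bar>c i\<bar> \<le> 1)}"

definition val :: "((nat \<Rightarrow> real) \<times> 'v) list \<Rightarrow> nat \<Rightarrow> 'v" where
  "val l = (\<Sum>(c, v)\<leftarrow>l. (\<lambda>i. c i *\<^sub>R v))"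

definition cost :: "((nat \<Rightarrow> real) \<times> 'v) list \<Rightarrow> real" where
  "cost l = (\<Sum>(c, v)\<leftarrow>l. q v)"

lemma val_simps [simp]:
  "val [] = 0" "val ((c, v) # l) = (\<lambda>i. c i *\<^sub>R v) + val l" "val (l @ l') = val l + val l'"
  by (simp_all add: val_def)

lemma cost_simps [simp]:
  "cost [] = 0" "cost ((c, v) # l) = q v + cost l" "cost (l @ l') = cost l + cost l'"
  by (simp_all add: cost_def)

lemma tensors_simps [simp]:
  "[] \<in> tensors" "l @ l' \<in> tensors \<longleftrightarrow> l \<in> tensors \<and> l' \<in> tensors"
  "(c, v) # l \<in> tensors \<longleftrightarrow> v \<in> S \<and> (\<forall>i. \<bar>c i\<bar> \<le> 1) \<and> l \<in> tensors"
  by (auto simp: tensors_def)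

lemma cost_nonneg: "l \<in> tensors \<Longrightarrow> 0 \<le> cost l"
  by (induction l) (auto simp: q_nonneg)

lemma tensor_scale:
  assumes "l \<in> tensors"
  shows "\<exists>l'\<in>tensors. val l' = t *\<^sub>R val l \<and> cost l' = \<bar>t\<bar> * cost l"
  using assms
proof (induction l)
  case Nil
  show ?case by (intro bexI[of _ "[]"]) auto
next
  case (Cons a l)
  obtain c v where a: "a = (c, v)" by fastforce
  have "l \<in> tensors" using Cons.prems a by simp
  from Cons.IH[OF this] obtain l'
    where "l' \<in> tensors" "val l' = t *\<^sub>R val l" "cost l' = \<bar>t\<bar> * cost l" by blast
  then show ?case
    using Cons.prems S_closed(3) unfolding a
    by (intro bexI[of _ "(c, t *\<^sub>R v) # l'"])
      (auto simp: q_scale algebra_simps fun_eq_iff scaleR_add_right)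
qed

definition tensor_norm :: "(nat \<Rightarrow> 'v) \<Rightarrow> real" where
  "tensor_norm U = (INF l\<in>{l \<in> tensors. val l = U}. cost l)"

lemma tensor_norm_le: "l \<in> tensors \<Longrightarrow> tensor_norm (val l) \<le> cost l"
  unfolding tensor_norm_def
  by (intro cINF_lower bdd_belowI2[of _ 0]) (auto simp: cost_nonneg)

lemma tensor_norm_ge:
  assumes "l \<in> tensors" "\<And>l'. l' \<in> tensors \<Longrightarrow> val l' = val l \<Longrightarrow> c \<le> cost l'"
  shows "c \<le> tensor_norm (val l)"
  unfolding tensor_norm_def using assms by (intro cINF_greatest) auto

lemma subspace_tensors: "subspace (val ` tensors)"
proof (rule subspaceI)
  show "0 \<in> val ` tensors" by (intro image_eqI[of _ _ "[]"]) auto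
next
  fix x y assume "x \<in> val ` tensors" "y \<in> val ` tensors"
  then obtain l l' where "l \<in> tensors" "l' \<in> tensors" "x = val l" "y = val l'" by auto
  then show "x + y \<in> val ` tensors" by (intro image_eqI[of _ _ "l @ l'"]) auto
next
  fix x and t :: real assume "x \<in> val ` tensors"
  then show "t *\<^sub>R x \<in> val ` tensors" using tensor_scale[of _ t] by (force simp: image_iff)
qed

lemma sublinear_tensor_norm: "sublinear_on (val ` tensors) tensor_norm"
proof (rule sublinear_onI[OF subspace_tensors])
  fix x y assume "x \<in> val ` tensors" "y \<in> val ` tensors"
  then obtain l k where l: "l \<in> tensors" "x = val l" and k: "k \<in> tensors" "y = val k" by auto
  have 1: "tensor_norm (x + y) \<le> cost l' + cost k'"
    if "l' \<in> tensors" "val l' = x" "k' \<in> tensors" "val k' = y" for l' k'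
    using tensor_norm_le[of "l' @ k'"] that by simp
  have "tensor_norm (x + y) - cost l' \<le> tensor_norm y" if "l' \<in> tensors" "val l' = x" for l'
    unfolding k(2) by (rule tensor_norm_ge) (use 1[OF that] k in \<open>force+\<close>)
  then have "tensor_norm (x + y) - tensor_norm y \<le> tensor_norm x"
    unfolding l(2) by (intro tensor_norm_ge) (use l in \<open>force+\<close>)
  then show "tensor_norm (x + y) \<le> tensor_norm x + tensor_norm y" by simp
next
  fix t :: real and x assume t: "0 < t" and "x \<in> val ` tensors"
  then obtain l where l: "l \<in> tensors" "x = val l" by auto
  have "tensor_norm (t *\<^sub>R x) / t \<le> tensor_norm x"
    unfolding l(2)
  proof (rule tensor_norm_ge[OF l(1)])
    fix l' assume l': "l' \<in> tensors" "val l' = val l"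
    then obtain m where "m \<in> tensors" "val m = t *\<^sub>R val l" "cost m = t * cost l'"
      using tensor_scale[OF l'(1), of t] t by auto
    then show "tensor_norm (t *\<^sub>R val l) / t \<le> cost l'"
      using tensor_norm_le[of m] t by (simp add: field_simps)
  qed
  then show "tensor_norm (t *\<^sub>R x) \<le> t * tensor_norm x"
    using t by (simp add: field_simps)
next
  show "tensor_norm 0 = 0"
    using tensor_norm_le[of "[]"] tensor_norm_ge[of "[]" 0] cost_nonneg by simp
qed

text \<open>The elementary tensor of the \<open>i\<close>-th unit vector of \<open>c\<^sub>0\<close>
  with \<open>v\<close>.\<close>

definition unit_seq :: "nat \<Rightarrow> 'v \<Rightarrow> nat \<Rightarrow> 'v" where
  "unit_seq i v = (\<lambda>j. if j = i then v else 0)"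

lemma unit_seq_tensor:
  assumes "v \<in> S"
  shows "unit_seq i v \<in> val ` tensors"
  using assms
  by (intro image_eqI[of _ _ "[(\<lambda>j. if j = i then 1 else 0, v)]"]) (auto simp: unit_seq_def fun_eq_iff)

text \<open>If the projective norm were at least \<open>\<eta>\<close> on the whole hull, some
  \<open>L\<close> below that norm would be at least \<open>\<eta>\<close> on every
  \<open>unit_seq i (h i)\<close>. The duality between tensors and operators reads \<open>L\<close>
  as a contraction into \<open>\<ell>\<^sup>1\<close>; its coordinates \<open>\<zeta> i\<close> form
  a weakly unconditionally Cauchy series that stays away from zero along \<open>h i\<close>.\<close>

lemma Vstar_tensor:
  assumes V: "Vstar_set Z (rep ` K)" and K: "K \<subseteq> S"
    and h: "\<And>i. h i \<in> convex hull K" and \<eta>: "0 < \<eta>"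
  obtains l where "l \<in> tensors" "cost l < \<eta>" "val l \<in> convex hull (range (\<lambda>i. unit_seq i (h i)))"
proof (rule ccontr)
  assume neg: "\<not> thesis"
  note main = that
  define D where "D = convex hull (range (\<lambda>i. unit_seq i (h i)))"
  have "convex S" using S by (rule subspace_imp_convex)
  then have hS: "h i \<in> S" for i using h[of i] hull_minimal[of K S convex] K by auto
  have D: "D \<subseteq> val ` tensors"
    unfolding D_def
    by (intro hull_minimal subspace_imp_convex subspace_tensors) (use unit_seq_tensor hS in auto)
  obtain L where L: "linear L" "\<And>U. U \<in> val ` tensors \<Longrightarrow> L U \<le> tensor_norm U"
    "\<And>d. d \<in> D \<Longrightarrow> \<eta> \<le> L d"
  proof (rule mazur_orlicz[OF subspace_tensors sublinear_tensor_norm _ D, of \<eta>])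
    show "convex D" by (simp add: D_def convex_convex_hull)
    fix d assume d: "d \<in> D"
    then obtain l where l: "l \<in> tensors" "d = val l" using D by auto
    show "\<eta> \<le> tensor_norm d"
      unfolding l(2)
    proof (rule tensor_norm_ge[OF l(1)])
      fix l' assume l': "l' \<in> tensors" "val l' = val l"
      show "\<eta> \<le> cost l'"
      proof (rule ccontr)
        assume "\<not> \<eta> \<le> cost l'"
        then show False
          using neg main[of l'] l' d unfolding l(2) D_def by simp
      qed
    qed
  qed blast
  define \<zeta> where "\<zeta> i v = L (unit_seq i v)" for i v
  have usum: "unit_seq i (x + y) = unit_seq i x + unit_seq i y"
    "unit_seq i (c *\<^sub>R x) = c *\<^sub>R unit_seq i x" for i x y c
    by (auto simp: unit_seq_def fun_eq_iff)
  have bd: "(\<Sum>i<N. \<bar>\<zeta> i x\<bar>) \<le> 1 * q x" if x: "x \<in> S" for x N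
  proof -
    \<comment> \<open>The signs are absorbed into the \<open>c\<^sub>0\<close> factor: the single
      pair \<open>(c, x)\<close> costs \<open>q x\<close>, independently of
      \<open>N\<close>.\<close>
    define c where "c i = (if i < N then sgn (\<zeta> i x) else 0)" for i
    have eq: "(\<lambda>i. c i *\<^sub>R x) = (\<Sum>i<N. c i *\<^sub>R unit_seq i x)"
    proof
      fix j
      have "(\<Sum>i<N. c i *\<^sub>R unit_seq i x) j = (\<Sum>i<N. if j = i then c i *\<^sub>R x else 0)"
        unfolding sum_fun_apply by (intro sum.cong) (auto simp: unit_seq_def)
      also have "\<dots> = c j *\<^sub>R x" by (simp add: c_def)
      finally show "c j *\<^sub>R x = (\<Sum>i<N. c i *\<^sub>R unit_seq i x) j" by simp
    qed
    have "(\<Sum>i<N. \<bar>\<zeta> i x\<bar>) = (\<Sum>i<N. c i * \<zeta> i x)"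
      by (intro sum.cong refl) (simp add: c_def sgn_if)
    also have "\<dots> = L (\<lambda>i. c i *\<^sub>R x)"
      unfolding eq linear_sum[OF L(1)] by (simp add: \<zeta>_def linear_cmul[OF L(1)])
    also have "(\<lambda>i. c i *\<^sub>R x) = val [(c, x)]" by simp
    also have "L \<dots> \<le> tensor_norm \<dots>"
      using x by (intro L(2) imageI) (auto simp: c_def sgn_if)
    also have "\<dots> \<le> cost [(c, x)]"
      using x by (intro tensor_norm_le) (auto simp: c_def sgn_if)
    finally show ?thesis by simp
  qed
  have fn: "functional (\<zeta> i) 1" for i
    unfolding functional_def
  proof (intro conjI ballI allI)
    fix x assume x: "x \<in> S"
    have "\<bar>\<zeta> i x\<bar> \<le> (\<Sum>j<Suc i. \<bar>\<zeta> j x\<bar>)" by (simp add: sum_nonneg)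
    also have "\<dots> \<le> 1 * q x" by (rule bd[OF x])
    finally show "\<bar>\<zeta> i x\<bar> \<le> 1 * q x" .
  qed (auto simp: \<zeta>_def usum linear_add[OF L(1)] linear_cmul[OF L(1)])
  have "\<forall>\<^sub>F i in sequentially. \<bar>\<zeta> i (h i)\<bar> < \<eta>"
    by (rule Vstar_tendsto[OF V K fn bd h \<eta>])
  then obtain i where "\<bar>\<zeta> i (h i)\<bar> < \<eta>" by (auto simp: eventually_sequentially)
  moreover have "\<eta> \<le> \<zeta> i (h i)"
    unfolding \<zeta>_def by (rule L(3)) (auto simp: D_def intro: hull_inc)
  ultimately show False by simp
qed

text \<open>If the hull kept distance \<open>\<epsilon>\<close> from \<open>y\<close>, Mazur-Orlicz
  would give a functional that is at least \<open>\<epsilon>\<close> on all \<open>x n - y\<close>.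
  One index with a one-sided estimate already contradicts this, so \<open>weak\<close> asks for
  nothing more.\<close>

lemma mazur:
  fixes x :: "nat \<Rightarrow> 'v"
  assumes y: "y \<in> S" and x: "\<And>n. x n \<in> S" and \<epsilon>: "0 < \<epsilon>"
    and weak: "\<And>L \<delta>. linear L \<Longrightarrow> (\<And>v. v \<in> S \<Longrightarrow> L v \<le> q v) \<Longrightarrow> 0 < \<delta> \<Longrightarrow> \<exists>n. L (x n - y) < \<delta>"
  obtains h where "h \<in> convex hull (range x)" "q (h - y) < \<epsilon>"
proof (rule ccontr)
  assume neg: "\<not> thesis"
  note main = that
  define D where "D = (\<lambda>h. h - y) ` (convex hull (range x))"
  have "convex hull (range x) \<subseteq> S"
    by (intro hull_minimal subspace_imp_convex S) (use x in auto)
  then have D: "D \<subseteq> S" using S_closed(4) y by (auto simp: D_def)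
  have cD: "convex D"
    unfolding D_def by (rule convex_translation_subtract) (rule convex_convex_hull)
  obtain L where L: "linear L" "\<And>v. v \<in> S \<Longrightarrow> L v \<le> q v" "\<And>d. d \<in> D \<Longrightarrow> \<epsilon> \<le> L d"
  proof (rule mazur_orlicz[OF S q_sublinear cD D, of \<epsilon>])
    fix d assume "d \<in> D"
    then obtain h where "h \<in> convex hull (range x)" "d = h - y" by (auto simp: D_def)
    then show "\<epsilon> \<le> q d" using neg main[of h] by (meson not_le)
  qed blast
  obtain n where n: "L (x n - y) < \<epsilon>" using weak[OF L(1,2) \<epsilon>] by blast
  have "x n - y \<in> D" by (auto simp: D_def intro!: imageI hull_inc)
  then show False using L(3) n by force
qed

section \<open>Weak cluster points and a sequential criterion for weak compactness\<close>

lemma topspace_weak_topology: "topspace (weak_topology Z) = vcarrier Z"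
proof -
  have "{x \<in> vcarrier Z. (\<lambda>x. 0) x \<in> (UNIV::real set)} \<in> {{x \<in> vcarrier Z. \<phi> x \<in> U} |\<phi> U. \<phi> \<in> vcarrier (dual Z) \<and> open U}"
    using dual_zero by (intro CollectI exI[of _ "\<lambda>x. 0"] exI[of _ UNIV]) simp
  then show ?thesis
    unfolding weak_topology_def topology_generated_by_topspace by auto
qed

lemma openin_weak_topology:
  "\<phi> \<in> vcarrier (dual Z) \<Longrightarrow> open U \<Longrightarrow> openin (weak_topology Z) {x \<in> vcarrier Z. \<phi> x \<in> U}"
  unfolding weak_topology_def by (rule topology_generated_by_Basis) auto

text \<open>If no \<open>y\<close> is a cluster point, each point of the closure has a weak
  neighbourhood, given by one functional, that the sequence leaves for good. Finitely many of these
  cover the closure, yet a late enough term lies in none of them.\<close>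

lemma cluster_point:
  fixes x :: "nat \<Rightarrow> 'v"
  assumes A: "relatively_weakly_compact Z A" and x: "\<And>n. rep (x n) \<in> A"
  obtains y where "y \<in> S"
    "\<And>\<phi> \<epsilon> N. \<phi> \<in> vcarrier (dual Z) \<Longrightarrow> 0 < \<epsilon> \<Longrightarrow> \<exists>n\<ge>N. \<bar>\<phi> (rep (x n)) - \<phi> (rep y)\<bar> < \<epsilon>"
proof (rule ccontr)
  assume neg: "\<not> thesis"
  have "\<forall>a\<in>vcarrier Z. \<exists>\<phi> \<epsilon> N. \<phi> \<in> vcarrier (dual Z) \<and> 0 < \<epsilon> \<and> (\<forall>n\<ge>N. \<epsilon> \<le> \<bar>\<phi> (rep (x n)) - \<phi> a\<bar>)"
  proof
    fix a assume "a \<in> vcarrier Z"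
    then obtain y where "y \<in> S" "a = rep y" using carrier by auto
    then show "\<exists>\<phi> \<epsilon> N. \<phi> \<in> vcarrier (dual Z) \<and> 0 < \<epsilon> \<and> (\<forall>n\<ge>N. \<epsilon> \<le> \<bar>\<phi> (rep (x n)) - \<phi> a\<bar>)"
      using neg that[of y] by (meson not_le)
  qed
  then obtain \<phi> \<epsilon> N where *: "\<And>a. a \<in> vcarrier Z \<Longrightarrow> \<phi> a \<in> vcarrier (dual Z)"
    "\<And>a. a \<in> vcarrier Z \<Longrightarrow> 0 < (\<epsilon> a :: real)"
    "\<And>a n. a \<in> vcarrier Z \<Longrightarrow> N a \<le> n \<Longrightarrow> \<epsilon> a \<le> \<bar>\<phi> a (rep (x n)) - \<phi> a a\<bar>"
    by metis
  define cl where "cl = weak_topology Z closure_of A"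
  have cl: "compactin (weak_topology Z) cl" "A \<subseteq> cl" "cl \<subseteq> vcarrier Z"
    using A closure_of_subset[of A "weak_topology Z"] closure_of_subset_topspace[of "weak_topology Z" A]
    by (auto simp: relatively_weakly_compact_def cl_def topspace_weak_topology)
  define U where "U a = {z \<in> vcarrier Z. \<phi> a z \<in> ball (\<phi> a a) (\<epsilon> a)}" for a
  have "\<exists>\<F>. finite \<F> \<and> \<F> \<subseteq> U ` cl \<and> cl \<subseteq> \<Union>\<F>"
    using cl(1) unfolding compactin_def
  proof (elim conjE allE[of _ "U ` cl"] impE)
    show "Ball (U ` cl) (openin (weak_topology Z)) \<and> cl \<subseteq> \<Union> (U ` cl)"
    proof (intro conjI ballI subsetI)
      fix V assume "V \<in> U ` cl"
      then show "openin (weak_topology Z) V"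
        using cl(3) *(1) unfolding U_def by (auto intro!: openin_weak_topology simp del: mem_ball)
    next
      fix a assume "a \<in> cl"
      then show "a \<in> \<Union> (U ` cl)"
        using cl(3) *(2) by (intro UN_I[of a]) (auto simp: U_def)
    qed
  qed blast
  then obtain \<F> where \<F>: "finite \<F>" "\<F> \<subseteq> U ` cl" "cl \<subseteq> \<Union>\<F>" by blast
  obtain F where F: "finite F" "F \<subseteq> cl" "cl \<subseteq> \<Union> (U ` F)"
    using finite_subset_image[OF \<F>(1,2)] \<F>(3) by blast
  define n where "n = Max (insert 0 (N ` F))"
  have n: "N a \<le> n" if "a \<in> F" for a
    unfolding n_def using F(1) that by (intro Max_ge) auto
  obtain a where a: "a \<in> F" "rep (x n) \<in> U a" using F(3) cl(2) x[of n] by blast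
  then have "a \<in> vcarrier Z" using F(2) cl(3) by auto
  from *(3)[OF this n[OF a(1)]] a(2) show False
    by (simp add: U_def dist_real_def abs_minus_commute)
qed

text \<open>Mazur's theorem, applied to each tail of the sequence, yields norm approximations of one
  and the same cluster point from every tail.\<close>

lemma cluster_convex:
  fixes x :: "nat \<Rightarrow> 'v"
  assumes A: "relatively_weakly_compact Z A" and x: "\<And>n. rep (x n) \<in> A" "\<And>n. x n \<in> S"
  obtains y where "y \<in> S"
    "\<And>\<phi> \<epsilon> N. \<phi> \<in> vcarrier (dual Z) \<Longrightarrow> 0 < \<epsilon> \<Longrightarrow> \<exists>n\<ge>N. \<bar>\<phi> (rep (x n)) - \<phi> (rep y)\<bar> < \<epsilon>"
    "\<And>n \<epsilon>. 0 < \<epsilon> \<Longrightarrow> \<exists>h\<in>convex hull (x ` {n..}). q (h - y) < \<epsilon>"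
proof -
  obtain y where y: "y \<in> S"
    "\<And>\<phi> \<epsilon> N. \<phi> \<in> vcarrier (dual Z) \<Longrightarrow> 0 < \<epsilon> \<Longrightarrow> \<exists>n\<ge>N. \<bar>\<phi> (rep (x n)) - \<phi> (rep y)\<bar> < \<epsilon>"
    using cluster_point[OF A, of x] x(1) by blast
  moreover have "\<exists>h\<in>convex hull (x ` {n..}). q (h - y) < \<epsilon>" if \<epsilon>: "0 < \<epsilon>" for n \<epsilon>
  proof (rule mazur[OF y(1), of "\<lambda>k. x (n + k)" \<epsilon>])
    show "\<exists>k. L (x (n + k) - y) < \<delta>" if L: "linear L" "\<And>v. v \<in> S \<Longrightarrow> L v \<le> q v" and \<delta>: "0 < \<delta>" for L \<delta>
    proof -
      have fL: "functional L 1" using linear_functional L by blast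
      obtain m where "m \<ge> n" "\<bar>lift L (rep (x m)) - lift L (rep y)\<bar> < \<delta>"
        using y(2)[OF lift_dual[OF fL] \<delta>] by blast
      then have "L (x (n + (m - n)) - y) < \<delta>"
        using lift_rep[OF fL] y(1) x(2) by (simp add: linear_diff[OF L(1)] abs_less_iff)
      then show ?thesis by blast
    qed
    have "range (\<lambda>k. x (n + k)) = x ` {n..}"
      by (auto simp: image_iff) (metis le_Suc_ex)
    then show "h \<in> convex hull (range (\<lambda>k. x (n + k))) \<Longrightarrow> q (h - y) < \<epsilon> \<Longrightarrow> ?thesis" for h
      by auto
  qed (use x \<epsilon> in auto)
  ultimately show thesis using that by blast
qed

end

text \<open>The hulls of the finite initial pieces increase with \<open>m\<close>, so their union is
  convex.\<close>

lemma convex_hull_range_finite: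
  fixes x :: "nat \<Rightarrow> 'v::real_vector"
  assumes "h \<in> convex hull (range x)"
  obtains m where "h \<in> convex hull (x ` {..<m})"
proof -
  have "convex (\<Union>m. convex hull (x ` {..<m}))"
  proof (rule convexI, clarsimp)
    fix a b m n and u v :: real
    assume a: "a \<in> convex hull (x ` {..<m})" and b: "b \<in> convex hull (x ` {..<n})"
      and uv: "0 \<le> u" "0 \<le> v" "u + v = 1"
    have "x ` {..<m} \<subseteq> x ` {..<max m n}" "x ` {..<n} \<subseteq> x ` {..<max m n}" by auto
    then have "a \<in> convex hull (x ` {..<max m n})" "b \<in> convex hull (x ` {..<max m n})"
      using a b hull_mono by blast+
    then have "u *\<^sub>R a + v *\<^sub>R b \<in> convex hull (x ` {..<max m n})"
      using uv by (intro convexD convex_convex_hull)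
    then show "\<exists>k. u *\<^sub>R a + v *\<^sub>R b \<in> convex hull (x ` {..<k})" by blast
  qed
  moreover have "range x \<subseteq> (\<Union>m. convex hull (x ` {..<m}))"
  proof (clarsimp)
    fix i show "\<exists>m. x i \<in> convex hull (x ` {..<m})"
      by (rule exI[of _ "Suc i"]) (auto intro: hull_inc)
  qed
  ultimately have "convex hull (range x) \<subseteq> (\<Union>m. convex hull (x ` {..<m}))"
    by (rule hull_minimal[rotated])
  then show thesis using assms that by blast
qed

context space_rep
begin

lemma functional_sum:
  assumes L: "functional L C" and x: "\<And>i. i < (n::nat) \<Longrightarrow> x i \<in> S"
  shows "L (\<Sum>i<n. c i *\<^sub>R x i) = (\<Sum>i<n. c i * L (x i)) \<and> (\<Sum>i<n. c i *\<^sub>R x i) \<in> S"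
  using x
proof (induction n)
  case 0
  then show ?case using functionalD(2)[OF L, of 0 0] S_closed(1) by simp
next
  case (Suc n)
  then show ?case using S_closed by (simp add: functionalD[OF L])
qed

lemma functional_hull_mono:
  assumes L: "functional L C" and x: "\<And>i. i \<in> I \<Longrightarrow> x i \<in> S \<and> L (x i) \<le> a"
    and h: "h \<in> convex hull (x ` I)"
  shows "h \<in> S \<and> L h \<le> a"
proof -
  have "convex {h \<in> S. L h \<le> a}"
  proof (rule convexI, clarsimp)
    fix y z and u v :: real
    assume "y \<in> S" "z \<in> S" "L y \<le> a" "L z \<le> a" "0 \<le> u" "0 \<le> v" "u + v = 1"
    then show "u *\<^sub>R y + v *\<^sub>R z \<in> S \<and> L (u *\<^sub>R y + v *\<^sub>R z) \<le> a"
      using S_closed convex_bound_le[of "L y" a "L z" u v] by (simp add: functionalD[OF L])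
  qed
  then have "convex hull (x ` I) \<subseteq> {h \<in> S. L h \<le> a}"
    by (intro hull_minimal) (use x in auto)
  then show ?thesis using h by auto
qed

text \<open>The dual unit ball, described by evaluations on representatives so that estimates do not
  pass through the supremum in \<open>vnorm\<close>.\<close>

definition dual_ball :: "('a \<Rightarrow> real) set" where
  "dual_ball = {\<phi> \<in> vcarrier (dual Z). \<forall>x\<in>S. \<bar>\<phi> (rep x)\<bar> \<le> q x}"

lemma dual_ball_functional: "\<phi> \<in> dual_ball \<Longrightarrow> functional (\<lambda>x. \<phi> (rep x)) 1"
  by (rule dual_functional[of \<phi>]) (auto simp: dual_ball_def functional_def)

lemma norming_dual_ball:
  assumes "x \<in> S"
  obtains \<phi> where "\<phi> \<in> dual_ball" "\<phi> (rep x) = q x"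
proof -
  obtain L where L: "linear L" "\<And>y. y \<in> S \<Longrightarrow> L y \<le> q y" "L x = q x"
    using norming_functional[OF assms] by blast
  have fL: "functional L 1" using linear_functional L by blast
  show thesis
    by (rule that[of "lift L"])
      (use functionalD(3)[OF fL] lift_dual[OF fL] lift_rep[OF fL] assms L(3) in \<open>auto simp: dual_ball_def\<close>)
qed

lemma dual_ball_combination:
  assumes "\<phi> \<in> dual_ball" "\<psi> \<in> dual_ball" "\<bar>u\<bar> + \<bar>v\<bar> \<le> 1"
  shows "(\<lambda>x. u * \<phi> x + v * \<psi> x) \<in> dual_ball"
proof -
  have "\<bar>u * \<phi> (rep x) + v * \<psi> (rep x)\<bar> \<le> q x" if x: "x \<in> S" for x
  proof -
    have "\<bar>u * \<phi> (rep x) + v * \<psi> (rep x)\<bar> \<le> \<bar>u\<bar> * \<bar>\<phi> (rep x)\<bar> + \<bar>v\<bar> * \<bar>\<psi> (rep x)\<bar>"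
      by (simp add: abs_mult[symmetric])
    also have "\<dots> \<le> \<bar>u\<bar> * q x + \<bar>v\<bar> * q x"
      using assms(1,2) x by (intro add_mono mult_left_mono) (auto simp: dual_ball_def)
    also have "\<dots> = (\<bar>u\<bar> + \<bar>v\<bar>) * q x" by (simp add: algebra_simps)
    also have "\<dots> \<le> 1 * q x" using assms(3) q_nonneg[OF x] by (intro mult_right_mono)
    finally show ?thesis by simp
  qed
  then show ?thesis
    using assms(1,2) dual_combination by (auto simp: dual_ball_def)
qed

lemma dual_separates:
  assumes "x \<in> S" "y \<in> S" "\<And>\<phi>. \<phi> \<in> vcarrier (dual Z) \<Longrightarrow> \<phi> (rep x) = \<phi> (rep y)"
  shows "rep x = rep y"
proof -
  obtain \<phi> where \<phi>: "\<phi> \<in> dual_ball" "\<phi> (rep (x - y)) = q (x - y)"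
    using norming_dual_ball[of "x - y"] assms S_closed by blast
  have "\<phi> (rep x) = \<phi> (rep y)" using \<phi>(1) by (intro assms(3)) (simp add: dual_ball_def)
  then have "q (x - y) = 0"
    using functionalD(4)[OF dual_ball_functional[OF \<phi>(1)], of x y] assms(1,2) \<phi>(2) by simp
  then show ?thesis using rep_eqI assms by blast
qed

text \<open>
  If \<open>G\<close> has distance more than \<open>\<epsilon>\<close> from \<open>Z\<close>, then so it has from the span of finitely many
  vectors, and a separation in finite dimension gives a functional of the unit ball that almost
  annihilates these vectors.
\<close>

lemma isolate_functional:
  fixes n :: nat
  assumes Glin: "\<And>\<phi> \<psi> a b. \<phi> \<in> vcarrier (dual Z) \<Longrightarrow> \<psi> \<in> vcarrier (dual Z) \<Longrightarrow>
      G (\<lambda>x. a * \<phi> x + b * \<psi> x) = a * G \<phi> + b * G \<psi>"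
    and far: "\<And>z. z \<in> S \<Longrightarrow> \<exists>\<phi>\<in>dual_ball. \<epsilon> < G \<phi> - \<phi> (rep z)"
    and \<epsilon>: "0 < \<epsilon>" and \<eta>: "0 < \<eta>" and xs: "\<And>i. i < n \<Longrightarrow> xs i \<in> S"
  obtains \<phi> where "\<phi> \<in> dual_ball" "\<And>i. i < n \<Longrightarrow> \<bar>\<phi> (rep (xs i))\<bar> < \<eta>" "\<epsilon> - \<eta> < G \<phi>"
proof (rule ccontr)
  assume neg: "\<not> thesis"
  note main = that
  \<comment> \<open>The first \<open>n\<close> coordinates measure how far a functional is from
    annihilating the vectors \<open>xs i\<close>. Coordinate \<open>n\<close> measures by how much
    \<open>G \<phi>\<close> falls short of \<open>\<epsilon>\<close>; an excess is harmless, hence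
    \<open>max 0\<close>.\<close>
  define p :: "(nat \<Rightarrow> real) \<Rightarrow> real" where "p z = (\<Sum>i<n. \<bar>z i\<bar>) + max 0 (z n)" for z
  have p: "sublinear_on UNIV p"
  proof (rule sublinear_onI[OF subspace_UNIV])
    fix x y :: "nat \<Rightarrow> real"
    have "(\<Sum>i<n. \<bar>x i + y i\<bar>) \<le> (\<Sum>i<n. \<bar>x i\<bar> + \<bar>y i\<bar>)" by (intro sum_mono) simp
    then show "p (x + y) \<le> p x + p y" by (simp add: p_def sum.distrib)
  next
    fix t :: real and x :: "nat \<Rightarrow> real" assume "0 < t"
    then show "p (t *\<^sub>R x) \<le> t * p x"
      by (simp add: p_def abs_mult sum_distrib_left algebra_simps max_def zero_le_mult_iff mult_le_0_iff)
  qed (simp add: p_def)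
  define d :: "('a \<Rightarrow> real) \<Rightarrow> nat \<Rightarrow> real" where
    "d \<phi> i = (if i < n then \<phi> (rep (xs i)) else if i = n then \<epsilon> - G \<phi> else 0)" for \<phi> i
  have cD: "convex (d ` dual_ball)"
  proof (rule convexI, clarsimp)
    fix \<phi> \<psi> and u v :: real
    assume *: "\<phi> \<in> dual_ball" "\<psi> \<in> dual_ball" "0 \<le> u" "0 \<le> v" "u + v = 1"
    then have "G (\<lambda>x. u * \<phi> x + v * \<psi> x) = u * G \<phi> + v * G \<psi>"
      by (intro Glin) (auto simp: dual_ball_def)
    moreover have "\<epsilon> = u * \<epsilon> + v * \<epsilon>" using *(5) by (simp add: distrib_right[symmetric])
    ultimately have "u *\<^sub>R d \<phi> + v *\<^sub>R d \<psi> = d (\<lambda>x. u * \<phi> x + v * \<psi> x)"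
      by (auto simp: d_def fun_eq_iff algebra_simps)
    then show "u *\<^sub>R d \<phi> + v *\<^sub>R d \<psi> \<in> d ` dual_ball"
      using dual_ball_combination[of \<phi> \<psi> u v] * by auto
  qed
  obtain L where L: "linear L" "\<And>x. x \<in> UNIV \<Longrightarrow> L x \<le> p x" "\<And>z. z \<in> d ` dual_ball \<Longrightarrow> \<eta> \<le> L z"
  proof (rule mazur_orlicz[OF subspace_UNIV p cD, of \<eta>])
    fix z assume "z \<in> d ` dual_ball"
    then obtain \<phi> where \<phi>: "\<phi> \<in> dual_ball" "z = d \<phi>" by auto
    show "\<eta> \<le> p z"
    proof (rule ccontr)
      assume "\<not> \<eta> \<le> p z"
      then have lt: "(\<Sum>i<n. \<bar>\<phi> (rep (xs i))\<bar>) + max 0 (\<epsilon> - G \<phi>) < \<eta>"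
        by (simp add: p_def d_def \<phi>(2))
      have "\<bar>\<phi> (rep (xs i))\<bar> < \<eta>" if "i < n" for i
        using member_le_sum[of i "{..<n}" "\<lambda>i. \<bar>\<phi> (rep (xs i))\<bar>"] that lt by simp
      moreover have "\<epsilon> - \<eta> < G \<phi>"
      proof -
        have "0 \<le> (\<Sum>i<n. \<bar>\<phi> (rep (xs i))\<bar>)" by (simp add: sum_nonneg)
        then show ?thesis using lt by linarith
      qed
      ultimately show False using main[of \<phi>] \<phi>(1) neg by blast
    qed
  qed auto
  define c where "c i = L (\<lambda>j. if j = i then 1 else 0)" for i
  have Ld: "L (d \<phi>) = (\<Sum>i<n. c i * \<phi> (rep (xs i))) + c n * (\<epsilon> - G \<phi>)" for \<phi>
  proof -
    have "d \<phi> = (\<Sum>i\<le>n. d \<phi> i *\<^sub>R (\<lambda>j. if j = i then 1 else 0))"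
    proof
      fix j
      have "(\<Sum>i\<le>n. d \<phi> i *\<^sub>R (\<lambda>j. if j = i then 1 else 0::real)) j = (\<Sum>i\<le>n. if i = j then d \<phi> i else 0)"
        unfolding sum_fun_apply by (intro sum.cong) auto
      also have "\<dots> = d \<phi> j" by (simp add: d_def)
      finally show "d \<phi> j = (\<Sum>i\<le>n. d \<phi> i *\<^sub>R (\<lambda>j. if j = i then 1 else 0)) j" by simp
    qed
    from arg_cong[OF this, of L] have "L (d \<phi>) = (\<Sum>i\<le>n. d \<phi> i * c i)"
      unfolding linear_sum[OF L(1)] linear_cmul[OF L(1)] by (simp add: c_def)
    also have "\<dots> = (\<Sum>i<n. d \<phi> i * c i) + d \<phi> n * c n"
      by (simp flip: lessThan_Suc_atMost)
    also have "(\<Sum>i<n. d \<phi> i * c i) = (\<Sum>i<n. c i * \<phi> (rep (xs i)))"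
      by (intro sum.cong) (auto simp: d_def)
    also have "d \<phi> n = \<epsilon> - G \<phi>" by (simp add: d_def)
    finally show ?thesis by (simp add: mult.commute)
  qed
  \<comment> \<open>At the zero functional only coordinate \<open>n\<close> survives, with value
    \<open>\<epsilon>\<close>. This forces \<open>c n > 0\<close> and allows division by it.\<close>
  have zb: "(\<lambda>x. 0) \<in> dual_ball" by (auto simp: dual_ball_def dual_zero q_nonneg)
  have "G (\<lambda>x. 0) = 0" using Glin[OF dual_zero dual_zero, of 0 0] by simp
  then have "0 < c n * \<epsilon>" using L(3)[of "d (\<lambda>x. 0)"] zb \<eta> Ld[of "\<lambda>x. 0"] by simp
  then have cn: "0 < c n" using \<epsilon> by (simp add: zero_less_mult_iff)
  \<comment> \<open>The separating \<open>L\<close> is read as a vector \<open>z\<close> in the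
    span: \<open>L (d \<phi>)\<close> becomes
    \<open>c n * (\<phi> (rep z) + \<epsilon> - G \<phi>)\<close>, which \<open>far\<close> makes
    negative for some \<open>\<phi>\<close>.\<close>
  define z where "z = (\<Sum>i<n. (c i / c n) *\<^sub>R xs i)"
  have "z \<in> S" unfolding z_def using functional_sum[OF dual_ball_functional[OF zb] xs] by simp
  then obtain \<phi> where \<phi>: "\<phi> \<in> dual_ball" "\<epsilon> < G \<phi> - \<phi> (rep z)" using far by blast
  have "\<phi> (rep z) = (\<Sum>i<n. (c i / c n) * \<phi> (rep (xs i)))"
    unfolding z_def using functional_sum[OF dual_ball_functional[OF \<phi>(1)] xs] by simp
  then have "c n * \<phi> (rep z) = (\<Sum>i<n. c i * \<phi> (rep (xs i)))"
    using cn by (simp add: sum_distrib_left)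
  moreover have "\<eta> \<le> (\<Sum>i<n. c i * \<phi> (rep (xs i))) + c n * (\<epsilon> - G \<phi>)"
    using L(3)[of "d \<phi>"] Ld[of \<phi>] \<phi>(1) by simp
  ultimately have "c n * (G \<phi> - \<phi> (rep z) - \<epsilon>) < 0"
    using \<eta> by (simp add: algebra_simps)
  then show False using cn \<phi>(2) by (simp add: mult_less_0_iff)
qed

definition complete :: bool where
  "complete \<longleftrightarrow> (\<forall>x::nat \<Rightarrow> 'v. (\<forall>n. x n \<in> S) \<longrightarrow> (\<forall>\<epsilon>>0. \<exists>N. \<forall>m\<ge>N. \<forall>n\<ge>N. q (x m - x n) < \<epsilon>) \<longrightarrow>
     (\<exists>y\<in>S. (\<lambda>n. q (x n - y)) \<longlonglongrightarrow> 0))"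

text \<open>\<open>G\<close> is in effect a weak-star cluster point of \<open>K\<close> in the
  bidual. If it had positive distance from the space, an Eberlein-Smulian construction would give
  \<open>x n\<close> in \<open>K\<close> and functionals \<open>\<phi> m\<close> that are large on
  \<open>x n\<close> for \<open>m \<le> n\<close> and small for \<open>n < m\<close>. Blocks from an
  initial piece and from a tail would then be close to the same \<open>y\<close> while
  \<open>\<phi> m\<close> separates them. So \<open>G\<close> is a uniform limit on
  \<open>dual_ball\<close> of evaluations, and completeness provides the point.\<close>

lemma bidual_point:
  assumes K: "K \<subseteq> S" and complete: complete
    and blocks: "\<And>x::nat \<Rightarrow> 'v. (\<And>n. x n \<in> K) \<Longrightarrow>
      \<exists>y\<in>S. \<forall>n. \<forall>\<epsilon>>0. \<exists>h\<in>convex hull (x ` {n..}). q (h - y) < \<epsilon>"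
    and appr: "\<And>F \<epsilon>. finite F \<Longrightarrow> F \<subseteq> vcarrier (dual Z) \<Longrightarrow> 0 < \<epsilon> \<Longrightarrow>
      \<exists>x\<in>K. \<forall>\<phi>\<in>F. \<bar>\<phi> (rep x) - G \<phi>\<bar> < \<epsilon>"
  shows "\<exists>z\<in>S. \<forall>\<phi>\<in>vcarrier (dual Z). G \<phi> = \<phi> (rep z)"
proof -
  have Glin: "G (\<lambda>x. a * \<phi> x + b * \<psi> x) = a * G \<phi> + b * G \<psi>"
    if \<phi>: "\<phi> \<in> vcarrier (dual Z)" and \<psi>: "\<psi> \<in> vcarrier (dual Z)" for \<phi> \<psi> a b
  proof -
    let ?\<chi> = "\<lambda>x. a * \<phi> x + b * \<psi> x"
    have "\<bar>G ?\<chi> - (a * G \<phi> + b * G \<psi>)\<bar> \<le> 0 + e" if e: "0 < e" for e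
    proof -
      define \<epsilon> where "\<epsilon> = e / (1 + \<bar>a\<bar> + \<bar>b\<bar>)"
      have pos: "0 < 1 + \<bar>a\<bar> + \<bar>b\<bar>" by (simp add: add_pos_nonneg)
      have \<epsilon>: "0 < \<epsilon>" using e pos by (simp add: \<epsilon>_def)
      obtain x where x: "\<forall>\<theta>\<in>{?\<chi>, \<phi>, \<psi>}. \<bar>\<theta> (rep x) - G \<theta>\<bar> < \<epsilon>"
        using appr[of "{?\<chi>, \<phi>, \<psi>}" \<epsilon>] \<phi> \<psi> \<epsilon> dual_combination[OF \<phi> \<psi>, of a b] by auto
      have "G ?\<chi> - (a * G \<phi> + b * G \<psi>) =
          (G ?\<chi> - ?\<chi> (rep x)) + (a * (\<phi> (rep x) - G \<phi>) + b * (\<psi> (rep x) - G \<psi>))"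
        by (simp add: algebra_simps)
      also have "\<bar>\<dots>\<bar> \<le> \<bar>G ?\<chi> - ?\<chi> (rep x)\<bar> + (\<bar>a\<bar> * \<bar>\<phi> (rep x) - G \<phi>\<bar> + \<bar>b\<bar> * \<bar>\<psi> (rep x) - G \<psi>\<bar>)"
        unfolding abs_mult[symmetric] by linarith
      also have "\<dots> \<le> \<epsilon> + (\<bar>a\<bar> * \<epsilon> + \<bar>b\<bar> * \<epsilon>)"
        using x by (intro add_mono mult_left_mono) (auto simp: abs_minus_commute)
      also have "\<dots> = \<epsilon> * (1 + \<bar>a\<bar> + \<bar>b\<bar>)" by (simp add: algebra_simps)
      also have "\<dots> = e" using pos by (simp add: \<epsilon>_def)
      finally show ?thesis by simp
    qed
    then have "\<bar>G ?\<chi> - (a * G \<phi> + b * G \<psi>)\<bar> \<le> 0" by (rule field_le_epsilon)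
    then show ?thesis by simp
  qed
  have close: "\<exists>z\<in>S. \<forall>\<phi>\<in>dual_ball. \<bar>G \<phi> - \<phi> (rep z)\<bar> \<le> \<epsilon>" if \<epsilon>: "0 < \<epsilon>" for \<epsilon>
  proof (rule ccontr)
    assume neg: "\<not> (\<exists>z\<in>S. \<forall>\<phi>\<in>dual_ball. \<bar>G \<phi> - \<phi> (rep z)\<bar> \<le> \<epsilon>)"
    have far: "\<exists>\<phi>\<in>dual_ball. \<epsilon> < G \<phi> - \<phi> (rep z)" if z: "z \<in> S" for z
    proof -
      obtain \<phi> where \<phi>: "\<phi> \<in> dual_ball" "\<epsilon> < \<bar>G \<phi> - \<phi> (rep z)\<bar>" using neg z by force
      have m: "(\<lambda>x. (-1) * \<phi> x + 0 * \<phi> x) \<in> dual_ball"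
        using \<phi>(1) by (intro dual_ball_combination) auto
      have "G (\<lambda>x. (-1) * \<phi> x + 0 * \<phi> x) = - G \<phi>"
        using Glin[of \<phi> \<phi> "-1" 0] \<phi>(1) by (simp add: dual_ball_def)
      then show ?thesis using \<phi> m by (cases "0 \<le> G \<phi> - \<phi> (rep z)") (force+)
    qed
    \<comment> \<open>The pair chosen at stage \<open>n\<close>: the functional nearly annihilates
      the earlier vectors but keeps \<open>G\<close> above \<open>3*\<epsilon>/4\<close>, and the
      vector imitates \<open>G\<close> on all functionals chosen so far, the new one
      included.\<close>
    define P where "P f n r \<longleftrightarrow> fst r \<in> dual_ball \<and> snd r \<in> K \<and>
        (\<forall>i<n. \<bar>fst r (rep (snd (f i)))\<bar> < \<epsilon>/4) \<and> 3*\<epsilon>/4 < G (fst r) \<and>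
        (\<forall>m<n. \<bar>fst (f m) (rep (snd r)) - G (fst (f m))\<bar> < \<epsilon>/4) \<and>
        \<bar>fst r (rep (snd r)) - G (fst r)\<bar> < \<epsilon>/4"
      for f :: "nat \<Rightarrow> ('a \<Rightarrow> real) \<times> 'v" and n r
    have "\<exists>f. \<forall>n. P f n (f n)"
    proof (rule dependent_wellorder_choice)
      fix n :: nat and f assume IH: "\<And>m. m < n \<Longrightarrow> P f m (f m)"
      have fK: "snd (f i) \<in> S" "fst (f i) \<in> dual_ball" if "i < n" for i
        using IH[OF that] K by (auto simp: P_def)
      obtain \<phi> where \<phi>: "\<phi> \<in> dual_ball" "\<And>i. i < n \<Longrightarrow> \<bar>\<phi> (rep (snd (f i)))\<bar> < \<epsilon>/4" "\<epsilon> - \<epsilon>/4 < G \<phi>"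
        using isolate_functional[of G \<epsilon> "\<epsilon>/4" n "\<lambda>i. snd (f i)"] Glin far \<epsilon> fK(1) by auto
      obtain x where "x \<in> K" "\<forall>\<theta>\<in>insert \<phi> ((\<lambda>i. fst (f i)) ` {..<n}). \<bar>\<theta> (rep x) - G \<theta>\<bar> < \<epsilon>/4"
        using appr[of "insert \<phi> ((\<lambda>i. fst (f i)) ` {..<n})" "\<epsilon>/4"] \<phi>(1) fK(2) \<epsilon>
        by (auto simp: dual_ball_def)
      then show "\<exists>r. P f n r"
        using \<phi> by (intro exI[of _ "(\<phi>, x)"]) (auto simp: P_def)
    qed (auto simp: P_def)
    then obtain f where f: "\<And>n. P f n (f n)" by blast
    define \<phi> where "\<phi> n = fst (f n)" for n
    define x where "x n = snd (f n)" for n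
    have \<phi>: "\<phi> n \<in> dual_ball" and xK: "x n \<in> K" for n
      using f[of n] by (auto simp: P_def \<phi>_def x_def)
    have small: "\<bar>\<phi> n (rep (x i))\<bar> < \<epsilon>/4" if "i < n" for i n
      using f[of n] that by (auto simp: P_def \<phi>_def x_def)
    have large: "\<epsilon>/2 < \<phi> m (rep (x n))" if "m \<le> n" for m n
    proof -
      have "\<bar>\<phi> m (rep (x n)) - G (\<phi> m)\<bar> < \<epsilon>/4"
        using f[of n] that by (cases "m = n") (auto simp: P_def \<phi>_def x_def)
      moreover have "3*\<epsilon>/4 < G (\<phi> m)" using f[of m] by (auto simp: P_def \<phi>_def)
      ultimately show ?thesis by linarith
    qed
    obtain y where y: "y \<in> S" "\<And>n \<epsilon>. 0 < \<epsilon> \<Longrightarrow> \<exists>h\<in>convex hull (x ` {n..}). q (h - y) < \<epsilon>"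
      using blocks[of x] xK by blast
    have xS: "x n \<in> S" for n using xK K by auto
    \<comment> \<open>\<open>h\<close> uses only vectors before \<open>m\<close>, so
      \<open>\<phi> m\<close> is at most \<open>\<epsilon>/4\<close> there; \<open>k\<close> uses
      only vectors from \<open>m\<close> on, so \<open>\<phi> m\<close> is at least
      \<open>\<epsilon>/2\<close>. Both are within \<open>\<epsilon>/16\<close> of
      \<open>y\<close>.\<close>
    obtain h where h: "h \<in> convex hull (x ` {0..})" "q (h - y) < \<epsilon>/16"
      using y(2)[of "\<epsilon>/16" 0] \<epsilon> by auto
    then have "h \<in> convex hull (range x)" by (simp add: atLeast_0)
    then obtain m where m: "h \<in> convex hull (x ` {..<m})" by (rule convex_hull_range_finite)
    have fm: "functional (\<lambda>x. \<phi> m (rep x)) 1" by (rule dual_ball_functional[OF \<phi>])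
    have hS: "h \<in> S" "\<phi> m (rep h) \<le> \<epsilon>/4"
      using functional_hull_mono[OF fm _ m, of "\<epsilon>/4"] xS small by (force simp: abs_less_iff intro: less_imp_le)+
    obtain k where k: "k \<in> convex hull (x ` {m..})" "q (k - y) < \<epsilon>/16"
      using y(2)[of "\<epsilon>/16" m] \<epsilon> by auto
    have fm': "functional (\<lambda>x. - \<phi> m (rep x)) 1"
      using fm by (auto simp: functional_def)
    have kS: "k \<in> S" "\<epsilon>/2 \<le> \<phi> m (rep k)"
      using functional_hull_mono[OF fm' _ k(1), of "- (\<epsilon>/2)"] xS large by (force intro: less_imp_le)+
    have "\<bar>\<phi> m (rep h) - \<phi> m (rep y)\<bar> < \<epsilon>/16" "\<bar>\<phi> m (rep k) - \<phi> m (rep y)\<bar> < \<epsilon>/16"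
      using functionalD(3)[OF fm, of "h - y"] functionalD(3)[OF fm, of "k - y"] functionalD(4)[OF fm]
        hS kS y(1) h(2) k(2) S_closed(4) by force+
    then show False using hS(2) kS(2) \<epsilon> by linarith
  qed
  have "\<forall>n. \<exists>z. z \<in> S \<and> (\<forall>\<phi>\<in>dual_ball. \<bar>G \<phi> - \<phi> (rep z)\<bar> \<le> 1 / real (Suc n))"
    using close[of "1 / real (Suc n)" for n] by (auto simp: Bex_def)
  from choice[OF this] obtain z
    where z: "\<And>n. z n \<in> S" "\<And>n \<phi>. \<phi> \<in> dual_ball \<Longrightarrow> \<bar>G \<phi> - \<phi> (rep (z n))\<bar> \<le> 1 / real (Suc n)"
    by blast
  have zdist: "q (z m - z n) \<le> 1 / real (Suc m) + 1 / real (Suc n)" for m n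
  proof -
    have "z m - z n \<in> S" using z(1) by (intro S_closed)
    from norming_dual_ball[OF this] obtain \<phi>
      where \<phi>: "\<phi> \<in> dual_ball" "\<phi> (rep (z m - z n)) = q (z m - z n)" by blast
    have "q (z m - z n) = \<phi> (rep (z m)) - \<phi> (rep (z n))"
      using functionalD(4)[OF dual_ball_functional[OF \<phi>(1)]] z(1) \<phi>(2) by simp
    then show ?thesis using z(2)[OF \<phi>(1), of m] z(2)[OF \<phi>(1), of n] by linarith
  qed
  have lim: "(\<lambda>n. 1 / real (Suc n)) \<longlonglongrightarrow> 0" by (rule LIMSEQ_Suc[OF lim_1_over_n])
  have "\<exists>N. \<forall>m\<ge>N. \<forall>n\<ge>N. q (z m - z n) < \<epsilon>" if \<epsilon>: "0 < \<epsilon>" for \<epsilon>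
  proof -
    have "\<forall>\<^sub>F n in sequentially. 1 / real (Suc n) < \<epsilon>/2"
      using order_tendstoD(2)[OF lim, of "\<epsilon>/2"] \<epsilon> by simp
    then obtain N where "\<And>n. N \<le> n \<Longrightarrow> 1 / real (Suc n) < \<epsilon>/2" by (auto simp: eventually_sequentially)
    then show ?thesis using zdist by (intro exI[of _ N]) (smt (verit) field_sum_of_halves)
  qed
  then obtain y where y: "y \<in> S" "(\<lambda>n. q (z n - y)) \<longlonglongrightarrow> 0"
    using complete z(1) unfolding complete_def by blast
  have ball: "G \<phi> = \<phi> (rep y)" if \<phi>: "\<phi> \<in> dual_ball" for \<phi>
  proof -
    have "\<bar>G \<phi> - \<phi> (rep y)\<bar> \<le> 1 / real (Suc n) + q (z n - y)" for n
      using z(2)[OF \<phi>, of n] functionalD(3)[OF dual_ball_functional[OF \<phi>], of "z n - y"]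
        functionalD(4)[OF dual_ball_functional[OF \<phi>], of "z n" y] z(1) y(1) S_closed(4) by force
    moreover have "(\<lambda>n. 1 / real (Suc n) + q (z n - y)) \<longlonglongrightarrow> 0"
      using tendsto_add[OF lim y(2)] by simp
    ultimately have "\<bar>G \<phi> - \<phi> (rep y)\<bar> \<le> 0" by (intro LIMSEQ_le_const) auto
    then show ?thesis by simp
  qed
  have "G \<phi> = \<phi> (rep y)" if \<phi>: "\<phi> \<in> vcarrier (dual Z)" for \<phi>
  proof -
    obtain C where C: "functional (\<lambda>x. \<phi> (rep x)) C" "0 < C" using dual_functional[OF \<phi>] by blast
    have "(\<lambda>x. inverse C * \<phi> x + 0 * \<phi> x) \<in> dual_ball"
      using dual_combination[OF \<phi> \<phi>, of "inverse C" 0] functionalD(3)[OF C(1)] C(2)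
      by (auto simp: dual_ball_def abs_mult field_simps)
    from ball[OF this] show ?thesis using Glin[OF \<phi> \<phi>, of "inverse C" 0] C(2) by simp
  qed
  then show ?thesis using y(1) by blast
qed

text \<open>Compactness is found in the product of real lines over all functionals: the closure
  \<open>Q\<close> of the evaluations of \<open>K\<close> lies in a product of compact intervals.
  The points of \<open>Q\<close> are represented by vectors thanks to \<open>bidual_point\<close>,
  and the resulting map \<open>r\<close> back to the space is weakly continuous. The weak closure of
  \<open>K\<close> is a closed subset of the compact image of \<open>Q\<close> under
  \<open>r\<close>.\<close>

lemma relatively_weakly_compactI:
  assumes K: "K \<subseteq> S" and complete: complete and bounded: "\<And>x. x \<in> K \<Longrightarrow> q x \<le> B"
    and blocks: "\<And>x::nat \<Rightarrow> 'v. (\<And>n. x n \<in> K) \<Longrightarrow>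
      \<exists>y\<in>S. \<forall>n. \<forall>\<epsilon>>0. \<exists>h\<in>convex hull (x ` {n..}). q (h - y) < \<epsilon>"
  shows "relatively_weakly_compact Z (rep ` K)"
proof -
  let ?D = "vcarrier (dual Z)"
  define T :: "(('a \<Rightarrow> real) \<Rightarrow> real) topology" where "T = product_topology (\<lambda>_. euclideanreal) UNIV"
  \<comment> \<open>Coordinates at functions outside the dual are set to \<open>0\<close>, so that
    all functions can serve as indices.\<close>
  define e :: "'a \<Rightarrow> ('a \<Rightarrow> real) \<Rightarrow> real" where "e a = (\<lambda>\<phi>. if \<phi> \<in> ?D then \<phi> a else 0)" for a
  have cont_e: "continuous_map (weak_topology Z) T e"
    unfolding T_def continuous_map_componentwise_UNIV
  proof
    fix \<phi>
    show "continuous_map (weak_topology Z) euclideanreal (\<lambda>a. e a \<phi>)"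
    proof (cases "\<phi> \<in> ?D")
      case True
      then show ?thesis
        unfolding continuous_map_def e_def
        using openin_weak_topology[of \<phi>] by (simp add: topspace_weak_topology)
    qed (simp add: e_def)
  qed
  have "\<forall>\<phi>. \<exists>b. \<forall>x\<in>K. \<bar>e (rep x) \<phi>\<bar> \<le> b"
  proof
    fix \<phi>
    show "\<exists>b. \<forall>x\<in>K. \<bar>e (rep x) \<phi>\<bar> \<le> b"
    proof (cases "\<phi> \<in> ?D")
      case True
      then obtain C where C: "functional (\<lambda>x. \<phi> (rep x)) C" "0 < C" using dual_functional by blast
      have "\<bar>e (rep x) \<phi>\<bar> \<le> C * B" if "x \<in> K" for x
      proof -
        have "\<bar>\<phi> (rep x)\<bar> \<le> C * q x" using functionalD(3)[OF C(1)] that K by auto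
        also have "\<dots> \<le> C * B" using bounded[OF that] C(2) by simp
        finally show ?thesis using True by (simp add: e_def)
      qed
      then show ?thesis by blast
    qed (auto simp: e_def)
  qed
  then obtain b where b: "\<And>\<phi> x. x \<in> K \<Longrightarrow> \<bar>e (rep x) \<phi>\<bar> \<le> b \<phi>" by metis
  define P where "P = Pi\<^sub>E UNIV (\<lambda>\<phi>. {- b \<phi>..b \<phi>})"
  have P: "compactin T P" unfolding T_def P_def by (simp add: compactin_PiE)
  have haus: "Hausdorff_space T" unfolding T_def by (simp add: Hausdorff_space_product_topology)
  define Q where "Q = T closure_of (e ` rep ` K)"
  have "e ` rep ` K \<subseteq> P" using b by (force simp: P_def abs_le_iff)
  then have "Q \<subseteq> P" unfolding Q_def using compactin_imp_closedin[OF haus P] by (rule closure_of_minimal)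
  then have Q: "compactin T Q" using closed_compactin[OF P] by (simp add: Q_def)
  have point: "\<exists>z\<in>S. \<forall>\<phi>\<in>?D. G \<phi> = \<phi> (rep z)" if G: "G \<in> Q" for G
  proof (rule bidual_point[OF K complete blocks])
    fix F :: "('a \<Rightarrow> real) set" and \<epsilon> :: real
    assume F: "finite F" "F \<subseteq> ?D" and \<epsilon>: "0 < \<epsilon>"
    define X where "X \<phi> = (if \<phi> \<in> F then ball (G \<phi>) \<epsilon> else UNIV)" for \<phi>
    have "openin T (Pi\<^sub>E UNIV X)"
      unfolding T_def
    proof (rule product_topology_basis)
      show "finite {\<phi>. X \<phi> \<noteq> topspace euclideanreal}"
        by (rule finite_subset[OF _ F(1)]) (auto simp: X_def)
    qed (simp add: X_def)
    moreover have "G \<in> Pi\<^sub>E UNIV X" using \<epsilon> by (auto simp: X_def)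
    ultimately obtain H where H: "H \<in> e ` rep ` K" "H \<in> Pi\<^sub>E UNIV X"
      using G unfolding Q_def in_closure_of by blast
    then obtain x where x: "x \<in> K" "H = e (rep x)" by auto
    have "\<bar>\<phi> (rep x) - G \<phi>\<bar> < \<epsilon>" if "\<phi> \<in> F" for \<phi>
    proof -
      have "H \<phi> \<in> X \<phi>" using H(2) by auto
      then show ?thesis
        using that F(2) x(2) by (auto simp: X_def e_def dist_real_def abs_minus_commute subset_iff)
    qed
    then show "\<exists>x\<in>K. \<forall>\<phi>\<in>F. \<bar>\<phi> (rep x) - G \<phi>\<bar> < \<epsilon>" using x(1) by blast
  qed
  then obtain w where w: "\<And>G. G \<in> Q \<Longrightarrow> w G \<in> S" "\<And>G \<phi>. G \<in> Q \<Longrightarrow> \<phi> \<in> ?D \<Longrightarrow> G \<phi> = \<phi> (rep (w G))"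
    by metis
  define r where "r G = rep (w G)" for G
  have top: "topspace (subtopology T Q) = Q"
    using compactin_subset_topspace[OF Q] by (simp add: Int_absorb1)
  have "continuous_map (subtopology T Q) (weak_topology Z) r"
    unfolding weak_topology_def
  proof (rule continuous_on_generated_topo)
    fix U assume "U \<in> {{x \<in> vcarrier Z. \<phi> x \<in> U} |\<phi> U. \<phi> \<in> ?D \<and> open U}"
    then obtain \<phi> V where \<phi>: "\<phi> \<in> ?D" "open V" "U = {x \<in> vcarrier Z. \<phi> x \<in> V}" by blast
    have "continuous_map (subtopology T Q) euclideanreal (\<lambda>G. G \<phi>)"
      unfolding T_def by (intro continuous_map_from_subtopology continuous_map_product_projection) simp
    then have "openin (subtopology T Q) {G \<in> topspace (subtopology T Q). G \<phi> \<in> V}"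
      by (rule openin_continuous_map_preimage) (use \<phi>(2) in simp)
    then have "openin (subtopology T Q) {G \<in> Q. G \<phi> \<in> V}" unfolding top .
    also have "{G \<in> Q. G \<phi> \<in> V} = r -` U \<inter> topspace (subtopology T Q)"
    proof -
      have "r G \<in> U \<longleftrightarrow> G \<phi> \<in> V" if "G \<in> Q" for G
        unfolding \<phi>(3) r_def w(2)[OF that \<phi>(1)] using w(1)[OF that] carrier by auto
      then show ?thesis unfolding top by auto
    qed
    finally show "openin (subtopology T Q) (r -` U \<inter> topspace (subtopology T Q))" .
  next
    have "r ` Q \<subseteq> vcarrier Z" using w(1) carrier by (auto simp: r_def)
    then show "r ` topspace (subtopology T Q) \<subseteq> \<Union> {{x \<in> vcarrier Z. \<phi> x \<in> U} |\<phi> U. \<phi> \<in> ?D \<and> open U}"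
      unfolding top using topspace_weak_topology
      unfolding weak_topology_def topology_generated_by_topspace by simp
  qed
  then have rQ: "compactin (weak_topology Z) (r ` Q)"
    using Q by (intro image_compactin[of "subtopology T Q"]) (auto simp: compactin_subtopology)
  have "weak_topology Z closure_of (rep ` K) \<subseteq> r ` Q"
  proof
    fix a assume a: "a \<in> weak_topology Z closure_of (rep ` K)"
    then have "a \<in> vcarrier Z" by (simp add: in_closure_of topspace_weak_topology)
    then obtain z where z: "z \<in> S" "a = rep z" using carrier by auto
    have eQ: "e a \<in> Q"
      using continuous_map_image_closure_subset[OF cont_e, of "rep ` K"] a unfolding Q_def by blast
    have "rep z = rep (w (e a))"
    proof (rule dual_separates[OF z(1) w(1)[OF eQ]])
      fix \<phi> assume "\<phi> \<in> ?D"
      then show "\<phi> (rep z) = \<phi> (rep (w (e a)))" using w(2)[OF eQ] z(2) by (simp add: e_def)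
    qed
    then have "a = r (e a)" using z(2) by (simp add: r_def)
    then show "a \<in> r ` Q" using eQ by blast
  qed
  then have "compactin (weak_topology Z) (weak_topology Z closure_of (rep ` K))"
    by (rule closed_compactin[OF rQ]) simp
  then show ?thesis
    using K carrier by (auto simp: relatively_weakly_compact_def)
qed

end

section \<open>The type \<open>'x\<close> as its own space of representatives; operators into
  \<open>\<ell>\<^sup>1\<close>\<close>

interpretation type_rep: space_rep UNIV norm "\<lambda>x::'x::real_normed_vector. x" type_space
  by unfold_locales (auto simp: type_space_simps norm_triangle_ineq)

lemma type_rep_complete: "type_rep.complete TYPE('x::banach)"
  unfolding type_rep.complete_def
proof (intro allI impI)
  fix x :: "nat \<Rightarrow> 'x" assume "\<forall>\<epsilon>>0. \<exists>N. \<forall>m\<ge>N. \<forall>n\<ge>N. norm (x m - x n) < \<epsilon>"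
  then have "Cauchy x" by (simp add: Cauchy_iff)
  then obtain y where "x \<longlonglongrightarrow> y" using convergent_eq_Cauchy by blast
  then have "(\<lambda>n. norm (x n - y)) \<longlonglongrightarrow> 0" using tendsto_norm_zero LIM_zero by blast
  then show "\<exists>y\<in>UNIV. (\<lambda>n. norm (x n - y)) \<longlonglongrightarrow> 0" by blast
qed

context space_rep
begin

lemma dual_bounded_evaluation:
  assumes \<phi>: "\<phi> \<in> vcarrier (dual Z)" and x: "x \<in> S"
  shows "\<bar>\<phi> (rep x)\<bar> \<le> vnorm (dual Z) \<phi> * q x"
proof -
  obtain C where C: "functional (\<lambda>x. \<phi> (rep x)) C" "0 < C" by (rule dual_functional[OF \<phi>])
  have bdd: "bdd_above ((\<lambda>z. \<bar>\<phi> z\<bar>) ` {z \<in> vcarrier Z. vnorm Z z \<le> 1})"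
  proof (rule bdd_aboveI2)
    fix z assume "z \<in> {z \<in> vcarrier Z. vnorm Z z \<le> 1}"
    then obtain y where y: "y \<in> S" "z = rep y" "q y \<le> 1" using carrier rep_norm by auto
    have "\<bar>\<phi> z\<bar> \<le> C * q y" using functionalD(3)[OF C(1) y(1)] y(2) by simp
    also have "\<dots> \<le> C * 1" using y(3) C(2) by (intro mult_left_mono) auto
    finally show "\<bar>\<phi> z\<bar> \<le> C" by simp
  qed
  have le: "\<bar>\<phi> (rep y)\<bar> \<le> vnorm (dual Z) \<phi>" if "y \<in> S" "q y \<le> 1" for y
    unfolding dual_simps by (rule cSUP_upper[OF _ bdd]) (use that rep_norm carrier in auto)
  show ?thesis
  proof (cases "q x = 0")
    case True
    then show ?thesis using functionalD(3)[OF C(1) x] by simp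
  next
    case False
    have q: "0 < q x" using q_nonneg[OF x] False by simp
    have "\<bar>\<phi> (rep (inverse (q x) *\<^sub>R x))\<bar> \<le> vnorm (dual Z) \<phi>"
      by (rule le) (use q x in \<open>auto simp: q_scale S_closed\<close>)
    then show ?thesis using q by (simp add: functionalD(2)[OF C(1) x] abs_mult field_simps)
  qed
qed

text \<open>Evaluation at \<open>x\<close> is an element of the bidual.\<close>

lemma wuc_dual_pointwise:
  assumes wuc: "wuc (dual Z) \<zeta>" and x: "x \<in> S"
  shows "summable (\<lambda>i. \<bar>\<zeta> i (rep x)\<bar>)"
proof -
  define \<Phi> where "\<Phi> \<phi> = (if \<phi> \<in> vcarrier (dual Z) then \<phi> (rep x) else 0)" for \<phi> :: "'a \<Rightarrow> real"
  have "\<Phi> \<in> vcarrier (dual (dual Z))"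
    unfolding vcarrier_dual[of \<Phi>]
  proof (intro conjI)
    show "linear_between (dual Z) type_space \<Phi>"
    proof -
      have "(\<lambda>v. c * \<phi> v) \<in> vcarrier (dual Z)" if "\<phi> \<in> vcarrier (dual Z)" for c \<phi>
        using dual_combination[OF that that, of c 0] by simp
      then show ?thesis
        unfolding linear_between_def type_space_simps dual_simps
        using dual_combination[of _ Z _ 1 1] by (auto simp: \<Phi>_def)
    qed
    show "\<exists>C. \<forall>\<phi>\<in>vcarrier (dual Z). \<bar>\<Phi> \<phi>\<bar> \<le> C * vnorm (dual Z) \<phi>"
      using dual_bounded_evaluation[OF _ x] by (auto simp: \<Phi>_def mult.commute intro!: exI[of _ "q x"])
  qed (simp add: \<Phi>_def)
  then have "summable (\<lambda>n. \<bar>\<Phi> (\<zeta> n)\<bar>)" using wuc by (simp add: wuc_def)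
  then show ?thesis using wuc by (simp add: wuc_def \<Phi>_def)
qed

end

text \<open>Uniform boundedness through Baire's theorem: some set \<open>A k\<close> contains a
  ball. Differences of its points give the bound \<open>2 * real k\<close> on the ball of radius
  \<open>r\<close> around zero, and scaling to norm \<open>r / 2\<close> gives the constant;
  \<open>real k + 1\<close> in it keeps it positive.\<close>

lemma summable_functionals_uniform:
  fixes \<zeta> :: "nat \<Rightarrow> 'x::banach \<Rightarrow> real"
  assumes bl: "\<And>i. bounded_linear (\<zeta> i)" and sum: "\<And>x. summable (\<lambda>i. \<bar>\<zeta> i x\<bar>)"
  obtains C where "0 < C" "\<And>x N. (\<Sum>i<N. \<bar>\<zeta> i x\<bar>) \<le> C * norm x"
proof -
  note lin = bounded_linear.linear[OF bl]
  define A where "A k = {x. \<forall>N. (\<Sum>i<N. \<bar>\<zeta> i x\<bar>) \<le> real k}" for k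
  have A: "closed (A k)" for k
  proof -
    have "A k = (\<Inter>N. {x. (\<Sum>i<N. \<bar>\<zeta> i x\<bar>) \<le> real k})" by (auto simp: A_def)
    moreover have "closed {x. (\<Sum>i<N. \<bar>\<zeta> i x\<bar>) \<le> real k}" for N
      by (intro closed_Collect_le continuous_intros bounded_linear.continuous_on[OF bl])
    ultimately show ?thesis by auto
  qed
  have "\<exists>k. x \<in> A k" for x
  proof -
    obtain k where k: "(\<Sum>i. \<bar>\<zeta> i x\<bar>) \<le> real k" using real_arch_simple by blast
    have "(\<Sum>i<N. \<bar>\<zeta> i x\<bar>) \<le> (\<Sum>i. \<bar>\<zeta> i x\<bar>)" for N
      by (rule sum_le_suminf[OF sum]) auto
    then show ?thesis using k by (auto simp: A_def intro: order_trans)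
  qed
  then have "\<Union> (range A) = UNIV" by auto
  then have "euclidean interior_of \<Union> (range A) = UNIV" by simp
  then have "\<exists>k. interior (A k) \<noteq> {}"
    using Baire_category_alt[of "euclidean :: 'x topology" "range A"] A completely_metrizable_space_euclidean
    by auto
  then obtain k a r where r: "0 < r" "ball a r \<subseteq> A k"
    by (meson ex_in_conv mem_interior)
  have small: "(\<Sum>i<N. \<bar>\<zeta> i y\<bar>) \<le> 2 * real k" if y: "norm y < r" for y N
  proof -
    have "a + y \<in> A k" "a \<in> A k" using r y by (auto simp: dist_norm subset_iff)
    then have "(\<Sum>i<N. \<bar>\<zeta> i (a + y)\<bar>) \<le> real k" "(\<Sum>i<N. \<bar>\<zeta> i a\<bar>) \<le> real k" by (auto simp: A_def)
    moreover have "(\<Sum>i<N. \<bar>\<zeta> i y\<bar>) \<le> (\<Sum>i<N. \<bar>\<zeta> i (a + y)\<bar> + \<bar>\<zeta> i a\<bar>)"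
      by (intro sum_mono) (simp add: linear_add[OF lin])
    ultimately show ?thesis by (simp add: sum.distrib)
  qed
  show thesis
  proof (rule that)
    show "0 < 4 * (real k + 1) / r" using r(1) by simp
    fix x N
    show "(\<Sum>i<N. \<bar>\<zeta> i x\<bar>) \<le> 4 * (real k + 1) / r * norm x"
    proof (cases "x = 0")
      case True
      then show ?thesis by (simp add: linear_0[OF lin])
    next
      case False
      define c where "c = r / (2 * norm x)"
      have c: "0 < c" using r(1) False by (simp add: c_def)
      have "norm (c *\<^sub>R x) < r" using r(1) False by (simp add: c_def)
      from small[OF this, of N] have "c * (\<Sum>i<N. \<bar>\<zeta> i x\<bar>) \<le> 2 * real k"
        using c by (simp add: linear_cmul[OF lin] abs_mult sum_distrib_left)
      then have "(\<Sum>i<N. \<bar>\<zeta> i x\<bar>) \<le> 2 * real k / c" using c by (simp add: field_simps)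
      also have "\<dots> \<le> 2 * (real k + 1) / c" using c by (intro divide_right_mono) auto
      also have "\<dots> = 4 * (real k + 1) / r * norm x" using False by (simp add: c_def)
      finally show ?thesis .
    qed
  qed
qed

text \<open>The contractions from the space into \<open>\<ell>\<^sup>1\<close>, given by their coordinate functionals.\<close>

definition l1_ops :: "(nat \<Rightarrow> 'x::real_normed_vector \<Rightarrow> real) set" where
  "l1_ops = {T. (\<forall>i. linear (T i)) \<and> (\<forall>x N. (\<Sum>i<N. \<bar>T i x\<bar>) \<le> norm x)}"

lemma l1_ops_subseq:
  assumes T: "T \<in> l1_ops" and r: "strict_mono r"
  shows "(\<lambda>i. T (r i)) \<in> l1_ops"
proof -
  have "(\<Sum>i<N. \<bar>T (r i) x\<bar>) \<le> norm x" for x N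
  proof -
    have "(\<Sum>i<N. \<bar>T (r i) x\<bar>) = (\<Sum>j\<in>r ` {..<N}. \<bar>T j x\<bar>)"
      using r by (simp add: sum.reindex strict_mono_imp_inj_on)
    also have "\<dots> \<le> (\<Sum>j<r N. \<bar>T j x\<bar>)"
      by (intro sum_mono2) (auto simp: strict_mono_less[OF r])
    also have "\<dots> \<le> norm x" using T by (simp add: l1_ops_def)
    finally show ?thesis .
  qed
  then show ?thesis using T by (simp add: l1_ops_def)
qed

lemma l1_ops_bound: "T \<in> l1_ops \<Longrightarrow> \<bar>T i x\<bar> \<le> norm x"
proof -
  assume T: "T \<in> l1_ops"
  have "\<bar>T i x\<bar> \<le> (\<Sum>j<Suc i. \<bar>T j x\<bar>)" by (simp add: sum_nonneg)
  also have "\<dots> \<le> norm x" using T unfolding l1_ops_def by blast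
  finally show ?thesis .
qed

text \<open>If the range fails to be a \<open>V\<^sup>*\<close>-set, some weakly unconditionally
  Cauchy series stays large along points \<open>x n\<close>. Every fixed \<open>x n\<close> is
  eventually almost annihilated, so \<open>n\<close> can be driven to infinity together with the
  index of the functional. Subsequences, signs and normalisation by \<open>C\<close> turn the series
  into one contraction with \<open>T k\<close> large at some \<open>x n\<close>,
  \<open>n \<ge> k\<close>.\<close>

lemma Vstar_set_rangeI:
  fixes x :: "nat \<Rightarrow> 'x::banach"
  assumes no: "\<And>T \<delta>. T \<in> l1_ops \<Longrightarrow> 0 < \<delta> \<Longrightarrow> \<exists>j. \<forall>i\<ge>j. T j (x i) < \<delta>"
  shows "Vstar_set type_space (range x)"
  unfolding Vstar_set_def
proof (intro conjI allI impI)
  fix \<zeta> :: "nat \<Rightarrow> 'x \<Rightarrow> real" assume wuc: "wuc (dual type_space) \<zeta>"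
  obtain C where C: "0 < C" "\<And>x N. (\<Sum>i<N. \<bar>\<zeta> i x\<bar>) \<le> C * norm x"
  proof (rule summable_functionals_uniform[of \<zeta>])
    show "bounded_linear (\<zeta> i)" for i using wuc by (simp add: wuc_def vcarrier_dual_type_space)
  qed (use type_rep.wuc_dual_pointwise[OF wuc] in auto)
  have lin: "linear (\<zeta> i)" for i
    using wuc by (simp add: wuc_def vcarrier_dual_type_space bounded_linear.linear)
  show "(\<lambda>n. SUP z\<in>range x. ennreal \<bar>\<zeta> n z\<bar>) \<longlonglongrightarrow> 0"
  proof (rule order_tendstoI)
    fix a :: ennreal assume "0 < a"
    then obtain b where b: "0 < b" "b < a" using dense by blast
    define e where "e = enn2real b"
    have e: "0 < e" "ennreal e = b"
      using b by (auto simp: e_def enn2real_positive_iff less_top[symmetric] dest: less_le_trans[OF _ top_greatest])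
    have "\<forall>\<^sub>F n in sequentially. (SUP z\<in>range x. ennreal \<bar>\<zeta> n z\<bar>) \<le> ennreal e"
    proof (rule ccontr)
      assume "\<not> ?thesis"
      then have "\<exists>j\<ge>m. \<not> (SUP z\<in>range x. ennreal \<bar>\<zeta> j z\<bar>) \<le> ennreal e" for m
        by (auto simp: eventually_sequentially)
      then have freq: "\<exists>j\<ge>m. \<exists>n. e < \<bar>\<zeta> j (x n)\<bar>" for m
        using e(1) by (fastforce simp: SUP_le_iff not_le ennreal_less_iff)
      \<comment> \<open>The first \<open>k\<close> points are finitely many, and each has
        \<open>\<zeta> j (x n) \<longlonglongrightarrow> 0\<close> in \<open>j\<close>; hence a
        large value must come from a point with index at least \<open>k\<close>.\<close>
      have far: "\<exists>j\<ge>m. \<exists>n\<ge>k. e < \<bar>\<zeta> j (x n)\<bar>" for m k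
      proof -
        have "\<forall>\<^sub>F j in sequentially. \<forall>n\<in>{..<k}. \<bar>\<zeta> j (x n)\<bar> < e"
          using order_tendstoD(2)[OF summable_LIMSEQ_zero[OF type_rep.wuc_dual_pointwise[OF wuc UNIV_I]] e(1)]
          by (intro eventually_ball_finite) auto
        then obtain N where N: "\<And>j n. N \<le> j \<Longrightarrow> n < k \<Longrightarrow> \<bar>\<zeta> j (x n)\<bar> < e"
          by (auto simp: eventually_sequentially)
        obtain j n where "j \<ge> max m N" "e < \<bar>\<zeta> j (x n)\<bar>" using freq by blast
        moreover from this have "\<not> n < k" using N[of j n] by auto
        ultimately show ?thesis by (intro exI[of _ j]) (auto intro!: exI[of _ n])
      qed
      have "\<exists>r. \<forall>k. (\<exists>n\<ge>k. e < \<bar>\<zeta> (r k) (x n)\<bar>) \<and> r k < r (Suc k)"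
        by (rule dependent_nat_choice) (use far in blast, use far Suc_le_eq in meson)
      then obtain r where r: "\<And>k. \<exists>n\<ge>k. e < \<bar>\<zeta> (r k) (x n)\<bar>" "strict_mono r"
        by (auto simp: strict_mono_Suc_iff)
      from r(1) have "\<forall>k. \<exists>n. k \<le> n \<and> e < \<bar>\<zeta> (r k) (x n)\<bar>" by blast
      from choice[OF this] obtain n where n: "\<And>k. k \<le> n k" "\<And>k. e < \<bar>\<zeta> (r k) (x (n k))\<bar>" by blast
      define T where "T k v = sgn (\<zeta> (r k) (x (n k))) * \<zeta> (r k) v / C" for k v
      have "(\<lambda>i v. \<zeta> i v / C) \<in> l1_ops"
      proof -
        have "(\<Sum>i<N. \<bar>\<zeta> i v / C\<bar>) \<le> norm v" for v N
          using C(2)[where x = v and N = N] C(1)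
          by (simp add: sum_divide_distrib[symmetric] divide_le_eq mult.commute)
        then show ?thesis using lin by (auto simp: l1_ops_def linear_iff add_divide_distrib)
      qed
      from l1_ops_subseq[OF this r(2)] have S: "(\<lambda>i v. \<zeta> (r i) v / C) \<in> l1_ops" .
      have "\<bar>T i v\<bar> \<le> \<bar>\<zeta> (r i) v / C\<bar>" for i v by (simp add: T_def abs_mult sgn_if)
      then have "(\<Sum>i<N. \<bar>T i v\<bar>) \<le> (\<Sum>i<N. \<bar>\<zeta> (r i) v / C\<bar>)" for N v
        by (intro sum_mono)
      also have "\<And>N v. (\<Sum>i<N. \<bar>\<zeta> (r i) v / C\<bar>) \<le> norm v"
        using S by (simp add: l1_ops_def)
      finally have "(\<Sum>i<N. \<bar>T i v\<bar>) \<le> norm v" for N v .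
      moreover have "linear (T i)" for i
        using lin by (auto simp: T_def linear_iff add_divide_distrib algebra_simps)
      ultimately have T: "T \<in> l1_ops" by (simp add: l1_ops_def)
      obtain j where j: "\<forall>i\<ge>j. T j (x i) < e / C" using no[OF T, of "e / C"] e(1) C(1) by auto
      have "T j (x (n j)) = \<bar>\<zeta> (r j) (x (n j))\<bar> / C" by (simp add: T_def sgn_if)
      then show False using j n[of j] C(1) by (force simp: divide_less_cancel)
    qed
    then show "\<forall>\<^sub>F n in sequentially. (SUP z\<in>range x. ennreal \<bar>\<zeta> n z\<bar>) < a"
      by eventually_elim (use e(2) b(2) in auto)
  qed simp
qed (simp add: type_space_simps)

section \<open>Midpoint blocks\<close>

text \<open>A dyadic convex hull. A countable set has a countable midpoint hull, and almost sure
  statements about all its elements can be made simultaneously.\<close>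

inductive_set midhull :: "'v::real_vector set \<Rightarrow> 'v set" for A where
  base: "a \<in> A \<Longrightarrow> a \<in> midhull A"
| mid: "x \<in> midhull A \<Longrightarrow> y \<in> midhull A \<Longrightarrow> (1/2) *\<^sub>R (x + y) \<in> midhull A"

lemma midhull_minimal:
  assumes "A \<subseteq> B" "\<And>x y. x \<in> B \<Longrightarrow> y \<in> B \<Longrightarrow> (1/2) *\<^sub>R (x + y) \<in> B"
  shows "midhull A \<subseteq> B"
proof
  fix x assume "x \<in> midhull A"
  then show "x \<in> B" by induction (use assms in auto)
qed

lemma midhull_mono: "A \<subseteq> B \<Longrightarrow> midhull A \<subseteq> midhull B"
  by (intro midhull_minimal) (auto intro: midhull.intros)

lemma midhull_trans: "A \<subseteq> midhull B \<Longrightarrow> midhull A \<subseteq> midhull B"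
  by (intro midhull_minimal) (auto intro: midhull.intros)

lemma convex_midpoint: "convex C \<Longrightarrow> x \<in> C \<Longrightarrow> y \<in> C \<Longrightarrow> (1/2) *\<^sub>R (x + y) \<in> C"
  using convexD[of C x y "1/2" "1/2"] by (simp add: scaleR_add_right)

lemma midhull_subset_convex: "convex C \<Longrightarrow> A \<subseteq> C \<Longrightarrow> midhull A \<subseteq> C"
  by (intro midhull_minimal convex_midpoint)

lemma midhull_subset_hull: "midhull A \<subseteq> convex hull A"
  by (intro midhull_subset_convex convex_convex_hull hull_subset)

lemma midhull_image_apply:
  fixes F :: "('w \<Rightarrow> 'x::real_vector) set"
  assumes "g \<in> midhull F"
  shows "g \<omega> \<in> midhull ((\<lambda>f. f \<omega>) ` F)"
  using assms by induction (auto intro: midhull.intros)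

lemma countable_midhull:
  assumes "countable A"
  shows "countable (midhull A)"
proof -
  define F where "F = rec_nat A (\<lambda>_ B. B \<union> (\<lambda>(x, y). (1/2) *\<^sub>R (x + y)) ` (B \<times> B))"
  have F: "F 0 = A" "F (Suc n) = F n \<union> (\<lambda>(x, y). (1/2) *\<^sub>R (x + y)) ` (F n \<times> F n)" for n
    by (simp_all add: F_def)
  have mono: "F m \<subseteq> F n" if "m \<le> n" for m n
    using that by (rule lift_Suc_mono_le[rotated]) (auto simp: F)
  have "midhull A \<subseteq> (\<Union>n. F n)"
  proof (rule midhull_minimal)
    show "A \<subseteq> (\<Union>n. F n)" using F(1) by auto
    fix x y assume "x \<in> (\<Union>n. F n)" "y \<in> (\<Union>n. F n)"
    then obtain m n where "x \<in> F m" "y \<in> F n" by auto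
    then have "x \<in> F (max m n)" "y \<in> F (max m n)" using mono[of m "max m n"] mono[of n "max m n"] by auto
    then have "(1/2) *\<^sub>R (x + y) \<in> F (Suc (max m n))" by (force simp: F)
    then show "(1/2) *\<^sub>R (x + y) \<in> (\<Union>n. F n)" by blast
  qed
  moreover have "countable (F n)" for n by (induction n) (use assms in \<open>auto simp: F\<close>)
  ultimately show ?thesis by (meson countable_UN countable_subset countableI_type)
qed

text \<open>Blocks may overlap and may use any tail; only their asymptotic position matters. This
  makes the relation transitive and compatible with diagonal sequences, at the price of a threshold
  \<open>n0\<close> that \<open>blk_normalize\<close> removes by a subsequence.\<close>

definition blk :: "(nat \<Rightarrow> 'v::real_vector) \<Rightarrow> (nat \<Rightarrow> 'v) \<Rightarrow> bool" where
  "blk h g \<longleftrightarrow> (\<forall>N. \<exists>n0. \<forall>n\<ge>n0. h n \<in> midhull (g ` {N..}))"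

lemma blkI: "(\<And>n. h n \<in> midhull (g ` {n..})) \<Longrightarrow> blk h g"
proof (unfold blk_def, intro allI)
  fix N assume h: "\<And>n. h n \<in> midhull (g ` {n..})"
  have "midhull (g ` {n..}) \<subseteq> midhull (g ` {N..})" if "N \<le> n" for n
    using that by (intro midhull_mono) auto
  then show "\<exists>n0. \<forall>n\<ge>n0. h n \<in> midhull (g ` {N..})" using h by blast
qed

lemma blk_refl: "blk g g"
  by (rule blkI) (auto intro: midhull.base)

lemma blk_subseq: "strict_mono r \<Longrightarrow> blk (\<lambda>n. g (r n)) g"
  by (rule blkI) (auto intro!: midhull.base simp: seq_suble)

lemma blk_trans:
  assumes "blk h g" "blk g f"
  shows "blk h f"
  unfolding blk_def
proof
  fix N
  obtain n0 where n0: "\<And>n. n0 \<le> n \<Longrightarrow> g n \<in> midhull (f ` {N..})"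
    using assms(2) unfolding blk_def by blast
  obtain n1 where n1: "\<And>n. n1 \<le> n \<Longrightarrow> h n \<in> midhull (g ` {n0..})"
    using assms(1) unfolding blk_def by blast
  have "midhull (g ` {n0..}) \<subseteq> midhull (f ` {N..})" using n0 by (intro midhull_trans) auto
  then show "\<exists>n0. \<forall>n\<ge>n0. h n \<in> midhull (f ` {N..})" using n1 by blast
qed

text \<open>The \<open>n\<close>-th diagonal term is taken so late in \<open>G n\<close> that it
  lies in the midpoint hull of the tail from \<open>n\<close> of each of \<open>G 0\<close>, ...,
  \<open>G n\<close>.\<close>

lemma blk_diagonal:
  assumes "\<And>n. blk (G (Suc n)) (G n)"
  obtains g where "\<And>n. blk g (G n)"
proof -
  have blk: "blk (G n) (G j)" if "j \<le> n" for j n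
    using that
  proof (induction rule: dec_induct)
    case base
    show ?case by (rule blk_refl)
  next
    case (step m)
    then show ?case using blk_trans[OF assms[of m]] by blast
  qed
  have "\<exists>k. \<forall>j\<le>n. G n k \<in> midhull (G j ` {n..})" for n
  proof -
    have "\<forall>j. \<exists>n0. j \<le> n \<longrightarrow> (\<forall>k\<ge>n0. G n k \<in> midhull (G j ` {n..}))"
      using blk unfolding blk_def by blast
    from choice[OF this] obtain n0 where n0: "\<And>j k. j \<le> n \<Longrightarrow> n0 j \<le> k \<Longrightarrow> G n k \<in> midhull (G j ` {n..})"
      by blast
    have "n0 j \<le> Max (n0 ` {..n})" if "j \<le> n" for j using that by (intro Max_ge) auto
    then show ?thesis using n0 by blast
  qed
  then obtain k where k: "\<And>n j. j \<le> n \<Longrightarrow> G n (k n) \<in> midhull (G j ` {n..})" by metis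
  show thesis
  proof (rule that)
    fix j
    show "blk (\<lambda>n. G n (k n)) (G j)"
      unfolding blk_def
    proof
      fix N
      have "G n (k n) \<in> midhull (G j ` {N..})" if "max j N \<le> n" for n
      proof -
        have "G j ` {n..} \<subseteq> G j ` {N..}" using that by auto
        from midhull_mono[OF this] show ?thesis using k[of j n] that by auto
      qed
      then show "\<exists>n0. \<forall>n\<ge>n0. G n (k n) \<in> midhull (G j ` {N..})" by blast
    qed
  qed
qed

lemma blk_simultaneous:
  assumes step: "\<And>n g. blk g f \<Longrightarrow> \<exists>h. blk h g \<and> P n h"
    and hered: "\<And>n g h. P n g \<Longrightarrow> blk h g \<Longrightarrow> P n h"
  obtains g where "blk g f" "\<And>n::nat. P n g"
proof -
  \<comment> \<open>Property \<open>P n\<close> is attained by \<open>G (Suc n)\<close>; the shift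
    leaves the starting sequence without an obligation.\<close>
  have "\<exists>G. \<forall>n. (blk (G n) f \<and> (n > 0 \<longrightarrow> P (n - 1) (G n))) \<and> blk (G (Suc n)) (G n)"
  proof (rule dependent_nat_choice)
    show "\<exists>g. blk g f \<and> (0 < (0::nat) \<longrightarrow> P (0 - 1) g)" using blk_refl by auto
    fix g n assume g: "blk g f \<and> (0 < n \<longrightarrow> P (n - 1) g)"
    then obtain h where "blk h g" "P n h" using step by blast
    then show "\<exists>h. (blk h f \<and> (0 < Suc n \<longrightarrow> P (Suc n - 1) h)) \<and> blk h g"
      using g blk_trans by auto
  qed
  then obtain G where G: "\<And>n. blk (G n) f" "\<And>n. P n (G (Suc n))" "\<And>n. blk (G (Suc n)) (G n)"
    by (metis diff_Suc_1 zero_less_Suc)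
  obtain g where g: "\<And>n. blk g (G n)" using blk_diagonal[of G] G(3) by blast
  show thesis
    by (rule that[of g]) (use blk_trans[OF g G(1)] hered[OF G(2) g] in auto)
qed

text \<open>Each \<open>\<Lambda> k\<close> can only decrease and is bounded below, so a suitable
  block sequence comes within \<open>1 / real (Suc m)\<close> of its infimum over further blocks.
  The pairs \<open>(k, m)\<close> are coded as natural numbers, and the diagonal sequence serves all
  of them.\<close>

lemma blk_stable:
  fixes \<Lambda> :: "nat \<Rightarrow> (nat \<Rightarrow> 'v::real_vector) \<Rightarrow> real"
  assumes mono: "\<And>k g h. blk h g \<Longrightarrow> \<Lambda> k h \<le> \<Lambda> k g" and nonneg: "\<And>k g. 0 \<le> \<Lambda> k g"
  obtains g where "blk g f" "\<And>k h. blk h g \<Longrightarrow> \<Lambda> k h = \<Lambda> k g"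
proof -
  define P where "P n g \<longleftrightarrow> (\<forall>h. blk h g \<longrightarrow>
      \<Lambda> (fst (prod_decode n)) g \<le> \<Lambda> (fst (prod_decode n)) h + 1 / real (Suc (snd (prod_decode n))))" for n g
  obtain g where g: "blk g f" "\<And>n. P n g"
  proof (rule blk_simultaneous[of f P])
    fix n g
    define k where "k = fst (prod_decode n)"
    define \<epsilon> where "\<epsilon> = 1 / real (Suc (snd (prod_decode n)))"
    have \<epsilon>: "0 < \<epsilon>" by (simp add: \<epsilon>_def)
    define c where "c = (INF h\<in>{h. blk h g}. \<Lambda> k h)"
    have bdd: "bdd_below (\<Lambda> k ` {h. blk h g})" using nonneg by (intro bdd_belowI2[of _ 0])
    have "c < c + \<epsilon>" using \<epsilon> by simp
    then obtain h where h: "blk h g" "\<Lambda> k h < c + \<epsilon>"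
      using cINF_less_iff[OF _ bdd, of "c + \<epsilon>"] blk_refl[of g] unfolding c_def[symmetric] by auto
    have "\<Lambda> k h \<le> \<Lambda> k h' + \<epsilon>" if "blk h' h" for h'
      using cINF_lower[OF bdd, of h'] blk_trans[OF that h(1)] h(2) unfolding c_def[symmetric] by simp
    then show "\<exists>h. blk h g \<and> P n h" using h(1) by (auto simp: P_def k_def \<epsilon>_def)
  next
    fix n g h assume P: "P n g" and h: "blk h g"
    show "P n h"
      unfolding P_def
    proof (intro allI impI)
      fix h' assume "blk h' h"
      then have "blk h' g" using h blk_trans by blast
      then show "\<Lambda> (fst (prod_decode n)) h \<le> \<Lambda> (fst (prod_decode n)) h' + 1 / real (Suc (snd (prod_decode n)))"
        using P mono[OF h, of "fst (prod_decode n)"] unfolding P_def by force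
    qed
  qed blast
  show thesis
  proof (rule that[OF g(1)])
    fix k h assume h: "blk h g"
    have le: "\<Lambda> k g \<le> \<Lambda> k h + 1 / real (Suc m)" for m
      using g(2)[of "prod_encode (k, m)"] h by (simp add: P_def)
    have "(\<lambda>m. \<Lambda> k h + 1 / real (Suc m)) \<longlonglongrightarrow> \<Lambda> k h + 0"
      by (intro tendsto_intros LIMSEQ_Suc[OF lim_1_over_n])
    then have "\<Lambda> k g \<le> \<Lambda> k h + 0" by (rule LIMSEQ_le_const) (use le in auto)
    then show "\<Lambda> k h = \<Lambda> k g" using mono[OF h, of k] by simp
  qed
qed

section \<open>Almost everywhere convergent selections from convex sets\<close>

lemma (in prob_space) AE_summable_abs:
  fixes D :: "nat \<Rightarrow> 'a \<Rightarrow> real"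
  assumes D: "\<And>k. integrable M (D k)" and s: "summable (\<lambda>k. \<integral>\<omega>. \<bar>D k \<omega>\<bar> \<partial>M)"
  shows "AE \<omega> in M. summable (\<lambda>k. \<bar>D k \<omega>\<bar>)"
proof -
  have "(\<integral>\<^sup>+\<omega>. (\<Sum>k. ennreal \<bar>D k \<omega>\<bar>) \<partial>M) = (\<Sum>k. \<integral>\<^sup>+\<omega>. ennreal \<bar>D k \<omega>\<bar> \<partial>M)"
    using D by (intro nn_integral_suminf) auto
  also have "\<dots> = (\<Sum>k. ennreal (\<integral>\<omega>. \<bar>D k \<omega>\<bar> \<partial>M))"
    using D by (intro suminf_cong nn_integral_eq_integral) auto
  also have "\<dots> = ennreal (\<Sum>k. \<integral>\<omega>. \<bar>D k \<omega>\<bar> \<partial>M)" using s by (intro suminf_ennreal2) auto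
  finally have "(\<integral>\<^sup>+\<omega>. (\<Sum>k. ennreal \<bar>D k \<omega>\<bar>) \<partial>M) \<noteq> \<infinity>" by simp
  then have "AE \<omega> in M. (\<Sum>k. ennreal \<bar>D k \<omega>\<bar>) \<noteq> \<infinity>"
    by (intro nn_integral_PInf_AE) (use D in auto)
  then show ?thesis by eventually_elim (auto intro: summable_suminf_not_top)
qed

text \<open>Convexity of \<open>P\<close> gives only an inequality at the midpoint. It can be
  inserted into \<open>t + exp (- t)\<close> because this function increases for
  \<open>t \<ge> 0\<close>.\<close>

lemma add_exp_minus_mono:
  assumes "0 \<le> a" "a \<le> b"
  shows "a + exp (- a) \<le> b + exp (- b :: real)"
proof -
  have "exp (- a) - exp (- b) = exp (- a) * (1 - exp (- (b - a)))"
    by (simp add: right_diff_distrib exp_add[symmetric])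
  also have "\<dots> \<le> 1 * (1 - exp (- (b - a)))" using assms by (intro mult_right_mono) auto
  also have "\<dots> \<le> b - a"
  proof -
    have "1 + t \<le> e \<Longrightarrow> 1 * (1 - e) \<le> - t" for t e :: real by simp
    from this[OF exp_ge_add_one_self[of "- (b - a)"]] show ?thesis by (simp only: minus_minus)
  qed
  finally show ?thesis by simp
qed

text \<open>
  The strictly convex function \<open>t + exp (- t)\<close> has an exact parallelogram defect
  \<open>(exp (- a/2) - exp (- b/2))\<^sup>2\<close>, so nearly minimising its expectation gives a Cauchy
  sequence without any assumption of boundedness on \<open>P\<close>.
\<close>

lemma (in prob_space) convex_selection:
  fixes H :: "nat \<Rightarrow> 'v::real_vector set" and P :: "'v \<Rightarrow> 'a \<Rightarrow> real"
  assumes anti: "\<And>m n. m \<le> n \<Longrightarrow> H n \<subseteq> H m" and ne: "\<And>n. H n \<noteq> {}"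
    and mid: "\<And>n x y. x \<in> H n \<Longrightarrow> y \<in> H n \<Longrightarrow> (1/2) *\<^sub>R (x + y) \<in> H n"
    and int: "\<And>h. h \<in> H 0 \<Longrightarrow> integrable M (P h)"
    and nonneg: "\<And>h \<omega>. h \<in> H 0 \<Longrightarrow> 0 \<le> P h \<omega>"
    and bound: "\<And>h. h \<in> H 0 \<Longrightarrow> expectation (P h) \<le> C"
    and conv: "\<And>x y. x \<in> H 0 \<Longrightarrow> y \<in> H 0 \<Longrightarrow> AE \<omega> in M. P ((1/2) *\<^sub>R (x + y)) \<omega> \<le> (P x \<omega> + P y \<omega>) / 2"
  obtains h where "\<And>n. h n \<in> H n" "AE \<omega> in M. convergent (\<lambda>n. P (h n) \<omega>)"
proof -
  \<comment> \<open>\<open>y\<close> is the square root of \<open>exp (- P)\<close>: it lies in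
    \<open>(0, 1]\<close> for nonnegative \<open>P\<close>, and the parallelogram defect is the
    squared difference of two such functions.\<close>
  define y where "y h \<omega> = exp (- P h \<omega> / 2)" for h \<omega>
  define E where "E h = expectation (\<lambda>\<omega>. P h \<omega> + exp (- P h \<omega>))" for h
  have H0: "H n \<subseteq> H 0" for n by (rule anti) simp
  have Pm [measurable]: "P h \<in> borel_measurable M" if "h \<in> H 0" for h using int[OF that] by simp
  have y01: "0 < y h \<omega>" "h \<in> H 0 \<Longrightarrow> y h \<omega> \<le> 1" for h \<omega> using nonneg by (auto simp: y_def)
  have inte: "integrable M (\<lambda>\<omega>. exp (- P h \<omega>))" if "h \<in> H 0" for h
    by (rule integrable_const_bound[of _ 1]) (use that nonneg in auto)
  have E: "integrable M (\<lambda>\<omega>. P h \<omega> + exp (- P h \<omega>))" if "h \<in> H 0" for h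
    using int[OF that] inte[OF that] by simp
  have E0: "0 \<le> E h" if "h \<in> H 0" for h
    unfolding E_def using nonneg[OF that] by (intro integral_nonneg_AE) (simp add: add_nonneg_nonneg)
  have EC: "E h \<le> C + 1" if "h \<in> H 0" for h
  proof -
    have "expectation (\<lambda>\<omega>. exp (- P h \<omega>)) \<le> expectation (\<lambda>\<omega>. 1)"
      using that nonneg inte by (intro integral_mono) auto
    then show ?thesis using bound[OF that] int[OF that] inte[OF that] by (simp add: E_def prob_space)
  qed
  define i where "i n = (INF h\<in>H n. E h)" for n
  have bdd: "bdd_below (E ` H n)" for n using E0 H0 by (intro bdd_belowI2[of _ 0]) auto
  have i_le: "i n \<le> E h" if "h \<in> H n" for n h unfolding i_def using bdd that by (rule cINF_lower)
  have i_mono: "i m \<le> i n" if "m \<le> n" for m n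
    unfolding i_def using anti[OF that] ne bdd by (intro cINF_superset_mono) auto
  have "i n \<le> C + 1" for n using ne[of n] i_le EC H0 by (meson ex_in_conv order_trans subsetD)
  then obtain I where I: "i \<longlonglongrightarrow> I" "\<And>n. i n \<le> I"
    using incseq_convergent[of i "C + 1"] i_mono by (auto simp: incseq_def)
  have "\<exists>h. h \<in> H n \<and> E h < i n + 1 / real (Suc n)" for n
    using cINF_less_iff[OF ne bdd, of n "i n + 1 / real (Suc n)"] by (auto simp: i_def)
  then obtain h0 where h0: "\<And>n. h0 n \<in> H n" "\<And>n. E (h0 n) < i n + 1 / real (Suc n)" by metis
  have sq_int: "integrable M (\<lambda>\<omega>. (y a \<omega> - y b \<omega>)\<^sup>2)" if "a \<in> H 0" "b \<in> H 0" for a b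
  proof (rule integrable_const_bound[of _ 1])
    have "\<bar>y a \<omega> - y b \<omega>\<bar> \<le> 1" for \<omega> using y01 that by (auto simp: abs_le_iff) (smt (verit) y01 that)+
    then show "AE \<omega> in M. norm ((y a \<omega> - y b \<omega>)\<^sup>2) \<le> 1" by (simp add: abs_square_le_1)
    show "(\<lambda>\<omega>. (y a \<omega> - y b \<omega>)\<^sup>2) \<in> borel_measurable M" unfolding y_def using that by measurable
  qed
  have key: "expectation (\<lambda>\<omega>. (y a \<omega> - y b \<omega>)\<^sup>2) \<le> E a + E b - 2 * i m" if ab: "a \<in> H m" "b \<in> H m" for a b m
  proof -
    define c where "c = (1/2) *\<^sub>R (a + b)"
    have c: "c \<in> H m" unfolding c_def by (rule mid[OF ab])
    note in0 = subsetD[OF H0 ab(1)] subsetD[OF H0 ab(2)] subsetD[OF H0 c]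
    have "AE \<omega> in M. 2 * (P c \<omega> + exp (- P c \<omega>)) \<le>
        (P a \<omega> + exp (- P a \<omega>)) + (P b \<omega> + exp (- P b \<omega>)) - (y a \<omega> - y b \<omega>)\<^sup>2"
      using conv[OF in0(1,2)]
    proof eventually_elim
      case (elim \<omega>)
      have "P c \<omega> + exp (- P c \<omega>) \<le> (P a \<omega> + P b \<omega>) / 2 + exp (- ((P a \<omega> + P b \<omega>) / 2))"
        using elim nonneg[OF in0(3)] by (intro add_exp_minus_mono) (auto simp: c_def)
      moreover have "p + e \<le> (pa + pb) / 2 + X \<Longrightarrow> S = ea + eb - 2 * X \<Longrightarrow>
          2 * (p + e) \<le> (pa + ea) + (pb + eb) - S" for p e pa pb X S ea eb :: real
        by (simp add: field_simps)
      moreover have "(y a \<omega> - y b \<omega>)\<^sup>2 = exp (- P a \<omega>) + exp (- P b \<omega>) - 2 * exp (- ((P a \<omega> + P b \<omega>) / 2))"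
        by (simp add: y_def power2_eq_square algebra_simps exp_add[symmetric] add_divide_distrib diff_divide_distrib)
      ultimately show ?case by blast
    qed
    then have "expectation (\<lambda>\<omega>. 2 * (P c \<omega> + exp (- P c \<omega>))) \<le> expectation (\<lambda>\<omega>.
        (P a \<omega> + exp (- P a \<omega>)) + (P b \<omega> + exp (- P b \<omega>)) - (y a \<omega> - y b \<omega>)\<^sup>2)"
      by (intro integral_mono_AE integrable_mult_right Bochner_Integration.integrable_diff
          Bochner_Integration.integrable_add E sq_int in0)
    also have "\<dots> = E a + E b - expectation (\<lambda>\<omega>. (y a \<omega> - y b \<omega>)\<^sup>2)"
      unfolding E_def using E in0 sq_int by (subst Bochner_Integration.integral_diff) auto
    finally have "2 * E c \<le> E a + E b - expectation (\<lambda>\<omega>. (y a \<omega> - y b \<omega>)\<^sup>2)"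
      unfolding E_def integral_mult_right_zero .
    then show ?thesis using i_le[OF c] by simp
  qed
  have close: "\<exists>N. \<forall>m\<ge>N. \<forall>n\<ge>m. expectation (\<lambda>\<omega>. (y (h0 m) \<omega> - y (h0 n) \<omega>)\<^sup>2) < \<epsilon>" if \<epsilon>: "0 < \<epsilon>" for \<epsilon>
  proof -
    have "(\<lambda>m. I - i m + 2 / real (Suc m)) \<longlonglongrightarrow> I - I + 2 * 0"
      using tendsto_mult[OF tendsto_const LIMSEQ_Suc[OF lim_1_over_n], of 2]
      by (intro tendsto_add tendsto_diff tendsto_const I) simp
    then have "\<forall>\<^sub>F m in sequentially. I - i m + 2 / real (Suc m) < \<epsilon>"
      by (rule order_tendstoD) (use \<epsilon> in simp)
    then obtain N where N: "\<And>m. N \<le> m \<Longrightarrow> I - i m + 2 / real (Suc m) < \<epsilon>" by (auto simp: eventually_sequentially)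
    have "expectation (\<lambda>\<omega>. (y (h0 m) \<omega> - y (h0 n) \<omega>)\<^sup>2) < \<epsilon>" if "N \<le> m" "m \<le> n" for m n
    proof -
      have "expectation (\<lambda>\<omega>. (y (h0 m) \<omega> - y (h0 n) \<omega>)\<^sup>2) \<le> E (h0 m) + E (h0 n) - 2 * i m"
        using h0(1) anti[OF that(2)] by (intro key) auto
      also have "\<dots> \<le> i m + 1 / real (Suc m) + (I + 1 / real (Suc m)) - 2 * i m"
      proof -
        have "1 / real (Suc n) \<le> 1 / real (Suc m)" using that by (intro divide_left_mono) auto
        then show ?thesis using h0(2)[of m] h0(2)[of n] I(2)[of n] by linarith
      qed
      also have "\<dots> = I - i m + 2 / real (Suc m)" by simp
      also have "\<dots> < \<epsilon>" by (rule N[OF that(1)])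
      finally show ?thesis .
    qed
    then show ?thesis by blast
  qed
  \<comment> \<open>The rate \<open>(1/4) ^ k\<close> in the mean square is chosen so that the mean
    absolute differences are summable.\<close>
  have "\<exists>r. \<forall>k. (\<forall>n\<ge>r k. expectation (\<lambda>\<omega>. (y (h0 (r k)) \<omega> - y (h0 n) \<omega>)\<^sup>2) < (1/4) ^ k) \<and> r k < r (Suc k)"
  proof (rule dependent_nat_choice)
    show "\<exists>m. \<forall>n\<ge>m. expectation (\<lambda>\<omega>. (y (h0 m) \<omega> - y (h0 n) \<omega>)\<^sup>2) < (1/4) ^ 0"
      using close[of 1] by auto
    fix m :: nat and k
    obtain N where "\<forall>m\<ge>N. \<forall>n\<ge>m. expectation (\<lambda>\<omega>. (y (h0 m) \<omega> - y (h0 n) \<omega>)\<^sup>2) < (1/4) ^ Suc k"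
      using close[of "(1/4) ^ Suc k"] by auto
    then show "\<exists>m'. (\<forall>n\<ge>m'. expectation (\<lambda>\<omega>. (y (h0 m') \<omega> - y (h0 n) \<omega>)\<^sup>2) < (1/4) ^ Suc k) \<and> m < m'"
      by (intro exI[of _ "max N (Suc m)"]) auto
  qed
  then obtain r where r: "\<And>k n. r k \<le> n \<Longrightarrow> expectation (\<lambda>\<omega>. (y (h0 (r k)) \<omega> - y (h0 n) \<omega>)\<^sup>2) < (1/4) ^ k"
    "strict_mono r" by (auto simp: strict_mono_Suc_iff)
  define h where "h k = h0 (r k)" for k
  have hH: "h k \<in> H k" for k using h0(1)[of "r k"] anti[OF seq_suble[OF r(2), of k]] by (auto simp: h_def)
  then have hH0: "h k \<in> H 0" for k using H0 by blast
  define D where "D k \<omega> = y (h (Suc k)) \<omega> - y (h k) \<omega>" for k \<omega>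
  have yint: "integrable M (y (h k))" for k
    by (rule integrable_const_bound[of _ 1])
      (use y01 hH0 in \<open>auto simp: abs_of_pos y_def[abs_def] intro!: borel_measurable_exp borel_measurable_divide borel_measurable_uminus Pm\<close>)
  have Dint: "integrable M (D k)" for k unfolding D_def using yint by simp
  have Dsmall: "expectation (\<lambda>\<omega>. \<bar>D k \<omega>\<bar>) \<le> (1/2) ^ k" for k
  proof -
    \<comment> \<open>The arithmetic-geometric mean inequality with weight \<open>2 ^ k\<close>
      converts the mean square rate into the mean rate \<open>(1/2) ^ k\<close>.\<close>
    have "\<bar>D k \<omega>\<bar> \<le> (2 ^ k * (D k \<omega>)\<^sup>2 + (1/2) ^ k) / 2" for \<omega>
    proof -
      have "0 \<le> 2 ^ k * (\<bar>D k \<omega>\<bar> - (1/2) ^ k)\<^sup>2" by simp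
      also have "\<dots> = 2 ^ k * (D k \<omega>)\<^sup>2 + (1/2) ^ k - 2 * \<bar>D k \<omega>\<bar>"
        by (simp add: power2_eq_square algebra_simps power_one_over)
      finally show ?thesis by simp
    qed
    moreover have sq: "integrable M (\<lambda>\<omega>. (D k \<omega>)\<^sup>2)" unfolding D_def using sq_int hH0 by simp
    ultimately have "expectation (\<lambda>\<omega>. \<bar>D k \<omega>\<bar>) \<le> expectation (\<lambda>\<omega>. (2 ^ k * (D k \<omega>)\<^sup>2 + (1/2) ^ k) / 2)"
      using Dint by (intro integral_mono) auto
    also have "\<dots> = (2 ^ k * expectation (\<lambda>\<omega>. (D k \<omega>)\<^sup>2) + (1/2) ^ k) / 2"
      using sq by (simp add: prob_space)
    also have "expectation (\<lambda>\<omega>. (D k \<omega>)\<^sup>2) \<le> (1/4) ^ k"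
      using r(1)[of k "r (Suc k)"] strict_monoD[OF r(2), of k "Suc k"]
      by (simp add: D_def h_def power2_commute less_imp_le)
    also have "(2 ^ k * (1/4) ^ k + (1/2) ^ k) / 2 = (1/2::real) ^ k"
      by (simp add: power_mult_distrib[symmetric])
    finally show ?thesis by simp
  qed
  have geo: "summable (\<lambda>k. (1/2::real) ^ k)" by (rule summable_geometric) simp
  have "norm (expectation (\<lambda>\<omega>. \<bar>D k \<omega>\<bar>)) \<le> (1/2) ^ k" for k
    using Dsmall[of k] integral_nonneg_AE[of "\<lambda>\<omega>. \<bar>D k \<omega>\<bar>" M] by simp
  then have "summable (\<lambda>k. expectation (\<lambda>\<omega>. \<bar>D k \<omega>\<bar>))"
    by (rule summable_comparison_test'[OF geo, of 0])
  from AE_summable_abs[OF Dint this] have sD: "AE \<omega> in M. summable (\<lambda>k. \<bar>D k \<omega>\<bar>)" .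
  \<comment> \<open>Convergence of \<open>y\<close> yields convergence of \<open>P\<close> unless
    the limit is \<open>0\<close>, where \<open>P\<close> would tend to infinity. Fatou's lemma and
    the bound \<open>C\<close> exclude this almost everywhere.\<close>
  have "(\<integral>\<^sup>+\<omega>. liminf (\<lambda>n. ennreal (P (h n) \<omega>)) \<partial>M) \<le> liminf (\<lambda>n. \<integral>\<^sup>+\<omega>. ennreal (P (h n) \<omega>) \<partial>M)"
    using hH0 by (intro nn_integral_liminf) auto
  also have "\<dots> \<le> liminf (\<lambda>n::nat. ennreal C)"
  proof (rule Liminf_mono, rule always_eventually, rule allI)
    fix n
    have "(\<integral>\<^sup>+\<omega>. ennreal (P (h n) \<omega>) \<partial>M) = ennreal (expectation (P (h n)))"
      using hH0 int nonneg by (intro nn_integral_eq_integral) auto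
    then show "(\<integral>\<^sup>+\<omega>. ennreal (P (h n) \<omega>) \<partial>M) \<le> ennreal C" using bound[OF hH0] by (simp add: ennreal_leI)
  qed
  also have "\<dots> < \<infinity>" by (simp add: Liminf_const)
  finally have "AE \<omega> in M. liminf (\<lambda>n. ennreal (P (h n) \<omega>)) \<noteq> \<infinity>"
    using hH0 by (intro nn_integral_PInf_AE) auto
  with sD have "AE \<omega> in M. convergent (\<lambda>n. P (h n) \<omega>)"
  proof eventually_elim
    case (elim \<omega>)
    have "summable (\<lambda>k. D k \<omega>)" using elim(1) by (rule summable_rabs_cancel)
    then have "convergent (\<lambda>n. \<Sum>k<n. D k \<omega>)" by (simp add: summable_iff_convergent)
    moreover have "(\<Sum>k<n. D k \<omega>) = y (h n) \<omega> - y (h 0) \<omega>" for n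
      unfolding D_def by (rule sum_lessThan_telescope)
    ultimately have "convergent (\<lambda>n. y (h n) \<omega>)" using convergent_add_const_right_iff[of _ "- y (h 0) \<omega>"] by simp
    then obtain l where l: "(\<lambda>n. y (h n) \<omega>) \<longlonglongrightarrow> l" by (auto simp: convergent_def)
    have Py: "P (h n) \<omega> = - 2 * ln (y (h n) \<omega>)" for n by (simp add: y_def)
    have "l \<noteq> 0"
    proof
      assume "l = 0"
      then have "filterlim (\<lambda>n. y (h n) \<omega>) (at_right 0) sequentially"
        using l y01(1) less_imp_neq[OF y01(1)] by (auto simp: filterlim_at intro!: always_eventually)
      then have "filterlim (\<lambda>n. ln (y (h n) \<omega>)) at_bot sequentially"
        by (rule filterlim_compose[OF ln_at_0])
      then have "filterlim (\<lambda>n. - ln (y (h n) \<omega>)) at_top sequentially"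
        by (simp add: filterlim_uminus_at_top)
      then have "filterlim (\<lambda>n. 2 * - ln (y (h n) \<omega>)) at_top sequentially"
        by (intro filterlim_tendsto_pos_mult_at_top[OF tendsto_const]) auto
      then have "filterlim (\<lambda>n. P (h n) \<omega>) at_top sequentially"
        unfolding Py by simp
      then have "(\<lambda>n. ennreal (P (h n) \<omega>)) \<longlonglongrightarrow> top"
        by (simp add: ennreal_tendsto_top_eq_at_top)
      then have "liminf (\<lambda>n. ennreal (P (h n) \<omega>)) = top" by (intro lim_imp_Liminf) auto
      then show False using elim(2) by simp
    qed
    moreover have "0 \<le> l" using l by (rule LIMSEQ_le_const) (auto intro: less_imp_le y01)
    ultimately have "(\<lambda>n. P (h n) \<omega>) \<longlonglongrightarrow> - 2 * ln l"
      unfolding Py by (intro tendsto_intros l) auto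
    then show ?case by (auto simp: convergent_def)
  qed
  then show thesis using that hH by blast
qed

section \<open>Countably valued functions and upper envelopes\<close>

text \<open>Measurability is required of the fibres, so no sigma-algebra on the range is involved
  and composition with an arbitrary function preserves the notion. It applies equally to vectors,
  lists of vectors and natural numbers.\<close>

definition cval :: "'w measure \<Rightarrow> ('w \<Rightarrow> 'b) \<Rightarrow> bool" where
  "cval M f \<longleftrightarrow> countable (f ` space M) \<and> (\<forall>x. {\<omega> \<in> space M. f \<omega> = x} \<in> sets M)"

lemma cval_sets:
  assumes "cval M f"
  shows "{\<omega> \<in> space M. Q (f \<omega>)} \<in> sets M"
proof -
  have "{\<omega> \<in> space M. Q (f \<omega>)} = (\<Union>x\<in>f ` space M \<inter> {x. Q x}. {\<omega> \<in> space M. f \<omega> = x})" by auto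
  also have "\<dots> \<in> sets M"
    using assms by (intro sets.countable_UN') (auto simp: cval_def)
  finally show ?thesis .
qed

lemma cval_const: "cval M (\<lambda>_. c)"
  by (auto simp: cval_def intro: countable_subset[of _ "{c}"])

lemma cval_comp2:
  assumes f: "cval M f" and g: "cval M g"
  shows "cval M (\<lambda>\<omega>. H (f \<omega>) (g \<omega>))"
proof -
  let ?C = "f ` space M \<times> g ` space M"
  have C: "countable ?C" using f g by (simp add: cval_def)
  have "(\<lambda>\<omega>. H (f \<omega>) (g \<omega>)) ` space M \<subseteq> (\<lambda>(a, b). H a b) ` ?C" by auto
  then have "countable ((\<lambda>\<omega>. H (f \<omega>) (g \<omega>)) ` space M)" using C by (meson countable_image countable_subset)
  moreover have "{\<omega> \<in> space M. H (f \<omega>) (g \<omega>) = x} \<in> sets M" for x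
  proof -
    have "{\<omega> \<in> space M. H (f \<omega>) (g \<omega>) = x} =
        (\<Union>(a, b)\<in>?C \<inter> {(a, b). H a b = x}. {\<omega> \<in> space M. f \<omega> = a} \<inter> {\<omega> \<in> space M. g \<omega> = b})" by auto
    also have "\<dots> \<in> sets M"
      using f g by (intro sets.countable_UN') (auto simp: cval_def intro: countable_subset[OF _ C])
    finally show ?thesis .
  qed
  ultimately show ?thesis by (simp add: cval_def)
qed

lemma cval_comp: "cval M f \<Longrightarrow> cval M (\<lambda>\<omega>. H (f \<omega>))"
  using cval_comp2[of M f f "\<lambda>a _. H a"] by simp

text \<open>Over each of the countably many values of \<open>f\<close> the function agrees with one
  measurable \<open>G x\<close>. In this way the envelopes \<open>\<Psi> l x\<close> can be
  evaluated at random \<open>l\<close> and \<open>x\<close>.\<close>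

lemma cval_compose_measurable:
  assumes f: "cval M f" and G: "\<And>x. x \<in> f ` space M \<Longrightarrow> G x \<in> borel_measurable M"
  shows "(\<lambda>\<omega>. G (f \<omega>) \<omega>) \<in> borel_measurable M"
proof (rule measurable_compose_countable'[where I = "f ` space M"])
  show "f \<in> M \<rightarrow>\<^sub>M count_space (f ` space M)"
  proof (rule measurableI)
    fix A assume "A \<in> sets (count_space (f ` space M))"
    have "f -` A \<inter> space M = {\<omega> \<in> space M. f \<omega> \<in> A}" by auto
    then show "f -` A \<inter> space M \<in> sets M" using cval_sets[OF f, of "\<lambda>x. x \<in> A"] by simp
  qed simp
qed (use f G in \<open>auto simp: cval_def\<close>)

lemma cval_measurable: "cval M f \<Longrightarrow> (\<lambda>\<omega>. u (f \<omega>) :: real) \<in> borel_measurable M"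
  by (rule cval_compose_measurable[where G = "\<lambda>x _. u x"]) auto

lemma cval_midhull:
  fixes F :: "('w \<Rightarrow> 'x::real_vector) set"
  assumes "g \<in> midhull F" "\<And>f. f \<in> F \<Longrightarrow> cval M f"
  shows "cval M g"
proof -
  have "midhull F \<subseteq> {f. cval M f}"
  proof (rule midhull_minimal)
    fix x y :: "'w \<Rightarrow> 'x" assume "x \<in> {f. cval M f}" "y \<in> {f. cval M f}"
    then have "cval M (\<lambda>\<omega>. (1/2) *\<^sub>R (x \<omega> + y \<omega>))" using cval_comp2[of M x y "\<lambda>a b. (1/2) *\<^sub>R (a + b)"] by simp
    then show "(1/2) *\<^sub>R (x + y) \<in> {f. cval M f}" by (simp add: scaleR_fun_def plus_fun_def)
  qed (use assms in auto)
  then show ?thesis using assms by auto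
qed

lemma simple_function_cval: "simple_function M f \<Longrightarrow> cval M f"
proof -
  assume f: "simple_function M f"
  have "{\<omega> \<in> space M. f \<omega> = x} \<in> sets M" for x
  proof -
    have "f -` {x} \<inter> space M \<in> sets M" using f by (rule simple_functionD(2))
    then show ?thesis by (simp add: vimage_def Int_def conj_commute)
  qed
  then show ?thesis using simple_functionD(1)[OF f] by (auto simp: cval_def countable_finite)
qed

text \<open>The value at \<open>\<omega>\<close> is the first term after which the simple approximations oscillate little.\<close>

lemma strongly_measurable_cval:
  fixes f :: "'w \<Rightarrow> 'x::real_normed_vector"
  assumes f: "strongly_measurable M f" and \<epsilon>: "0 < \<epsilon>"
  obtains g where "cval M g" "AE \<omega> in M. norm (g \<omega> - f \<omega>) \<le> \<epsilon>"
proof -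
  obtain s where s: "\<And>n. simple_function M (s n)" "AE \<omega> in M. (\<lambda>n. s n \<omega>) \<longlonglongrightarrow> f \<omega>"
    using f by (auto simp: strongly_measurable_def)
  define A where "A k = {\<omega> \<in> space M. \<forall>j. k \<le> j \<longrightarrow> norm (s j \<omega> - s k \<omega>) \<le> \<epsilon>}" for k
  have A: "A k \<in> sets M" for k
  proof -
    have "A k = space M \<inter> (\<Inter>j\<in>{k..}. {\<omega> \<in> space M. norm (s j \<omega> - s k \<omega>) \<le> \<epsilon>})" by (auto simp: A_def)
    moreover have "{\<omega> \<in> space M. norm (s j \<omega> - s k \<omega>) \<le> \<epsilon>} \<in> sets M" for j
      by (rule cval_sets[where Q = "\<lambda>r. r \<le> \<epsilon>"])
          (rule cval_comp2[OF simple_function_cval[OF s(1)] simple_function_cval[OF s(1)]])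
    ultimately show ?thesis by (auto intro!: sets.Int sets.countable_INT'')
  qed
  \<comment> \<open>\<open>Suc\<close> reserves the value \<open>0\<close> for points at which no
    term qualifies; these form a null set.\<close>
  define K where "K \<omega> = (if \<exists>k. \<omega> \<in> A k then Suc (LEAST k. \<omega> \<in> A k) else 0)" for \<omega>
  define g where "g \<omega> = (case K \<omega> of 0 \<Rightarrow> 0 | Suc k \<Rightarrow> s k \<omega>)" for \<omega>
  have K: "{\<omega> \<in> space M. K \<omega> = k} \<in> sets M" for k
  proof (cases k)
    case 0
    have "{\<omega> \<in> space M. K \<omega> = k} = space M - (\<Union>k. A k)" by (auto simp: K_def 0)
    then show ?thesis using A by auto
  next
    case (Suc m)
    have "{\<omega> \<in> space M. K \<omega> = k} = A m - (\<Union>j<m. A j)"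
    proof (intro set_eqI iffI)
      fix \<omega> assume "\<omega> \<in> {\<omega> \<in> space M. K \<omega> = k}"
      then have "\<exists>k. \<omega> \<in> A k" "(LEAST k. \<omega> \<in> A k) = m" by (auto simp: K_def Suc split: if_splits)
      then show "\<omega> \<in> A m - (\<Union>j<m. A j)" using LeastI_ex[of "\<lambda>k. \<omega> \<in> A k"] not_less_Least by blast
    next
      fix \<omega> assume \<omega>: "\<omega> \<in> A m - (\<Union>j<m. A j)"
      then have "(LEAST k. \<omega> \<in> A k) = m" by (intro Least_equality) (auto simp: not_less[symmetric])
      then show "\<omega> \<in> {\<omega> \<in> space M. K \<omega> = k}" using \<omega> by (auto simp: K_def Suc A_def)
    qed
    then show ?thesis using A by auto
  qed
  have "cval M g"
    unfolding cval_def
  proof (intro conjI allI)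
    have "g ` space M \<subseteq> insert 0 (\<Union>k. s k ` space M)"
    proof (rule image_subsetI)
      fix \<omega> assume "\<omega> \<in> space M"
      then show "g \<omega> \<in> insert 0 (\<Union>k. s k ` space M)" by (cases "K \<omega>") (simp add: g_def, simp add: g_def, blast)
    qed
    moreover have "countable (\<Union>k. s k ` space M)"
      using simple_functionD(1)[OF s(1)] by (intro countable_UN) (auto simp: countable_finite)
    ultimately show "countable (g ` space M)" by (meson countable_insert countable_subset)
    fix x
    have "{\<omega> \<in> space M. g \<omega> = x} = (\<Union>k. {\<omega> \<in> space M. K \<omega> = k} \<inter>
        {\<omega> \<in> space M. (case k of 0 \<Rightarrow> 0 | Suc k \<Rightarrow> s k \<omega>) = x})" by (auto simp: g_def)
    also have "\<dots> \<in> sets M"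
    proof (rule sets.countable_UN, clarify)
      fix k
      have "{\<omega> \<in> space M. (case k of 0 \<Rightarrow> 0 | Suc k \<Rightarrow> s k \<omega>) = x} \<in> sets M"
        using simple_function_cval[OF s(1)] by (cases k) (auto simp: cval_def)
      then show "{\<omega> \<in> space M. K \<omega> = k} \<inter> {\<omega> \<in> space M. (case k of 0 \<Rightarrow> 0 | Suc k \<Rightarrow> s k \<omega>) = x} \<in> sets M"
        using K by blast
    qed
    finally show "{\<omega> \<in> space M. g \<omega> = x} \<in> sets M" .
  qed
  moreover have "AE \<omega> in M. norm (g \<omega> - f \<omega>) \<le> \<epsilon>"
    using s(2) AE_space
  proof eventually_elim
    case (elim \<omega>)
    obtain N where N: "\<And>m n. N \<le> m \<Longrightarrow> N \<le> n \<Longrightarrow> norm (s m \<omega> - s n \<omega>) < \<epsilon>"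
      using LIMSEQ_imp_Cauchy[OF elim(1)] \<epsilon> by (meson CauchyD)
    then have "\<omega> \<in> A N" using elim(2) by (auto simp: A_def less_imp_le)
    then have ex: "\<exists>k. \<omega> \<in> A k" by blast
    define k where "k = (LEAST k. \<omega> \<in> A k)"
    have k: "\<omega> \<in> A k" unfolding k_def using ex by (rule LeastI_ex)
    have "g \<omega> = s k \<omega>" using ex by (simp add: g_def K_def k_def)
    moreover have "(\<lambda>j. norm (s j \<omega> - s k \<omega>)) \<longlonglongrightarrow> norm (f \<omega> - s k \<omega>)"
      by (intro tendsto_intros elim(1))
    then have "norm (f \<omega> - s k \<omega>) \<le> \<epsilon>"
      by (rule LIMSEQ_le_const2) (use k in \<open>auto simp: A_def\<close>)
    ultimately show ?case by (simp add: norm_minus_commute)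
  qed
  ultimately show thesis using that by blast
qed

section \<open>Limits of countably valued functions; upper integrals\<close>

context prob_space
begin

text \<open>Cutting \<open>g n\<close> down to finitely many values alters it on a set of
  probability below \<open>(1/2) ^ n\<close>. By Borel-Cantelli almost every point is eventually
  unaffected.\<close>

lemma AE_limit_strongly_measurable:
  fixes f :: "'a \<Rightarrow> 'x::real_normed_vector"
  assumes g: "\<And>n. cval M (g n)" and lim: "AE \<omega> in M. (\<lambda>n. g n \<omega>) \<longlonglongrightarrow> f \<omega>"
  shows "strongly_measurable M f"
proof -
  have "\<exists>s. simple_function M s \<and> prob {\<omega> \<in> space M. s \<omega> \<noteq> g n \<omega>} < (1/2) ^ n" for n
  proof -
    obtain e :: "nat \<Rightarrow> 'x" where e: "g n ` space M \<subseteq> range e"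
      using g[of n] not_empty by (metis cval_def image_is_empty uncountable_def order_refl)
    define B where "B k = {\<omega> \<in> space M. g n \<omega> \<notin> e ` {..<k}}" for k
    have B: "B k \<in> sets M" for k unfolding B_def by (rule cval_sets[OF g])
    have "(\<lambda>k. prob (B k)) \<longlonglongrightarrow> prob (\<Inter>k. B k)"
      by (rule finite_Lim_measure_decseq) (use B in \<open>auto simp: decseq_def B_def\<close>)
    moreover have "(\<Inter>k. B k) = {}" using e by (auto simp: B_def)
    ultimately have "(\<lambda>k. prob (B k)) \<longlonglongrightarrow> 0" by simp
    then have "\<forall>\<^sub>F k in sequentially. prob (B k) < (1/2) ^ n" by (rule order_tendstoD) simp
    then obtain k where k: "prob (B k) < (1/2) ^ n" by (auto simp: eventually_sequentially)
    define s where "s \<omega> = (if g n \<omega> \<in> e ` {..<k} then g n \<omega> else 0)" for \<omega>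
    have "cval M s" unfolding s_def by (rule cval_comp[OF g, of "\<lambda>x. if x \<in> e ` {..<k} then x else 0"])
    moreover have "finite (s ` space M)"
      by (rule finite_subset[of _ "insert 0 (e ` {..<k})"]) (auto simp: s_def)
    moreover have "s -` {x} \<inter> space M = {\<omega> \<in> space M. s \<omega> = x}" for x by auto
    ultimately have "simple_function M s" by (simp add: simple_function_def cval_def)
    moreover have "prob {\<omega> \<in> space M. s \<omega> \<noteq> g n \<omega>} \<le> prob (B k)"
      using B by (intro finite_measure_mono) (auto simp: s_def B_def)
    ultimately show ?thesis using k by (intro exI[of _ s]) auto
  qed
  then obtain s where s: "\<And>n. simple_function M (s n)" "\<And>n. prob {\<omega> \<in> space M. s n \<omega> \<noteq> g n \<omega>} < (1/2) ^ n"
    by metis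
  have meas: "{\<omega> \<in> space M. s n \<omega> \<noteq> g n \<omega>} \<in> sets M" for n
    by (rule cval_sets[where Q = "\<lambda>b. b"]) (rule cval_comp2[OF simple_function_cval[OF s(1)] g])
  have geo: "summable (\<lambda>k. (1/2::real) ^ k)" by (rule summable_geometric) simp
  have "AE \<omega> in M. \<forall>\<^sub>F n in sequentially. \<omega> \<in> space M - {\<omega> \<in> space M. s n \<omega> \<noteq> g n \<omega>}"
  proof (rule borel_cantelli_AE1)
    show "summable (\<lambda>n. prob {\<omega> \<in> space M. s n \<omega> \<noteq> g n \<omega>})"
      by (rule summable_comparison_test'[OF geo, of 0]) (use s(2) in \<open>auto simp: less_imp_le\<close>)
  qed (use meas in \<open>auto simp: less_top[symmetric]\<close>)
  then have "AE \<omega> in M. (\<lambda>n. s n \<omega>) \<longlonglongrightarrow> f \<omega>"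
    using lim
  proof eventually_elim
    case (elim \<omega>)
    have "\<forall>\<^sub>F n in sequentially. g n \<omega> = s n \<omega>" using elim(1) by eventually_elim auto
    then show ?case using elim(2) by (rule Lim_transform_eventually[rotated])
  qed
  then show ?thesis using s(1) by (auto simp: strongly_measurable_def)
qed

text \<open>The upper integral, for functions that may fail to be measurable. Majorants in
  \<open>[0, 1]\<close> are integrable on a probability space.\<close>

definition upper_int :: "('a \<Rightarrow> real) \<Rightarrow> real" where
  "upper_int \<phi> = (INF \<psi>\<in>{\<psi> \<in> borel_measurable M. \<forall>\<omega>\<in>space M. \<phi> \<omega> \<le> \<psi> \<omega> \<and> 0 \<le> \<psi> \<omega> \<and> \<psi> \<omega> \<le> 1}.
     expectation \<psi>)"

lemma upper_int_le:
  assumes "\<psi> \<in> borel_measurable M" "\<And>\<omega>. \<omega> \<in> space M \<Longrightarrow> \<phi> \<omega> \<le> \<psi> \<omega> \<and> 0 \<le> \<psi> \<omega> \<and> \<psi> \<omega> \<le> 1"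
  shows "upper_int \<phi> \<le> expectation \<psi>"
  unfolding upper_int_def
  by (rule cINF_lower) (use assms in \<open>auto intro!: bdd_belowI2[of _ 0] integral_nonneg_AE\<close>)

lemma upper_int_ge:
  assumes "\<And>\<omega>. \<omega> \<in> space M \<Longrightarrow> \<phi> \<omega> \<le> 1"
    and "\<And>\<psi>. \<psi> \<in> borel_measurable M \<Longrightarrow> (\<And>\<omega>. \<omega> \<in> space M \<Longrightarrow> \<phi> \<omega> \<le> \<psi> \<omega> \<and> 0 \<le> \<psi> \<omega> \<and> \<psi> \<omega> \<le> 1) \<Longrightarrow>
      c \<le> expectation \<psi>"
  shows "c \<le> upper_int \<phi>"
  unfolding upper_int_def
proof (rule cINF_greatest)
  show "{\<psi> \<in> borel_measurable M. \<forall>\<omega>\<in>space M. \<phi> \<omega> \<le> \<psi> \<omega> \<and> 0 \<le> \<psi> \<omega> \<and> \<psi> \<omega> \<le> 1} \<noteq> {}"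
    using assms(1) by (intro ex_in_conv[THEN iffD1] exI[of _ "\<lambda>_. 1"]) auto
qed (use assms(2) in auto)

lemma upper_int_nonneg: "(\<And>\<omega>. \<omega> \<in> space M \<Longrightarrow> \<phi> \<omega> \<le> 1) \<Longrightarrow> 0 \<le> upper_int \<phi>"
  by (rule upper_int_ge) (auto intro!: integral_nonneg_AE)

lemma upper_int_mono:
  assumes "\<And>\<omega>. \<omega> \<in> space M \<Longrightarrow> \<phi> \<omega> \<le> \<phi>' \<omega>" "\<And>\<omega>. \<omega> \<in> space M \<Longrightarrow> \<phi>' \<omega> \<le> 1"
  shows "upper_int \<phi> \<le> upper_int \<phi>'"
  using assms by (intro upper_int_ge[of \<phi>'] upper_int_le) (auto intro: order_trans)

text \<open>The pointwise infimum of a minimising sequence of majorants is a majorant, so the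
  infimum of the expectations is attained.\<close>

lemma upper_envelope:
  assumes \<phi>: "\<And>\<omega>. \<omega> \<in> space M \<Longrightarrow> \<phi> \<omega> \<le> 1"
  obtains \<psi> where "\<psi> \<in> borel_measurable M"
    "\<And>\<omega>. \<omega> \<in> space M \<Longrightarrow> \<phi> \<omega> \<le> \<psi> \<omega> \<and> 0 \<le> \<psi> \<omega> \<and> \<psi> \<omega> \<le> 1" "expectation \<psi> = upper_int \<phi>"
proof -
  let ?A = "{\<psi> \<in> borel_measurable M. \<forall>\<omega>\<in>space M. \<phi> \<omega> \<le> \<psi> \<omega> \<and> 0 \<le> \<psi> \<omega> \<and> \<psi> \<omega> \<le> 1}"
  have ne: "?A \<noteq> {}" using \<phi> by (intro ex_in_conv[THEN iffD1] exI[of _ "\<lambda>_. 1"]) auto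
  have bdd: "bdd_below (expectation ` ?A)" by (auto intro!: bdd_belowI2[of _ 0] integral_nonneg_AE)
  have "\<forall>n. \<exists>\<psi>. \<psi> \<in> ?A \<and> expectation \<psi> < upper_int \<phi> + 1 / real (Suc n)"
    using cINF_less_iff[OF ne bdd, of "upper_int \<phi> + 1 / real (Suc n)" for n]
    unfolding upper_int_def[symmetric] by auto
  from choice[OF this] obtain \<Psi>
    where \<Psi>: "\<And>n. \<Psi> n \<in> ?A" "\<And>n. expectation (\<Psi> n) < upper_int \<phi> + 1 / real (Suc n)" by blast
  define \<psi> where "\<psi> \<omega> = (INF n. \<Psi> n \<omega>)" for \<omega>
  have bd: "bdd_below (range (\<lambda>n. \<Psi> n \<omega>))" if "\<omega> \<in> space M" for \<omega>
    using \<Psi>(1) that by (auto intro!: bdd_belowI2[of _ 0])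
  have m: "\<psi> \<in> borel_measurable M"
    unfolding \<psi>_def by (rule borel_measurable_cINF) (use \<Psi>(1) bd in auto)
  have le: "\<psi> \<omega> \<le> \<Psi> n \<omega>" if "\<omega> \<in> space M" for \<omega> n
    unfolding \<psi>_def using bd[OF that] by (rule cINF_lower) simp
  have b: "\<phi> \<omega> \<le> \<psi> \<omega> \<and> 0 \<le> \<psi> \<omega> \<and> \<psi> \<omega> \<le> 1" if \<omega>: "\<omega> \<in> space M" for \<omega>
    using le[OF \<omega>, of 0] \<Psi>(1) \<omega> unfolding \<psi>_def by (auto intro!: cINF_greatest intro: order_trans)
  have int: "integrable M \<theta>" if "\<theta> \<in> borel_measurable M" "\<And>\<omega>. \<omega> \<in> space M \<Longrightarrow> 0 \<le> \<theta> \<omega> \<and> \<theta> \<omega> \<le> 1" for \<theta> :: "'a \<Rightarrow> real"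
    by (rule integrable_const_bound[of _ 1]) (use that in auto)
  have "expectation \<psi> \<le> upper_int \<phi> + 1 / real (Suc n)" for n
  proof -
    have "expectation \<psi> \<le> expectation (\<Psi> n)"
      using m b \<Psi>(1) le by (intro integral_mono int) auto
    then show ?thesis using \<Psi>(2)[of n] by simp
  qed
  moreover have "(\<lambda>n. upper_int \<phi> + 1 / real (Suc n)) \<longlonglongrightarrow> upper_int \<phi> + 0"
    by (intro tendsto_intros LIMSEQ_Suc[OF lim_1_over_n])
  ultimately have "expectation \<psi> \<le> upper_int \<phi> + 0" by (intro LIMSEQ_le_const) auto
  then show thesis using that[OF m b] upper_int_le[OF m b] by simp
qed

text \<open>The minimum of \<open>\<psi>\<close> and \<open>\<theta>\<close>, corrected on the null
  set where \<open>\<theta>\<close> fails to dominate \<open>\<phi>\<close>, is again an admissible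
  majorant. Its expectation cannot be smaller, so it agrees with \<open>\<psi>\<close> almost
  everywhere.\<close>

lemma upper_envelope_minimal:
  assumes \<psi>: "\<psi> \<in> borel_measurable M" "\<And>\<omega>. \<omega> \<in> space M \<Longrightarrow> 0 \<le> \<psi> \<omega> \<and> \<psi> \<omega> \<le> 1"
    and min: "expectation \<psi> = upper_int \<phi>"
    and le: "\<And>\<omega>. \<omega> \<in> space M \<Longrightarrow> \<phi> \<omega> \<le> \<psi> \<omega>" and \<phi>: "\<And>\<omega>. \<omega> \<in> space M \<Longrightarrow> 0 \<le> \<phi> \<omega>"
    and \<theta>: "\<theta> \<in> borel_measurable M" "AE \<omega> in M. \<phi> \<omega> \<le> \<theta> \<omega>"
  shows "AE \<omega> in M. \<psi> \<omega> \<le> \<theta> \<omega>"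
proof -
  obtain N where N: "N \<in> null_sets M" "{\<omega> \<in> space M. \<not> \<phi> \<omega> \<le> \<theta> \<omega>} \<subseteq> N" using \<theta>(2) by (auto elim!: AE_E)
  define \<xi> where "\<xi> \<omega> = (if \<omega> \<in> N then \<psi> \<omega> else min (\<psi> \<omega>) (\<theta> \<omega>))" for \<omega>
  have [measurable]: "N \<in> sets M" using N by auto
  have m: "\<xi> \<in> borel_measurable M" unfolding \<xi>_def using \<psi>(1) \<theta>(1) by measurable
  have b: "\<phi> \<omega> \<le> \<xi> \<omega> \<and> 0 \<le> \<xi> \<omega> \<and> \<xi> \<omega> \<le> 1" if "\<omega> \<in> space M" for \<omega>
    using that \<psi>(2)[OF that] le[OF that] \<phi>[OF that] N(2) by (auto simp: \<xi>_def min_def)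
  have int: "integrable M \<psi>" "integrable M \<xi>"
    by (rule integrable_const_bound[of _ 1]; use \<psi> m b in auto)+
  have "expectation (\<lambda>\<omega>. \<psi> \<omega> - \<xi> \<omega>) \<le> 0"
    using int upper_int_le[OF m b] min by simp
  moreover have nn: "AE \<omega> in M. 0 \<le> \<psi> \<omega> - \<xi> \<omega>" by (auto simp: \<xi>_def)
  ultimately have "expectation (\<lambda>\<omega>. \<psi> \<omega> - \<xi> \<omega>) = 0" using integral_nonneg_AE[OF nn] by simp
  then have "AE \<omega> in M. \<psi> \<omega> - \<xi> \<omega> = 0" using integral_nonneg_eq_0_iff_AE[OF _ nn] int by simp
  moreover have "AE \<omega> in M. \<omega> \<notin> N" using N(1) by (rule AE_not_in)
  ultimately show ?thesis by eventually_elim (auto simp: \<xi>_def min_def split: if_splits)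
qed

end

section \<open>Pointwise \<open>V\<^sup>*\<close>-sets\<close>

text \<open>
  \<open>extendible \<delta> g l\<close>: some contraction into \<open>\<ell>\<^sup>1\<close> is large on the finite sequence \<open>l\<close> and then on
  a subsequence of \<open>g\<close>. The value \<open>ext_val \<delta> g l x\<close> is convex in \<open>x\<close> and it exceeds
  \<open>\<delta>/2\<close> exactly if \<open>l @ [x]\<close> is still extendible.
\<close>

definition extendible :: "real \<Rightarrow> (nat \<Rightarrow> 'x::real_normed_vector) \<Rightarrow> 'x list \<Rightarrow> bool" where
  "extendible \<delta> g l \<longleftrightarrow> (\<exists>T\<in>l1_ops. (\<forall>i<length l. \<delta>/2 < T i (l ! i)) \<and>
     (\<forall>j. \<exists>i\<ge>j. \<delta> \<le> T (length l + j) (g i)))"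

text \<open>The operators for \<open>l\<close> with slot \<open>length l\<close> left free for a
  vector \<open>x\<close>; the tail condition starts one place later. If there are none, the
  \<open>0\<close> in \<open>ext_val\<close> keeps the supremum meaningful.\<close>

definition ext_set :: "real \<Rightarrow> (nat \<Rightarrow> 'x::real_normed_vector) \<Rightarrow> 'x list \<Rightarrow> (nat \<Rightarrow> 'x \<Rightarrow> real) set" where
  "ext_set \<delta> g l = {T \<in> l1_ops. (\<forall>i<length l. \<delta>/2 < T i (l ! i)) \<and>
     (\<forall>j. \<exists>i\<ge>j. \<delta> \<le> T (Suc (length l) + j) (g i))}"

definition ext_val :: "real \<Rightarrow> (nat \<Rightarrow> 'x::real_normed_vector) \<Rightarrow> 'x list \<Rightarrow> 'x \<Rightarrow> real" where
  "ext_val \<delta> g l x = Sup (insert 0 ((\<lambda>T. T (length l) x) ` ext_set \<delta> g l))"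

lemma bdd_ext_val: "bdd_above (insert 0 ((\<lambda>T. T (length l) x) ` ext_set \<delta> g l))"
proof (rule bdd_aboveI[of _ "norm x"])
  fix r assume "r \<in> insert 0 ((\<lambda>T. T (length l) x) ` ext_set \<delta> g l)"
  then show "r \<le> norm x"
    using l1_ops_bound[of _ "length l" x] by (auto simp: ext_set_def abs_le_iff)
qed

lemma ext_val_ge: "T \<in> ext_set \<delta> g l \<Longrightarrow> T (length l) x \<le> ext_val \<delta> g l x"
  unfolding ext_val_def by (rule cSup_upper[OF _ bdd_ext_val]) auto

lemma ext_val_nonneg: "0 \<le> ext_val \<delta> g l x"
  unfolding ext_val_def by (rule cSup_upper[OF _ bdd_ext_val]) auto

lemma ext_val_le:
  "0 \<le> c \<Longrightarrow> (\<And>T. T \<in> ext_set \<delta> g l \<Longrightarrow> T (length l) x \<le> c) \<Longrightarrow> ext_val \<delta> g l x \<le> c"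
  unfolding ext_val_def by (rule cSup_least) auto

lemma ext_val_le_norm: "ext_val \<delta> g l x \<le> norm x"
  using l1_ops_bound[of _ "length l" x] by (intro ext_val_le) (auto simp: ext_set_def abs_le_iff)

lemma ext_val_midpoint: "ext_val \<delta> g l ((1/2) *\<^sub>R (x + y)) \<le> (ext_val \<delta> g l x + ext_val \<delta> g l y) / 2"
proof (rule ext_val_le)
  show "0 \<le> (ext_val \<delta> g l x + ext_val \<delta> g l y) / 2"
    using ext_val_nonneg[of \<delta> g l] by simp
  fix T assume T: "T \<in> ext_set \<delta> g l"
  then have "linear (T (length l))" by (simp add: ext_set_def l1_ops_def)
  then show "T (length l) ((1/2) *\<^sub>R (x + y)) \<le> (ext_val \<delta> g l x + ext_val \<delta> g l y) / 2"
    using ext_val_ge[OF T, of x] ext_val_ge[OF T, of y] by (simp add: linear_cmul linear_add)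
qed

lemma extendible_snoc: "extendible \<delta> g (l @ [x]) \<longleftrightarrow> (\<exists>T\<in>ext_set \<delta> g l. \<delta>/2 < T (length l) x)"
  by (auto simp: extendible_def ext_set_def nth_append less_Suc_eq all_conj_distrib)

lemma ext_val_gt:
  assumes "0 < \<delta>"
  shows "\<delta>/2 < ext_val \<delta> g l x \<longleftrightarrow> extendible \<delta> g (l @ [x])"
proof
  assume "\<delta>/2 < ext_val \<delta> g l x"
  then show "extendible \<delta> g (l @ [x])"
    using assms ext_val_le[of "\<delta>/2" \<delta> g l x] by (force simp: extendible_snoc)
next
  assume "extendible \<delta> g (l @ [x])"
  then show "\<delta>/2 < ext_val \<delta> g l x"
    using ext_val_ge[of _ \<delta> g l x] by (force simp: extendible_snoc)
qed

text \<open>Passing to blocks replaces the tail of \<open>T\<close> by a subsequence.\<close>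

lemma blk_tail:
  fixes T :: "nat \<Rightarrow> 'x::real_normed_vector \<Rightarrow> real"
  assumes hg: "blk h g" and T: "T \<in> l1_ops" and tail: "\<And>j. \<exists>i\<ge>j. \<delta> \<le> T (n + j) (h i)"
  obtains T' where "T' \<in> l1_ops" "\<And>i. i < n \<Longrightarrow> T' i = T i" "\<And>j. \<exists>i\<ge>j. \<delta> \<le> T' (n + j) (g i)"
proof -
  have "\<forall>N. \<exists>n0. \<forall>n\<ge>n0. h n \<in> midhull (g ` {N..})" using hg by (simp add: blk_def)
  from choice[OF this] obtain n0 where n0: "\<And>N n. n0 N \<le> n \<Longrightarrow> h n \<in> midhull (g ` {N..})" by blast
  define r where "r = rec_nat (n0 0) (\<lambda>j r. Suc (max r (n0 (Suc j))))"
  have r: "r j < r (Suc j)" "n0 j \<le> r j" for j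
    by (simp_all add: r_def, cases j, simp_all)
  then have sr: "strict_mono r" by (simp add: strict_mono_Suc_iff)
  define s where "s i = (if i < n then i else n + r (i - n))" for i
  have "strict_mono s"
    by (rule strict_monoI) (auto simp: s_def strict_mono_less[OF sr])
  then have T': "(\<lambda>i. T (s i)) \<in> l1_ops" by (rule l1_ops_subseq[OF T])
  have "\<exists>i\<ge>j. \<delta> \<le> T (n + r j) (g i)" for j
  proof (rule ccontr)
    \<comment> \<open>If \<open>T (n + r j)\<close> were below \<open>\<delta>\<close> on the tail
      of \<open>g\<close> from \<open>j\<close>, it would be so on its midpoint hull, which contains
      \<open>h i\<close> for \<open>i \<ge> r j\<close>.\<close>
    assume no: "\<not> (\<exists>i\<ge>j. \<delta> \<le> T (n + r j) (g i))"
    have lin: "linear (T (n + r j))" using T by (simp add: l1_ops_def)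
    have "convex {x. T (n + r j) x < \<delta>}"
      using convex_linear_vimage[OF lin, of "{..<\<delta>}"] by (simp add: vimage_def convex_real_interval)
    then have "midhull (g ` {j..}) \<subseteq> {x. T (n + r j) x < \<delta>}"
      by (rule midhull_subset_convex) (use no not_le in blast)
    moreover obtain i where "i \<ge> r j" "\<delta> \<le> T (n + r j) (h i)" using tail by blast
    moreover have "h i \<in> midhull (g ` {j..})" using n0[of j i] r(2)[of j] \<open>i \<ge> r j\<close> by simp
    ultimately show False by auto
  qed
  then show thesis by (intro that[OF T']) (auto simp: s_def)
qed

lemma extendible_blk:
  assumes "blk h g" "extendible \<delta> h l"
  shows "extendible \<delta> g l"
proof -
  obtain T where T: "T \<in> l1_ops" "\<forall>i<length l. \<delta>/2 < T i (l ! i)" "\<And>j. \<exists>i\<ge>j. \<delta> \<le> T (length l + j) (h i)"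
    using assms(2) by (auto simp: extendible_def)
  obtain T' where "T' \<in> l1_ops" "\<And>i. i < length l \<Longrightarrow> T' i = T i" "\<And>j. \<exists>i\<ge>j. \<delta> \<le> T' (length l + j) (g i)"
    using blk_tail[OF assms(1) T(1,3)] by blast
  then show ?thesis using T(2) unfolding extendible_def by metis
qed

lemma ext_val_blk:
  assumes "blk h g"
  shows "ext_val \<delta> h l x \<le> ext_val \<delta> g l x"
proof (rule ext_val_le[OF ext_val_nonneg])
  fix T assume T: "T \<in> ext_set \<delta> h l"
  then obtain T' where "T' \<in> l1_ops" "\<And>i. i < Suc (length l) \<Longrightarrow> T' i = T i"
      "\<And>j. \<exists>i\<ge>j. \<delta> \<le> T' (Suc (length l) + j) (g i)"
    using blk_tail[OF assms, of T \<delta> "Suc (length l)"] by (auto simp: ext_set_def)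
  then have "T' \<in> ext_set \<delta> g l" "T' (length l) = T (length l)" using T by (auto simp: ext_set_def)
  then show "T (length l) x \<le> ext_val \<delta> g l x" using ext_val_ge by metis
qed

text \<open>Deleting the \<open>N\<close> coordinates that follow the first \<open>length l\<close>
  ones puts coordinate \<open>length l + N\<close> into the free slot, and there the operator
  reaches \<open>\<delta>\<close> at some \<open>g i\<close> with \<open>i \<ge> N\<close>.\<close>

lemma ext_val_frequently:
  assumes "extendible \<delta> g l"
  shows "\<exists>i\<ge>N. \<delta> \<le> ext_val \<delta> g l (g i)"
proof -
  obtain T where T: "T \<in> l1_ops" "\<forall>i<length l. \<delta>/2 < T i (l ! i)" "\<And>j. \<exists>i\<ge>j. \<delta> \<le> T (length l + j) (g i)"
    using assms by (auto simp: extendible_def)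
  obtain i where i: "i \<ge> N" "\<delta> \<le> T (length l + N) (g i)" using T(3) by blast
  define s where "s j = (if j < length l then j else j + N)" for j
  have "strict_mono s" by (rule strict_monoI) (auto simp: s_def)
  then have "(\<lambda>j. T (s j)) \<in> l1_ops" by (rule l1_ops_subseq[OF T(1)])
  moreover have "\<exists>i\<ge>j. \<delta> \<le> T (s (Suc (length l) + j)) (g i)" for j
  proof -
    obtain i where "i \<ge> Suc j + N" "\<delta> \<le> T (length l + (Suc j + N)) (g i)" using T(3) by blast
    moreover have "s (Suc (length l) + j) = length l + (Suc j + N)" by (simp add: s_def)
    ultimately show ?thesis by (intro exI[of _ i]) auto
  qed
  ultimately have "(\<lambda>j. T (s j)) \<in> ext_set \<delta> g l" using T(2) by (auto simp: ext_set_def s_def)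
  from ext_val_ge[OF this, of "g i"] i show ?thesis by (intro exI[of _ i]) (auto simp: s_def)
qed

lemma blk_apply: "blk h g \<Longrightarrow> blk (\<lambda>n. h n \<omega>) (\<lambda>n. g n \<omega>)"
  for h g :: "nat \<Rightarrow> 'w \<Rightarrow> 'x::real_vector"
proof -
  assume *: "blk h g"
  have "f \<in> midhull (g ` {N..}) \<Longrightarrow> f \<omega> \<in> midhull ((\<lambda>n. g n \<omega>) ` {N..})" for f N
    using midhull_image_apply[of f "g ` {N..}" \<omega>] by (simp add: image_image)
  then show ?thesis using * unfolding blk_def by blast
qed

lemma blk_normalize:
  assumes "blk g f"
  obtains r where "strict_mono r" "\<And>n. g (r n) \<in> midhull (f ` {n..})"
proof -
  have "\<forall>N. \<exists>n0. \<forall>n\<ge>n0. g n \<in> midhull (f ` {N..})" using assms by (simp add: blk_def)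
  from choice[OF this] obtain n0 where n0: "\<And>N n. n0 N \<le> n \<Longrightarrow> g n \<in> midhull (f ` {N..})" by blast
  define r where "r = rec_nat (n0 0) (\<lambda>j r. Suc (max r (n0 (Suc j))))"
  have r: "r j < r (Suc j)" "n0 j \<le> r j" for j
    by (simp_all add: r_def, cases j, simp_all)
  then show thesis using n0 by (intro that[of r]) (auto simp: strict_mono_Suc_iff)
qed

context prob_space
begin

lemma prob_tendsto_0:
  assumes B: "\<And>i. B i \<in> sets M" and "AE \<omega> in M. \<forall>\<^sub>F i in sequentially. \<omega> \<notin> B i"
  shows "(\<lambda>i. prob (B i)) \<longlonglongrightarrow> 0"
proof -
  have "(\<lambda>i. expectation (indicator (B i) :: 'a \<Rightarrow> real)) \<longlonglongrightarrow> expectation (\<lambda>_. 0 :: real)"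
  proof (rule integral_dominated_convergence[where w = "\<lambda>_. 1"])
    show "AE \<omega> in M. (\<lambda>i. indicator (B i) \<omega> :: real) \<longlonglongrightarrow> 0"
      using assms(2)
    proof eventually_elim
      case (elim \<omega>)
      then have "\<forall>\<^sub>F i in sequentially. 0 = (indicator (B i) \<omega> :: real)" by eventually_elim simp
      then show ?case by (rule Lim_transform_eventually[OF tendsto_const])
    qed
  qed (use B in auto)
  then show ?thesis using B by simp
qed

end

lemma midhull_tail_mono: "(m::nat) \<le> n \<Longrightarrow> midhull (f ` {n..}) \<subseteq> midhull (f ` {m..})"
  by (intro midhull_mono image_mono) auto

lemma map_butlast_lists:
  assumes "\<And>h. h \<in> set hs \<Longrightarrow> h \<omega> \<in> D"
  shows "map (\<lambda>h. h \<omega>) (butlast hs) \<in> lists D"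
proof -
  have "x \<in> D" if x: "x \<in> set (map (\<lambda>h. h \<omega>) (butlast hs))" for x
  proof -
    obtain h where "h \<in> set (butlast hs)" "x = h \<omega>" using x by auto
    then show ?thesis using assms[OF in_set_butlastD] by simp
  qed
  then show ?thesis by (auto simp: in_lists_conv_set)
qed

section \<open>Blocks with minimal upper integrals\<close>

context prob_space
begin

text \<open>
  Among the blocks of \<open>f\<close> we take a sequence \<open>g\<close> for which the upper integrals of all
  \<open>ext_val\<close> are minimal. The envelopes \<open>\<Psi>\<close> of these functions then do not change under
  further blocks. If \<open>g \<omega>\<close> were extendible on a non-null set, convexity would give
  blocks \<open>h\<close> that keep \<open>\<Psi>\<close> above \<open>\<delta>/2\<close> for almost all those \<open>\<omega>\<close> at the same time, and
  hence a single sequence that carries a copy of \<open>\<ell>\<^sup>1\<close> on a set of positive measure.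
\<close>

lemma stable_blocks:
  fixes f :: "nat \<Rightarrow> 'a \<Rightarrow> 'x::real_normed_vector"
  assumes f: "\<And>n. cval M (f n)" "\<And>n \<omega>. norm (f n \<omega>) \<le> 1"
    and no_l1: "\<And>g S \<delta> c. (\<And>i. g i \<in> midhull (f ` {i..})) \<Longrightarrow> 0 < \<delta> \<Longrightarrow> 0 < c \<Longrightarrow>
      (\<And>k. S k \<in> events \<and> c \<le> prob (S k)) \<Longrightarrow>
      (\<And>k. AE \<omega> in M. \<omega> \<in> S k \<longrightarrow> (\<exists>T\<in>l1_ops. \<forall>i\<le>k. \<delta> < T i (g i \<omega>))) \<Longrightarrow> False"
  obtains g where "blk g f" "AE \<omega> in M. \<forall>\<delta>>0. \<not> extendible \<delta> (\<lambda>n. g n \<omega>) []"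
proof -
  \<comment> \<open>All values of all blocks lie in this countable set, which is closed under
    midpoints.\<close>
  define D where "D = midhull (\<Union>n. f n ` space M)"
  have D_count: "countable D" unfolding D_def using f(1) by (intro countable_midhull) (auto simp: cval_def)
  have D_ball: "norm x \<le> 1" if "x \<in> D" for x
  proof -
    have "D \<subseteq> cball 0 1" unfolding D_def by (rule midhull_subset_convex) (use f(2) in auto)
    then show ?thesis using that by auto
  qed
  have D_mid: "(1/2) *\<^sub>R (x + y) \<in> D" if "x \<in> D" "y \<in> D" for x y
    using that unfolding D_def by (rule midhull.mid)
  have inD: "h \<omega> \<in> D" if "h \<in> midhull (f ` {n..})" "\<omega> \<in> space M" for h \<omega> n
    using midhull_image_apply[OF that(1), of \<omega>] that(2) unfolding D_def
    by (elim subsetD[OF midhull_mono, rotated]) auto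
  have D_ne: "D \<noteq> {}" using inD[of "f 0" 0] not_empty by (auto intro: midhull.base)
  have LD: "countable (lists D)" using D_count by simp
  have AE_pairs: "AE \<omega> in M. \<forall>l\<in>lists D. \<forall>x\<in>D. P l x \<omega>"
    if "\<And>l x. l \<in> lists D \<Longrightarrow> x \<in> D \<Longrightarrow> AE \<omega> in M. P l x \<omega>" for P :: "'x list \<Rightarrow> 'x \<Rightarrow> 'a \<Rightarrow> bool"
    by (intro AE_ball_countable' LD D_count that)
  \<comment> \<open>One functional for each threshold \<open>1 / real (Suc m)\<close>, list and
    vector; there are countably many, as \<open>blk_stable\<close> demands.\<close>
  define I where "I = (UNIV :: nat set) \<times> lists D \<times> D"
  have I: "countable I" "I \<noteq> {}" unfolding I_def using LD D_count D_ne by auto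
  define V where "V m l x g = upper_int (\<lambda>\<omega>. ext_val (1 / real (Suc m)) (\<lambda>n. g n \<omega>) l x)"
    for m l x and g :: "nat \<Rightarrow> 'a \<Rightarrow> 'x"
  define \<Lambda> where "\<Lambda> k g = (case from_nat_into I k of (m, l, x) \<Rightarrow> V m l x g)" for k g
  have le1: "ext_val \<delta> g l x \<le> 1" if "x \<in> D" for \<delta> g l x
    using ext_val_le_norm D_ball[OF that] by (rule order_trans)
  have V_mono: "V m l x h \<le> V m l x g" if "blk h g" "x \<in> D" for m l x g h
    unfolding V_def using ext_val_blk[OF blk_apply[OF that(1)]] le1[OF that(2)] by (rule upper_int_mono)
  have from_I: "from_nat_into I k = (m, l, x) \<Longrightarrow> x \<in> D" for k m l x
    using from_nat_into[OF I(2), of k] by (simp add: I_def)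
  have \<Lambda>_mono: "\<Lambda> k h \<le> \<Lambda> k g" if "blk h g" for k g h
    unfolding \<Lambda>_def using V_mono[OF that] from_I by (auto split: prod.split)
  have \<Lambda>_nonneg: "0 \<le> \<Lambda> k g" for k g
    unfolding \<Lambda>_def V_def using from_I by (auto split: prod.split intro!: upper_int_nonneg le1)
  have "\<exists>g. blk g f \<and> (\<forall>k h. blk h g \<longrightarrow> \<Lambda> k h = \<Lambda> k g)"
    by (rule blk_stable[where \<Lambda> = \<Lambda> and f = f, OF \<Lambda>_mono \<Lambda>_nonneg]) (assumption, blast)
  then obtain g0 where g0: "blk g0 f" "\<And>k h. blk h g0 \<Longrightarrow> \<Lambda> k h = \<Lambda> k g0" by blast
  obtain r where r: "strict_mono r" "\<And>n. g0 (r n) \<in> midhull (f ` {n..})" using blk_normalize[OF g0(1)] by blast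
  define g where "g n = g0 (r n)" for n
  have gg0: "blk g g0" unfolding g_def by (rule blk_subseq[OF r(1)])
  have gf: "g n \<in> midhull (f ` {n..})" for n using r(2) by (simp add: g_def)
  have stable: "V m l x h = V m l x g" if hlx: "blk h g" "l \<in> lists D" "x \<in> D" for m l x h
  proof -
    have "(m, l, x) \<in> I" using hlx by (simp add: I_def)
    from from_nat_into_surj[OF I(1) this] obtain k where "from_nat_into I k = (m, l, x)" by blast
    then show ?thesis
      using g0(2)[OF gg0, of k] g0(2)[OF blk_trans[OF hlx(1) gg0], of k] by (simp add: \<Lambda>_def)
  qed
  have gtail: "midhull (g ` {n..}) \<subseteq> midhull (f ` {n..})" for n
    using gf midhull_tail_mono[of n _ f] by (intro midhull_trans) blast
  have gM: "cval M h" "h \<omega> \<in> D" if "h \<in> midhull (g ` {n..})" "\<omega> \<in> space M" for h n \<omega>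
  proof -
    have h: "h \<in> midhull (f ` {n..})" using gtail that(1) by blast
    show "cval M h" by (rule cval_midhull[OF h]) (use f in auto)
    show "h \<omega> \<in> D" by (rule inD[OF h that(2)])
  qed
  have main: "AE \<omega> in M. \<not> extendible (1 / real (Suc m)) (\<lambda>n. g n \<omega>) []" for m
  proof -
    define \<delta> where "\<delta> = 1 / real (Suc m)"
    have \<delta>: "0 < \<delta>" by (simp add: \<delta>_def)
    let ?v = "\<lambda>h l x \<omega>. ext_val \<delta> (\<lambda>n. h n \<omega>) l x"
    let ?env = "\<lambda>l x \<psi>. \<psi> \<in> borel_measurable M \<and> expectation \<psi> = upper_int (?v g l x) \<and>
        (\<forall>\<omega>\<in>space M. ?v g l x \<omega> \<le> \<psi> \<omega> \<and> 0 \<le> \<psi> \<omega> \<and> \<psi> \<omega> \<le> 1)"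
    have ex: "\<exists>\<psi>. ?env l x \<psi>" if "x \<in> D" for l x
    proof -
      obtain \<psi> where "\<psi> \<in> borel_measurable M"
        "\<And>\<omega>. \<omega> \<in> space M \<Longrightarrow> ?v g l x \<omega> \<le> \<psi> \<omega> \<and> 0 \<le> \<psi> \<omega> \<and> \<psi> \<omega> \<le> 1"
        "expectation \<psi> = upper_int (?v g l x)"
        using upper_envelope[of "?v g l x"] le1[OF \<open>x \<in> D\<close>] by blast
      then show ?thesis by blast
    qed
    define \<Psi> where "\<Psi> l x = (SOME \<psi>. ?env l x \<psi>)" for l x
    have "?env l x (\<Psi> l x)" if "x \<in> D" for l x
      unfolding \<Psi>_def using ex[OF that] by (rule someI_ex)
    then have \<Psi>: "\<And>l x. x \<in> D \<Longrightarrow> \<Psi> l x \<in> borel_measurable M"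
      "\<And>l x \<omega>. x \<in> D \<Longrightarrow> \<omega> \<in> space M \<Longrightarrow> ?v g l x \<omega> \<le> \<Psi> l x \<omega> \<and> 0 \<le> \<Psi> l x \<omega> \<and> \<Psi> l x \<omega> \<le> 1"
      "\<And>l x. x \<in> D \<Longrightarrow> expectation (\<Psi> l x) = upper_int (?v g l x)"
      by blast+
    \<comment> \<open>Blocks leave the upper integral unchanged, so the envelope made for
      \<open>g\<close> is also an optimal majorant for every block sequence
      \<open>h\<close>.\<close>
    have minimal: "AE \<omega> in M. \<Psi> l x \<omega> \<le> \<theta> \<omega>"
      if h: "blk h g" and lx: "l \<in> lists D" "x \<in> D" and \<theta>: "\<theta> \<in> borel_measurable M" "\<And>\<omega>. \<omega> \<in> space M \<Longrightarrow> ?v h l x \<omega> \<le> \<theta> \<omega>"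
      for h l x \<theta>
    proof (rule upper_envelope_minimal[OF \<Psi>(1)[OF lx(2)]])
      show "expectation (\<Psi> l x) = upper_int (?v h l x)"
        using \<Psi>(3)[OF lx(2)] stable[OF h lx, of m] by (simp add: V_def \<delta>_def)
      show "?v h l x \<omega> \<le> \<Psi> l x \<omega>" if "\<omega> \<in> space M" for \<omega>
        using ext_val_blk[OF blk_apply[OF h]] \<Psi>(2)[OF lx(2) that] by (meson order_trans)
    qed (use \<Psi>(2)[OF lx(2)] \<theta> ext_val_nonneg in auto)
    have mid: "AE \<omega> in M. \<forall>l\<in>lists D. \<forall>x\<in>D. \<forall>y\<in>D. \<Psi> l ((1/2) *\<^sub>R (x + y)) \<omega> \<le> (\<Psi> l x \<omega> + \<Psi> l y \<omega>) / 2"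
    proof (rule AE_pairs)
      fix l x assume l: "l \<in> lists D" and x: "x \<in> D"
      show "AE \<omega> in M. \<forall>y\<in>D. \<Psi> l ((1/2) *\<^sub>R (x + y)) \<omega> \<le> (\<Psi> l x \<omega> + \<Psi> l y \<omega>) / 2"
      proof (rule AE_ball_countable'[OF _ D_count])
        fix y assume y: "y \<in> D"
        have m: "(\<lambda>\<omega>. (\<Psi> l x \<omega> + \<Psi> l y \<omega>) / 2) \<in> borel_measurable M"
          using \<Psi>(1)[OF x, of l] \<Psi>(1)[OF y, of l] by measurable
        have "?v g l ((1/2) *\<^sub>R (x + y)) \<omega> \<le> (\<Psi> l x \<omega> + \<Psi> l y \<omega>) / 2" if \<omega>: "\<omega> \<in> space M" for \<omega>
          using \<Psi>(2)[OF x \<omega>, of l] \<Psi>(2)[OF y \<omega>, of l]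
          by (intro order_trans[OF ext_val_midpoint] divide_right_mono add_mono) auto
        with m show "AE \<omega> in M. \<Psi> l ((1/2) *\<^sub>R (x + y)) \<omega> \<le> (\<Psi> l x \<omega> + \<Psi> l y \<omega>) / 2"
          by (rule minimal[OF blk_refl l D_mid[OF x y]])
      qed
    qed
    \<comment> \<open>The existence of \<open>T\<close> depends on the vectors only, not on
      \<open>\<omega>\<close>. If there is no \<open>T\<close>, the constant
      \<open>\<delta>/2\<close> majorises \<open>ext_val\<close>, hence also the envelope. Thus a
      large envelope produces an operator without any measurable choice.\<close>
    have witness: "AE \<omega> in M. \<forall>l\<in>lists D. \<forall>x\<in>D. \<delta>/2 < \<Psi> l x \<omega> \<longrightarrow>
        (\<exists>T\<in>l1_ops. \<forall>i\<le>length l. \<delta>/2 < T i ((l @ [x]) ! i))"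
    proof (rule AE_pairs)
      fix l x assume l: "l \<in> lists D" and x: "x \<in> D"
      show "AE \<omega> in M. \<delta>/2 < \<Psi> l x \<omega> \<longrightarrow> (\<exists>T\<in>l1_ops. \<forall>i\<le>length l. \<delta>/2 < T i ((l @ [x]) ! i))"
      proof (cases "\<exists>T\<in>l1_ops. \<forall>i\<le>length l. \<delta>/2 < T i ((l @ [x]) ! i)")
        case False
        then have "\<not> extendible \<delta> (\<lambda>n. g n \<omega>) (l @ [x])" for \<omega>
          unfolding extendible_def length_append_singleton less_Suc_eq_le by blast
        then have "?v g l x \<omega> \<le> \<delta>/2" for \<omega> using ext_val_gt[OF \<delta>] by (meson not_le)
        then have "AE \<omega> in M. \<Psi> l x \<omega> \<le> \<delta>/2" by (intro minimal[OF blk_refl l x]) auto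
        then show ?thesis by eventually_elim simp
      qed simp
    qed
    have meas: "(\<lambda>\<omega>. \<Psi> (L \<omega>) (h \<omega>) \<omega>) \<in> borel_measurable M"
      if "cval M L" "cval M h" "\<And>\<omega>. \<omega> \<in> space M \<Longrightarrow> h \<omega> \<in> D" for L h
      using cval_compose_measurable[OF cval_comp2[OF that(1,2), of Pair], of "\<lambda>(l, x). \<Psi> l x"] \<Psi>(1) that(3)
      by (auto simp: image_iff)
    \<comment> \<open>\<open>F\<close> is the measurable set where the next envelope reaches
      \<open>\<delta>\<close> frequently along \<open>h\<close>. Off \<open>F\<close> the list
      \<open>l @ [x]\<close> is not extendible along \<open>h\<close>, so the function that is
      \<open>1\<close> on \<open>F\<close> and \<open>\<delta>/2\<close> elsewhere is a majorant;
      minimality does the rest.\<close>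
    have persist: "AE \<omega> in M. \<forall>l\<in>lists D. \<forall>x\<in>D. \<delta>/2 < \<Psi> l x \<omega> \<longrightarrow> (\<forall>N. \<exists>i\<ge>N. \<delta> \<le> \<Psi> (l @ [x]) (h i \<omega>) \<omega>)"
      if h: "blk h g" and hM: "\<And>i. cval M (h i)" "\<And>i \<omega>. \<omega> \<in> space M \<Longrightarrow> h i \<omega> \<in> D" for h
    proof (rule AE_pairs)
      fix l x assume l: "l \<in> lists D" and x: "x \<in> D"
      define F where "F = {\<omega> \<in> space M. \<forall>N. \<exists>i\<ge>N. \<delta> \<le> \<Psi> (l @ [x]) (h i \<omega>) \<omega>}"
      have [measurable]: "(\<lambda>\<omega>. \<Psi> (l @ [x]) (h i \<omega>) \<omega>) \<in> borel_measurable M" for i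
        by (rule meas[OF cval_const]) (use hM in auto)
      have [measurable]: "F \<in> sets M" unfolding F_def by measurable
      have "AE \<omega> in M. \<Psi> l x \<omega> \<le> (if \<omega> \<in> F then 1 else \<delta>/2)"
      proof (rule minimal[OF h l x])
        fix \<omega> assume \<omega>: "\<omega> \<in> space M"
        show "?v h l x \<omega> \<le> (if \<omega> \<in> F then 1 else \<delta>/2)"
        proof (cases "\<delta>/2 < ?v h l x \<omega>")
          case True
          then have "extendible \<delta> (\<lambda>n. h n \<omega>) (l @ [x])" using ext_val_gt[OF \<delta>] by blast
          then have "\<exists>i\<ge>N. \<delta> \<le> ?v h (l @ [x]) (h i \<omega>) \<omega>" for N using ext_val_frequently by blast
          moreover have "?v h (l @ [x]) (h i \<omega>) \<omega> \<le> \<Psi> (l @ [x]) (h i \<omega>) \<omega>" for i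
            using ext_val_blk[OF blk_apply[OF h]] \<Psi>(2)[OF hM(2)[OF \<omega>] \<omega>] by (meson order_trans)
          ultimately have "\<omega> \<in> F" unfolding F_def using \<omega> by (blast intro: order_trans)
          then show ?thesis using le1[OF x] by simp
        next
          case False
          then show ?thesis using le1[OF x, of \<delta> "\<lambda>n. h n \<omega>" l] by simp
        qed
      qed measurable
      then show "AE \<omega> in M. \<delta>/2 < \<Psi> l x \<omega> \<longrightarrow> (\<forall>N. \<exists>i\<ge>N. \<delta> \<le> \<Psi> (l @ [x]) (h i \<omega>) \<omega>)"
        using AE_space by eventually_elim (auto simp: F_def split: if_splits)
    qed
    show ?thesis
    proof (rule ccontr)
      assume neg: "\<not> ?thesis"
      \<comment> \<open>The event that the envelope still permits the random list \<open>hs\<close>: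
        its last entry is the candidate, the entries before it form the list.\<close>
      define Ev where "Ev hs = {\<omega> \<in> space M. \<delta>/2 < \<Psi> (map (\<lambda>h. h \<omega>) (butlast hs)) (last hs \<omega>) \<omega>}"
        for hs :: "('a \<Rightarrow> 'x) list"
      have cvm: "cval M (\<lambda>\<omega>. map (\<lambda>h. h \<omega>) hs)" if "\<And>h. h \<in> set hs \<Longrightarrow> cval M h" for hs :: "('a \<Rightarrow> 'x) list"
        using that
      proof (induction hs)
        case (Cons h hs)
        then show ?case using cval_comp2[of M h "\<lambda>\<omega>. map (\<lambda>h. h \<omega>) hs" Cons] by simp
      qed (simp add: cval_const)
      have "\<exists>i0. \<not> (AE \<omega> in M. \<Psi> [] (g i0 \<omega>) \<omega> \<le> \<delta>/2)"
      proof (rule ccontr)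
        assume "\<not> ?thesis"
        then have "AE \<omega> in M. \<forall>i. \<Psi> [] (g i \<omega>) \<omega> \<le> \<delta>/2" by (simp add: AE_all_countable)
        then have "AE \<omega> in M. \<not> extendible \<delta> (\<lambda>n. g n \<omega>) []"
          using AE_space
        proof eventually_elim
          case (elim \<omega>)
          show ?case
          proof
            assume "extendible \<delta> (\<lambda>n. g n \<omega>) []"
            from ext_val_frequently[OF this, of 0] obtain i where i: "\<delta> \<le> ?v g [] (g i \<omega>) \<omega>" by auto
            have "g i \<omega> \<in> D" using gM(2)[of "g i" i] elim(2) by (auto intro: midhull.base)
            from \<Psi>(2)[OF this elim(2), of "[]"] i elim(1) \<delta> show False by (smt (verit) field_sum_of_halves)
          qed
        qed
        then show False using neg by (simp add: \<delta>_def)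
      qed
      then obtain i0 where i0: "\<not> (AE \<omega> in M. \<Psi> [] (g i0 \<omega>) \<omega> \<le> \<delta>/2)" by blast
      have gi: "g i0 \<in> midhull (g ` {i0..})" by (auto intro: midhull.base)
      have Ev_sets: "Ev hs \<in> events" if mem: "\<And>h. h \<in> set hs \<Longrightarrow> \<exists>n. h \<in> midhull (g ` {n..})" and ne: "hs \<noteq> []" for hs
      proof -
        have hs: "cval M h" "\<And>\<omega>. \<omega> \<in> space M \<Longrightarrow> h \<omega> \<in> D" if "h \<in> set hs" for h
          using mem[OF that] gM not_empty by blast+
        have [measurable]: "(\<lambda>\<omega>. \<Psi> (map (\<lambda>h. h \<omega>) (butlast hs)) (last hs \<omega>) \<omega>) \<in> borel_measurable M"
          using ne by (intro meas cvm hs) (auto dest: in_set_butlastD)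
        show ?thesis unfolding Ev_def by measurable
      qed
      define c where "c = prob (Ev [g i0])"
      have c: "0 < c"
      proof (rule ccontr)
        assume "\<not> 0 < c"
        then have "prob (Ev [g i0]) = 0" using measure_nonneg[of M "Ev [g i0]"] by (simp add: c_def)
        then have "AE \<omega> in M. \<omega> \<notin> Ev [g i0]"
          using Ev_sets[of "[g i0]"] gi prob_eq_0[of "Ev [g i0]"] by auto
        then have "AE \<omega> in M. \<Psi> [] (g i0 \<omega>) \<omega> \<le> \<delta>/2"
          using AE_space by eventually_elim (auto simp: Ev_def)
        then show False using i0 by blast
      qed
      \<comment> \<open>The lower bound starts at \<open>3/4 * c\<close> and decreases towards
        \<open>c/2\<close>, so step \<open>k\<close> may lose an event of probability
        \<open>c * (1/2) ^ (k + 3)\<close> and a positive amount always remains.\<close>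
      define Q where "Q k hs \<longleftrightarrow> length hs = Suc k \<and> (\<forall>i\<le>k. hs ! i \<in> midhull (g ` {i..})) \<and>
          c * (1/2 + (1/2) ^ (k + 2)) < prob (Ev hs)" for k hs
      have "\<exists>hs. \<forall>k. Q k (hs k) \<and> (\<exists>h. hs (Suc k) = hs k @ [h])"
      proof (rule dependent_nat_choice)
        have "g i0 \<in> midhull (g ` {0..})" using gi midhull_tail_mono[of 0 i0 g] by auto
        then show "\<exists>hs. Q 0 hs" using c by (intro exI[of _ "[g i0]"]) (auto simp: Q_def c_def[symmetric] power2_eq_square)
        fix hs k assume Q: "Q k hs"
        then have ne: "hs \<noteq> []" and mem: "h \<in> set hs \<Longrightarrow> \<exists>n. h \<in> midhull (g ` {n..})" for h
          by (auto simp: Q_def in_set_conv_nth less_Suc_eq_le)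
        have hs: "cval M h" "\<And>\<omega>. \<omega> \<in> space M \<Longrightarrow> h \<omega> \<in> D" if "h \<in> set hs" for h
          using mem[OF that] gM not_empty by blast+
        define L where "L \<omega> = map (\<lambda>h. h \<omega>) hs" for \<omega>
        have L: "cval M L" unfolding L_def using hs(1) by (rule cvm)
        have LDm: "L \<omega> \<in> lists D" if "\<omega> \<in> space M" for \<omega> using hs(2) that by (auto simp: L_def)
        \<comment> \<open>The next vector becomes entry \<open>Suc k\<close>, which has to come from
          the tail starting there.\<close>
        define H where "H n = midhull (g ` {max n (Suc k)..})" for n
        define P where "P h \<omega> = (if \<omega> \<in> space M then \<Psi> (L \<omega>) (h \<omega>) \<omega> else 0)" for h \<omega>
        have H0: "cval M h" "\<And>\<omega>. \<omega> \<in> space M \<Longrightarrow> h \<omega> \<in> D" if "h \<in> H n" for h n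
          using gM[of h "max n (Suc k)"] that not_empty by (auto simp: H_def)
        have Pb: "0 \<le> P h \<omega>" "P h \<omega> \<le> 1" if "h \<in> H n" for h \<omega> n
          using \<Psi>(2)[OF H0(2)[OF that]] by (auto simp: P_def)
        have Pm: "P h \<in> borel_measurable M" if "h \<in> H n" for h n
          using meas[OF L H0(1)[OF that] H0(2)[OF that]] by (simp add: P_def cong: measurable_cong)
        have Pint: "integrable M (P h)" if "h \<in> H n" for h n
          by (rule integrable_const_bound[of _ 1]) (use Pb[OF that] Pm[OF that] in auto)
        \<comment> \<open>\<open>persist\<close> gives large values at infinitely many
          \<open>i\<close>, but at indices depending on \<open>\<omega>\<close>. Along blocks for
          which \<open>P (h n)\<close> converges, the limit is at least \<open>\<delta>\<close> on
          \<open>Ev hs\<close>, so a single late \<open>h i\<close> exceeds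
          \<open>\<delta>/2\<close> there off an event of small probability.\<close>
        have "\<exists>h. (\<forall>n. h n \<in> H n) \<and> (AE \<omega> in M. convergent (\<lambda>n. P (h n) \<omega>))"
        proof (rule convex_selection[of H P 1])
          fix h assume "\<And>n. h n \<in> H n" "AE \<omega> in M. convergent (\<lambda>n. P (h n) \<omega>)"
          then show "\<exists>h. (\<forall>n. h n \<in> H n) \<and> (AE \<omega> in M. convergent (\<lambda>n. P (h n) \<omega>))" by blast
        next
          show "H n \<subseteq> H m" if "m \<le> n" for m n unfolding H_def using that by (intro midhull_tail_mono) auto
          show "H n \<noteq> {}" for n unfolding H_def using midhull.base[of "g (max n (Suc k))" "g ` {max n (Suc k)..}"] by auto
          show "(1/2) *\<^sub>R (x + y) \<in> H n" if "x \<in> H n" "y \<in> H n" for n x y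
            using that unfolding H_def by (rule midhull.mid)
          show "expectation (P h) \<le> 1" if "h \<in> H 0" for h
            using integral_mono[OF Pint[OF that], of "\<lambda>_. 1"] Pb[OF that] by (simp add: prob_space)
          show "AE \<omega> in M. P ((1/2) *\<^sub>R (x + y)) \<omega> \<le> (P x \<omega> + P y \<omega>) / 2" if "x \<in> H 0" "y \<in> H 0" for x y
            using mid AE_space
          proof eventually_elim
            case (elim \<omega>)
            then show ?case using LDm H0(2)[OF that(1)] H0(2)[OF that(2)] by (auto simp: P_def)
          qed
        qed (use Pint Pb in auto)
        then obtain h where h: "\<And>n. h n \<in> H n" "AE \<omega> in M. convergent (\<lambda>n. P (h n) \<omega>)" by blast
        have "H n \<subseteq> midhull (g ` {n..})" for n unfolding H_def by (intro midhull_tail_mono) auto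
        then have hg: "blk h g" using h(1) by (intro blkI) blast
        have hM: "cval M (h i)" "\<omega> \<in> space M \<Longrightarrow> h i \<omega> \<in> D" for i \<omega> using H0[OF h(1)] by auto
        have pers: "AE \<omega> in M. \<forall>l\<in>lists D. \<forall>x\<in>D. \<delta>/2 < \<Psi> l x \<omega> \<longrightarrow> (\<forall>N. \<exists>i\<ge>N. \<delta> \<le> \<Psi> (l @ [x]) (h i \<omega>) \<omega>)"
          by (rule persist[OF hg]) (use hM in auto)
        have "AE \<omega> in M. \<forall>\<^sub>F i in sequentially. \<omega> \<notin> Ev hs - Ev (hs @ [h i])"
          using pers h(2) AE_space
        proof eventually_elim
          case (elim \<omega>)
          show ?case
          proof (cases "\<omega> \<in> Ev hs")
            case True
            have Leq: "map (\<lambda>h. h \<omega>) (butlast hs) @ [last hs \<omega>] = L \<omega>"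
              using ne by (cases hs rule: rev_cases) (auto simp: L_def)
            have "map (\<lambda>h. h \<omega>) (butlast hs) \<in> lists D" "last hs \<omega> \<in> D"
              using map_butlast_lists[of hs \<omega> D] hs(2)[OF _ elim(3)] ne by auto
            moreover have "\<delta>/2 < \<Psi> (map (\<lambda>h. h \<omega>) (butlast hs)) (last hs \<omega>) \<omega>"
              using True by (simp add: Ev_def)
            ultimately have "\<exists>i\<ge>N. \<delta> \<le> \<Psi> (map (\<lambda>h. h \<omega>) (butlast hs) @ [last hs \<omega>]) (h i \<omega>) \<omega>" for N
              using elim(1) by blast
            then have freq: "\<exists>i\<ge>N. \<delta> \<le> P (h i) \<omega>" for N
              using elim(3) unfolding Leq P_def by simp
            obtain p where p: "(\<lambda>i. P (h i) \<omega>) \<longlonglongrightarrow> p" using elim(2) by (auto simp: convergent_def)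
            have "\<delta> \<le> p"
            proof (rule ccontr)
              assume "\<not> \<delta> \<le> p"
              then have "\<forall>\<^sub>F i in sequentially. P (h i) \<omega> < \<delta>" by (intro order_tendstoD(2)[OF p]) simp
              then show False using freq by (force simp: eventually_sequentially)
            qed
            then have "\<forall>\<^sub>F i in sequentially. \<delta>/2 < P (h i) \<omega>" by (intro order_tendstoD(1)[OF p]) (use \<delta> in simp)
            then show ?thesis by eventually_elim (use elim(3) in \<open>auto simp: Ev_def P_def L_def\<close>)
          qed simp
        qed
        moreover have ev: "Ev (hs @ [h i]) \<in> events" for i
          using mem h(1)[of i] by (intro Ev_sets) (auto simp: H_def)
        moreover have ev0: "Ev hs \<in> events" by (rule Ev_sets[OF mem ne])
        ultimately have "(\<lambda>i. prob (Ev hs - Ev (hs @ [h i]))) \<longlonglongrightarrow> 0" by (intro prob_tendsto_0) auto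
        then have "\<forall>\<^sub>F i in sequentially. prob (Ev hs - Ev (hs @ [h i])) < c * (1/2) ^ (k + 3)"
          by (rule order_tendstoD) (use c in simp)
        then obtain i where i: "prob (Ev hs - Ev (hs @ [h i])) < c * (1/2) ^ (k + 3)" by (auto simp: eventually_sequentially)
        have "prob (Ev hs) \<le> prob (Ev hs - Ev (hs @ [h i])) + prob (Ev (hs @ [h i]))"
          using ev[of i] ev0 by (intro order_trans[OF finite_measure_mono measure_Un_le]) auto
        moreover have "p \<le> d + p' \<Longrightarrow> c * (1/2 + 2 * e) < p \<Longrightarrow> d < c * e \<Longrightarrow> c * (1/2 + e) < p'"
          for p p' d e :: real by (simp add: algebra_simps)
        moreover have "(1/2::real) ^ (k + 2) = 2 * (1/2) ^ (k + 3)"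
          by (simp add: power_add power2_eq_square power3_eq_cube)
        moreover have "c * (1/2 + (1/2) ^ (k + 2)) < prob (Ev hs)" using Q by (simp only: Q_def)
        ultimately have "c * (1/2 + (1/2) ^ (k + 3)) < prob (Ev (hs @ [h i]))" using i by metis
        moreover have "Suc k + 2 = k + 3" by simp
        ultimately have "c * (1/2 + (1/2) ^ (Suc k + 2)) < prob (Ev (hs @ [h i]))" by (simp only:)
        moreover have "h i \<in> midhull (g ` {Suc k..})"
          using h(1)[of i] midhull_tail_mono[of "Suc k" "max i (Suc k)" g] by (auto simp: H_def)
        ultimately have "Q (Suc k) (hs @ [h i])"
          using Q by (auto simp: Q_def nth_append le_Suc_eq)
        then show "\<exists>hs'. Q (Suc k) hs' \<and> (\<exists>h. hs' = hs @ [h])" by blast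
      qed
      then obtain hs where hs: "\<And>k. Q k (hs k)" "\<And>k. \<exists>h. hs (Suc k) = hs k @ [h]" by blast
      define G where "G i = hs i ! i" for i
      have hsG: "hs k ! i = G i" if "i \<le> k" for i k
        using that
      proof (induction rule: dec_induct)
        case (step n)
        obtain h where "hs (Suc n) = hs n @ [h]" using hs(2) by blast
        then show ?case using step hs(1)[of n] by (simp add: nth_append Q_def)
      qed (simp add: G_def)
      show False
      proof (rule no_l1[of G "\<delta>/2" "c/2" "\<lambda>k. Ev (hs k)"])
        show "G i \<in> midhull (f ` {i..})" for i
          using hs(1)[of i] gtail[of i] by (auto simp: Q_def G_def)
        show "Ev (hs k) \<in> events \<and> c/2 \<le> prob (Ev (hs k))" for k
        proof
          show "Ev (hs k) \<in> events"
            using hs(1)[of k] by (intro Ev_sets) (auto simp: Q_def in_set_conv_nth less_Suc_eq_le)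
          have "c * (1/2) \<le> c * (1/2 + (1/2) ^ (k + 2))" using c by (intro mult_left_mono) auto
          then show "c/2 \<le> prob (Ev (hs k))" using hs(1)[of k] by (simp add: Q_def)
        qed
        show "AE \<omega> in M. \<omega> \<in> Ev (hs k) \<longrightarrow> (\<exists>T\<in>l1_ops. \<forall>i\<le>k. \<delta>/2 < T i (G i \<omega>))" for k
          using witness AE_space
        proof eventually_elim
          case (elim \<omega>)
          have len: "length (hs k) = Suc k" and ne: "hs k \<noteq> []" using hs(1)[of k] by (auto simp: Q_def)
          have mem: "h \<omega> \<in> D" if "h \<in> set (hs k)" for h
            using that hs(1)[of k] gM(2)[OF _ elim(2)] by (auto simp: Q_def in_set_conv_nth less_Suc_eq_le)
          let ?l = "map (\<lambda>h. h \<omega>) (butlast (hs k))"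
          have lx: "?l \<in> lists D" "last (hs k) \<omega> \<in> D" using map_butlast_lists[of "hs k" \<omega> D] mem ne by auto
          have eq: "?l @ [last (hs k) \<omega>] = map (\<lambda>h. h \<omega>) (hs k)"
            using ne by (cases "hs k" rule: rev_cases) auto
          have nth: "(?l @ [last (hs k) \<omega>]) ! i = G i \<omega>" if "i \<le> k" for i
            unfolding eq using that len hsG[OF that] by simp
          show ?case
          proof
            assume "\<omega> \<in> Ev (hs k)"
            then have "\<delta>/2 < \<Psi> ?l (last (hs k) \<omega>) \<omega>" by (simp add: Ev_def)
            then obtain T where "T \<in> l1_ops" "\<forall>i\<le>length ?l. \<delta>/2 < T i ((?l @ [last (hs k) \<omega>]) ! i)"
              using elim(1) lx by blast
            then show "\<exists>T\<in>l1_ops. \<forall>i\<le>k. \<delta>/2 < T i (G i \<omega>)" using nth len by (intro bexI[of _ T]) auto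
          qed
        qed
      qed (use \<delta> c in auto)
    qed
  qed
  have "AE \<omega> in M. \<forall>m. \<not> extendible (1 / real (Suc m)) (\<lambda>n. g n \<omega>) []"
    unfolding AE_all_countable using main by blast
  then have "AE \<omega> in M. \<forall>\<delta>>0. \<not> extendible \<delta> (\<lambda>n. g n \<omega>) []"
  proof eventually_elim
    case (elim \<omega>)
    show ?case
    proof (intro allI impI notI)
      fix \<delta> :: real assume "0 < \<delta>" and ext: "extendible \<delta> (\<lambda>n. g n \<omega>) []"
      then obtain m where "1 / real (Suc m) < \<delta>" using nat_approx_posE by metis
      then have "extendible (1 / real (Suc m)) (\<lambda>n. g n \<omega>) []"
        using ext unfolding extendible_def by simp (meson less_imp_le order_trans)
      then show False using elim by blast
    qed
  qed
  then show thesis using that blk_trans[OF gg0 g0(1)] by blast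
qed

end

section \<open>Weak limits of pointwise \<open>V\<^sup>*\<close>-sets\<close>

text \<open>The rational span. It is countable for a countable set, so that a family of densities
  can be made rationally linear off one null set, and for nonempty \<open>A\<close> its closure is a
  real subspace.\<close>

inductive_set qspan :: "'v::real_vector set \<Rightarrow> 'v set" for A where
  qspan_base: "a \<in> A \<Longrightarrow> a \<in> qspan A"
| qspan_add: "x \<in> qspan A \<Longrightarrow> y \<in> qspan A \<Longrightarrow> x + y \<in> qspan A"
| qspan_scale: "x \<in> qspan A \<Longrightarrow> of_rat r *\<^sub>R x \<in> qspan A"

lemma qspan_diff: "x \<in> qspan A \<Longrightarrow> y \<in> qspan A \<Longrightarrow> x - y \<in> qspan A"
  using qspan_add[of x A "of_rat (-1) *\<^sub>R y"] qspan_scale[of y A "-1"] by simp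

lemma midhull_qspan: "midhull A \<subseteq> qspan A"
proof (rule midhull_minimal)
  fix x y assume "x \<in> qspan A" "y \<in> qspan A"
  then have "of_rat (1/2) *\<^sub>R (x + y) \<in> qspan A" by (intro qspan_scale qspan_add)
  then show "(1/2) *\<^sub>R (x + y) \<in> qspan A" by (simp add: of_rat_divide)
qed (auto intro: qspan_base)

lemma countable_qspan:
  assumes "countable A"
  shows "countable (qspan A)"
proof -
  define F where "F = rec_nat A (\<lambda>_ B. B \<union> (\<lambda>(x, y). x + y) ` (B \<times> B) \<union>
      (\<lambda>(r, x). of_rat r *\<^sub>R x) ` (UNIV \<times> B))"
  have F: "F 0 = A" "F (Suc n) = F n \<union> (\<lambda>(x, y). x + y) ` (F n \<times> F n) \<union>
      (\<lambda>(r, x). of_rat r *\<^sub>R x) ` (UNIV \<times> F n)" for n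
    by (simp_all add: F_def)
  have mono: "F m \<subseteq> F n" if "m \<le> n" for m n
    using that by (rule lift_Suc_mono_le[rotated]) (auto simp: F)
  have "qspan A \<subseteq> (\<Union>n. F n)"
  proof
    fix x assume "x \<in> qspan A"
    then show "x \<in> (\<Union>n. F n)"
    proof induction
      case (qspan_base a)
      then show ?case using F(1) by auto
    next
      case (qspan_add x y)
      then obtain m n where "x \<in> F m" "y \<in> F n" by auto
      then have "x \<in> F (max m n)" "y \<in> F (max m n)" using mono[of m "max m n"] mono[of n "max m n"] by auto
      then have "x + y \<in> F (Suc (max m n))" by (force simp: F)
      then show ?case by blast
    next
      case (qspan_scale x r)
      then obtain n where "x \<in> F n" by auto
      then have "of_rat r *\<^sub>R x \<in> F (Suc n)" by (force simp: F)
      then show ?case by blast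
    qed
  qed
  moreover have "countable (F n)" for n by (induction n) (use assms in \<open>auto simp: F\<close>)
  ultimately show ?thesis by (meson countable_UN countable_subset countableI_type)
qed

lemma of_rat_approx:
  fixes c :: real
  assumes "0 < \<epsilon>"
  obtains r where "\<bar>of_rat r - c\<bar> < \<epsilon>"
proof -
  obtain r where "c < of_rat r" "of_rat r < c + \<epsilon>" using of_rat_dense[of c "c + \<epsilon>"] assms by auto
  then show thesis by (intro that[of r]) auto
qed

lemma subspace_closure_qspan:
  fixes A :: "'x::real_normed_vector set"
  assumes "A \<noteq> {}"
  shows "subspace (closure (qspan A))"
proof -
  obtain a where a: "a \<in> qspan A" using assms qspan_base by blast
  show ?thesis
  proof (rule subspaceI)
    show "0 \<in> closure (qspan A)" using qspan_scale[OF a, of 0] closure_subset[of "qspan A"] by auto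
    fix x y :: 'x assume x: "x \<in> closure (qspan A)"
    {
      assume y: "y \<in> closure (qspan A)"
      obtain s t where "\<And>n. s n \<in> qspan A" "s \<longlonglongrightarrow> x" "\<And>n. t n \<in> qspan A" "t \<longlonglongrightarrow> y"
        using x y unfolding closure_sequential by blast
      then show "x + y \<in> closure (qspan A)"
        unfolding closure_sequential by (intro exI[of _ "\<lambda>n. s n + t n"]) (auto intro: qspan_add tendsto_add)
    }
    fix c :: real
    have "\<forall>n. \<exists>r. \<bar>of_rat r - c\<bar> < 1 / real (Suc n)"
      by (intro allI) (rule of_rat_approx[of "1 / real (Suc _)"], simp, blast)
    from choice[OF this] obtain r where r: "\<And>n. \<bar>of_rat (r n) - c\<bar> < 1 / real (Suc n)" by blast
    have "(\<lambda>n. of_rat (r n) - c) \<longlonglongrightarrow> 0"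
      by (rule Lim_null_comparison[OF _ LIMSEQ_Suc[OF lim_1_over_n]])
        (use r in \<open>auto intro!: always_eventually simp: less_imp_le\<close>)
    then have "(\<lambda>n. of_rat (r n) :: real) \<longlonglongrightarrow> c" by (simp add: LIM_zero_iff)
    moreover obtain s where "\<And>n. s n \<in> qspan A" "s \<longlonglongrightarrow> x" using x unfolding closure_sequential by blast
    ultimately show "c *\<^sub>R x \<in> closure (qspan A)"
      unfolding closure_sequential
      by (intro exI[of _ "\<lambda>n. of_rat (r n) *\<^sub>R s n"]) (auto intro: qspan_scale tendsto_scaleR)
  qed
qed

text \<open>
  Sublinearity of the infimal convolution over the \<open>\<rat>\<close>-space \<open>D\<close>: it is homogeneous for
  rational factors, hence for real ones since it is \<open>1\<close>-Lipschitz.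
\<close>

lemma qspan_extension:
  fixes \<kappa> :: "'x::real_normed_vector \<Rightarrow> real"
  assumes D: "D = qspan A" "A \<noteq> {}"
    and add: "\<And>u v. u \<in> D \<Longrightarrow> v \<in> D \<Longrightarrow> \<kappa> (u + v) = \<kappa> u + \<kappa> v"
    and scale: "\<And>r u. u \<in> D \<Longrightarrow> \<kappa> (of_rat r *\<^sub>R u) = of_rat r * \<kappa> u"
    and le: "\<And>u. u \<in> D \<Longrightarrow> \<kappa> u \<le> norm u"
  obtains L where "linear L" "\<And>x. L x \<le> norm x" "\<And>u. u \<in> D \<Longrightarrow> L u = \<kappa> u"
proof -
  obtain a where a: "a \<in> D" using D qspan_base by blast
  have neg: "- u \<in> D" "\<kappa> (- u) = - \<kappa> u" if "u \<in> D" for u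
    using qspan_scale[of u A "-1"] scale[OF that, of "-1"] that D(1) by auto
  define Q where "Q z = (INF u\<in>D. \<kappa> u + norm (z - u))" for z
  have lower: "- norm z \<le> \<kappa> u + norm (z - u)" if "u \<in> D" for u z
    using le[OF neg(1)[OF that]] neg(2)[OF that] norm_triangle_ineq3[of u z] norm_minus_commute[of u z]
    by (simp add: abs_le_iff)
  then have bdd: "bdd_below ((\<lambda>u. \<kappa> u + norm (z - u)) ` D)" for z by (intro bdd_belowI2)
  have Qle: "Q z \<le> \<kappa> u + norm (z - u)" if "u \<in> D" for u z unfolding Q_def using bdd that by (rule cINF_lower)
  have Qge: "c \<le> Q z" if "\<And>u. u \<in> D \<Longrightarrow> c \<le> \<kappa> u + norm (z - u)" for c z
    unfolding Q_def by (rule cINF_greatest) (use a that in auto)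
  have Q0: "0 \<in> D" "\<kappa> 0 = 0" using qspan_scale[of a A 0] scale[OF a, of 0] a D(1) by auto
  have Qnorm: "Q z \<le> norm z" for z using Qle[OF Q0(1), of z] Q0(2) by simp
  have sub: "Q (y + z) \<le> Q y + Q z" for y z
  proof -
    have 1: "Q (y + z) \<le> (\<kappa> u + norm (y - u)) + (\<kappa> v + norm (z - v))" if "u \<in> D" "v \<in> D" for u v
    proof -
      have "Q (y + z) \<le> \<kappa> (u + v) + norm (y + z - (u + v))" by (rule Qle) (use that D qspan_add in auto)
      also have "norm (y + z - (u + v)) \<le> norm (y - u) + norm (z - v)"
        using norm_triangle_ineq[of "y - u" "z - v"] by (simp add: algebra_simps)
      finally show ?thesis using add[OF that] by simp
    qed
    have "Q (y + z) - (\<kappa> u + norm (y - u)) \<le> Q z" if "u \<in> D" for u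
      by (rule Qge) (use 1[OF that] in \<open>fastforce simp: algebra_simps\<close>)
    then have "Q (y + z) - Q z \<le> Q y" by (intro Qge) (fastforce simp: algebra_simps)
    then show ?thesis by simp
  qed
  have homr: "Q (of_rat r *\<^sub>R z) \<le> of_rat r * Q z" if r: "0 < r" for r z
  proof -
    have r': "0 < (of_rat r :: real)" using r by simp
    have "Q (of_rat r *\<^sub>R z) / of_rat r \<le> Q z"
    proof (rule Qge)
      fix u assume u: "u \<in> D"
      have "Q (of_rat r *\<^sub>R z) \<le> \<kappa> (of_rat r *\<^sub>R u) + norm (of_rat r *\<^sub>R z - of_rat r *\<^sub>R u)"
        by (rule Qle) (use u D qspan_scale in auto)
      also have "\<dots> = of_rat r * (\<kappa> u + norm (z - u))"
        using r' by (simp add: scale[OF u] scaleR_diff_right[symmetric] distrib_left)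
      finally show "Q (of_rat r *\<^sub>R z) / of_rat r \<le> \<kappa> u + norm (z - u)"
        using r' by (simp add: field_simps)
    qed
    then show ?thesis using r' by (simp add: field_simps)
  qed
  have hom: "Q (t *\<^sub>R z) \<le> t * Q z" if t: "0 < t" for t z
  proof (rule field_le_epsilon)
    fix e :: real assume e: "0 < e"
    define \<eta> where "\<eta> = e / (2 * (norm z + 1))"
    have \<eta>: "0 < \<eta>" using e by (simp add: \<eta>_def add_nonneg_pos)
    obtain r where r: "\<bar>of_rat r - t\<bar> < min \<eta> t" using of_rat_approx[of "min \<eta> t" t] \<eta> t by auto
    then have r0: "0 < (of_rat r :: real)" by linarith
    have Qabs: "\<bar>Q z\<bar> \<le> norm z" using Qnorm[of z] Qge[of "- norm z" z] lower by (auto simp: abs_le_iff)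
    have "t *\<^sub>R z = of_rat r *\<^sub>R z + (t - of_rat r) *\<^sub>R z" by (simp add: algebra_simps)
    then have "Q (t *\<^sub>R z) \<le> of_rat r * Q z + Q ((t - of_rat r) *\<^sub>R z)"
      using sub[of "of_rat r *\<^sub>R z" "(t - of_rat r) *\<^sub>R z"] homr[of r z] r0 by simp
    also have "of_rat r * Q z = t * Q z + (of_rat r - t) * Q z" by (simp add: algebra_simps)
    also have "(of_rat r - t) * Q z \<le> \<eta> * norm z"
    proof -
      have "(of_rat r - t) * Q z \<le> \<bar>of_rat r - t\<bar> * \<bar>Q z\<bar>" by (metis abs_ge_self abs_mult)
      also have "\<dots> \<le> \<eta> * norm z" using r Qabs by (intro mult_mono) auto
      finally show ?thesis .
    qed
    also have "Q ((t - of_rat r) *\<^sub>R z) \<le> \<eta> * norm z"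
    proof -
      have "Q ((t - of_rat r) *\<^sub>R z) \<le> \<bar>t - of_rat r\<bar> * norm z" using Qnorm[of "(t - of_rat r) *\<^sub>R z"] by simp
      also have "\<dots> \<le> \<eta> * norm z" using r by (intro mult_right_mono) auto
      finally show ?thesis .
    qed
    also have "t * Q z + \<eta> * norm z + \<eta> * norm z = t * Q z + 2 * norm z * \<eta>" by simp
    also have "2 * norm z * \<eta> \<le> e"
    proof -
      have "2 * norm z * \<eta> \<le> 2 * (norm z + 1) * \<eta>" using \<eta> by (intro mult_right_mono) auto
      also have "\<dots> = e"
        using norm_ge_zero[of z] unfolding \<eta>_def by (metis add_nonneg_pos less_numeral_extra(1,3) mult_eq_0_iff
            nonzero_mult_div_cancel_left times_divide_eq_right zero_neq_numeral)
      finally show ?thesis .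
    qed
    finally show "Q (t *\<^sub>R z) \<le> t * Q z + e" by simp
  qed
  have "0 \<le> Q 0"
  proof (rule Qge)
    show "0 \<le> \<kappa> u + norm (0 - u)" if "u \<in> D" for u using lower[OF that, of 0] by simp
  qed
  then have "Q 0 = 0" using Qnorm[of 0] by simp
  then have "sublinear_on UNIV Q" by (intro sublinear_onI subspace_UNIV sub hom)
  then obtain L where L: "linear L" "\<And>x. L x \<le> Q x" using hahn_banach_UNIV by blast
  have "L u \<le> \<kappa> u" if "u \<in> D" for u using L(2)[of u] Qle[OF that, of u] by simp
  then have "L u = \<kappa> u" if "u \<in> D" for u
    using neg[OF that] linear_neg[OF L(1), of u] that by (metis antisym minus_le_iff minus_minus)
  then show thesis using that[OF L(1)] L(2) Qnorm by (meson order_trans)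
qed

text \<open>Weak compactness provides a cluster point for every subsequence, and by Mazur's theorem
  it lies in \<open>closure D\<close>. The functionals \<open>\<xi> u v\<close>, norming differences
  of points of \<open>D\<close>, separate \<open>closure D\<close> and converge along the sequence.
  Hence all cluster points coincide, which is weak convergence.\<close>

lemma weak_limit:
  fixes x :: "nat \<Rightarrow> 'x::real_normed_vector" and \<xi> :: "'x \<Rightarrow> 'x \<Rightarrow> 'x \<Rightarrow> real"
  assumes wc: "relatively_weakly_compact type_space (range x)"
    and D: "D = qspan A" "A \<noteq> {}" and x: "\<And>n. x n \<in> D"
    and \<xi>: "\<And>u v. linear (\<xi> u v)" "\<And>u v y. \<xi> u v y \<le> norm y" "\<And>u v. \<xi> u v (u - v) = norm (u - v)"
    and conv: "\<And>u v. u \<in> D \<Longrightarrow> v \<in> D \<Longrightarrow> convergent (\<lambda>n. \<xi> u v (x n))"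
  obtains y where "y \<in> closure D" "\<And>\<phi>. bounded_linear \<phi> \<Longrightarrow> (\<lambda>n. \<phi> (x n)) \<longlonglongrightarrow> (\<phi> y :: real)"
proof -
  have \<xi>abs: "\<bar>\<xi> u v z\<bar> \<le> norm z" for u v z
    using \<xi>(2)[of u v z] \<xi>(2)[of u v "- z"] linear_neg[OF \<xi>(1), of u v z] by (simp add: abs_le_iff)
  have bl: "bounded_linear (\<xi> u v)" for u v
    using \<xi>(1)[of u v] \<xi>abs[of u v] by (auto simp: bounded_linear_def bounded_linear_axioms_def intro: exI[of _ 1])
  have sub: "subspace (closure D)" unfolding D(1) by (rule subspace_closure_qspan[OF D(2)])
  have cluster: "\<exists>y\<in>closure D. \<forall>\<phi>. bounded_linear \<phi> \<longrightarrow> (\<forall>\<epsilon>>0. \<forall>N. \<exists>n\<ge>N. \<bar>\<phi> (x (r n)) - \<phi> y\<bar> < (\<epsilon>::real))"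
    for r :: "nat \<Rightarrow> nat"
  proof -
    obtain y where y: "\<And>\<phi> \<epsilon> N. \<phi> \<in> vcarrier (dual type_space) \<Longrightarrow> 0 < \<epsilon> \<Longrightarrow> \<exists>n\<ge>N. \<bar>\<phi> (x (r n)) - \<phi> y\<bar> < \<epsilon>"
      "\<And>n \<epsilon>. 0 < \<epsilon> \<Longrightarrow> \<exists>h\<in>convex hull ((\<lambda>n. x (r n)) ` {n..}). norm (h - y) < \<epsilon>"
      using type_rep.cluster_convex[OF wc, of "\<lambda>n. x (r n)"] by auto
    have "convex hull ((\<lambda>n. x (r n)) ` {0..}) \<subseteq> closure D"
      using x closure_subset[of D] by (intro hull_minimal subspace_imp_convex sub) auto
    then have "\<exists>h\<in>closure D. dist h y < \<epsilon>" if "0 < \<epsilon>" for \<epsilon>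
      using y(2)[OF that, of 0] by (auto simp: dist_norm)
    then have "y \<in> closure (closure D)" by (subst closure_approachable) blast
    then show ?thesis using y(1)[unfolded vcarrier_dual_type_space mem_Collect_eq] by (intro bexI[of _ y]) (blast, simp)
  qed
  have unique: "y = y'"
    if y: "y \<in> closure D" "y' \<in> closure D" and eq: "\<And>u v. u \<in> D \<Longrightarrow> v \<in> D \<Longrightarrow> \<xi> u v y = \<xi> u v y'" for y y'
  proof (rule ccontr)
    assume "y \<noteq> y'"
    define e where "e = norm (y - y') / 8"
    have e: "0 < e" using \<open>y \<noteq> y'\<close> by (simp add: e_def)
    obtain u where u: "u \<in> D" "norm (u - y) < e" using y(1) e by (auto simp: closure_approachable dist_norm)
    obtain v where v: "v \<in> D" "norm (v - y') < e" using y(2) e by (auto simp: closure_approachable dist_norm)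
    have "norm (y - y') \<le> norm (u - v) + norm (u - y) + norm (v - y')"
      using norm_triangle_ineq[of "u - v" "(y - u) + (v - y')"] norm_triangle_ineq[of "y - u" "v - y'"]
      by (simp add: norm_minus_commute)
    moreover have "norm (u - v) = \<xi> u v (u - y) + (\<xi> u v y - \<xi> u v y') - \<xi> u v (v - y')"
      using \<xi>(3)[of u v] by (simp add: linear_diff[OF \<xi>(1)])
    moreover have "\<bar>\<xi> u v (u - y)\<bar> \<le> norm (u - y)" "\<bar>\<xi> u v (v - y')\<bar> \<le> norm (v - y')" by (rule \<xi>abs)+
    ultimately have "norm (y - y') < 8 * e" using eq[OF u(1) v(1)] u(2) v(2) by linarith
    then show False by (simp add: e_def)
  qed
  have lim: "(\<lambda>n. \<xi> u v (x n)) \<longlonglongrightarrow> \<xi> u v y"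
    if r: "strict_mono r" and cl: "\<forall>\<phi>. bounded_linear \<phi> \<longrightarrow> (\<forall>\<epsilon>>0. \<forall>N. \<exists>n\<ge>N. \<bar>\<phi> (x (r n)) - \<phi> y\<bar> < (\<epsilon>::real))"
      and uv: "u \<in> D" "v \<in> D" for r :: "nat \<Rightarrow> nat" and y u v
  proof -
    obtain l where l: "(\<lambda>n. \<xi> u v (x n)) \<longlonglongrightarrow> l" using conv[OF uv] by (auto simp: convergent_def)
    then have lr: "(\<lambda>n. \<xi> u v (x (r n))) \<longlonglongrightarrow> l" using LIMSEQ_subseq_LIMSEQ[OF l r] by (simp add: comp_def)
    have "\<bar>\<xi> u v y - l\<bar> \<le> 0 + e" if e: "0 < e" for e
    proof -
      have "\<forall>\<^sub>F n in sequentially. \<bar>\<xi> u v (x (r n)) - l\<bar> < e / 2"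
        using tendstoD[OF lr, of "e/2"] e by (simp add: dist_real_def)
      then obtain N where "\<And>n. N \<le> n \<Longrightarrow> \<bar>\<xi> u v (x (r n)) - l\<bar> < e / 2" by (auto simp: eventually_sequentially)
      moreover obtain n where "n \<ge> N" "\<bar>\<xi> u v (x (r n)) - \<xi> u v y\<bar> < e / 2"
        using cl bl[of u v] e by (meson half_gt_zero)
      ultimately have "\<bar>\<xi> u v (x (r n)) - l\<bar> < e / 2" "\<bar>\<xi> u v (x (r n)) - \<xi> u v y\<bar> < e / 2" by auto
      then show ?thesis by linarith
    qed
    then have "\<bar>\<xi> u v y - l\<bar> \<le> 0" by (rule field_le_epsilon)
    then show ?thesis using l by simp
  qed
  obtain y where y: "y \<in> closure D"
    "\<forall>\<phi>. bounded_linear \<phi> \<longrightarrow> (\<forall>\<epsilon>>0. \<forall>N. \<exists>n\<ge>N. \<bar>\<phi> (x n) - \<phi> y\<bar> < (\<epsilon>::real))"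
    using cluster[of "\<lambda>n. n"] by auto
  have "(\<lambda>n. \<phi> (x n)) \<longlonglongrightarrow> \<phi> y" if \<phi>: "bounded_linear \<phi>" for \<phi> :: "'x \<Rightarrow> real"
  proof (rule ccontr)
    assume "\<not> ?thesis"
    then obtain \<epsilon> where \<epsilon>: "0 < \<epsilon>" "\<And>N. \<exists>n\<ge>N. \<epsilon> \<le> \<bar>\<phi> (x n) - \<phi> y\<bar>"
      unfolding LIMSEQ_def dist_real_def by (meson not_le)
    have "\<exists>r. \<forall>k. \<epsilon> \<le> \<bar>\<phi> (x (r k)) - \<phi> y\<bar> \<and> r k < r (Suc k)"
    proof (rule dependent_nat_choice)
      show "\<exists>n. \<epsilon> \<le> \<bar>\<phi> (x n) - \<phi> y\<bar>" using \<epsilon>(2) by blast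
      show "\<exists>m. \<epsilon> \<le> \<bar>\<phi> (x m) - \<phi> y\<bar> \<and> n < m" for n using \<epsilon>(2)[of "Suc n"] by (auto simp: Suc_le_eq)
    qed
    then obtain r :: "nat \<Rightarrow> nat" where r: "\<And>k. \<epsilon> \<le> \<bar>\<phi> (x (r k)) - \<phi> y\<bar>" "strict_mono r" by (auto simp: strict_mono_Suc_iff)
    obtain y' where y': "y' \<in> closure D"
      "\<forall>\<phi>. bounded_linear \<phi> \<longrightarrow> (\<forall>\<epsilon>>0. \<forall>N. \<exists>n\<ge>N. \<bar>\<phi> (x (r n)) - \<phi> y'\<bar> < (\<epsilon>::real))"
      using cluster[of r] by blast
    have "y = y'"
    proof (rule unique[OF y(1) y'(1)])
      fix u v assume "u \<in> D" "v \<in> D"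
      then show "\<xi> u v y = \<xi> u v y'"
        using LIMSEQ_unique[OF lim[of "\<lambda>n. n" y u v] lim[OF r(2) y'(2), of u v]] y(2) by (simp add: strict_mono_def)
    qed
    then show False using y'(2) \<phi> \<epsilon>(1) r(1) by (meson not_le)
  qed
  then show thesis using that[OF y(1)] by blast
qed

text \<open>The part of \<open>L\<^sup>1(X)\<close> in which separation takes place. The bound holds
  at every point, so pointwise estimates apply without exceptional sets.\<close>

definition cvb :: "'w measure \<Rightarrow> ('w \<Rightarrow> 'x::real_normed_vector) set" where
  "cvb M = {f. cval M f \<and> (\<exists>C. \<forall>\<omega>. norm (f \<omega>) \<le> C)}"

lemma subspace_cvb:
  fixes M :: "'w measure"
  shows "subspace (cvb M :: ('w \<Rightarrow> 'x::real_normed_vector) set)"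
proof (rule subspaceI)
  show "0 \<in> cvb M" using cval_const[of M 0] by (auto simp: cvb_def zero_fun_def)
next
  fix f g :: "'w \<Rightarrow> 'x" assume fg: "f \<in> cvb M" "g \<in> cvb M"
  then obtain C D where "\<And>\<omega>. norm (f \<omega>) \<le> C" "\<And>\<omega>. norm (g \<omega>) \<le> D" by (auto simp: cvb_def)
  then have "norm (f \<omega> + g \<omega>) \<le> C + D" for \<omega> by (meson add_mono norm_triangle_le)
  then show "f + g \<in> cvb M"
    using cval_comp2[of M f g "(+)"] fg by (auto simp: cvb_def plus_fun_def)
next
  fix c and f :: "'w \<Rightarrow> 'x" assume f: "f \<in> cvb M"
  then obtain C where "\<And>\<omega>. norm (f \<omega>) \<le> C" by (auto simp: cvb_def)
  then have "norm (c *\<^sub>R f \<omega>) \<le> \<bar>c\<bar> * C" for \<omega> by (simp add: mult_left_mono)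
  then show "c *\<^sub>R f \<in> cvb M"
    using cval_comp[of M f "(*\<^sub>R) c"] f by (auto simp: cvb_def scaleR_fun_def)
qed

lemma cval_indicator: "A \<in> sets M \<Longrightarrow> cval M (\<lambda>\<omega>. indicator A \<omega> :: real)"
proof -
  assume A: "A \<in> sets M"
  have "(\<lambda>\<omega>. indicator A \<omega> :: real) ` space M \<subseteq> {0, 1}" by (auto simp: indicator_def)
  then have "countable ((\<lambda>\<omega>. indicator A \<omega> :: real) ` space M)" by (meson countable_finite finite.intros finite_subset)
  moreover have "{\<omega> \<in> space M. (indicator A \<omega> :: real) = x} \<in> sets M" for x
  proof -
    have "{\<omega> \<in> space M. (indicator A \<omega> :: real) = x} =
        (if x = 1 then A else if x = 0 then space M - A else {})"
      using sets.sets_into_space[OF A] by (auto simp: indicator_def)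
    then show ?thesis using A by simp
  qed
  ultimately show ?thesis by (simp add: cval_def)
qed

lemma cvb_indicator:
  assumes f: "f \<in> cvb M" and A: "A \<in> sets M"
  shows "(\<lambda>\<omega>. indicator A \<omega> *\<^sub>R f \<omega>) \<in> cvb M"
proof -
  obtain C where C: "\<And>\<omega>. norm (f \<omega>) \<le> C" using f by (auto simp: cvb_def)
  have "norm (indicator A \<omega> *\<^sub>R f \<omega>) \<le> C" for \<omega>
    using C[of \<omega>] norm_ge_zero[of "f \<omega>"] by (auto simp: indicator_def simp del: norm_ge_zero)
  then show ?thesis
    using cval_comp2[OF cval_indicator[OF A], of f "(*\<^sub>R)"] f by (auto simp: cvb_def)
qed

lemma cvb_const: "(\<lambda>_. u) \<in> cvb M"
  using cval_const[of M u] by (auto simp: cvb_def)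

section \<open>Densities of functionals on bounded countably valued functions\<close>

context prob_space
begin

lemma AE_le_integrals:
  fixes f g :: "'a \<Rightarrow> real"
  assumes int: "integrable M f" "integrable M g"
    and le: "\<And>A. A \<in> events \<Longrightarrow> expectation (\<lambda>\<omega>. f \<omega> * indicator A \<omega>) \<le> expectation (\<lambda>\<omega>. g \<omega> * indicator A \<omega>)"
  shows "AE \<omega> in M. f \<omega> \<le> g \<omega>"
proof -
  define A where "A = {\<omega> \<in> space M. g \<omega> < f \<omega>}"
  have A: "A \<in> events" unfolding A_def using int by measurable
  define h where "h \<omega> = f \<omega> * indicator A \<omega> - g \<omega> * indicator A \<omega>" for \<omega>
  have h: "integrable M h" unfolding h_def
    by (intro Bochner_Integration.integrable_diff integrable_real_mult_indicator A int)
  have nn: "AE \<omega> in M. 0 \<le> h \<omega>" by (auto simp: h_def A_def indicator_def)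
  have "expectation h \<le> 0"
    unfolding h_def using le[OF A] integrable_real_mult_indicator[OF A] int
    by (subst Bochner_Integration.integral_diff) (auto simp: mult.commute)
  then have "expectation h = 0" using integral_nonneg_AE[OF nn] by simp
  then have "AE \<omega> in M. h \<omega> = 0" using integral_nonneg_eq_0_iff_AE[OF h nn] by simp
  then show ?thesis using AE_space by eventually_elim (auto simp: h_def A_def indicator_def split: if_splits)
qed

lemma AE_eq_integrals:
  fixes f g :: "'a \<Rightarrow> real"
  assumes int: "integrable M f" "integrable M g"
    and eq: "\<And>A. A \<in> events \<Longrightarrow> expectation (\<lambda>\<omega>. f \<omega> * indicator A \<omega>) = expectation (\<lambda>\<omega>. g \<omega> * indicator A \<omega>)"
  shows "AE \<omega> in M. f \<omega> = g \<omega>"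
  using AE_le_integrals[OF int] AE_le_integrals[OF int(2,1)] eq by (auto simp: order_eq_iff)

text \<open>Adding \<open>c * prob A\<close> makes the set function nonnegative. Domination by
  \<open>2 * c * prob A\<close> gives continuity at the empty set, hence countable additivity, and
  also absolute continuity. The constant is subtracted again from the Radon-Nikodym
  derivative.\<close>

lemma signed_density:
  fixes \<nu> :: "'a set \<Rightarrow> real"
  assumes add: "\<And>A B. A \<in> events \<Longrightarrow> B \<in> events \<Longrightarrow> A \<inter> B = {} \<Longrightarrow> \<nu> (A \<union> B) = \<nu> A + \<nu> B"
    and bd: "\<And>A. A \<in> events \<Longrightarrow> \<bar>\<nu> A\<bar> \<le> c * prob A"
  obtains \<kappa> where "integrable M \<kappa>" "\<And>A. A \<in> events \<Longrightarrow> \<nu> A = expectation (\<lambda>\<omega>. \<kappa> \<omega> * indicator A \<omega>)"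
proof -
  define \<mu> where "\<mu> A = \<nu> A + c * prob A" for A
  have \<mu>0: "0 \<le> \<mu> A" "\<mu> A \<le> 2 * c * prob A" if "A \<in> events" for A
    using bd[OF that] by (auto simp: \<mu>_def)
  define N where "N = measure_of (space M) events (\<lambda>A. ennreal (\<mu> A))"
  have pos: "positive events (\<lambda>A. ennreal (\<mu> A))"
    using \<mu>0[of "{}"] by (simp add: positive_def antisym)
  have "countably_additive events (\<lambda>A. ennreal (\<mu> A))"
  proof (rule sets.empty_continuous_imp_countably_additive[OF pos])
    show "additive events (\<lambda>A. ennreal (\<mu> A))"
      unfolding additive_def
    proof (intro ballI impI)
      fix A B assume AB: "A \<in> events" "B \<in> events" "A \<inter> B = {}"
      then have "\<mu> (A \<union> B) = \<mu> A + \<mu> B"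
        unfolding \<mu>_def using add by (simp add: finite_measure_Union algebra_simps)
      then show "ennreal (\<mu> (A \<union> B)) = ennreal (\<mu> A) + ennreal (\<mu> B)" using \<mu>0 AB by (simp add: ennreal_plus)
    qed
    fix A :: "nat \<Rightarrow> 'a set" assume A: "range A \<subseteq> events" "decseq A" "(\<Inter>i. A i) = {}"
    have "(\<lambda>i. prob (A i)) \<longlonglongrightarrow> prob (\<Inter>i. A i)" using A by (intro finite_Lim_measure_decseq) auto
    then have "(\<lambda>i. 2 * c * prob (A i)) \<longlonglongrightarrow> 2 * c * 0" using A(3) by (intro tendsto_mult tendsto_const) simp
    then have "(\<lambda>i. 2 * c * prob (A i)) \<longlonglongrightarrow> 0" by simp
    then have "(\<lambda>i. \<mu> (A i)) \<longlonglongrightarrow> 0"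
      by (rule Lim_null_comparison[rotated]) (use A(1) \<mu>0 in \<open>auto intro!: always_eventually\<close>)
    then have "(\<lambda>i. ennreal (\<mu> (A i))) \<longlonglongrightarrow> ennreal 0" by (rule tendsto_ennrealI)
    then show "(\<lambda>i. ennreal (\<mu> (A i))) \<longlonglongrightarrow> 0" by simp
  qed simp
  then have em: "emeasure N A = ennreal (\<mu> A)" if "A \<in> events" for A
    using emeasure_measure_of_sigma[OF sets.sigma_algebra_axioms pos] that by (simp add: N_def)
  have setsN: "sets N = events" by (simp add: N_def sets.space_closed sets.sigma_sets_eq)
  have "absolutely_continuous M N"
    unfolding absolutely_continuous_def
  proof
    fix A assume "A \<in> null_sets M"
    then have A: "A \<in> events" "prob A = 0" by (auto simp: null_sets_def measure_def)
    then show "A \<in> null_sets N" using \<mu>0[OF A(1)] em[OF A(1)] setsN by (auto simp: null_sets_def)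
  qed
  then obtain f where f: "f \<in> borel_measurable M" "density M f = N" using Radon_Nikodym setsN by blast
  have fi: "(\<integral>\<^sup>+\<omega>. f \<omega> * indicator A \<omega> \<partial>M) = ennreal (\<mu> A)" if "A \<in> events" for A
    using emeasure_density[OF f(1) that] em[OF that] f(2) by simp
  have "(\<integral>\<^sup>+\<omega>. f \<omega> \<partial>M) = ennreal (\<mu> (space M))"
    using fi[of "space M"] by (simp cong: nn_integral_cong)
  then have fin: "AE \<omega> in M. f \<omega> \<noteq> \<infinity>" by (intro nn_integral_PInf_AE f(1)) simp
  have intf: "integrable M (\<lambda>\<omega>. enn2real (f \<omega>))" and val: "expectation (\<lambda>\<omega>. enn2real (f \<omega>) * indicator A \<omega>) = \<mu> A"
    if "A \<in> events" for A
  proof -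
    have "(\<integral>\<^sup>+\<omega>. ennreal (enn2real (f \<omega>) * indicator B \<omega>) \<partial>M) = (\<integral>\<^sup>+\<omega>. f \<omega> * indicator B \<omega> \<partial>M)" for B
      using fin by (intro nn_integral_cong_AE) (auto simp: indicator_def less_top)
    then have *: "(\<integral>\<^sup>+\<omega>. ennreal (enn2real (f \<omega>) * indicator B \<omega>) \<partial>M) = ennreal (\<mu> B)" if "B \<in> events" for B
      using fi[OF that] by simp
    have "(\<integral>\<^sup>+\<omega>. ennreal (enn2real (f \<omega>)) \<partial>M) = ennreal (\<mu> (space M))"
      using *[of "space M"] by (simp cong: nn_integral_cong)
    then show "integrable M (\<lambda>\<omega>. enn2real (f \<omega>))" using f(1) by (intro integrableI_nonneg) auto
    show "expectation (\<lambda>\<omega>. enn2real (f \<omega>) * indicator A \<omega>) = \<mu> A"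
      using *[OF that] \<mu>0(1)[OF that] f(1) that by (subst integral_eq_nn_integral) auto
  qed
  show thesis
  proof (rule that[of "\<lambda>\<omega>. enn2real (f \<omega>) - c"])
    have i: "integrable M (\<lambda>\<omega>. enn2real (f \<omega>))" by (rule intf[of "space M"]) simp
    then show "integrable M (\<lambda>\<omega>. enn2real (f \<omega>) - c)" by simp
    fix A assume A: "A \<in> events"
    have "expectation (\<lambda>\<omega>. (enn2real (f \<omega>) - c) * indicator A \<omega>)
        = expectation (\<lambda>\<omega>. enn2real (f \<omega>) * indicator A \<omega>) - expectation (\<lambda>\<omega>. c * indicator A \<omega>)"
      unfolding left_diff_distrib
      by (intro Bochner_Integration.integral_diff integrable_real_mult_indicator[OF A] i) simp
    also have "\<dots> = \<nu> A" using val[OF A] A by (simp add: \<mu>_def)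
    finally show "\<nu> A = expectation (\<lambda>\<omega>. (enn2real (f \<omega>) - c) * indicator A \<omega>)" by simp
  qed
qed

lemma cvb_integrable: "f \<in> cvb M \<Longrightarrow> integrable M (\<lambda>\<omega>. norm (f \<omega>))"
proof -
  assume "f \<in> cvb M"
  then obtain C where "cval M f" "\<And>\<omega>. norm (f \<omega>) \<le> C" by (auto simp: cvb_def)
  then show ?thesis by (intro integrable_const_bound[of _ C] cval_measurable) auto
qed

lemma sublinear_cvb: "sublinear_on (cvb M) (\<lambda>f. expectation (\<lambda>\<omega>. norm (f \<omega>)))"
  unfolding sublinear_on_def
proof (intro conjI ballI allI impI)
  fix f g :: "'a \<Rightarrow> 'b" assume fg: "f \<in> cvb M" "g \<in> cvb M"
  have "expectation (\<lambda>\<omega>. norm ((f + g) \<omega>)) \<le> expectation (\<lambda>\<omega>. norm (f \<omega>) + norm (g \<omega>))"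
    using cvb_integrable[OF fg(1)] cvb_integrable[OF fg(2)] cvb_integrable[OF subspace_add[OF subspace_cvb fg]]
    by (intro integral_mono) (auto intro: norm_triangle_ineq)
  also have "\<dots> = expectation (\<lambda>\<omega>. norm (f \<omega>)) + expectation (\<lambda>\<omega>. norm (g \<omega>))"
    by (rule Bochner_Integration.integral_add[OF cvb_integrable[OF fg(1)] cvb_integrable[OF fg(2)]])
  finally show "expectation (\<lambda>\<omega>. norm ((f + g) \<omega>)) \<le> expectation (\<lambda>\<omega>. norm (f \<omega>)) + expectation (\<lambda>\<omega>. norm (g \<omega>))" .
qed simp

text \<open>
  Functionals on the simple part of \<open>L\<^sup>1(X)\<close> have a density with values in the dual of a
  separable subspace. No lifting is needed: the Radon-Nikodym derivatives of countably many
  scalar measures suffice.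
\<close>

lemma functional_density:
  fixes L :: "('a \<Rightarrow> 'x::real_normed_vector) \<Rightarrow> real"
  assumes L: "linear L" "\<And>f. f \<in> cvb M \<Longrightarrow> L f \<le> expectation (\<lambda>\<omega>. norm (f \<omega>))"
    and D: "D = qspan A" "A \<noteq> {}" "countable D"
  obtains \<kappa> where "\<And>u. u \<in> D \<Longrightarrow> \<kappa> u \<in> borel_measurable M"
    "AE \<omega> in M. \<exists>l. linear l \<and> (\<forall>x. l x \<le> norm x) \<and> (\<forall>u\<in>D. l u = \<kappa> u \<omega>)"
    "\<And>f. f \<in> cvb M \<Longrightarrow> (\<And>\<omega>. \<omega> \<in> space M \<Longrightarrow> f \<omega> \<in> D) \<Longrightarrow> L f = expectation (\<lambda>\<omega>. \<kappa> (f \<omega>) \<omega>)"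
proof -
  have Labs: "\<bar>L f\<bar> \<le> expectation (\<lambda>\<omega>. norm (f \<omega>))" if "f \<in> cvb M" for f
    using L(2)[OF that] L(2)[of "- f"] subspace_neg[OF subspace_cvb that] linear_neg[OF L(1), of f]
    by (simp add: abs_le_iff)
  define u1 where "u1 u B = (\<lambda>\<omega>. indicator B \<omega> *\<^sub>R u)" for u :: 'x and B :: "'a set"
  have u1: "u1 u B \<in> cvb M" if "B \<in> events" for u B
    unfolding u1_def using cvb_indicator[OF cvb_const that] .
  have dens: "\<exists>\<kappa>. integrable M \<kappa> \<and> (\<forall>B\<in>events. L (u1 u B) = expectation (\<lambda>\<omega>. \<kappa> \<omega> * indicator B \<omega>))" for u
  proof (rule signed_density[of "\<lambda>B. L (u1 u B)" "norm u"])
    fix B C assume BC: "B \<in> events" "C \<in> events" "B \<inter> C = {}"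
    then have "u1 u (B \<union> C) = u1 u B + u1 u C"
      by (auto simp: u1_def fun_eq_iff indicator_def)
    then show "L (u1 u (B \<union> C)) = L (u1 u B) + L (u1 u C)" by (simp add: linear_add[OF L(1)])
  next
    fix B assume B: "B \<in> events"
    have "expectation (\<lambda>\<omega>. norm (u1 u B \<omega>)) = expectation (\<lambda>\<omega>. norm u * indicator B \<omega>)"
      by (intro Bochner_Integration.integral_cong) (auto simp: u1_def indicator_def)
    then show "\<bar>L (u1 u B)\<bar> \<le> norm u * prob B" using Labs[OF u1[OF B], of u] B by simp
  qed blast
  have "\<forall>u. \<exists>\<kappa>. integrable M \<kappa> \<and> (\<forall>B\<in>events. L (u1 u B) = expectation (\<lambda>\<omega>. \<kappa> \<omega> * indicator B \<omega>))"
    using dens by blast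
  from choice[OF this] obtain \<kappa> where \<kappa>: "\<And>u. integrable M (\<kappa> u)"
    "\<And>u B. B \<in> events \<Longrightarrow> L (u1 u B) = expectation (\<lambda>\<omega>. \<kappa> u \<omega> * indicator B \<omega>)" by blast
  have \<kappa>i: "integrable M (\<lambda>\<omega>. \<kappa> u \<omega> * indicator B \<omega>)" if "B \<in> events" for u B
    by (rule integrable_real_mult_indicator[OF that \<kappa>(1)])
  have add: "AE \<omega> in M. \<kappa> (u + v) \<omega> = \<kappa> u \<omega> + \<kappa> v \<omega>" for u v
  proof (rule AE_eq_integrals)
    fix B assume B: "B \<in> events"
    have "u1 (u + v) B = u1 u B + u1 v B" by (auto simp: u1_def fun_eq_iff scaleR_add_right)
    then have "L (u1 (u + v) B) = L (u1 u B) + L (u1 v B)" by (simp add: linear_add[OF L(1)])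
    then show "expectation (\<lambda>\<omega>. \<kappa> (u + v) \<omega> * indicator B \<omega>) = expectation (\<lambda>\<omega>. (\<kappa> u \<omega> + \<kappa> v \<omega>) * indicator B \<omega>)"
      using \<kappa>(2)[OF B] \<kappa>i[OF B] by (simp add: distrib_right)
  qed (use \<kappa>(1) in auto)
  have scale: "AE \<omega> in M. \<kappa> (c *\<^sub>R u) \<omega> = c * \<kappa> u \<omega>" for c u
  proof (rule AE_eq_integrals)
    fix B assume B: "B \<in> events"
    have "u1 (c *\<^sub>R u) B = c *\<^sub>R u1 u B" by (auto simp: u1_def fun_eq_iff)
    then have "L (u1 (c *\<^sub>R u) B) = c * L (u1 u B)" by (simp add: linear_cmul[OF L(1)])
    then show "expectation (\<lambda>\<omega>. \<kappa> (c *\<^sub>R u) \<omega> * indicator B \<omega>) = expectation (\<lambda>\<omega>. (c * \<kappa> u \<omega>) * indicator B \<omega>)"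
      using \<kappa>(2)[OF B] by (simp add: mult.assoc)
  qed (use \<kappa>(1) in auto)
  have le: "AE \<omega> in M. \<kappa> u \<omega> \<le> norm u" for u
  proof (rule AE_le_integrals)
    fix B assume B: "B \<in> events"
    have "expectation (\<lambda>\<omega>. \<kappa> u \<omega> * indicator B \<omega>) \<le> expectation (\<lambda>\<omega>. norm (u1 u B \<omega>))"
      using L(2)[OF u1[OF B], of u] \<kappa>(2)[OF B] by simp
    also have "\<dots> = expectation (\<lambda>\<omega>. norm u * indicator B \<omega>)"
      by (intro Bochner_Integration.integral_cong) (auto simp: u1_def indicator_def)
    finally show "expectation (\<lambda>\<omega>. \<kappa> u \<omega> * indicator B \<omega>) \<le> expectation (\<lambda>\<omega>. norm u * indicator B \<omega>)" .
  qed (use \<kappa>(1) in auto)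
  \<comment> \<open>Linearity over the rationals and the norm bound involve only countably many
    relations on \<open>D\<close>, so one null set serves; \<open>qspan_extension\<close> then
    supplies a functional at each remaining point.\<close>
  have "AE \<omega> in M. \<forall>u\<in>D. \<forall>v\<in>D. \<kappa> (u + v) \<omega> = \<kappa> u \<omega> + \<kappa> v \<omega>"
    by (intro AE_ball_countable' D(3) add)
  moreover have "AE \<omega> in M. \<forall>u\<in>D. \<forall>r::rat. \<kappa> (of_rat r *\<^sub>R u) \<omega> = of_rat r * \<kappa> u \<omega>"
    using AE_ball_countable'[OF scale, of "UNIV :: rat set"]
    by (intro AE_ball_countable'[OF _ D(3)]) (simp add: AE_all_countable scale)
  moreover have "AE \<omega> in M. \<forall>u\<in>D. \<kappa> u \<omega> \<le> norm u" by (intro AE_ball_countable' D(3) le)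
  ultimately have ext: "AE \<omega> in M. \<exists>l. linear l \<and> (\<forall>x. l x \<le> norm x) \<and> (\<forall>u\<in>D. l u = \<kappa> u \<omega>)"
  proof eventually_elim
    case (elim \<omega>)
    show ?case
      by (rule qspan_extension[OF D(1,2), of "\<lambda>u. \<kappa> u \<omega>"]) (use elim in blast)+
  qed
  have rep: "L f = expectation (\<lambda>\<omega>. \<kappa> (f \<omega>) \<omega>)"
    if f: "f \<in> cvb M" and fD: "\<And>\<omega>. \<omega> \<in> space M \<Longrightarrow> f \<omega> \<in> D" for f
  proof -
    obtain C where C: "cval M f" "\<And>\<omega>. norm (f \<omega>) \<le> C" using f by (auto simp: cvb_def)
    have C0: "0 \<le> C" using C(2) norm_ge_zero order_trans by blast
    have m: "(\<lambda>\<omega>. \<kappa> (f \<omega>) \<omega>) \<in> borel_measurable M"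
      by (rule cval_compose_measurable[OF C(1), of \<kappa>]) (use \<kappa>(1) in blast)
    have bd: "AE \<omega> in M. \<bar>\<kappa> (f \<omega>) \<omega>\<bar> \<le> C"
      using ext AE_space
    proof eventually_elim
      case (elim \<omega>)
      then obtain l where l: "linear l" "\<And>x. l x \<le> norm x" "\<And>u. u \<in> D \<Longrightarrow> l u = \<kappa> u \<omega>" by blast
      then show ?case
        using l(2)[of "f \<omega>"] l(2)[of "- f \<omega>"] linear_neg[OF l(1), of "f \<omega>"] l(3)[OF fD[OF elim(2)]] C(2)[of \<omega>]
        by (simp add: abs_le_iff)
    qed
    have i: "integrable M (\<lambda>\<omega>. \<kappa> (f \<omega>) \<omega>)"
      by (rule integrable_const_bound[of _ C]) (use bd m in auto)
    define e where "e = from_nat_into (f ` space M)"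
    have e: "range e = f ` space M" unfolding e_def
      using C(1) not_empty by (intro range_from_nat_into) (auto simp: cval_def)
    define B where "B m = {\<omega> \<in> space M. f \<omega> \<in> e ` {..<m}}" for m
    have B: "B m \<in> events" for m unfolding B_def by (rule cval_sets[OF C(1)])
    have fin: "L (\<lambda>\<omega>. indicator (B m) \<omega> *\<^sub>R f \<omega>) = expectation (\<lambda>\<omega>. \<kappa> (f \<omega>) \<omega> * indicator (B m) \<omega>)" for m
    proof (induction m)
      case 0
      have "(\<lambda>\<omega>. indicator (B 0) \<omega> *\<^sub>R f \<omega>) = 0" by (auto simp: B_def fun_eq_iff)
      then show ?case by (simp add: linear_0[OF L(1)] B_def)
    next
      case (Suc m)
      \<comment> \<open>The enumeration \<open>e\<close> may repeat values; the subtraction of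
        \<open>B m\<close> prevents counting a fibre twice.\<close>
      define E where "E = {\<omega> \<in> space M. f \<omega> = e m} - B m"
      have E: "E \<in> events" unfolding E_def using cval_sets[OF C(1), of "\<lambda>x. x = e m"] B by auto
      have ind: "indicator (B (Suc m)) \<omega> = indicator (B m) \<omega> + (indicator E \<omega> :: real)" for \<omega>
        by (auto simp: B_def E_def indicator_def lessThan_Suc)
      have "(\<lambda>\<omega>. indicator (B (Suc m)) \<omega> *\<^sub>R f \<omega>) = (\<lambda>\<omega>. indicator (B m) \<omega> *\<^sub>R f \<omega>) + u1 (e m) E"
        by (auto simp: fun_eq_iff u1_def E_def indicator_def B_def lessThan_Suc)
      then have "L (\<lambda>\<omega>. indicator (B (Suc m)) \<omega> *\<^sub>R f \<omega>) =
          expectation (\<lambda>\<omega>. \<kappa> (f \<omega>) \<omega> * indicator (B m) \<omega>) + expectation (\<lambda>\<omega>. \<kappa> (e m) \<omega> * indicator E \<omega>)"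
        using Suc \<kappa>(2)[OF E] by (simp add: linear_add[OF L(1)])
      also have "expectation (\<lambda>\<omega>. \<kappa> (e m) \<omega> * indicator E \<omega>) = expectation (\<lambda>\<omega>. \<kappa> (f \<omega>) \<omega> * indicator E \<omega>)"
        by (intro Bochner_Integration.integral_cong) (auto simp: E_def indicator_def)
      finally show ?case
        using integrable_real_mult_indicator[OF B[of m] i] integrable_real_mult_indicator[OF E i]
        by (simp add: ind distrib_left)
    qed
    have cmpl: "space M - B m \<in> events" for m using B by auto
    \<comment> \<open>Both \<open>L\<close> and the integral change by at most
      \<open>C * prob (space M - B m)\<close> when \<open>f\<close> is restricted to
      \<open>B m\<close>, where they agree.\<close>
    have "\<bar>L f - expectation (\<lambda>\<omega>. \<kappa> (f \<omega>) \<omega>)\<bar> \<le> 2 * C * prob (space M - B m)" for m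
    proof -
      let ?g = "\<lambda>\<omega>. indicator (B m) \<omega> *\<^sub>R f \<omega>"
      have ci: "integrable M (\<lambda>\<omega>. C * indicator (space M - B m) \<omega>)"
        by (intro integrable_mult_right integrable_real_indicator cmpl) (simp add: less_top[symmetric])
      have g: "f - ?g \<in> cvb M" by (rule subspace_diff[OF subspace_cvb f cvb_indicator[OF f B]])
      have "\<bar>L f - L ?g\<bar> \<le> expectation (\<lambda>\<omega>. norm ((f - ?g) \<omega>))"
        using Labs[OF g] by (simp add: linear_diff[OF L(1)])
      also have "\<dots> \<le> expectation (\<lambda>\<omega>. C * indicator (space M - B m) \<omega>)"
      proof (rule integral_mono[OF cvb_integrable[OF g] ci])
        show "norm ((f - ?g) \<omega>) \<le> C * indicator (space M - B m) \<omega>" if "\<omega> \<in> space M" for \<omega>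
          using that C(2)[of \<omega>] by (simp add: indicator_def)
      qed
      finally have 1: "\<bar>L f - L ?g\<bar> \<le> C * prob (space M - B m)" using cmpl by simp
      have "\<bar>expectation (\<lambda>\<omega>. \<kappa> (f \<omega>) \<omega>) - expectation (\<lambda>\<omega>. \<kappa> (f \<omega>) \<omega> * indicator (B m) \<omega>)\<bar> =
          \<bar>expectation (\<lambda>\<omega>. \<kappa> (f \<omega>) \<omega> - \<kappa> (f \<omega>) \<omega> * indicator (B m) \<omega>)\<bar>"
        using i integrable_real_mult_indicator[OF B[of m] i] by simp
      also have "\<dots> \<le> expectation (\<lambda>\<omega>. \<bar>\<kappa> (f \<omega>) \<omega> - \<kappa> (f \<omega>) \<omega> * indicator (B m) \<omega>\<bar>)"
        by (rule integral_abs_bound)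
      also have "\<dots> \<le> expectation (\<lambda>\<omega>. C * indicator (space M - B m) \<omega>)"
      proof (rule integral_mono_AE)
        show "AE \<omega> in M. \<bar>\<kappa> (f \<omega>) \<omega> - \<kappa> (f \<omega>) \<omega> * indicator (B m) \<omega>\<bar> \<le> C * indicator (space M - B m) \<omega>"
          using bd AE_space by eventually_elim (auto simp: indicator_def)
      qed (use i ci integrable_real_mult_indicator[OF B[of m] i] in auto)
      finally have 2: "\<bar>expectation (\<lambda>\<omega>. \<kappa> (f \<omega>) \<omega>) - L ?g\<bar> \<le> C * prob (space M - B m)"
        unfolding fin using cmpl by simp
      from 1 2 show ?thesis by linarith
    qed
    moreover have "(\<lambda>m. 2 * C * prob (space M - B m)) \<longlonglongrightarrow> 2 * C * 0"
    proof (intro tendsto_mult tendsto_const)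
      have "(\<lambda>m. prob (space M - B m)) \<longlonglongrightarrow> prob (\<Inter>m. space M - B m)"
        using B by (intro finite_Lim_measure_decseq) (auto simp: decseq_def B_def)
      moreover have "(\<Inter>m. space M - B m) = {}"
      proof -
        have "\<exists>m. \<omega> \<in> B m" if "\<omega> \<in> space M" for \<omega>
        proof -
          have "f \<omega> \<in> range e" using e that by auto
          then obtain k where "f \<omega> = e k" by auto
          then show ?thesis using that by (intro exI[of _ "Suc k"]) (auto simp: B_def)
        qed
        then show ?thesis by auto
      qed
      ultimately show "(\<lambda>m. prob (space M - B m)) \<longlonglongrightarrow> 0" by (simp only: measure_empty)
    qed
    ultimately have "\<bar>L f - expectation (\<lambda>\<omega>. \<kappa> (f \<omega>) \<omega>)\<bar> \<le> 2 * C * 0"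
      by (intro LIMSEQ_le_const) auto
    then show ?thesis by simp
  qed
  show thesis by (rule that[OF _ ext rep]) (use \<kappa>(1) in auto)
qed

end

lemma norming_functionals:
  obtains \<xi> :: "'x::real_normed_vector \<Rightarrow> 'x \<Rightarrow> 'x \<Rightarrow> real" where
    "\<And>u v. linear (\<xi> u v)" "\<And>u v y. \<xi> u v y \<le> norm y" "\<And>u v. \<xi> u v (u - v) = norm (u - v)"
proof -
  have "\<forall>z. \<exists>l::'x \<Rightarrow> real. linear l \<and> (\<forall>y. l y \<le> norm y) \<and> l z = norm z"
  proof
    fix z :: 'x
    show "\<exists>l::'x \<Rightarrow> real. linear l \<and> (\<forall>y. l y \<le> norm y) \<and> l z = norm z"
    proof (rule type_rep.norming_functional[of z])
      fix L :: "'x \<Rightarrow> real" assume "linear L" "\<And>y. y \<in> UNIV \<Longrightarrow> L y \<le> norm y" "L z = norm z"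
      then show ?thesis by blast
    qed simp
  qed
  from choice[OF this] obtain l :: "'x \<Rightarrow> 'x \<Rightarrow> real"
    where l: "\<And>z. linear (l z)" "\<And>z y. l z y \<le> norm y" "\<And>z. l z z = norm z" by blast
  show thesis by (rule that[of "\<lambda>u v. l (u - v)"]) (use l in auto)
qed

lemma blk_tendsto:
  fixes x :: "nat \<Rightarrow> 'v::real_normed_vector"
  assumes yx: "blk y x" and x: "x \<longlonglongrightarrow> l"
  shows "y \<longlonglongrightarrow> l"
proof (rule tendstoI)
  fix e :: real assume "0 < e"
  then obtain N where N: "\<And>n. N \<le> n \<Longrightarrow> dist (x n) l < e" using x by (auto simp: lim_sequentially)
  then have "midhull (x ` {N..}) \<subseteq> ball l e"
    by (intro midhull_subset_convex convex_ball) (auto simp: dist_commute)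
  moreover obtain n0 where "\<And>n. n0 \<le> n \<Longrightarrow> y n \<in> midhull (x ` {N..})" using yx by (auto simp: blk_def)
  ultimately have "\<forall>n\<ge>n0. y n \<in> ball l e" by blast
  then show "\<forall>\<^sub>F n in sequentially. dist (y n) l < e"
    unfolding eventually_sequentially by (auto simp: dist_commute)
qed

lemma midhull_linear:
  assumes L: "linear L" and x: "x \<in> midhull A"
  shows "L x \<in> midhull (L ` A)"
  using x
proof induction
  case (mid x y)
  then show ?case using midhull.mid[OF mid.IH] by (simp add: linear_cmul[OF L] linear_add[OF L])
qed (auto intro: midhull.base)

lemma blk_linear:
  assumes L: "linear L" and yx: "blk y x"
  shows "blk (\<lambda>n. L (y n)) (\<lambda>n. L (x n))"
  unfolding blk_def
proof
  fix N
  obtain n0 where "\<And>n. n0 \<le> n \<Longrightarrow> y n \<in> midhull (x ` {N..})" using yx by (auto simp: blk_def)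
  then have "L (y n) \<in> midhull ((\<lambda>n. L (x n)) ` {N..})" if "n0 \<le> n" for n
    using midhull_linear[OF L, of "y n" "x ` {N..}"] that by (simp add: image_image)
  then show "\<exists>n0. \<forall>n\<ge>n0. L (y n) \<in> midhull ((\<lambda>n. L (x n)) ` {N..})" by blast
qed

lemma midhull_cvb_unit:
  assumes f: "\<And>n. cval M (f n)" "\<And>n \<omega>. norm (f n \<omega>) \<le> 1"
    and g: "g \<in> midhull (range f)"
  shows "cval M g \<and> (\<forall>\<omega>. norm (g \<omega>) \<le> 1)"
proof
  show "cval M g" by (rule cval_midhull[OF g]) (use f(1) in auto)
  show "\<forall>\<omega>. norm (g \<omega>) \<le> 1"
  proof
    fix \<omega>
    have "midhull ((\<lambda>h. h \<omega>) ` range f) \<subseteq> cball 0 1"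
      by (intro midhull_subset_convex convex_cball) (use f(2) in auto)
    then show "norm (g \<omega>) \<le> 1" using midhull_image_apply[OF g, of \<omega>] by auto
  qed
qed

section \<open>From pointwise weak convergence to norm convergence\<close>

context prob_space
begin

text \<open>Each \<open>\<xi> k\<close> is handled by \<open>convex_selection\<close>. The summand
  \<open>1\<close> makes the function nonnegative on vectors of norm at most \<open>1\<close>, and
  being affine it satisfies the midpoint condition. Blocks inherit convergence, so countably many
  functionals can be treated together.\<close>

lemma blocks_functionals_converge:
  fixes f :: "nat \<Rightarrow> 'a \<Rightarrow> 'x::real_normed_vector" and \<xi> :: "nat \<Rightarrow> 'x \<Rightarrow> real"
  assumes f: "\<And>n. cval M (f n)" "\<And>n \<omega>. norm (f n \<omega>) \<le> 1"
    and \<xi>: "\<And>k. linear (\<xi> k)" "\<And>k x. \<xi> k x \<le> norm x"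
  obtains g where "blk g f" "\<And>k. AE \<omega> in M. convergent (\<lambda>n. \<xi> k (g n \<omega>))"
proof -
  define P where "P k g \<longleftrightarrow> (AE \<omega> in M. convergent (\<lambda>n. \<xi> k (g n \<omega>)))" for k and g :: "nat \<Rightarrow> 'a \<Rightarrow> 'x"
  have \<xi>abs: "\<bar>\<xi> k z\<bar> \<le> norm z" for k z
    using \<xi>(2)[of k z] \<xi>(2)[of k "- z"] linear_neg[OF \<xi>(1), of k z] by (simp add: abs_le_iff)
  obtain g where "blk g f" "\<And>k::nat. P k g"
  proof (rule blk_simultaneous[of f P])
    fix k g assume gf: "blk g f"
    obtain r where r: "strict_mono r" "\<And>n. g (r n) \<in> midhull (f ` {n..})" by (rule blk_normalize[OF gf]) blast
    define H where "H n = midhull ((\<lambda>i. g (r i)) ` {n..})" for n :: nat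
    define Q where "Q h \<omega> = \<xi> k (h \<omega>) + 1" for h :: "'a \<Rightarrow> 'x" and \<omega>
    have H0: "h \<in> H 0 \<Longrightarrow> cval M h \<and> (\<forall>\<omega>. norm (h \<omega>) \<le> 1)" for h
    proof -
      assume h: "h \<in> H 0"
      have "(\<lambda>i. g (r i)) ` {0..} \<subseteq> midhull (range f)"
        using r(2) midhull_mono[of "f ` {n..}" "range f" for n] by blast
      from midhull_trans[OF this] have "h \<in> midhull (range f)" using h by (auto simp: H_def)
      then show ?thesis by (rule midhull_cvb_unit[OF f])
    qed
    have Q: "0 \<le> Q h \<omega>" "Q h \<omega> \<le> 2" if "h \<in> H 0" for h \<omega>
      using \<xi>abs[of k "h \<omega>"] H0[OF that] unfolding Q_def by (smt (verit))+
    have Qi: "integrable M (Q h)" if "h \<in> H 0" for h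
    proof (rule integrable_const_bound[of _ 2])
      show "Q h \<in> borel_measurable M" unfolding Q_def using cval_measurable[of M h "\<xi> k"] H0[OF that] by simp
    qed (use Q[OF that] in auto)
    have Qe: "expectation (Q h) \<le> 2" if "h \<in> H 0" for h
      using Qi[OF that] Q[OF that] by (intro integral_le_const) auto
    have Qc: "AE \<omega> in M. Q ((1/2) *\<^sub>R (x + y)) \<omega> \<le> (Q x \<omega> + Q y \<omega>) / 2" for x y
      by (simp add: Q_def linear_cmul[OF \<xi>(1)] linear_add[OF \<xi>(1)] field_simps)
    have Ha: "H n \<subseteq> H m" if "m \<le> n" for m n
      unfolding H_def by (rule midhull_tail_mono[OF that])
    have He: "H n \<noteq> {}" for n unfolding H_def using midhull.base[of "g (r n)" "(\<lambda>i. g (r i)) ` {n..}"] by auto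
    have Hm: "(1/2) *\<^sub>R (x + y) \<in> H n" if "x \<in> H n" "y \<in> H n" for n x y
      using midhull.mid[of x "(\<lambda>i. g (r i)) ` {n..}" y] that by (simp add: H_def)
    have "\<exists>h. (\<forall>n. h n \<in> H n) \<and> (AE \<omega> in M. convergent (\<lambda>n. Q (h n) \<omega>))"
    proof (rule convex_selection[of H Q 2, OF Ha He Hm Qi Q(1) Qe Qc])
      fix h assume "\<And>n. h n \<in> H n" "AE \<omega> in M. convergent (\<lambda>n. Q (h n) \<omega>)"
      then show ?thesis by (intro exI[of _ h] conjI allI)
    qed
    then obtain h where h: "\<And>n. h n \<in> H n" "AE \<omega> in M. convergent (\<lambda>n. Q (h n) \<omega>)" by blast
    have "blk h (\<lambda>i. g (r i))" by (rule blkI) (use h(1) in \<open>simp add: H_def\<close>)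
    then have "blk h g" using blk_subseq[OF r(1)] by (rule blk_trans)
    moreover have "P k h"
      unfolding P_def using h(2)
    proof eventually_elim
      case (elim \<omega>)
      then obtain c where "(\<lambda>n. Q (h n) \<omega>) \<longlonglongrightarrow> c" by (auto simp: convergent_def)
      from tendsto_diff[OF this tendsto_const[of 1]] show ?case by (auto simp: convergent_def Q_def)
    qed
    ultimately show "\<exists>h. blk h g \<and> P k h" by blast
  next
    fix k g h assume g: "P k g" and hg: "blk h g"
    show "P k h"
      using g unfolding P_def
    proof eventually_elim
      case (elim \<omega>)
      then obtain c where "(\<lambda>n. \<xi> k (g n \<omega>)) \<longlonglongrightarrow> c" by (auto simp: convergent_def)
      from blk_tendsto[OF blk_linear[OF \<xi>(1) blk_apply[OF hg]] this] show ?case by (auto simp: convergent_def)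
    qed
  qed blast
  then show thesis using that unfolding P_def by blast
qed

text \<open>The limit \<open>\<gamma>\<close> is given only pointwise. Measurable information about
  it comes from the scalar limits \<open>m u v\<close>, which equal
  \<open>\<xi> u v (\<gamma> \<omega>)\<close>: a point \<open>u\<close> of \<open>D\<close> is
  within \<open>\<epsilon>\<close> of \<open>\<gamma> \<omega>\<close> if
  \<open>\<xi> u v (u - \<gamma> \<omega>) \<le> \<epsilon>\<close> for all \<open>v\<close> in
  \<open>D\<close>, as one sees by letting \<open>v\<close> approach
  \<open>\<gamma> \<omega>\<close>. The first such point in an enumeration is a measurable
  choice.\<close>

lemma weak_limit_cval:
  fixes g :: "nat \<Rightarrow> 'a \<Rightarrow> 'x::real_normed_vector"
  assumes g: "\<And>n. cval M (g n)" and D: "countable D" "D \<noteq> {}"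
    and w: "AE \<omega> in M. \<gamma> \<omega> \<in> closure D \<and> (\<forall>\<phi>::'x \<Rightarrow> real. bounded_linear \<phi> \<longrightarrow> (\<lambda>n. \<phi> (g n \<omega>)) \<longlonglongrightarrow> \<phi> (\<gamma> \<omega>))"
    and \<epsilon>: "0 < \<epsilon>"
  obtains \<gamma>' where "cval M \<gamma>'" "\<And>\<omega>. \<gamma>' \<omega> \<in> D" "AE \<omega> in M. norm (\<gamma>' \<omega> - \<gamma> \<omega>) \<le> \<epsilon>"
proof -
  obtain \<xi> :: "'x \<Rightarrow> 'x \<Rightarrow> 'x \<Rightarrow> real" where
    \<xi>: "\<And>u v. linear (\<xi> u v)" "\<And>u v y. \<xi> u v y \<le> norm y" "\<And>u v. \<xi> u v (u - v) = norm (u - v)"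
    using norming_functionals by metis
  have \<xi>abs: "\<bar>\<xi> u v z\<bar> \<le> norm z" for u v z
    using \<xi>(2)[of u v z] \<xi>(2)[of u v "- z"] linear_neg[OF \<xi>(1), of u v z] by (simp add: abs_le_iff)
  have bl: "bounded_linear (\<xi> u v)" for u v
    using \<xi>(1)[of u v] \<xi>abs[of u v] by (auto simp: bounded_linear_def bounded_linear_axioms_def intro: exI[of _ 1])
  define m where "m u v \<omega> = lim (\<lambda>n. \<xi> u v (g n \<omega>))" for u v \<omega>
  have [measurable]: "m u v \<in> borel_measurable M" for u v
    unfolding m_def by (rule borel_measurable_lim_metric) (rule cval_measurable[OF g])
  define N where "N u = {\<omega> \<in> space M. \<forall>v\<in>D. \<xi> u v u - m u v \<omega> \<le> \<epsilon>}" for u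
  have N: "N u \<in> events" for u
  proof -
    have "N u = (\<Inter>v\<in>D. {\<omega> \<in> space M. \<xi> u v u - m u v \<omega> \<le> \<epsilon>})" using D(2) by (auto simp: N_def)
    also have "\<dots> \<in> events" using D
      by (intro sets.countable_INT') auto
    finally show ?thesis .
  qed
  define e where "e = from_nat_into D"
  have e: "range e = D" unfolding e_def by (rule range_from_nat_into[OF D(2,1)])
  define \<tau> where "\<tau> \<omega> = (LEAST k. \<omega> \<in> N (e k))" for \<omega>
  have "\<tau> \<in> measurable M (count_space UNIV)"
    unfolding \<tau>_def by (rule measurable_Least) (use N in \<open>simp add: pred_def\<close>)
  then have "{\<omega> \<in> space M. \<tau> \<omega> = k} \<in> events" for k by measurable
  then have "cval M \<tau>" by (simp add: cval_def)
  then have c: "cval M (\<lambda>\<omega>. e (\<tau> \<omega>))" by (rule cval_comp)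
  have "AE \<omega> in M. norm (e (\<tau> \<omega>) - \<gamma> \<omega>) \<le> \<epsilon>"
    using w AE_space
  proof eventually_elim
    case (elim \<omega>)
    then have cl: "\<gamma> \<omega> \<in> closure D" by simp
    have m: "m u v \<omega> = \<xi> u v (\<gamma> \<omega>)" for u v unfolding m_def using elim(1) bl by (intro limI) blast
    obtain d where "d \<in> D" "dist d (\<gamma> \<omega>) < \<epsilon>" using cl \<epsilon> unfolding closure_approachable by blast
    moreover obtain k where "d = e k" using calculation e by blast
    ultimately have "\<xi> (e k) v (e k) - m (e k) v \<omega> \<le> \<epsilon>" for v
      using \<xi>(2)[of "e k" v "e k - \<gamma> \<omega>"] unfolding m by (simp add: linear_diff[OF \<xi>(1)] dist_norm)
    then have "\<omega> \<in> N (e k)" using elim(2) by (simp add: N_def)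
    then have "\<omega> \<in> N (e (\<tau> \<omega>))" unfolding \<tau>_def by (rule LeastI)
    then have le: "\<xi> u v u - \<xi> u v (\<gamma> \<omega>) \<le> \<epsilon>" if "v \<in> D" "u = e (\<tau> \<omega>)" for u v
      using that m by (auto simp: N_def)
    show ?case
    proof (rule field_le_epsilon)
      fix \<eta> :: real assume "0 < \<eta>"
      then obtain v where v: "v \<in> D" "dist v (\<gamma> \<omega>) < \<eta>/2" using cl unfolding closure_approachable by (meson half_gt_zero)
      let ?u = "e (\<tau> \<omega>)"
      have "norm (?u - \<gamma> \<omega>) \<le> norm (?u - v) + norm (v - \<gamma> \<omega>)" using norm_triangle_ineq[of "?u - v" "v - \<gamma> \<omega>"] by simp
      also have "norm (?u - v) = (\<xi> ?u v ?u - \<xi> ?u v (\<gamma> \<omega>)) + \<xi> ?u v (\<gamma> \<omega> - v)"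
        unfolding \<xi>(3)[symmetric] by (simp add: linear_diff[OF \<xi>(1)])
      also have "\<dots> \<le> \<epsilon> + norm (v - \<gamma> \<omega>)"
        using le[OF v(1) refl] \<xi>(2)[of ?u v "\<gamma> \<omega> - v"] by (simp add: norm_minus_commute)
      finally show "norm (?u - \<gamma> \<omega>) \<le> \<epsilon> + \<eta>" using v(2) by (simp add: dist_norm)
    qed
  qed
  then show thesis using that[OF c] e by blast
qed

text \<open>Otherwise a functional \<open>L\<close> below the mean norm is at least
  \<open>\<epsilon>\<close> on all \<open>g n - \<gamma>'\<close> in the tail. Its density
  \<open>\<kappa>\<close> acts at almost every \<open>\<omega>\<close> as a functional of norm at
  most \<open>1\<close>, so weak convergence and the distance \<open>\<epsilon>/2\<close> between
  \<open>\<gamma>\<close> and \<open>\<gamma>'\<close> bound the pointwise limit by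
  \<open>\<epsilon>/2\<close>. Dominated convergence gives the contradiction.\<close>

lemma mean_norm_blocks:
  fixes g :: "nat \<Rightarrow> 'a \<Rightarrow> 'x::real_normed_vector"
  assumes g: "\<And>n. cval M (g n)" "\<And>n \<omega>. norm (g n \<omega>) \<le> 1" "\<And>n \<omega>. \<omega> \<in> space M \<Longrightarrow> g n \<omega> \<in> D"
    and D: "D = qspan A" "A \<noteq> {}" "countable D"
    and w: "AE \<omega> in M. \<forall>\<phi>::'x \<Rightarrow> real. bounded_linear \<phi> \<longrightarrow> (\<lambda>n. \<phi> (g n \<omega>)) \<longlonglongrightarrow> \<phi> (\<gamma> \<omega>)"
    and \<epsilon>: "0 < \<epsilon>" and \<gamma>': "\<gamma>' \<in> cvb M" "\<And>\<omega>. \<gamma>' \<omega> \<in> D" "AE \<omega> in M. norm (\<gamma>' \<omega> - \<gamma> \<omega>) \<le> \<epsilon> / 2"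
  obtains h where "h \<in> convex hull (g ` {N..})" "expectation (\<lambda>\<omega>. norm (h \<omega> - \<gamma>' \<omega>)) < \<epsilon>"
proof (rule ccontr)
  assume neg: "\<not> thesis"
  have far: "\<epsilon> \<le> expectation (\<lambda>\<omega>. norm (h \<omega> - \<gamma>' \<omega>))" if "h \<in> convex hull (g ` {N..})" for h
    using neg that \<open>\<And>h. h \<in> convex hull (g ` {N..}) \<Longrightarrow> expectation (\<lambda>\<omega>. norm (h \<omega> - \<gamma>' \<omega>)) < \<epsilon> \<Longrightarrow> thesis\<close>
    by (meson not_le_imp_less)
  define C where "C = (\<lambda>h. h - \<gamma>') ` (convex hull (g ` {N..}))"
  have gc: "g n \<in> cvb M" for n using g by (auto simp: cvb_def)
  have "convex hull (g ` {N..}) \<subseteq> cvb M"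
    by (intro hull_minimal subspace_imp_convex subspace_cvb) (use gc in auto)
  then have Cc: "C \<subseteq> cvb M" unfolding C_def using subspace_diff[OF subspace_cvb _ \<gamma>'(1)] by blast
  have "convex C" unfolding C_def by (rule convex_translation_subtract) (rule convex_convex_hull)
  then have "\<exists>L. linear L \<and> (\<forall>x\<in>cvb M. L x \<le> expectation (\<lambda>\<omega>. norm (x \<omega>))) \<and> (\<forall>d\<in>C. \<epsilon> \<le> L d)"
  proof (rule mazur_orlicz[OF subspace_cvb sublinear_cvb _ Cc, of \<epsilon>])
    show "\<epsilon> \<le> expectation (\<lambda>\<omega>. norm (d \<omega>))" if "d \<in> C" for d using that far by (auto simp: C_def)
  qed blast
  then obtain L where L: "linear L" "\<And>f. f \<in> cvb M \<Longrightarrow> L f \<le> expectation (\<lambda>\<omega>. norm (f \<omega>))"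
    "\<And>d. d \<in> C \<Longrightarrow> \<epsilon> \<le> L d" by blast
  have "\<exists>\<kappa>. (\<forall>u\<in>D. \<kappa> u \<in> borel_measurable M) \<and>
      (AE \<omega> in M. \<exists>l. linear l \<and> (\<forall>x. l x \<le> norm x) \<and> (\<forall>u\<in>D. l u = \<kappa> u \<omega>)) \<and>
      (\<forall>f\<in>cvb M. (\<forall>\<omega>\<in>space M. f \<omega> \<in> D) \<longrightarrow> L f = expectation (\<lambda>\<omega>. \<kappa> (f \<omega>) \<omega>))" (is "\<exists>\<kappa>. ?P \<kappa>")
  proof (rule functional_density[OF L(1,2) D])
    fix \<kappa> :: "'x \<Rightarrow> 'a \<Rightarrow> real"
    assume "\<And>u. u \<in> D \<Longrightarrow> \<kappa> u \<in> borel_measurable M"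
      "AE \<omega> in M. \<exists>l. linear l \<and> (\<forall>x. l x \<le> norm x) \<and> (\<forall>u\<in>D. l u = \<kappa> u \<omega>)"
      "\<And>f. f \<in> cvb M \<Longrightarrow> (\<And>\<omega>. \<omega> \<in> space M \<Longrightarrow> f \<omega> \<in> D) \<Longrightarrow> L f = expectation (\<lambda>\<omega>. \<kappa> (f \<omega>) \<omega>)"
    then have "?P \<kappa>" by simp
    then show "\<exists>\<kappa>. ?P \<kappa>" by (rule exI[of ?P \<kappa>])
  qed
  then obtain \<kappa> where "?P \<kappa>" ..
  then have \<kappa>: "\<And>u. u \<in> D \<Longrightarrow> \<kappa> u \<in> borel_measurable M"
    "AE \<omega> in M. \<exists>l. linear l \<and> (\<forall>x. l x \<le> norm x) \<and> (\<forall>u\<in>D. l u = \<kappa> u \<omega>)"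
    "\<And>f. f \<in> cvb M \<Longrightarrow> (\<And>\<omega>. \<omega> \<in> space M \<Longrightarrow> f \<omega> \<in> D) \<Longrightarrow> L f = expectation (\<lambda>\<omega>. \<kappa> (f \<omega>) \<omega>)"
    by simp_all
  obtain B where B: "\<And>\<omega>. norm (\<gamma>' \<omega>) \<le> B" using \<gamma>'(1) by (auto simp: cvb_def)
  define d where "d n = g (N + n) - \<gamma>'" for n
  have dD: "d n \<omega> \<in> D" if "\<omega> \<in> space M" for n \<omega>
    unfolding d_def using g(3)[OF that] \<gamma>'(2)[of \<omega>] unfolding D(1) by (auto intro: qspan_diff)
  have dc: "d n \<in> cvb M" for n unfolding d_def by (rule subspace_diff[OF subspace_cvb gc \<gamma>'(1)])
  have "d n \<in> C" for n unfolding C_def d_def by (intro imageI hull_inc) auto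
  then have L\<epsilon>: "\<epsilon> \<le> expectation (\<lambda>\<omega>. \<kappa> (d n \<omega>) \<omega>)" for n
    using L(3)[of "d n"] \<kappa>(3)[OF dc dD] by simp
  have dm: "(\<lambda>\<omega>. \<kappa> (d n \<omega>) \<omega>) \<in> borel_measurable M" for n
  proof (rule cval_compose_measurable[of M "d n" \<kappa>])
    show "cval M (d n)" using dc[of n] by (simp add: cvb_def)
    show "\<kappa> x \<in> borel_measurable M" if "x \<in> d n ` space M" for x using that dD \<kappa>(1) by blast
  qed
  define F where "F \<omega> = lim (\<lambda>n. \<kappa> (d n \<omega>) \<omega>)" for \<omega>
  have Fm: "F \<in> borel_measurable M" unfolding F_def by (rule borel_measurable_lim_metric[OF dm])
  have pw: "AE \<omega> in M. (\<lambda>n. \<kappa> (d n \<omega>) \<omega>) \<longlonglongrightarrow> F \<omega> \<and> F \<omega> \<le> \<epsilon>/2 \<and> (\<forall>n. \<bar>\<kappa> (d n \<omega>) \<omega>\<bar> \<le> 1 + B)"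
    using \<kappa>(2) w \<gamma>'(3) AE_space
  proof eventually_elim
    case (elim \<omega>)
    from elim(1) obtain l where l: "linear l" "\<And>x. l x \<le> norm x" "\<And>u. u \<in> D \<Longrightarrow> l u = \<kappa> u \<omega>" by blast
    have labs: "\<bar>l z\<bar> \<le> norm z" for z
      using l(2)[of z] l(2)[of "- z"] linear_neg[OF l(1), of z] by (simp add: abs_le_iff)
    have bl: "bounded_linear l"
      using l(1) labs by (auto simp: bounded_linear_def bounded_linear_axioms_def intro: exI[of _ 1])
    have eq: "\<kappa> (d n \<omega>) \<omega> = l (g (N + n) \<omega>) - l (\<gamma>' \<omega>)" for n
      using l(3)[OF dD[OF elim(4)], of n] by (simp add: d_def linear_diff[OF l(1)])
    have "(\<lambda>n. l (g n \<omega>)) \<longlonglongrightarrow> l (\<gamma> \<omega>)" using elim(2) bl by blast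
    then have "(\<lambda>n. l (g (N + n) \<omega>)) \<longlonglongrightarrow> l (\<gamma> \<omega>)" using LIMSEQ_ignore_initial_segment[of "\<lambda>n. l (g n \<omega>)" _ N] by (simp add: add.commute)
    then have t: "(\<lambda>n. \<kappa> (d n \<omega>) \<omega>) \<longlonglongrightarrow> l (\<gamma> \<omega>) - l (\<gamma>' \<omega>)" unfolding eq by (intro tendsto_diff tendsto_const)
    then have F: "F \<omega> = l (\<gamma> \<omega>) - l (\<gamma>' \<omega>)" unfolding F_def by (rule limI)
    have "F \<omega> \<le> \<epsilon>/2"
      using l(2)[of "\<gamma> \<omega> - \<gamma>' \<omega>"] elim(3) unfolding F by (simp add: linear_diff[OF l(1)] norm_minus_commute)
    moreover have "\<bar>\<kappa> (d n \<omega>) \<omega>\<bar> \<le> 1 + B" for n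
      unfolding eq using labs[of "g (N + n) \<omega>"] labs[of "\<gamma>' \<omega>"] g(2)[of "N + n" \<omega>] B[of \<omega>] by linarith
    ultimately show ?case using t F by simp
  qed
  have c: "integrable M F" "(\<lambda>n. expectation (\<lambda>\<omega>. \<kappa> (d n \<omega>) \<omega>)) \<longlonglongrightarrow> expectation F"
  proof -
    have 1: "AE \<omega> in M. (\<lambda>n. \<kappa> (d n \<omega>) \<omega>) \<longlonglongrightarrow> F \<omega>" using pw by eventually_elim blast
    have 2: "AE \<omega> in M. norm (\<kappa> (d n \<omega>) \<omega>) \<le> 1 + B" for n using pw by eventually_elim simp
    show "integrable M F" by (rule integrable_dominated_convergence[OF Fm dm _ 1 2]) simp
    show "(\<lambda>n. expectation (\<lambda>\<omega>. \<kappa> (d n \<omega>) \<omega>)) \<longlonglongrightarrow> expectation F"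
      by (rule integral_dominated_convergence[OF Fm dm _ 1 2]) simp
  qed
  have "\<epsilon> \<le> expectation F" by (rule LIMSEQ_le_const[OF c(2)]) (use L\<epsilon> in auto)
  moreover have "expectation F \<le> \<epsilon>/2" by (rule integral_le_const[OF c(1)]) (use pw in \<open>eventually_elim, blast\<close>)
  ultimately show False using \<epsilon> by simp
qed

lemma convergent_blocks:
  fixes f :: "nat \<Rightarrow> 'a \<Rightarrow> 'x::banach"
  assumes V: "property_Vstar (type_space :: 'x nspace)"
    and f: "\<And>n. cval M (f n)" "\<And>n \<omega>. norm (f n \<omega>) \<le> 1"
    and no_l1: "\<And>g S \<delta> c. (\<And>i. g i \<in> midhull (f ` {i..})) \<Longrightarrow> 0 < \<delta> \<Longrightarrow> 0 < c \<Longrightarrow>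
      (\<And>k. S k \<in> events \<and> c \<le> prob (S k)) \<Longrightarrow>
      (\<And>k. AE \<omega> in M. \<omega> \<in> S k \<longrightarrow> (\<exists>T\<in>l1_ops. \<forall>i\<le>k. \<delta> < T i (g i \<omega>))) \<Longrightarrow> False"
  obtains h \<gamma> where "\<And>n. h n \<in> convex hull (f ` {n..})" "AE \<omega> in M. (\<lambda>n. h n \<omega>) \<longlonglongrightarrow> \<gamma> \<omega>"
proof -
  define A where "A = (\<Union>n. f n ` space M)"
  define D where "D = qspan A"
  have A: "A \<noteq> {}" "countable A" using not_empty f(1) by (auto simp: A_def cval_def)
  have D: "countable D" "D \<noteq> {}"
    unfolding D_def using countable_qspan[OF A(2)] A(1) qspan_base[of _ A] by auto
  obtain \<xi> :: "'x \<Rightarrow> 'x \<Rightarrow> 'x \<Rightarrow> real" where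
    \<xi>: "\<And>u v. linear (\<xi> u v)" "\<And>u v y. \<xi> u v y \<le> norm y" "\<And>u v. \<xi> u v (u - v) = norm (u - v)"
    using norming_functionals by metis
  define e where "e = from_nat_into (D \<times> D)"
  have e: "range e = D \<times> D" unfolding e_def using D by (intro range_from_nat_into) auto
  obtain g0 where g0: "blk g0 f" "AE \<omega> in M. \<forall>\<delta>>0. \<not> extendible \<delta> (\<lambda>n. g0 n \<omega>) []"
    by (rule stable_blocks[OF f no_l1])
  obtain r0 where r0: "strict_mono r0" "\<And>n. g0 (r0 n) \<in> midhull (f ` {n..})" by (rule blk_normalize[OF g0(1)]) blast
  have unit: "cval M h \<and> (\<forall>\<omega>. norm (h \<omega>) \<le> 1)" if "h \<in> midhull (f ` {n..})" for h n
    using that midhull_mono[of "f ` {n..}" "range f"] by (intro midhull_cvb_unit[of M f, OF f]) auto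
  obtain g1 where g1: "blk g1 (\<lambda>n. g0 (r0 n))"
    "\<And>k. AE \<omega> in M. convergent (\<lambda>n. \<xi> (fst (e k)) (snd (e k)) (g1 n \<omega>))"
    by (rule blocks_functionals_converge[of "\<lambda>n. g0 (r0 n)" "\<lambda>k. \<xi> (fst (e k)) (snd (e k))"])
      (use unit[OF r0(2)] \<xi> in blast)+
  have g1g0: "blk g1 g0" by (rule blk_trans[OF g1(1) blk_subseq[OF r0(1)]])
  obtain r where r: "strict_mono r" "\<And>n. g1 (r n) \<in> midhull (f ` {n..})"
    by (rule blk_normalize[OF blk_trans[OF g1g0 g0(1)]]) blast
  define g where "g n = g1 (r n)" for n
  have gg1: "blk g g1" unfolding g_def by (rule blk_subseq[OF r(1)])
  have g: "cval M (g n)" "norm (g n \<omega>) \<le> 1" for n \<omega> using unit[OF r(2)] by (auto simp: g_def)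
  have gD: "g n \<omega> \<in> D" if "\<omega> \<in> space M" for n \<omega>
  proof -
    have "g n \<omega> \<in> midhull ((\<lambda>h. h \<omega>) ` f ` {n..})" unfolding g_def by (rule midhull_image_apply[OF r(2)])
    also have "\<dots> \<subseteq> midhull A" using that by (intro midhull_mono) (auto simp: A_def)
    also have "\<dots> \<subseteq> D" unfolding D_def by (rule midhull_qspan)
    finally show ?thesis .
  qed
  have "AE \<omega> in M. \<forall>k. convergent (\<lambda>n. \<xi> (fst (e k)) (snd (e k)) (g1 n \<omega>))"
    using g1(2) by (simp add: AE_all_countable)
  with g0(2) AE_space have ex: "AE \<omega> in M. \<exists>y. y \<in> closure D \<and> (\<forall>\<phi>::'x \<Rightarrow> real. bounded_linear \<phi> \<longrightarrow> (\<lambda>n. \<phi> (g n \<omega>)) \<longlonglongrightarrow> \<phi> y)"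
  proof eventually_elim
    case (elim \<omega>)
    let ?x = "\<lambda>n. g n \<omega>"
    have b: "blk ?x (\<lambda>n. g0 n \<omega>)" by (rule blk_apply[OF blk_trans[OF gg1 g1g0]])
    have "Vstar_set type_space (range ?x)"
    proof (rule Vstar_set_rangeI)
      fix T :: "nat \<Rightarrow> 'x \<Rightarrow> real" and \<delta> :: real assume T: "T \<in> l1_ops" and \<delta>: "0 < \<delta>"
      have "\<not> extendible \<delta> ?x []" using extendible_blk[OF b, of \<delta> "[]"] elim(1) \<delta> by blast
      then have "\<not> (\<forall>j. \<exists>i\<ge>j. \<delta> \<le> T j (g i \<omega>))" using T unfolding extendible_def by auto
      then show "\<exists>j. \<forall>i\<ge>j. T j (g i \<omega>) < \<delta>" by (meson not_le)
    qed
    then have wc: "relatively_weakly_compact type_space (range ?x)" using V by (simp add: property_Vstar_def)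
    have cv: "convergent (\<lambda>n. \<xi> u v (g n \<omega>))" if uv: "u \<in> D" "v \<in> D" for u v
    proof -
      have "(u, v) \<in> range e" using e uv by simp
      then obtain k where "(u, v) = e k" by blast
      then have "convergent (\<lambda>n. \<xi> u v (g1 n \<omega>))" using elim(3) by (metis fst_conv snd_conv)
      then obtain c where "(\<lambda>n. \<xi> u v (g1 n \<omega>)) \<longlonglongrightarrow> c" by (auto simp: convergent_def)
      from blk_tendsto[OF blk_linear[OF \<xi>(1) blk_apply[OF gg1]] this] show ?thesis by (auto simp: convergent_def)
    qed
    show ?case
    proof (rule weak_limit[OF wc D_def A(1) gD[OF elim(2)] \<xi> cv])
      fix y assume "y \<in> closure D" "\<And>\<phi>::'x \<Rightarrow> real. bounded_linear \<phi> \<Longrightarrow> (\<lambda>n. \<phi> (g n \<omega>)) \<longlonglongrightarrow> \<phi> y"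
      then show ?thesis by blast
    qed
  qed
  define \<gamma> where "\<gamma> \<omega> = (SOME y. y \<in> closure D \<and> (\<forall>\<phi>::'x \<Rightarrow> real. bounded_linear \<phi> \<longrightarrow> (\<lambda>n. \<phi> (g n \<omega>)) \<longlonglongrightarrow> \<phi> y))" for \<omega>
  from ex have \<gamma>: "AE \<omega> in M. \<gamma> \<omega> \<in> closure D \<and> (\<forall>\<phi>::'x \<Rightarrow> real. bounded_linear \<phi> \<longrightarrow> (\<lambda>n. \<phi> (g n \<omega>)) \<longlonglongrightarrow> \<phi> (\<gamma> \<omega>))"
  proof eventually_elim
    case (elim \<omega>)
    then show ?case unfolding \<gamma>_def by (rule someI_ex)
  qed
  have \<gamma>w: "AE \<omega> in M. \<forall>\<phi>::'x \<Rightarrow> real. bounded_linear \<phi> \<longrightarrow> (\<lambda>n. \<phi> (g n \<omega>)) \<longlonglongrightarrow> \<phi> (\<gamma> \<omega>)"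
    using \<gamma> by eventually_elim blast
  have z: "0 \<in> D" using D(2) qspan_scale[of _ A 0] unfolding D_def by auto
  have step: "\<exists>h \<gamma>'. h \<in> convex hull (g ` {N..}) \<and> h \<in> cvb M \<and> \<gamma>' \<in> cvb M \<and> expectation (\<lambda>\<omega>. norm (h \<omega> - \<gamma>' \<omega>)) < \<epsilon> \<and>
      (AE \<omega> in M. norm (\<gamma>' \<omega> - \<gamma> \<omega>) \<le> \<epsilon>)" if \<epsilon>: "0 < \<epsilon>" for N \<epsilon>
  proof -
    obtain \<gamma>1 where \<gamma>1: "cval M \<gamma>1" "\<And>\<omega>. \<gamma>1 \<omega> \<in> D" "AE \<omega> in M. norm (\<gamma>1 \<omega> - \<gamma> \<omega>) \<le> \<epsilon>/2"
      by (rule weak_limit_cval[OF g(1) D \<gamma>, of "\<epsilon>/2"]) (use \<epsilon> in auto)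
    \<comment> \<open>Truncation makes the approximant bounded. It changes nothing almost
      everywhere, since weak limits of vectors of the unit ball have norm at most
      \<open>1\<close>.\<close>
    define \<gamma>' where "\<gamma>' \<omega> = (if norm (\<gamma>1 \<omega>) \<le> 1 + \<epsilon> then \<gamma>1 \<omega> else 0)" for \<omega>
    have "AE \<omega> in M. norm (\<gamma>' \<omega> - \<gamma> \<omega>) \<le> \<epsilon>/2"
      using \<gamma>w \<gamma>1(3)
    proof eventually_elim
      case (elim \<omega>)
      have "norm (\<gamma> \<omega>) \<le> 1"
      proof (rule type_rep.norming_functional[of "\<gamma> \<omega>"])
        fix L :: "'x \<Rightarrow> real" assume L: "linear L" "\<And>y. y \<in> UNIV \<Longrightarrow> L y \<le> norm y" "L (\<gamma> \<omega>) = norm (\<gamma> \<omega>)"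
        have labs: "\<bar>L z\<bar> \<le> norm z" for z
          using L(2)[of z] L(2)[of "- z"] linear_neg[OF L(1), of z] by (simp add: abs_le_iff)
        have "bounded_linear L"
          using L(1) labs by (auto simp: bounded_linear_def bounded_linear_axioms_def intro: exI[of _ 1])
        then have "(\<lambda>n. L (g n \<omega>)) \<longlonglongrightarrow> norm (\<gamma> \<omega>)" using elim(1) L(3) by metis
        then show ?thesis
        proof (rule LIMSEQ_le_const2)
          have "L (g n \<omega>) \<le> 1" for n using L(2)[of "g n \<omega>"] g(2)[of n \<omega>] by simp
          then show "\<exists>N. \<forall>n\<ge>N. L (g n \<omega>) \<le> 1" by blast
        qed
      qed simp
      then have "norm (\<gamma>1 \<omega>) \<le> 1 + \<epsilon>" using elim(2) \<epsilon> norm_triangle_sub[of "\<gamma>1 \<omega>" "\<gamma> \<omega>"] by linarith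
      then show ?case using elim(2) by (simp add: \<gamma>'_def)
    qed
    moreover have "\<gamma>' \<in> cvb M"
      unfolding cvb_def \<gamma>'_def using cval_comp[OF \<gamma>1(1), of "\<lambda>x. if norm x \<le> 1 + \<epsilon> then x else 0"] \<epsilon>
      by (auto intro: exI[of _ "1 + \<epsilon>"])
    moreover have "\<gamma>' \<omega> \<in> D" for \<omega> using \<gamma>1(2) z by (simp add: \<gamma>'_def)
    ultimately have \<gamma>': "\<gamma>' \<in> cvb M" "\<And>\<omega>. \<gamma>' \<omega> \<in> D" "AE \<omega> in M. norm (\<gamma>' \<omega> - \<gamma> \<omega>) \<le> \<epsilon>/2" by blast+
    obtain h where h: "h \<in> convex hull (g ` {N..})" "expectation (\<lambda>\<omega>. norm (h \<omega> - \<gamma>' \<omega>)) < \<epsilon>"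
      by (rule mean_norm_blocks[OF g(1,2) gD D_def A(1) D(1) \<gamma>w \<epsilon> \<gamma>'])
    have "convex hull (g ` {N..}) \<subseteq> cvb M"
      by (intro hull_minimal subspace_imp_convex subspace_cvb) (use g in \<open>auto simp: cvb_def\<close>)
    moreover have "AE \<omega> in M. norm (\<gamma>' \<omega> - \<gamma> \<omega>) \<le> \<epsilon>" using \<gamma>'(3) by eventually_elim (use \<epsilon> in simp)
    ultimately show ?thesis using h \<gamma>'(1) by blast
  qed
  \<comment> \<open>Errors \<open>(1/2) ^ n\<close> are summable, so convergence in the mean becomes
    convergence almost everywhere; \<open>snd p\<close> is the measurable stand-in for
    \<open>\<gamma>\<close>.\<close>
  have "\<forall>n. \<exists>p. fst p \<in> convex hull (g ` {n..}) \<and> fst p \<in> cvb M \<and> snd p \<in> cvb M \<and>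
      expectation (\<lambda>\<omega>. norm (fst p \<omega> - snd p \<omega>)) < (1/2) ^ n \<and> (AE \<omega> in M. norm (snd p \<omega> - \<gamma> \<omega>) \<le> (1/2) ^ n)"
    using step[of "(1/2) ^ n" n for n] by simp
  from choice[OF this] obtain p where p: "\<And>n. fst (p n) \<in> convex hull (g ` {n..})" "\<And>n. fst (p n) \<in> cvb M"
    "\<And>n. snd (p n) \<in> cvb M" "\<And>n. expectation (\<lambda>\<omega>. norm (fst (p n) \<omega> - snd (p n) \<omega>)) < (1/2) ^ n"
    "\<And>n. AE \<omega> in M. norm (snd (p n) \<omega> - \<gamma> \<omega>) \<le> (1/2) ^ n" by blast
  define \<Delta> where "\<Delta> n \<omega> = norm (fst (p n) \<omega> - snd (p n) \<omega>)" for n \<omega>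
  have \<Delta>: "integrable M (\<Delta> n)" for n
    using cvb_integrable[OF subspace_diff[OF subspace_cvb p(2,3)], of n] by (simp add: \<Delta>_def[abs_def])
  have "summable (\<lambda>n. expectation (\<lambda>\<omega>. \<bar>\<Delta> n \<omega>\<bar>))"
  proof (rule summable_comparison_test')
    show "summable (\<lambda>n. (1/2::real) ^ n)" by (rule summable_geometric) simp
    show "norm (expectation (\<lambda>\<omega>. \<bar>\<Delta> n \<omega>\<bar>)) \<le> (1/2) ^ n" if "0 \<le> n" for n
      using p(4)[of n] by (simp add: \<Delta>_def)
  qed
  from AE_summable_abs[OF \<Delta> this] have s: "AE \<omega> in M. summable (\<lambda>n. \<bar>\<Delta> n \<omega>\<bar>)" .
  have "AE \<omega> in M. \<forall>n. norm (snd (p n) \<omega> - \<gamma> \<omega>) \<le> (1/2) ^ n" using p(5) by (simp add: AE_all_countable)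
  with s have "AE \<omega> in M. (\<lambda>n. fst (p n) \<omega>) \<longlonglongrightarrow> \<gamma> \<omega>"
  proof eventually_elim
    case (elim \<omega>)
    have "(\<lambda>n. \<bar>\<Delta> n \<omega>\<bar> + (1/2) ^ n) \<longlonglongrightarrow> 0 + 0"
      by (intro tendsto_add summable_LIMSEQ_zero elim(1) LIMSEQ_power_zero) simp
    then have lim: "(\<lambda>n. \<bar>\<Delta> n \<omega>\<bar> + (1/2) ^ n) \<longlonglongrightarrow> 0" by simp
    have "norm (fst (p n) \<omega> - \<gamma> \<omega>) \<le> \<bar>\<Delta> n \<omega>\<bar> + (1/2) ^ n" for n
      using norm_triangle_ineq[of "fst (p n) \<omega> - snd (p n) \<omega>" "snd (p n) \<omega> - \<gamma> \<omega>"] elim(2) by (simp add: \<Delta>_def) (smt (verit))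
    then have "(\<lambda>n. fst (p n) \<omega> - \<gamma> \<omega>) \<longlonglongrightarrow> 0" by (intro Lim_null_comparison[OF _ lim] always_eventually) auto
    then show ?case by (rule LIM_zero_cancel)
  qed
  moreover have "fst (p n) \<in> convex hull (f ` {n..})" for n
  proof -
    have "g i \<in> convex hull (f ` {n..})" if "n \<le> i" for i
      using r(2)[of i] midhull_tail_mono[OF that, of f] midhull_subset_hull[of "f ` {n..}"] unfolding g_def by blast
    then have "convex hull (g ` {n..}) \<subseteq> convex hull (f ` {n..})"
      by (intro hull_minimal convex_convex_hull) auto
    then show ?thesis using p(1) by blast
  qed
  ultimately show thesis using that[of "\<lambda>n. fst (p n)" \<gamma>] by blast
qed

end

section \<open>Banach lattices without copies of \<open>c\<^sub>0\<close>\<close>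

text \<open>Each term exceeds the thresholds of all numbers up to the previous term. Relations
  between any two terms, not only neighbours, follow.\<close>

lemma sparse_sequence:
  assumes "\<And>p. \<forall>\<^sub>F n in sequentially. Q p (n::nat)"
  shows "\<exists>r::nat \<Rightarrow> nat. strict_mono r \<and> J \<le> r 0 \<and> (\<forall>i j. i < j \<longrightarrow> Q (r i) (r j))"
proof -
  have "\<forall>p. \<exists>N. \<forall>n\<ge>N. Q p n" using assms by (simp add: eventually_sequentially)
  from choice[OF this] obtain N where N: "\<And>p n. N p \<le> n \<Longrightarrow> Q p n" by blast
  define M where "M p = Max (N ` {..p})" for p
  have M: "N p \<le> M p'" if "p \<le> p'" for p p' using that by (auto simp: M_def intro!: Max_ge)
  define r where "r = rec_nat J (\<lambda>_ p. Suc (p + M p))"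
  have r: "r 0 = J" "r (Suc n) = Suc (r n + M (r n))" for n by (simp_all add: r_def)
  have mono: "strict_mono r" by (rule strict_mono_Suc_iff[THEN iffD2]) (simp add: r)
  have "Q (r i) (r j)" if ij: "i < j" for i j
  proof -
    obtain k where k: "j = Suc k" using ij by (cases j) auto
    have "r i \<le> r k" using ij k by (intro strict_mono_leD[OF mono]) simp
    then show ?thesis using M[of "r i" "r k"] by (intro N) (simp add: k r)
  qed
  with mono r(1) show ?thesis by (intro exI[of _ r]) auto
qed

lemma c0_bdd: "x \<longlonglongrightarrow> 0 \<Longrightarrow> bdd_above (range (\<lambda>n. \<bar>x n :: real\<bar>))"
  using convergent_imp_Bseq[of x] by (auto simp: convergent_def Bseq_def bdd_above_def)

text \<open>
  After passing to a subsequence, the functionals norming the terms \<open>w k\<close> converge at every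
  \<open>w j\<close>; a gliding hump makes the matrix of their values almost diagonal.
\<close>

lemma almost_biorthogonal:
  fixes w :: "nat \<Rightarrow> 'v::real_normed_vector"
  assumes \<epsilon>: "0 < \<epsilon>" "\<And>k. \<epsilon> \<le> norm (w k)"
    and bd: "\<And>x N. (\<And>i. \<bar>x i\<bar> \<le> 1) \<Longrightarrow> norm (\<Sum>i<N. x i *\<^sub>R w i) \<le> C"
  obtains r :: "nat \<Rightarrow> nat" and \<psi> :: "nat \<Rightarrow> 'v \<Rightarrow> real" where "strict_mono r" "\<And>m. linear (\<psi> m)" "\<And>m x. \<psi> m x \<le> norm x" "\<And>m. \<epsilon> \<le> \<psi> m (w (r m))"
    "\<And>m n. (\<Sum>i\<in>{..<n} - {m}. \<bar>\<psi> m (w (r i))\<bar>) \<le> \<epsilon> / 2"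
proof -
  obtain \<xi> :: "'v \<Rightarrow> 'v \<Rightarrow> 'v \<Rightarrow> real" where
    \<xi>: "\<And>u v. linear (\<xi> u v)" "\<And>u v y. \<xi> u v y \<le> norm y" "\<And>u v. \<xi> u v (u - v) = norm (u - v)"
    using norming_functionals by metis
  define \<phi> where "\<phi> k = \<xi> (w k) 0" for k :: nat
  have \<phi>: "linear (\<phi> k)" "\<phi> k y \<le> norm y" "\<phi> k (w k) = norm (w k)" for k y
    using \<xi>(1,2) \<xi>(3)[of "w k" 0] by (simp_all add: \<phi>_def)
  have \<phi>abs: "\<bar>\<phi> k y\<bar> \<le> norm y" for k y
    using \<phi>(2)[of k y] \<phi>(2)[of k "- y"] linear_neg[OF \<phi>(1), of k y] by (simp add: abs_le_iff)
  \<comment> \<open>Signs as coefficients turn \<open>bd\<close> into a bound for the absolute row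
    sums of the matrix \<open>\<phi> k (w i)\<close>.\<close>
  have row: "(\<Sum>i<N. \<bar>\<phi> k (w i)\<bar>) \<le> C" for k N
  proof -
    have "(\<Sum>i<N. \<bar>\<phi> k (w i)\<bar>) = \<phi> k (\<Sum>i<N. sgn (\<phi> k (w i)) *\<^sub>R w i)"
      by (simp add: linear_sum[OF \<phi>(1)] linear_cmul[OF \<phi>(1)] abs_sgn mult.commute)
    also have "\<dots> \<le> C" by (rule order_trans[OF \<phi>(2) bd]) (simp add: abs_sgn_eq)
    finally show ?thesis .
  qed
  interpret D: subseqs "\<lambda>j s. convergent (\<lambda>k. \<phi> (s k) (w j))"
  proof
    fix j and s :: "nat \<Rightarrow> nat"
    have "bounded (range (\<lambda>k. \<phi> (s k) (w j)))"
      using \<phi>abs by (auto simp: bounded_iff)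
    from bounded_imp_convergent_subsequence[OF this] obtain l t
      where "strict_mono t" "((\<lambda>k. \<phi> (s k) (w j)) \<circ> t) \<longlonglongrightarrow> l" by blast
    then show "\<exists>t. strict_mono t \<and> convergent (\<lambda>k. \<phi> ((s \<circ> t) k) (w j))"
      by (intro exI[of _ t]) (auto simp: convergent_def comp_def)
  qed
  define t where "t = D.diagseq"
  have t: "strict_mono t" unfolding t_def by (rule D.subseq_diagseq)
  have "convergent (\<lambda>k. \<phi> (t k) (w j))" for j
  proof -
    have "convergent (\<lambda>k. \<phi> ((t \<circ> (+) (Suc j)) k) (w j))"
      unfolding t_def
    proof (rule D.diagseq_holds)
      fix r s n assume "strict_mono (r :: nat \<Rightarrow> nat)" "convergent (\<lambda>k. \<phi> (s k) (w n))"
      then show "convergent (\<lambda>k. \<phi> ((s \<circ> r) k) (w n))"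
        using convergent_subseq_convergent[of "\<lambda>k. \<phi> (s k) (w n)" r] by (simp add: comp_def)
    qed
    then show ?thesis
      using convergent_ignore_initial_segment[of "\<lambda>k. \<phi> (t k) (w j)" "Suc j"] by (simp add: comp_def add.commute)
  qed
  then have "\<forall>j. \<exists>a. (\<lambda>k. \<phi> (t k) (w (t j))) \<longlonglongrightarrow> a" by (auto simp: convergent_def)
  from choice[OF this] obtain a where a: "\<And>j. (\<lambda>k. \<phi> (t k) (w (t j))) \<longlonglongrightarrow> a j" by blast
  define b where "b k j = \<phi> (t k) (w (t j))" for k j
  have rowb: "(\<Sum>j<N. \<bar>b k j\<bar>) \<le> C" for k N
  proof -
    have "(\<Sum>j<N. \<bar>b k j\<bar>) = (\<Sum>i\<in>t ` {..<N}. \<bar>\<phi> (t k) (w i)\<bar>)"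
      unfolding b_def by (subst sum.reindex) (auto intro: inj_on_subset strict_mono_imp_inj_on t)
    also have "\<dots> \<le> (\<Sum>i<t N. \<bar>\<phi> (t k) (w i)\<bar>)"
      using strict_mono_less[OF t] by (intro sum_mono2) auto
    finally show ?thesis using row[of "t k" "t N"] by linarith
  qed
  have sb: "summable (\<lambda>j. \<bar>b k j\<bar>)" for k by (rule summableI_nonneg_bounded[OF _ rowb]) simp
  have "(\<Sum>j<N. \<bar>a j\<bar>) \<le> C" for N
  proof (rule LIMSEQ_le_const2)
    show "(\<lambda>k. \<Sum>j<N. \<bar>b k j\<bar>) \<longlonglongrightarrow> (\<Sum>j<N. \<bar>a j\<bar>)"
      using a by (intro tendsto_sum tendsto_rabs) (simp add: b_def)
  qed (use rowb in blast)
  then have sa: "summable (\<lambda>j. \<bar>a j\<bar>)" by (intro summableI_nonneg_bounded) auto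
  have tail: "\<exists>N. \<forall>n\<ge>N. (\<Sum>j. \<bar>c (j + n)\<bar>) \<le> \<epsilon>/8" if c: "summable (\<lambda>j. \<bar>c j\<bar>)" for c :: "nat \<Rightarrow> real"
  proof -
    obtain N where N: "\<And>n. N \<le> n \<Longrightarrow> norm (\<Sum>j. \<bar>c (j + n)\<bar>) < \<epsilon>/8"
      using suminf_exist_split[OF _ c, of "\<epsilon>/8"] \<epsilon>(1) by auto
    have "(\<Sum>j. \<bar>c (j + n)\<bar>) \<le> \<epsilon>/8" if "N \<le> n" for n
      using N[OF that] by (simp add: abs_less_iff)
    then show ?thesis by blast
  qed
  obtain J where J: "(\<Sum>j. \<bar>a (j + J)\<bar>) \<le> \<epsilon>/8" using tail[OF sa] by blast
  \<comment> \<open>\<open>b\<close> is the matrix of values and \<open>a\<close> the limit of its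
    columns. \<open>Q p n\<close> controls both sides of the diagonal: column \<open>p\<close> is
    close to \<open>a p\<close> in row \<open>n\<close>, and row \<open>p\<close> has a small tail
    from column \<open>n\<close> on. With the tail of \<open>a\<close> beyond \<open>J\<close>, the
    off-diagonal sum is at most \<open>\<epsilon>/4\<close> on the left and
    \<open>\<epsilon>/8\<close> on the right.\<close>
  define Q where "Q p n \<longleftrightarrow> \<bar>b n p - a p\<bar> \<le> \<epsilon>/16 * (1/2)^p \<and> (\<Sum>j. \<bar>b p (j + n)\<bar>) \<le> \<epsilon>/8" for p n
  have "\<forall>\<^sub>F n in sequentially. Q p n" for p
  proof -
    have "\<forall>\<^sub>F n in sequentially. dist (b n p) (a p) < \<epsilon>/16 * (1/2)^p"
      using a[of p] \<epsilon>(1) by (intro tendstoD) (simp_all add: b_def)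
    moreover have "\<forall>\<^sub>F n in sequentially. (\<Sum>j. \<bar>b p (j + n)\<bar>) \<le> \<epsilon>/8"
      using tail[OF sb] by (simp add: eventually_sequentially)
    ultimately show ?thesis by eventually_elim (auto simp: Q_def dist_real_def)
  qed
  from sparse_sequence[of Q J, OF this] obtain s :: "nat \<Rightarrow> nat" where
    "strict_mono s \<and> J \<le> s 0 \<and> (\<forall>i j. i < j \<longrightarrow> Q (s i) (s j))" ..
  then have s: "strict_mono s" "J \<le> s 0" "\<And>i j. i < j \<Longrightarrow> Q (s i) (s j)" by simp_all
  have sub: "(\<Sum>i<n. \<bar>c (s (i + k))\<bar>) \<le> (\<Sum>j. \<bar>c (j + N)\<bar>)"
    if c: "summable (\<lambda>j. \<bar>c j\<bar>)" and N: "N \<le> s k" for c :: "nat \<Rightarrow> real" and n k N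
  proof -
    have ge: "N \<le> s (i + k)" for i by (rule order_trans[OF N strict_mono_leD[OF s(1)]]) simp
    have inj: "inj_on (\<lambda>i. s (i + k) - N) {..<n}"
    proof (rule inj_onI)
      fix x y assume "s (x + k) - N = s (y + k) - N"
      then have "s (x + k) = s (y + k)" using ge[of x] ge[of y] by linarith
      then show "x = y" using strict_mono_eq[OF s(1)] by simp
    qed
    have "(\<Sum>i<n. \<bar>c (s (i + k))\<bar>) = (\<Sum>j\<in>(\<lambda>i. s (i + k) - N) ` {..<n}. \<bar>c (j + N)\<bar>)"
      unfolding sum.reindex[OF inj] comp_def by (intro sum.cong refl) (simp only: le_add_diff_inverse2[OF ge])
    also have "\<dots> \<le> (\<Sum>j. \<bar>c (j + N)\<bar>)"
      using summable_ignore_initial_segment[OF c, of N] by (intro sum_le_suminf) auto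
    finally show ?thesis .
  qed
  have low: "(\<Sum>i<m. \<bar>b (s m) (s i)\<bar>) \<le> \<epsilon>/4" for m
  proof -
    have "(\<Sum>i<m. \<bar>b (s m) (s i)\<bar>) \<le> (\<Sum>i<m. \<bar>a (s i)\<bar> + \<epsilon>/16 * (1/2)^i)"
    proof (rule sum_mono)
      fix i assume "i \<in> {..<m}"
      then have "\<bar>b (s m) (s i) - a (s i)\<bar> \<le> \<epsilon>/16 * (1/2)^(s i)" using s(3)[of i m] by (simp add: Q_def)
      also have "\<dots> \<le> \<epsilon>/16 * (1/2)^i"
        using \<epsilon>(1) seq_suble[OF s(1), of i] by (intro mult_left_mono power_decreasing) auto
      finally show "\<bar>b (s m) (s i)\<bar> \<le> \<bar>a (s i)\<bar> + \<epsilon>/16 * (1/2)^i" by linarith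
    qed
    also have "\<dots> = (\<Sum>i<m. \<bar>a (s (i + 0))\<bar>) + \<epsilon>/16 * (\<Sum>i<m. (1/2)^i)"
      by (simp add: sum.distrib sum_distrib_left)
    also have "\<dots> \<le> \<epsilon>/8 + \<epsilon>/16 * 2"
    proof (intro add_mono mult_left_mono)
      show "(\<Sum>i<m. \<bar>a (s (i + 0))\<bar>) \<le> \<epsilon>/8" using sub[OF sa s(2), of m] J by simp
      have "(\<Sum>i<m. (1/2::real)^i) = 2 - 2 * (1/2)^m" by (induction m) simp_all
      then show "(\<Sum>i<m. (1/2::real)^i) \<le> 2" by simp
    qed (use \<epsilon>(1) in simp)
    finally show ?thesis by simp
  qed
  have high: "(\<Sum>i<n. \<bar>b (s m) (s (i + Suc m))\<bar>) \<le> \<epsilon>/8" for m n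
  proof -
    have "(\<Sum>j. \<bar>b (s m) (j + s (Suc m))\<bar>) \<le> \<epsilon>/8" using s(3)[of m "Suc m"] by (simp add: Q_def)
    then show ?thesis using sub[OF sb order_refl, where k = "Suc m" and n = n, of "s m"] by linarith
  qed
  have "(\<Sum>i\<in>{..<n} - {m}. \<bar>b (s m) (s i)\<bar>) \<le> \<epsilon>/2" for m n
  proof -
    have "(\<Sum>i\<in>{..<n} - {m}. \<bar>b (s m) (s i)\<bar>) \<le> (\<Sum>i\<in>{..<m} \<union> (\<lambda>i. i + Suc m) ` {..<n}. \<bar>b (s m) (s i)\<bar>)"
    proof (rule sum_mono2)
      show "{..<n} - {m} \<subseteq> {..<m} \<union> (\<lambda>i. i + Suc m) ` {..<n}"
      proof
        fix i assume "i \<in> {..<n} - {m}"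
        then show "i \<in> {..<m} \<union> (\<lambda>i. i + Suc m) ` {..<n}"
          by (cases "i < m") (auto intro!: image_eqI[of _ _ "i - Suc m"])
      qed
    qed auto
    also have "\<dots> \<le> (\<Sum>i<m. \<bar>b (s m) (s i)\<bar>) + (\<Sum>i\<in>(\<lambda>i. i + Suc m) ` {..<n}. \<bar>b (s m) (s i)\<bar>)"
      by (subst sum.union_disjoint) auto
    also have "(\<Sum>i\<in>(\<lambda>i. i + Suc m) ` {..<n}. \<bar>b (s m) (s i)\<bar>) = (\<Sum>i<n. \<bar>b (s m) (s (i + Suc m))\<bar>)"
      by (subst sum.reindex) (auto simp: inj_on_def)
    finally show ?thesis using low[of m] high[of m n] \<epsilon>(1) by linarith
  qed
  then show thesis
    by (intro that[of "\<lambda>m. t (s m)" "\<lambda>m. \<phi> (t (s m))"])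
      (use \<phi> \<epsilon>(2) t s(1) in \<open>auto simp: b_def strict_mono_def\<close>)
qed

text \<open>The Bessaga-Pelczynski argument. The upper estimate is \<open>bd\<close>, scaled. For
  the lower one, let \<open>s\<close> be the supremum norm of \<open>x\<close>: the functional
  \<open>\<psi> m\<close> shows that the image has norm at least
  \<open>\<epsilon> * \<bar>x m\<bar> - \<epsilon>/2 * s\<close>, and the supremum over
  \<open>m\<close> leaves \<open>\<epsilon>/2 * s\<close>.\<close>

lemma contains_c0:
  fixes w :: "nat \<Rightarrow> 'v::banach"
  assumes \<epsilon>: "0 < \<epsilon>" "\<And>k. \<epsilon> \<le> norm (w k)"
    and bd: "\<And>x N. (\<And>i. \<bar>x i\<bar> \<le> 1) \<Longrightarrow> norm (\<Sum>i<N. x i *\<^sub>R w i) \<le> C"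
  shows "contains_copy_of (type_space :: 'v nspace) c0_space"
proof -
  obtain r :: "nat \<Rightarrow> nat" and \<psi> :: "nat \<Rightarrow> 'v \<Rightarrow> real" where r: "strict_mono r" and \<psi>: "\<And>m. linear (\<psi> m)" "\<And>m x. \<psi> m x \<le> norm x"
      "\<And>m. \<epsilon> \<le> \<psi> m (w (r m))" "\<And>m n. (\<Sum>i\<in>{..<n} - {m}. \<bar>\<psi> m (w (r i))\<bar>) \<le> \<epsilon> / 2"
    using almost_biorthogonal[OF \<epsilon> bd] by metis
  define v where "v i = w (r i)" for i
  have \<psi>abs: "\<bar>\<psi> m y\<bar> \<le> norm y" for m y
    using \<psi>(2)[of m y] \<psi>(2)[of m "- y"] linear_neg[OF \<psi>(1), of m y] by (simp add: abs_le_iff)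
  have C: "0 \<le> C" using bd[of "\<lambda>_. 0" 0] by simp
  have v1: "norm (\<Sum>i<N. x i *\<^sub>R v i) \<le> C" if x: "\<And>i. \<bar>x i\<bar> \<le> 1" for x N
  proof -
    \<comment> \<open>Coefficients along the subsequence, extended by zero to the indices outside
      it.\<close>
    define x' where "x' j = (if j \<in> r ` {..<N} then x (inv r j) else 0)" for j
    have inj: "inj r" by (rule strict_mono_imp_inj_on[OF r])
    have "(\<Sum>i<N. x i *\<^sub>R v i) = (\<Sum>j\<in>r ` {..<N}. x' j *\<^sub>R w j)"
      using inj by (subst sum.reindex) (auto simp: x'_def v_def intro: inj_on_subset)
    also have "\<dots> = (\<Sum>j<r N. x' j *\<^sub>R w j)"
      using strict_mono_less[OF r] by (intro sum.mono_neutral_left) (auto simp: x'_def)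
    finally show ?thesis using bd[of x' "r N"] x by (simp add: x'_def)
  qed
  have vb: "norm (\<Sum>i<N. x i *\<^sub>R v i) \<le> C * B" if x: "\<And>i. \<bar>x i\<bar> \<le> B" for x N B
  proof (cases "B = 0")
    case True
    then show ?thesis using x by simp
  next
    case False
    have B: "0 < B" using False x[of 0] by linarith
    have "norm (\<Sum>i<N. (x i / B) *\<^sub>R v i) \<le> C" by (rule v1) (use x B in simp)
    moreover have "(\<Sum>i<N. x i *\<^sub>R v i) = B *\<^sub>R (\<Sum>i<N. (x i / B) *\<^sub>R v i)"
      using B by (simp add: scaleR_right.sum)
    ultimately show ?thesis using B by (simp add: mult.commute mult_left_mono)
  qed
  have vb': "norm (\<Sum>i\<in>{m..<n}. x i *\<^sub>R v i) \<le> C * B" if x: "\<And>i. m \<le> i \<Longrightarrow> \<bar>x i\<bar> \<le> B" and B: "0 \<le> B" for x m n B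
  proof -
    have "(\<Sum>i\<in>{m..<n}. x i *\<^sub>R v i) = (\<Sum>i<n. (if m \<le> i then x i else 0) *\<^sub>R v i)"
      by (intro sum.mono_neutral_cong_left) auto
    then show ?thesis using vb[of "\<lambda>i. if m \<le> i then x i else 0" B n] x B by simp
  qed
  have sm: "summable (\<lambda>i. x i *\<^sub>R v i)" if x: "x \<longlonglongrightarrow> 0" for x
    unfolding summable_Cauchy
  proof (intro allI impI)
    fix e :: real assume e: "0 < e"
    have "\<forall>\<^sub>F i in sequentially. dist (x i) 0 < e / (2 * (C + 1))" using C e by (intro tendstoD[OF x]) simp
    then obtain N where N: "\<And>i. N \<le> i \<Longrightarrow> \<bar>x i\<bar> < e / (2 * (C + 1))" by (auto simp: eventually_sequentially)
    have "norm (\<Sum>i\<in>{m..<n}. x i *\<^sub>R v i) < e" if "N \<le> m" for m n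
    proof -
      have "norm (\<Sum>i\<in>{m..<n}. x i *\<^sub>R v i) \<le> C * (e / (2 * (C + 1)))"
        by (rule vb') (use N that C e in \<open>auto intro: less_imp_le\<close>)
      also have "\<dots> < e" using C e by (auto simp: field_simps intro!: add_nonneg_pos mult_nonneg_nonneg)
      finally show ?thesis .
    qed
    then show "\<exists>N. \<forall>m\<ge>N. \<forall>n. norm (\<Sum>i\<in>{m..<n}. x i *\<^sub>R v i) < e" by blast
  qed
  define T where "T x = (\<Sum>i. x i *\<^sub>R v i)" for x
  have lim: "(\<lambda>n. norm (\<Sum>i<n. x i *\<^sub>R v i)) \<longlonglongrightarrow> norm (T x)" if "x \<longlonglongrightarrow> 0" for x
    unfolding T_def by (intro tendsto_norm summable_LIMSEQ sm that)
  have c0: "\<bar>x i\<bar> \<le> (SUP n. \<bar>x n\<bar>)" if "x \<longlonglongrightarrow> 0" for x :: "nat \<Rightarrow> real" and i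
    by (rule cSUP_upper[OF _ c0_bdd[OF that]]) simp
  have up: "norm (T x) \<le> C * (SUP n. \<bar>x n\<bar>)" if x: "x \<longlonglongrightarrow> 0" for x
  proof (rule LIMSEQ_le_const2[OF lim[OF x]])
    have "norm (\<Sum>i<n. x i *\<^sub>R v i) \<le> C * (SUP n. \<bar>x n\<bar>)" for n by (rule vb[OF c0[OF x]])
    then show "\<exists>N. \<forall>n\<ge>N. norm (\<Sum>i<n. x i *\<^sub>R v i) \<le> C * (SUP n. \<bar>x n\<bar>)" by blast
  qed
  have lo: "\<epsilon>/2 * (SUP n. \<bar>x n\<bar>) \<le> norm (T x)" if x: "x \<longlonglongrightarrow> 0" for x
  proof -
    let ?B = "SUP n. \<bar>x n\<bar>"
    have B: "0 \<le> ?B" using c0[OF x, of 0] by linarith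
    have "\<epsilon> * \<bar>x m\<bar> - \<epsilon>/2 * ?B \<le> norm (T x)" for m
    proof (rule LIMSEQ_le_const[OF lim[OF x]], intro exI allI impI)
      fix n assume n: "Suc m \<le> n"
      have "\<psi> m (\<Sum>i<n. x i *\<^sub>R v i) = (\<Sum>i<n. x i * \<psi> m (v i))"
        by (simp add: linear_sum[OF \<psi>(1)] linear_cmul[OF \<psi>(1)])
      also have "\<dots> = x m * \<psi> m (v m) + (\<Sum>i\<in>{..<n} - {m}. x i * \<psi> m (v i))"
        using n by (intro sum.remove) auto
      finally have eq: "\<psi> m (\<Sum>i<n. x i *\<^sub>R v i) = x m * \<psi> m (v m) + (\<Sum>i\<in>{..<n} - {m}. x i * \<psi> m (v i))" .
      have "\<bar>\<Sum>i\<in>{..<n} - {m}. x i * \<psi> m (v i)\<bar> \<le> (\<Sum>i\<in>{..<n} - {m}. ?B * \<bar>\<psi> m (v i)\<bar>)"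
        by (rule order_trans[OF sum_abs]) (use c0[OF x] in \<open>auto intro!: sum_mono mult_right_mono simp: abs_mult\<close>)
      also have "\<dots> \<le> ?B * (\<epsilon>/2)"
        unfolding sum_distrib_left[symmetric] v_def by (intro mult_left_mono \<psi>(4) B)
      finally have 1: "\<bar>\<Sum>i\<in>{..<n} - {m}. x i * \<psi> m (v i)\<bar> \<le> \<epsilon>/2 * ?B" by (simp add: mult.commute)
      have "\<epsilon> * \<bar>x m\<bar> \<le> \<bar>x m * \<psi> m (v m)\<bar>"
        using mult_right_mono[OF \<psi>(3)[of m], of "\<bar>x m\<bar>"] \<psi>(3)[of m] \<epsilon>(1) by (simp add: abs_mult v_def mult.commute)
      then show "\<epsilon> * \<bar>x m\<bar> - \<epsilon>/2 * ?B \<le> norm (\<Sum>i<n. x i *\<^sub>R v i)"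
        using 1 eq \<psi>abs[of m "\<Sum>i<n. x i *\<^sub>R v i"] by linarith
    qed
    then have "\<bar>x m\<bar> \<le> (norm (T x) + \<epsilon>/2 * ?B) / \<epsilon>" for m using \<epsilon>(1) by (simp add: field_simps)
    then have "?B \<le> (norm (T x) + \<epsilon>/2 * ?B) / \<epsilon>" by (intro cSUP_least) auto
    then show ?thesis using \<epsilon>(1) by (simp add: field_simps)
  qed
  have scale: "T (\<lambda>n. c * x n) = c *\<^sub>R T x" if x: "x \<longlonglongrightarrow> 0" for x c
    using suminf_scaleR_right[OF sm[OF x], of c] by (simp add: T_def)
  have add: "T (\<lambda>n. x n + y n) = T x + T y" if x: "x \<longlonglongrightarrow> 0" and y: "y \<longlonglongrightarrow> 0" for x y
    using suminf_add[OF sm[OF x] sm[OF y]] by (simp add: T_def scaleR_add_left)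
  show ?thesis
    unfolding contains_copy_of_def linear_between_def type_space_simps c0_space_def nspace.simps
    by (rule exI[of _ T], rule exI[of _ "\<epsilon>/2"], rule exI[of _ C]) (use \<epsilon>(1) up lo scale add in simp)
qed

text \<open>If the sequence is not Cauchy, its increments along a subsequence are nonnegative with
  norms at least \<open>e/2\<close>. Signed sums of them are dominated in the lattice by the
  unsigned sum, which telescopes and is bounded by \<open>2 * C\<close>. So they generate a copy of
  \<open>c\<^sub>0\<close>.\<close>

lemma incseq_bounded_convergent:
  fixes u :: "nat \<Rightarrow> 'e::banach_lattice"
  assumes no_c0: "\<not> contains_copy_of (type_space :: 'e nspace) c0_space"
    and u: "incseq u" "\<And>n. norm (u n) \<le> C"
  shows "convergent u"
proof (rule ccontr)
  assume "\<not> convergent u"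
  then have "\<not> Cauchy u" by (simp add: Cauchy_convergent_iff)
  then obtain e where e: "0 < e" "\<And>N. \<exists>m\<ge>N. \<exists>n\<ge>N. e \<le> norm (u m - u n)"
    unfolding Cauchy_iff by (meson not_le)
  have gap: "\<exists>n>N. e/2 \<le> norm (u n - u N)" for N
  proof (rule ccontr)
    assume *: "\<not> ?thesis"
    have lt: "norm (u n - u N) < e/2" if "N \<le> n" for n using * that e(1) by (cases "n = N") (auto simp: not_le)
    obtain m n where mn: "N \<le> m" "N \<le> n" "e \<le> norm (u m - u n)" using e(2) by blast
    have "norm (u m - u n) \<le> norm (u m - u N) + norm (u n - u N)"
      using norm_triangle_ineq4[of "u m - u N" "u n - u N"] by simp
    with lt[OF mn(1)] lt[OF mn(2)] mn(3) show False by linarith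
  qed
  have "\<exists>r::nat \<Rightarrow> nat. \<forall>k. r k < r (Suc k) \<and> e/2 \<le> norm (u (r (Suc k)) - u (r k))"
    using dependent_nat_choice[of "\<lambda>_ _. True" "\<lambda>_ x y. x < y \<and> e/2 \<le> norm (u y - u x)"] gap by auto
  then obtain r where r: "\<And>k. r k < r (Suc k)" "\<And>k. e/2 \<le> norm (u (r (Suc k)) - u (r k))" by blast
  define w where "w k = u (r (Suc k)) - u (r k)" for k
  have w0: "0 \<le> w k" for k using u(1) r(1)[of k] by (simp add: w_def incseq_def)
  have "contains_copy_of (type_space :: 'e nspace) c0_space"
  proof (rule contains_c0[of "e/2" w "2 * C"])
    fix x :: "nat \<Rightarrow> real" and N assume x: "\<And>i. \<bar>x i\<bar> \<le> 1"
    have le: "x i *\<^sub>R w i \<le> w i" "- (x i *\<^sub>R w i) \<le> w i" for i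
      using scaleR_right_mono[OF _ w0[of i], of "x i" 1] scaleR_right_mono[OF _ w0[of i], of "- x i" 1] x[of i]
      by (simp_all add: abs_le_iff)
    have "(\<Sum>i<N. x i *\<^sub>R w i) \<le> (\<Sum>i<N. w i)" by (rule sum_mono) (rule le)
    moreover have "- (\<Sum>i<N. x i *\<^sub>R w i) \<le> (\<Sum>i<N. w i)" unfolding sum_negf[symmetric] by (rule sum_mono) (rule le)
    ultimately have "\<bar>\<Sum>i<N. x i *\<^sub>R w i\<bar> \<le> (\<Sum>i<N. w i)" by (rule abs_leI)
    also have "\<dots> \<le> \<bar>\<Sum>i<N. w i\<bar>" by (rule abs_ge_self)
    finally have "norm (\<Sum>i<N. x i *\<^sub>R w i) \<le> norm (\<Sum>i<N. w i)" by (rule lattice_norm)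
    also have "(\<Sum>i<N. w i) = u (r N) - u (r 0)"
      unfolding w_def by (rule sum_lessThan_telescope)
    also have "norm \<dots> \<le> 2 * C" using norm_triangle_ineq4[of "u (r N)" "u (r 0)"] u(2)[of "r N"] u(2)[of "r 0"] by linarith
    finally show "norm (\<Sum>i<N. x i *\<^sub>R w i) \<le> 2 * C" .
  qed (use e(1) r(2) in \<open>auto simp: w_def\<close>)
  with no_c0 show False by contradiction
qed

text \<open>Convergence of the simple functions is demanded at every point. The norm of such a
  function is then Borel measurable even if the measure is not complete; every class in
  \<open>E(X)\<close> has a representative of this kind.\<close>

definition smeas :: "'w measure \<Rightarrow> ('w \<Rightarrow> 'x::real_normed_vector) \<Rightarrow> bool" where
  "smeas M f \<longleftrightarrow> (\<exists>s. (\<forall>n::nat. simple_function M (s n)) \<and> (\<forall>\<omega>\<in>space M. (\<lambda>n. s n \<omega>) \<longlonglongrightarrow> f \<omega>))"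

lemma smeas_strongly_measurable: "smeas M f \<Longrightarrow> strongly_measurable M f"
  unfolding smeas_def strongly_measurable_def by (elim exE conjE, intro exI conjI, assumption, rule AE_I2) blast

lemma smeas_const: "smeas M (\<lambda>_. c)"
  unfolding smeas_def by (intro exI[of _ "\<lambda>n _. c"]) auto

lemma smeas_add:
  assumes "smeas M f" "smeas M g"
  shows "smeas M (\<lambda>\<omega>. f \<omega> + g \<omega>)"
proof -
  obtain s where s: "\<forall>n::nat. simple_function M (s n)" "\<forall>\<omega>\<in>space M. (\<lambda>n. s n \<omega>) \<longlonglongrightarrow> f \<omega>"
    using assms(1) unfolding smeas_def by blast
  obtain t where t: "\<forall>n::nat. simple_function M (t n)" "\<forall>\<omega>\<in>space M. (\<lambda>n. t n \<omega>) \<longlonglongrightarrow> g \<omega>"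
    using assms(2) unfolding smeas_def by blast
  show ?thesis
    unfolding smeas_def
  proof (intro exI[of _ "\<lambda>n \<omega>. s n \<omega> + t n \<omega>"] conjI allI ballI)
    show "simple_function M (\<lambda>\<omega>. s n \<omega> + t n \<omega>)" for n
      using s(1) t(1) by (intro simple_function_compose2[of M "s n" "t n" "(+)"]) auto
  qed (use s(2) t(2) in \<open>auto intro: tendsto_add\<close>)
qed

lemma smeas_scaleR:
  assumes "smeas M \<phi>" "smeas M f"
  shows "smeas M (\<lambda>\<omega>. \<phi> \<omega> *\<^sub>R f \<omega>)"
proof -
  obtain s where s: "\<forall>n::nat. simple_function M (s n)" "\<forall>\<omega>\<in>space M. (\<lambda>n. s n \<omega>) \<longlonglongrightarrow> \<phi> \<omega>"
    using assms(1) unfolding smeas_def by blast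
  obtain t where t: "\<forall>n::nat. simple_function M (t n)" "\<forall>\<omega>\<in>space M. (\<lambda>n. t n \<omega>) \<longlonglongrightarrow> f \<omega>"
    using assms(2) unfolding smeas_def by blast
  show ?thesis
    unfolding smeas_def
  proof (intro exI[of _ "\<lambda>n \<omega>. s n \<omega> *\<^sub>R t n \<omega>"] conjI allI ballI)
    show "simple_function M (\<lambda>\<omega>. s n \<omega> *\<^sub>R t n \<omega>)" for n
      using s(1) t(1) by (intro simple_function_compose2[of M "s n" "t n" "(*\<^sub>R)"]) auto
  qed (use s(2) t(2) in \<open>auto intro: tendsto_scaleR\<close>)
qed

lemma smeas_indicator: "A \<in> sets M \<Longrightarrow> smeas M (\<lambda>\<omega>. indicator A \<omega> :: real)"
  unfolding smeas_def by (intro exI[of _ "\<lambda>n. indicator A"]) auto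

lemma smeas_norm [measurable (raw)]:
  assumes "smeas M f"
  shows "(\<lambda>\<omega>. norm (f \<omega>)) \<in> borel_measurable M"
proof -
  obtain s where s: "\<And>n::nat. simple_function M (s n)" "\<And>\<omega>. \<omega> \<in> space M \<Longrightarrow> (\<lambda>n. s n \<omega>) \<longlonglongrightarrow> f \<omega>"
    using assms by (auto simp: smeas_def)
  have m: "(\<lambda>\<omega>. norm (s n \<omega>)) \<in> borel_measurable M" for n
    using simple_function_compose1[OF s(1), of norm n] by (rule borel_measurable_simple_function)
  show ?thesis
    by (rule borel_measurable_LIMSEQ_real[of M "\<lambda>n \<omega>. norm (s n \<omega>)"]) (use s(2) m in \<open>auto intro: tendsto_norm\<close>)
qed

lemma strongly_measurable_smeas:
  assumes "strongly_measurable M f"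
  obtains g where "smeas M g" "AE \<omega> in M. g \<omega> = f \<omega>"
proof -
  obtain s where s: "\<And>n. simple_function M (s n)" "AE \<omega> in M. (\<lambda>n. s n \<omega>) \<longlonglongrightarrow> f \<omega>"
    using assms by (auto simp: strongly_measurable_def)
  from AE_E[OF s(2)] obtain N where N: "{\<omega> \<in> space M. \<not> (\<lambda>n. s n \<omega>) \<longlonglongrightarrow> f \<omega>} \<subseteq> N" "emeasure M N = 0" "N \<in> sets M"
    by blast
  define g where "g \<omega> = (if \<omega> \<in> N then 0 else f \<omega>)" for \<omega>
  have "simple_function M (\<lambda>\<omega>. if \<omega> \<in> N then 0 else s n \<omega>)" for n
    using N(3) s(1) by (intro simple_function_If_set simple_function_const) auto
  moreover have "(\<lambda>n. if \<omega> \<in> N then 0 else s n \<omega>) \<longlonglongrightarrow> g \<omega>" if "\<omega> \<in> space M" for \<omega>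
    using N(1) that by (auto simp: g_def)
  ultimately have "smeas M g" unfolding smeas_def by (intro exI[of _ "\<lambda>n \<omega>. if \<omega> \<in> N then 0 else s n \<omega>"]) blast
  moreover have "AE \<omega> in M. g \<omega> = f \<omega>"
    by (rule AE_I[of _ _ N]) (use N in \<open>auto simp: g_def\<close>)
  ultimately show thesis by (rule that)
qed

lemma (in prob_space) AE_limit_smeas:
  fixes h :: "nat \<Rightarrow> 'a \<Rightarrow> 'x::real_normed_vector"
  assumes h: "\<And>n. smeas M (h n)" "AE \<omega> in M. (\<lambda>n. h n \<omega>) \<longlonglongrightarrow> \<gamma> \<omega>"
  obtains g where "smeas M g" "AE \<omega> in M. g \<omega> = \<gamma> \<omega>"
proof -
  have "\<exists>c. cval M c \<and> (AE \<omega> in M. norm (c \<omega> - h n \<omega>) \<le> (1/2)^n)" for n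
  proof (rule strongly_measurable_cval[OF smeas_strongly_measurable[OF h(1)], of "(1/2)^n" n])
    fix c assume "cval M c" "AE \<omega> in M. norm (c \<omega> - h n \<omega>) \<le> (1/2)^n"
    then show ?thesis by blast
  qed simp
  then have "\<forall>n. \<exists>c. cval M c \<and> (AE \<omega> in M. norm (c \<omega> - h n \<omega>) \<le> (1/2)^n)" by blast
  from choice[OF this] obtain c where c: "\<And>n. cval M (c n)" "\<And>n. AE \<omega> in M. norm (c n \<omega> - h n \<omega>) \<le> (1/2)^n" by blast
  have "AE \<omega> in M. \<forall>n. norm (c n \<omega> - h n \<omega>) \<le> (1/2)^n" using c(2) by (simp add: AE_all_countable)
  with h(2) have "AE \<omega> in M. (\<lambda>n. c n \<omega>) \<longlonglongrightarrow> \<gamma> \<omega>"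
  proof eventually_elim
    case (elim \<omega>)
    have "(\<lambda>n. c n \<omega> - h n \<omega>) \<longlonglongrightarrow> 0"
      by (rule Lim_null_comparison[OF always_eventually LIMSEQ_power_zero]) (use elim(2) in auto)
    from tendsto_add[OF elim(1) this] show ?case by simp
  qed
  from AE_limit_strongly_measurable[OF c(1) this] have "strongly_measurable M \<gamma>" .
  then show thesis by (rule strongly_measurable_smeas) (rule that)
qed

lemma ae_class_eqI:
  assumes "AE \<omega> in M. f \<omega> = g \<omega>"
  shows "ae_class M f = ae_class M g"
proof -
  have "AE \<omega> in M. h \<omega> = g \<omega>" if "AE \<omega> in M. h \<omega> = f \<omega>" for h
    using assms that by eventually_elim simp
  moreover have "AE \<omega> in M. h \<omega> = f \<omega>" if "AE \<omega> in M. h \<omega> = g \<omega>" for h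
    using assms that by eventually_elim simp
  ultimately show ?thesis unfolding ae_class_def by blast
qed

section \<open>The function lattice\<close>

locale function_lattice = prob_space M for M :: "'w measure" +
  fixes R :: "'e::banach_lattice \<Rightarrow> 'w \<Rightarrow> real"
  assumes R: "function_lattice_representation M R"
    and no_c0: "\<not> contains_copy_of (type_space :: 'e nspace) c0_space"
begin

text \<open>In this order: integrability, sums, scalar multiples, suprema, injectivity, the ideal
  property, and the bounded functions.\<close>

lemmas R_facts =
  R[unfolded function_lattice_representation_def, THEN conjunct1, rule_format]
  R[unfolded function_lattice_representation_def, THEN conjunct2, THEN conjunct1, rule_format]
  R[unfolded function_lattice_representation_def, THEN conjunct2, THEN conjunct2, THEN conjunct1, rule_format]
  R[unfolded function_lattice_representation_def, THEN conjunct2, THEN conjunct2, THEN conjunct2, THEN conjunct1, rule_format]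
  R[unfolded function_lattice_representation_def, THEN conjunct2, THEN conjunct2, THEN conjunct2, THEN conjunct2, THEN conjunct2, THEN conjunct1, rule_format]
  R[unfolded function_lattice_representation_def, THEN conjunct2, THEN conjunct2, THEN conjunct2, THEN conjunct2, THEN conjunct2, THEN conjunct2, THEN conjunct1, rule_format]
  R[unfolded function_lattice_representation_def, THEN conjunct2, THEN conjunct2, THEN conjunct2, THEN conjunct2, THEN conjunct2, THEN conjunct2, THEN conjunct2, THEN conjunct1, rule_format]

lemma R_minus: "AE \<omega> in M. R (- u) \<omega> = - R u \<omega>"
  using R_facts(3)[of "- 1" u] by simp

lemma R_diff: "AE \<omega> in M. R (u - v) \<omega> = R u \<omega> - R v \<omega>"
  using R_facts(2)[of u "- v"] R_minus[of v] by eventually_elim simp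

lemma R_eq:
  assumes "AE \<omega> in M. R u \<omega> = R v \<omega>"
  shows "u = v"
proof -
  have "AE \<omega> in M. R (u - v) \<omega> = 0" using R_diff[of u v] assms by eventually_elim simp
  from R_facts(5)[OF this] show ?thesis by simp
qed

lemma R_le:
  assumes "AE \<omega> in M. R u \<omega> \<le> R v \<omega>"
  shows "u \<le> v"
proof -
  have "AE \<omega> in M. R (sup u v) \<omega> = R v \<omega>" using R_facts(4)[of u v] assms by eventually_elim auto
  from R_eq[OF this] show ?thesis by (metis sup_ge1)
qed

lemma R_abs: "AE \<omega> in M. R \<bar>u\<bar> \<omega> = \<bar>R u \<omega>\<bar>"
proof -
  have "AE \<omega> in M. R (sup u (- u)) \<omega> = \<bar>R u \<omega>\<bar>"
    using R_facts(4)[of u "- u"] R_minus[of u] by eventually_elim auto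
  then show ?thesis by (simp only: abs_lattice[of u])
qed

lemma R_norm_mono:
  assumes "AE \<omega> in M. \<bar>R u \<omega>\<bar> \<le> \<bar>R v \<omega>\<bar>"
  shows "norm u \<le> norm v"
proof (rule lattice_norm, rule R_le)
  show "AE \<omega> in M. R \<bar>u\<bar> \<omega> \<le> R \<bar>v\<bar> \<omega>" using R_abs[of u] R_abs[of v] assms by eventually_elim simp
qed

lemma R_bounded_norm:
  obtains c where "0 < c" "\<And>u C. 0 \<le> C \<Longrightarrow> AE \<omega> in M. \<bar>R u \<omega>\<bar> \<le> C \<Longrightarrow> norm u \<le> c * C"
proof -
  obtain c where c: "\<And>u C. AE \<omega> in M. \<bar>R u \<omega>\<bar> \<le> C \<Longrightarrow> norm u \<le> c * C"
    using R[unfolded function_lattice_representation_def, THEN conjunct2, THEN conjunct2, THEN conjunct2, THEN conjunct2, THEN conjunct2, THEN conjunct2, THEN conjunct2, THEN conjunct2, THEN conjunct1] by blast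
  have "norm u \<le> max c 1 * C" if "0 \<le> C" "AE \<omega> in M. \<bar>R u \<omega>\<bar> \<le> C" for u C
    using c[OF that(2)] mult_right_mono[OF max.cobounded1 that(1), of c 1] by linarith
  then show thesis by (intro that[of "max c 1"]) auto
qed

lemma R_mean:
  obtains c where "0 < c" "\<And>u. expectation (\<lambda>\<omega>. \<bar>R u \<omega>\<bar>) \<le> c * norm u"
proof -
  obtain c where c: "\<And>u. expectation (\<lambda>\<omega>. \<bar>R u \<omega>\<bar>) \<le> c * norm u"
    using R[unfolded function_lattice_representation_def, THEN conjunct2, THEN conjunct2, THEN conjunct2, THEN conjunct2, THEN conjunct2, THEN conjunct2, THEN conjunct2, THEN conjunct2, THEN conjunct2] by blast
  have "expectation (\<lambda>\<omega>. \<bar>R u \<omega>\<bar>) \<le> max c 1 * norm u" for u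
    using c[of u] mult_right_mono[OF max.cobounded1, of "norm u" c 1] by (metis norm_ge_zero order_trans)
  then show thesis by (intro that[of "max c 1"]) auto
qed

text \<open>Levi's theorem. The norm limit exists since \<open>E\<close> contains no
  \<open>c\<^sub>0\<close>; by the continuous inclusion into \<open>L\<^sup>1\<close> it is the
  almost sure limit of a subsequence, and monotonicity extends this to the whole sequence.\<close>

lemma monotone_limit:
  fixes u :: "nat \<Rightarrow> 'e"
  assumes mono: "\<And>n. AE \<omega> in M. R (u n) \<omega> \<le> R (u (Suc n)) \<omega>" and C: "\<And>n. norm (u n) \<le> C"
  obtains v where "u \<longlonglongrightarrow> v" "norm v \<le> C" "AE \<omega> in M. (\<lambda>n. R (u n) \<omega>) \<longlonglongrightarrow> R v \<omega>"
proof -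
  have "incseq u" by (rule incseq_SucI) (rule R_le[OF mono])
  from incseq_bounded_convergent[OF no_c0 this C] obtain v where v: "u \<longlonglongrightarrow> v" by (auto simp: convergent_def)
  have vC: "norm v \<le> C" by (rule LIMSEQ_le_const2[OF tendsto_norm[OF v]]) (use C in blast)
  obtain c where c: "0 < c" "\<And>u. expectation (\<lambda>\<omega>. \<bar>R u \<omega>\<bar>) \<le> c * norm u" by (rule R_mean) blast
  have "(\<lambda>n. expectation (\<lambda>\<omega>. norm (R (u n - v) \<omega>))) \<longlonglongrightarrow> 0"
  proof (rule Lim_null_comparison[OF always_eventually])
    show "\<forall>n. norm (expectation (\<lambda>\<omega>. norm (R (u n - v) \<omega>))) \<le> c * norm (u n - v)"
      using c(2) by (simp add: abs_of_nonneg)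
    show "(\<lambda>n. c * norm (u n - v)) \<longlonglongrightarrow> 0"
      using tendsto_mult_right_zero[OF tendsto_norm_zero[OF LIM_zero[OF v]], of c] by simp
  qed
  from tendsto_L1_AE_subseq[OF R_facts(1) this] obtain r :: "nat \<Rightarrow> nat"
    where r: "strict_mono r" "AE \<omega> in M. (\<lambda>n. R (u (r n) - v) \<omega>) \<longlonglongrightarrow> 0" by blast
  have d: "AE \<omega> in M. \<forall>n. R (u (r n) - v) \<omega> = R (u (r n)) \<omega> - R v \<omega>"
    using R_diff by (simp add: AE_all_countable)
  have m: "AE \<omega> in M. \<forall>n. R (u n) \<omega> \<le> R (u (Suc n)) \<omega>" using mono by (simp add: AE_all_countable)
  have "AE \<omega> in M. (\<lambda>n. R (u n) \<omega>) \<longlonglongrightarrow> R v \<omega>"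
    using r(2) d m
  proof eventually_elim
    case (elim \<omega>)
    let ?f = "\<lambda>n. R (u n) \<omega>"
    have inc: "incseq ?f" by (rule incseq_SucI) (use elim(3) in blast)
    have lim: "(\<lambda>n. ?f (r n)) \<longlonglongrightarrow> R v \<omega>" using elim(1,2) by (simp add: LIM_zero_iff)
    have "incseq (\<lambda>n. ?f (r n))" using inc strict_mono_leD[OF r(1)] by (auto simp: incseq_def)
    from incseq_le[OF this lim] have "?f (r n) \<le> R v \<omega>" for n .
    moreover have "?f n \<le> ?f (r n)" for n using inc seq_suble[OF r(1), of n] by (simp add: incseq_def)
    ultimately have "?f n \<le> R v \<omega>" for n by (meson order_trans)
    then have "bdd_above (range ?f)" by (intro bdd_aboveI2)
    from LIMSEQ_incseq_SUP[OF this inc] obtain l where l: "?f \<longlonglongrightarrow> l" ..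
    have "(\<lambda>n. ?f (r n)) \<longlonglongrightarrow> l" using LIMSEQ_subseq_LIMSEQ[OF l r(1)] by (simp add: comp_def)
    then have "l = R v \<omega>" using lim by (rule LIMSEQ_unique)
    with l show ?case by simp
  qed
  then show thesis by (rule that[OF v vC])
qed

definition V :: "('w \<Rightarrow> 'x::real_normed_vector) \<Rightarrow> 'e" where
  "V f = (SOME u. AE \<omega> in M. R u \<omega> = norm (f \<omega>))"

definition q :: "('w \<Rightarrow> 'x::real_normed_vector) \<Rightarrow> real" where
  "q f = norm (V f)"

definition S :: "('w \<Rightarrow> 'x::real_normed_vector) set" where
  "S = {f. smeas M f \<and> (\<exists>u. AE \<omega> in M. R u \<omega> = norm (f \<omega>))}"

lemma S_smeas: "f \<in> S \<Longrightarrow> smeas M f"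
  by (simp add: S_def)

lemma V: "f \<in> S \<Longrightarrow> AE \<omega> in M. R (V f) \<omega> = norm (f \<omega>)"
proof -
  assume "f \<in> S"
  then obtain u where "AE \<omega> in M. R u \<omega> = norm (f \<omega>)" by (auto simp: S_def)
  then show ?thesis unfolding V_def by (rule someI)
qed

text \<open>The ideal property: a norm function dominated by an element of \<open>E\<close> belongs
  to \<open>E\<close>, with the corresponding estimate.\<close>

lemma SI:
  assumes f: "smeas M f" and u: "AE \<omega> in M. norm (f \<omega>) \<le> \<bar>R u \<omega>\<bar>"
  shows "f \<in> S" "q f \<le> norm u"
proof -
  have "\<exists>v. AE \<omega> in M. R v \<omega> = norm (f \<omega>)" by (rule R_facts(6)[OF smeas_norm[OF f], of u]) (use u in simp)
  then show S: "f \<in> S" using f by (auto simp: S_def)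
  show "q f \<le> norm u"
    unfolding q_def by (rule R_norm_mono) (use V[OF S] u in \<open>eventually_elim, simp\<close>)
qed

lemma q_mono:
  assumes "g \<in> S" "smeas M f" "AE \<omega> in M. norm (f \<omega>) \<le> norm (g \<omega>)"
  shows "f \<in> S" "q f \<le> q g"
proof -
  have "AE \<omega> in M. norm (f \<omega>) \<le> \<bar>R (V g) \<omega>\<bar>" using assms(3) V[OF assms(1)] by eventually_elim simp
  from SI[OF assms(2) this] show "f \<in> S" "q f \<le> q g" by (simp_all add: q_def)
qed

lemma q_eq:
  assumes u: "AE \<omega> in M. R u \<omega> = norm (f \<omega>)"
  shows "q f = norm u"
proof -
  have "AE \<omega> in M. R (V f) \<omega> = norm (f \<omega>)" unfolding V_def using u by (rule someI)
  then have "AE \<omega> in M. R (V f) \<omega> = R u \<omega>" using u by eventually_elim simp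
  from R_eq[OF this] show ?thesis by (simp add: q_def)
qed

lemma space_rep_S:
  "space_rep (S :: ('w \<Rightarrow> 'x::real_normed_vector) set) q (ae_class M) (vector_valued_space M R)"
proof -
  have add: "f + g \<in> S \<and> q (f + g) \<le> q f + q g" if f: "f \<in> S" and g: "g \<in> S" for f g :: "'w \<Rightarrow> 'x"
  proof -
    have sm: "smeas M (f + g)" using smeas_add[OF S_smeas[OF f] S_smeas[OF g]] by (simp add: plus_fun_def)
    have "AE \<omega> in M. norm ((f + g) \<omega>) \<le> \<bar>R (V f + V g) \<omega>\<bar>"
      using V[OF f] V[OF g] R_facts(2)[of "V f" "V g"]
    proof eventually_elim
      case (elim \<omega>)
      then show ?case using norm_triangle_ineq[of "f \<omega>" "g \<omega>"] by simp
    qed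
    then have "f + g \<in> S" "q (f + g) \<le> norm (V f + V g)" by (rule SI[OF sm])+
    with norm_triangle_ineq[of "V f" "V g"] show ?thesis unfolding q_def by linarith
  qed
  have scale: "c *\<^sub>R f \<in> S \<and> q (c *\<^sub>R f) = \<bar>c\<bar> * q f" if f: "f \<in> S" for c and f :: "'w \<Rightarrow> 'x"
  proof -
    have sm: "smeas M (c *\<^sub>R f)"
      using smeas_scaleR[OF smeas_const S_smeas[OF f], of c] by (simp add: scaleR_fun_def)
    have u: "AE \<omega> in M. R (\<bar>c\<bar> *\<^sub>R V f) \<omega> = norm ((c *\<^sub>R f) \<omega>)"
      using V[OF f] R_facts(3)[of "\<bar>c\<bar>" "V f"] by eventually_elim simp
    then show ?thesis using sm q_eq[of _ "c *\<^sub>R f", OF u] by (auto simp: S_def q_def)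
  qed
  have "\<exists>v. AE \<omega> in M. R v \<omega> = (0::real)" by (rule R_facts(7)[of "\<lambda>_. 0" 0]) auto
  then have "(\<lambda>_. 0 :: 'x) \<in> S" using smeas_const[of M "0::'x"] unfolding S_def by simp
  then have zero: "(0 :: 'w \<Rightarrow> 'x) \<in> S" unfolding zero_fun_def .
  have h1: "subspace (S :: ('w \<Rightarrow> 'x) set)"
    by (rule subspaceI[OF zero conjunct1[OF add] conjunct1[OF scale]])
  have h2: "q (f + g) \<le> q f + q g" if "f \<in> S" "g \<in> S" for f g :: "'w \<Rightarrow> 'x" using add[OF that] by (rule conjunct2)
  have h3: "q (c *\<^sub>R f) = \<bar>c\<bar> * q f" if "f \<in> S" for c and f :: "'w \<Rightarrow> 'x" using scale[OF that] by (rule conjunct2)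
  have h4: "vcarrier (vector_valued_space M R) = ae_class M ` (S :: ('w \<Rightarrow> 'x) set)"
  proof (intro equalityI subsetI)
    fix A :: "('w \<Rightarrow> 'x) set" assume "A \<in> vcarrier (vector_valued_space M R)"
    then obtain f :: "'w \<Rightarrow> 'x" and u where f: "A = ae_class M f" "strongly_measurable M f" "AE \<omega> in M. R u \<omega> = norm (f \<omega>)"
      by (auto simp: vector_valued_space_def)
    obtain g where g: "smeas M g" "AE \<omega> in M. g \<omega> = f \<omega>" by (rule strongly_measurable_smeas[OF f(2)])
    have "AE \<omega> in M. R u \<omega> = norm (g \<omega>)" using f(3) g(2) by eventually_elim simp
    then have "g \<in> S" using g(1) by (auto simp: S_def)
    moreover have "A = ae_class M g" unfolding f(1) using ae_class_eqI[OF g(2)] by (rule sym)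
    ultimately show "A \<in> ae_class M ` S" by blast
  next
    fix A assume "A \<in> ae_class M ` (S :: ('w \<Rightarrow> 'x) set)"
    then show "A \<in> vcarrier (vector_valued_space M R)"
      by (auto simp: vector_valued_space_def S_def intro: smeas_strongly_measurable)
  qed
  have h5: "vadd (vector_valued_space M R) (ae_class M f) (ae_class M g) = ae_class M (f + g)"
    if "f \<in> S" "g \<in> S" for f g :: "'w \<Rightarrow> 'x"
    by (simp add: vadd_ae_class plus_fun_def)
  have h6: "vscale (vector_valued_space M R) c (ae_class M f) = ae_class M (c *\<^sub>R f)"
    if "f \<in> S" for c and f :: "'w \<Rightarrow> 'x"
    by (simp add: vscale_ae_class scaleR_fun_def)
  have h7: "vnorm (vector_valued_space M R) (ae_class M f) = q f" if "f \<in> S" for f :: "'w \<Rightarrow> 'x"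
    using vnorm_ae_class[OF R V[OF that]] by (simp add: q_def)
  have h8: "ae_class M f = ae_class M g" if f: "f \<in> S" and g: "g \<in> S" and q: "q (f - g) = 0"
    for f g :: "'w \<Rightarrow> 'x"
  proof -
    have "f - g \<in> S" by (rule subspace_diff[OF h1 f g])
    from V[OF this] have "AE \<omega> in M. R 0 \<omega> = norm ((f - g) \<omega>)" using q by (simp add: q_def)
    moreover have "AE \<omega> in M. R 0 \<omega> = 0" using R_facts(3)[of 0 0] by simp
    ultimately have "AE \<omega> in M. f \<omega> = g \<omega>" by eventually_elim simp
    then show ?thesis by (rule ae_class_eqI)
  qed
  show ?thesis
    by (rule space_rep.intro, rule h1, erule (1) h2, erule h3, rule h4, erule (1) h5, erule h6, erule h7, rule h8)
qed

end

section \<open>Absolute continuity, Fatou's lemma and completeness in \<open>E(X)\<close>\<close>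

context function_lattice
begin

lemma indicator_S:
  fixes f :: "'w \<Rightarrow> 'x::real_normed_vector"
  assumes "f \<in> S" "A \<in> events"
  shows "(\<lambda>\<omega>. indicator A \<omega> *\<^sub>R f \<omega>) \<in> S" "q (\<lambda>\<omega>. indicator A \<omega> *\<^sub>R f \<omega>) \<le> q f"
proof -
  have sm: "smeas M (\<lambda>\<omega>. indicator A \<omega> *\<^sub>R f \<omega>)"
    by (rule smeas_scaleR[OF smeas_indicator[OF assms(2)] S_smeas[OF assms(1)]])
  have "AE \<omega> in M. norm (indicator A \<omega> *\<^sub>R f \<omega>) \<le> norm (f \<omega>)"
    by (rule AE_I2) (simp add: indicator_def)
  from q_mono[OF assms(1) sm this]
  show "(\<lambda>\<omega>. indicator A \<omega> *\<^sub>R f \<omega>) \<in> S" "q (\<lambda>\<omega>. indicator A \<omega> *\<^sub>R f \<omega>) \<le> q f" .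
qed

text \<open>A sequence of counterexamples \<open>A n\<close> with summable probabilities would have
  tail unions \<open>B n\<close> decreasing to a null set. By Levi's theorem the restrictions of the
  norm function to the complements of \<open>B n\<close> converge in norm to \<open>V f\<close>, so
  what is left on \<open>B n\<close>, and hence on \<open>A n\<close>, becomes small.\<close>

lemma small_sets:
  fixes f :: "'w \<Rightarrow> 'x::real_normed_vector"
  assumes f: "f \<in> S" and \<epsilon>: "0 < \<epsilon>"
  shows "\<exists>\<theta>>0. \<forall>A\<in>events. prob A < \<theta> \<longrightarrow> q (\<lambda>\<omega>. indicator A \<omega> *\<^sub>R f \<omega>) < \<epsilon>"
proof (rule ccontr)
  assume neg: "\<not> ?thesis"
  have "\<forall>n::nat. \<exists>A. A \<in> events \<and> prob A < (1/2)^n \<and> \<epsilon> \<le> q (\<lambda>\<omega>. indicator A \<omega> *\<^sub>R f \<omega>)"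
  proof
    fix n :: nat
    have "0 < (1/2::real)^n" by simp
    with neg show "\<exists>A. A \<in> events \<and> prob A < (1/2)^n \<and> \<epsilon> \<le> q (\<lambda>\<omega>. indicator A \<omega> *\<^sub>R f \<omega>)"
      by (meson not_le)
  qed
  from choice[OF this] obtain A where A: "\<And>n. A n \<in> events" "\<And>n. prob (A n) < (1/2)^n"
    "\<And>n. \<epsilon> \<le> q (\<lambda>\<omega>. indicator (A n) \<omega> *\<^sub>R f \<omega>)" by blast
  have sA: "summable (\<lambda>n. prob (A n))"
  proof (rule summable_comparison_test')
    show "summable (\<lambda>n. (1/2::real)^n)" by (rule summable_geometric) simp
    show "norm (prob (A n)) \<le> (1/2)^n" if "0 \<le> n" for n using A(2)[of n] by simp
  qed
  have ev: "AE \<omega> in M. \<forall>\<^sub>F n in sequentially. \<omega> \<in> space M - A n"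
    by (rule borel_cantelli_AE1[OF A(1) _ sA]) (simp add: less_top[symmetric])
  define B where "B n = (\<Union>k\<in>{n..}. A k)" for n
  have B: "B n \<in> events" for n unfolding B_def using A(1) by (intro sets.countable_UN') auto
  have "\<forall>n. \<exists>u. AE \<omega> in M. R u \<omega> = norm (f \<omega>) * (1 - indicator (B n) \<omega>)"
  proof
    fix n
    show "\<exists>u. AE \<omega> in M. R u \<omega> = norm (f \<omega>) * (1 - indicator (B n) \<omega>)"
    proof (rule R_facts(6)[of _ "V f"])
      show "(\<lambda>\<omega>. norm (f \<omega>) * (1 - indicator (B n) \<omega>)) \<in> borel_measurable M"
        using smeas_norm[OF S_smeas[OF f]] B by measurable
      show "AE \<omega> in M. \<bar>norm (f \<omega>) * (1 - indicator (B n) \<omega>)\<bar> \<le> \<bar>R (V f) \<omega>\<bar>"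
        using V[OF f] by eventually_elim (simp add: indicator_def)
    qed
  qed
  from choice[OF this] obtain u where u: "\<And>n. AE \<omega> in M. R (u n) \<omega> = norm (f \<omega>) * (1 - indicator (B n) \<omega>)" by blast
  have u1: "AE \<omega> in M. R (u n) \<omega> \<le> R (u (Suc n)) \<omega>" for n
    using u[of n] u[of "Suc n"]
  proof eventually_elim
    case (elim \<omega>)
    have "B (Suc n) \<subseteq> B n" unfolding B_def by (intro UN_mono) auto
    then have "indicator (B (Suc n)) \<omega> \<le> (indicator (B n) \<omega> :: real)" by (auto simp: indicator_def)
    then show ?case unfolding elim by (intro mult_left_mono) auto
  qed
  have u2: "norm (u n) \<le> norm (V f)" for n
  proof (rule R_norm_mono)
    show "AE \<omega> in M. \<bar>R (u n) \<omega>\<bar> \<le> \<bar>R (V f) \<omega>\<bar>" using u[of n] V[OF f] by eventually_elim (simp add: indicator_def)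
  qed
  have "\<exists>v. u \<longlonglongrightarrow> v \<and> (AE \<omega> in M. (\<lambda>n. R (u n) \<omega>) \<longlonglongrightarrow> R v \<omega>)"
  proof (rule monotone_limit[of u, OF u1 u2])
    fix v assume "u \<longlonglongrightarrow> v" "AE \<omega> in M. (\<lambda>n. R (u n) \<omega>) \<longlonglongrightarrow> R v \<omega>"
    then show ?thesis by (intro exI[of _ v] conjI)
  qed
  then obtain v where v: "u \<longlonglongrightarrow> v" "AE \<omega> in M. (\<lambda>n. R (u n) \<omega>) \<longlonglongrightarrow> R v \<omega>" by blast
  have u': "AE \<omega> in M. \<forall>n. R (u n) \<omega> = norm (f \<omega>) * (1 - indicator (B n) \<omega>)" using u by (simp add: AE_all_countable)
  have "AE \<omega> in M. R v \<omega> = R (V f) \<omega>"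
    using v(2) u' ev V[OF f]
  proof eventually_elim
    case (elim \<omega>)
    obtain N where N: "\<And>k. N \<le> k \<Longrightarrow> \<omega> \<notin> A k" using elim(3) by (auto simp: eventually_sequentially)
    have "\<omega> \<notin> B n" if "N \<le> n" for n using N that by (auto simp: B_def)
    then have "\<forall>\<^sub>F n in sequentially. R (u n) \<omega> = norm (f \<omega>)"
      unfolding eventually_sequentially by (intro exI[of _ N]) (simp add: elim(2))
    then have "(\<lambda>n. R (u n) \<omega>) \<longlonglongrightarrow> norm (f \<omega>)" by (rule tendsto_eventually)
    from LIMSEQ_unique[OF elim(1) this] show ?case using elim(4) by simp
  qed
  from R_eq[OF this] have "u \<longlonglongrightarrow> V f" using v(1) by simp
  from tendsto_diff[OF tendsto_const[of "V f"] this] have "(\<lambda>n. V f - u n) \<longlonglongrightarrow> 0" by simp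
  then have "(\<lambda>n. norm (V f - u n)) \<longlonglongrightarrow> 0" by (rule tendsto_norm_zero)
  from order_tendstoD(2)[OF this \<epsilon>] obtain n where n: "norm (V f - u n) < \<epsilon>"
    by (auto simp: eventually_sequentially)
  have "q (\<lambda>\<omega>. indicator (A n) \<omega> *\<^sub>R f \<omega>) \<le> norm (V f - u n)"
  proof (rule SI(2)[OF S_smeas[OF indicator_S(1)[OF f A(1)]]])
    show "AE \<omega> in M. norm (indicator (A n) \<omega> *\<^sub>R f \<omega>) \<le> \<bar>R (V f - u n) \<omega>\<bar>"
      using R_diff[of "V f" "u n"] V[OF f] u[of n]
    proof eventually_elim
      case (elim \<omega>)
      have "A n \<subseteq> B n" by (auto simp: B_def)
      then show ?case unfolding elim by (auto simp: indicator_def)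
    qed
  qed
  with n A(3)[of n] show False by linarith
qed

text \<open>Levi's theorem for the infima \<open>\<phi> n\<close> of the tails: they increase to the
  norm of the limit and lie below the norms of \<open>h n\<close>, so they are bounded by
  \<open>C\<close> in \<open>E\<close>.\<close>

lemma fatou:
  fixes h :: "nat \<Rightarrow> 'w \<Rightarrow> 'x::real_normed_vector"
  assumes h: "\<And>n. h n \<in> S" "\<And>n. q (h n) \<le> C" and lim: "AE \<omega> in M. (\<lambda>n. h n \<omega>) \<longlonglongrightarrow> \<gamma> \<omega>"
  shows "\<exists>g\<in>S. (AE \<omega> in M. g \<omega> = \<gamma> \<omega>) \<and> q g \<le> C"
proof -
  define \<phi> where "\<phi> n \<omega> = (INF k\<in>{n..}. norm (h k \<omega>))" for n \<omega>
  have bdd: "bdd_below ((\<lambda>k. norm (h k \<omega>)) ` A)" for A \<omega> by (intro bdd_belowI2[of _ 0]) simp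
  have \<phi>le: "\<phi> n \<omega> \<le> norm (h n \<omega>)" for n \<omega> unfolding \<phi>_def by (intro cINF_lower bdd) simp
  have \<phi>0: "0 \<le> \<phi> n \<omega>" for n \<omega> unfolding \<phi>_def by (intro cINF_greatest) auto
  have \<phi>mono: "\<phi> n \<omega> \<le> \<phi> (Suc n) \<omega>" for n \<omega> unfolding \<phi>_def by (intro cINF_superset_mono bdd) auto
  have "\<forall>n. \<exists>u. AE \<omega> in M. R u \<omega> = \<phi> n \<omega>"
  proof
    fix n
    show "\<exists>u. AE \<omega> in M. R u \<omega> = \<phi> n \<omega>"
    proof (rule R_facts(6)[of _ "V (h n)"])
      show "\<phi> n \<in> borel_measurable M"
        unfolding \<phi>_def by (intro borel_measurable_cINF bdd smeas_norm S_smeas h(1)) simp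
      show "AE \<omega> in M. \<bar>\<phi> n \<omega>\<bar> \<le> \<bar>R (V (h n)) \<omega>\<bar>"
        using V[OF h(1)[of n]] by eventually_elim (simp add: \<phi>le \<phi>0)
    qed
  qed
  from choice[OF this] obtain u where u: "\<And>n. AE \<omega> in M. R (u n) \<omega> = \<phi> n \<omega>" by blast
  have u1: "AE \<omega> in M. R (u n) \<omega> \<le> R (u (Suc n)) \<omega>" for n
    using u[of n] u[of "Suc n"] by eventually_elim (simp add: \<phi>mono)
  have u2: "norm (u n) \<le> C" for n
  proof -
    have "AE \<omega> in M. \<bar>R (u n) \<omega>\<bar> \<le> \<bar>R (V (h n)) \<omega>\<bar>"
      using u[of n] V[OF h(1)[of n]] by eventually_elim (simp add: \<phi>le \<phi>0)
    from R_norm_mono[OF this] h(2)[of n] show ?thesis by (simp add: q_def)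
  qed
  have "\<exists>v. norm v \<le> C \<and> (AE \<omega> in M. (\<lambda>n. R (u n) \<omega>) \<longlonglongrightarrow> R v \<omega>)"
    by (rule monotone_limit[of u, OF u1 u2]) blast
  then obtain v where v: "norm v \<le> C" "AE \<omega> in M. (\<lambda>n. R (u n) \<omega>) \<longlonglongrightarrow> R v \<omega>" by blast
  obtain g where g: "smeas M g" "AE \<omega> in M. g \<omega> = \<gamma> \<omega>"
    by (rule AE_limit_smeas[of h \<gamma>, OF S_smeas[OF h(1)] lim])
  have u': "AE \<omega> in M. \<forall>n. R (u n) \<omega> = \<phi> n \<omega>" using u by (simp add: AE_all_countable)
  have gv: "AE \<omega> in M. R v \<omega> = norm (g \<omega>)"
    using v(2) u' lim g(2)
  proof eventually_elim
    case (elim \<omega>)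
    have hn: "(\<lambda>n. norm (h n \<omega>)) \<longlonglongrightarrow> norm (\<gamma> \<omega>)" by (rule tendsto_norm[OF elim(3)])
    have "(\<lambda>n. \<phi> n \<omega>) \<longlonglongrightarrow> norm (\<gamma> \<omega>)"
    proof (rule LIMSEQ_I)
      fix e :: real assume e: "0 < e"
      obtain N where N: "\<And>n. N \<le> n \<Longrightarrow> norm (norm (h n \<omega>) - norm (\<gamma> \<omega>)) < e/2"
        using LIMSEQ_D[OF hn, of "e/2"] e by auto
      have "norm (\<phi> n \<omega> - norm (\<gamma> \<omega>)) < e" if n: "N \<le> n" for n
      proof -
        have "norm (\<gamma> \<omega>) - e/2 \<le> \<phi> n \<omega>"
          unfolding \<phi>_def
        proof (rule cINF_greatest)
          fix k assume "k \<in> {n..}"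
          then have "N \<le> k" using n by simp
          from N[OF this] show "norm (\<gamma> \<omega>) - e/2 \<le> norm (h k \<omega>)" unfolding real_norm_def by linarith
        qed simp
        then show ?thesis using \<phi>le[of n \<omega>] N[OF n] e unfolding real_norm_def by linarith
      qed
      then show "\<exists>N. \<forall>n\<ge>N. norm (\<phi> n \<omega> - norm (\<gamma> \<omega>)) < e" by blast
    qed
    then have "R v \<omega> = norm (\<gamma> \<omega>)" by (intro LIMSEQ_unique[of "\<lambda>n. \<phi> n \<omega>"]) (use elim(1,2) in simp_all)
    then show ?case unfolding elim(4) .
  qed
  from gv g(1) have "g \<in> S" by (auto simp: S_def)
  moreover have "q g \<le> C" using q_eq[OF gv] v(1) by simp
  ultimately show ?thesis using g(2) by blast
qed

lemma S_mean:
  "\<exists>c>0. \<forall>f\<in>(S :: ('w \<Rightarrow> 'x::real_normed_vector) set).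
     integrable M (\<lambda>\<omega>. norm (f \<omega>)) \<and> expectation (\<lambda>\<omega>. norm (f \<omega>)) \<le> c * q f"
proof -
  obtain c where c: "0 < c" "\<And>u. expectation (\<lambda>\<omega>. \<bar>R u \<omega>\<bar>) \<le> c * norm u" by (rule R_mean) blast
  have *: "integrable M (\<lambda>\<omega>. norm (f \<omega>)) \<and> expectation (\<lambda>\<omega>. norm (f \<omega>)) \<le> c * q f"
    if f: "f \<in> S" for f :: "'w \<Rightarrow> 'x"
  proof -
    have ae: "AE \<omega> in M. \<bar>R (V f) \<omega>\<bar> = norm (f \<omega>)" using V[OF f] by eventually_elim simp
    have m: "(\<lambda>\<omega>. \<bar>R (V f) \<omega>\<bar>) \<in> borel_measurable M" using R_facts(1)[of "V f"] by simp
    note n = smeas_norm[OF S_smeas[OF f]]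
    show ?thesis
      using R_facts(1)[of "V f"] c(2)[of "V f"] integrable_cong_AE[OF m n ae] integral_cong_AE[OF m n ae]
      by (simp add: q_def)
  qed
  then have "\<forall>f\<in>(S :: ('w \<Rightarrow> 'x) set). integrable M (\<lambda>\<omega>. norm (f \<omega>)) \<and> expectation (\<lambda>\<omega>. norm (f \<omega>)) \<le> c * q f" ..
  with c(1) show ?thesis by (intro exI[of _ c] conjI)
qed

text \<open>The Riesz-Fischer argument: along a fast subsequence the differences are summable in
  mean, hence almost everywhere. Fatou's lemma for \<open>y (n + k) - y k\<close> shows at once that
  the limit belongs to the space and how close \<open>y k\<close> is to it.\<close>

lemma S_complete:
  fixes x :: "nat \<Rightarrow> 'w \<Rightarrow> 'x::banach"
  assumes x: "\<And>n. x n \<in> S" and cauchy: "\<And>\<epsilon>. 0 < \<epsilon> \<Longrightarrow> \<exists>N. \<forall>m\<ge>N. \<forall>n\<ge>N. q (x m - x n) < \<epsilon>"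
  shows "\<exists>y\<in>S. (\<lambda>n. q (x n - y)) \<longlonglongrightarrow> 0"
proof -
  interpret X: space_rep "S :: ('w \<Rightarrow> 'x) set" q "ae_class M" "vector_valued_space M R" by (rule space_rep_S)
  have "\<forall>k::nat. \<exists>N. \<forall>m\<ge>N. \<forall>n\<ge>N. q (x m - x n) < (1/2)^k" using cauchy by simp
  from choice[OF this] obtain N where N: "\<And>k m n. N k \<le> m \<Longrightarrow> N k \<le> n \<Longrightarrow> q (x m - x n) < (1/2)^k" by blast
  define r where "r k = Max (N ` {..k})" for k
  have rN: "N k \<le> r k" and rmono: "r k \<le> r (Suc k)" for k
    unfolding r_def by (auto intro!: Max_ge Max_mono)
  define y where "y k = x (r k)" for k
  have yS: "y k \<in> S" for k unfolding y_def by (rule x)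
  have r_le: "r k \<le> r m" if "k \<le> m" for k m using rmono that by (rule lift_Suc_mono_le)
  have yq: "q (y m - y k) < (1/2)^k" if "k \<le> m" for k m
    unfolding y_def using rN[of k] r_le[OF that] by (intro N) auto
  define d where "d k = y (Suc k) - y k" for k
  have dS: "d k \<in> S" for k unfolding d_def by (rule X.S_closed(4)[OF yS yS])
  obtain c where "0 < c \<and> (\<forall>f\<in>(S :: ('w \<Rightarrow> 'x) set).
      integrable M (\<lambda>\<omega>. norm (f \<omega>)) \<and> expectation (\<lambda>\<omega>. norm (f \<omega>)) \<le> c * q f)" using S_mean ..
  then have c: "0 < c" "\<And>f :: 'w \<Rightarrow> 'x. f \<in> S \<Longrightarrow> integrable M (\<lambda>\<omega>. norm (f \<omega>))"
    "\<And>f :: 'w \<Rightarrow> 'x. f \<in> S \<Longrightarrow> expectation (\<lambda>\<omega>. norm (f \<omega>)) \<le> c * q f" by simp_all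
  have "summable (\<lambda>k. expectation (\<lambda>\<omega>. \<bar>norm (d k \<omega>)\<bar>))"
  proof (rule summable_comparison_test')
    show "summable (\<lambda>k. c * (1/2::real)^k)" by (intro summable_mult summable_geometric) simp
    show "norm (expectation (\<lambda>\<omega>. \<bar>norm (d k \<omega>)\<bar>)) \<le> c * (1/2)^k" if "0 \<le> k" for k
    proof -
      have "c * q (d k) \<le> c * (1/2)^k" using yq[of k "Suc k"] c(1) by (intro mult_left_mono) (simp_all add: d_def)
      then show ?thesis using c(3)[OF dS[of k]] by simp
    qed
  qed
  from AE_summable_abs[of "\<lambda>k \<omega>. norm (d k \<omega>)", OF c(2)[OF dS] this] have "AE \<omega> in M. summable (\<lambda>k. \<bar>norm (d k \<omega>)\<bar>)" .
  then have conv: "AE \<omega> in M. (\<lambda>n. y n \<omega>) \<longlonglongrightarrow> lim (\<lambda>n. y n \<omega>)"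
  proof eventually_elim
    case (elim \<omega>)
    have "summable (\<lambda>k. d k \<omega>)" by (rule summable_norm_cancel) (use elim in simp)
    then have "(\<lambda>n. \<Sum>k<n. d k \<omega>) \<longlonglongrightarrow> (\<Sum>k. d k \<omega>)" by (rule summable_LIMSEQ)
    moreover have "(\<Sum>k<n. d k \<omega>) = y n \<omega> - y 0 \<omega>" for n
      by (induction n) (simp_all add: d_def)
    ultimately have "(\<lambda>n. y n \<omega> - y 0 \<omega>) \<longlonglongrightarrow> (\<Sum>k. d k \<omega>)" by simp
    from tendsto_add[OF this tendsto_const[of "y 0 \<omega>"]] have "convergent (\<lambda>n. y n \<omega>)" by (auto simp: convergent_def)
    then show ?case by (simp add: convergent_LIMSEQ_iff)
  qed
  define \<gamma> where "\<gamma> \<omega> = lim (\<lambda>n. y n \<omega>)" for \<omega>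
  have lim: "AE \<omega> in M. (\<lambda>n. y n \<omega>) \<longlonglongrightarrow> \<gamma> \<omega>" using conv by (simp add: \<gamma>_def)
  have g: "\<exists>g\<in>S. (AE \<omega> in M. g \<omega> = \<gamma> \<omega> - y k \<omega>) \<and> q g \<le> (1/2)^k" for k
  proof (rule fatou[of "\<lambda>n. y (n + k) - y k"])
    show "y (n + k) - y k \<in> S" for n by (rule X.S_closed(4)[OF yS yS])
    show "q (y (n + k) - y k) \<le> (1/2)^k" for n using yq[of k "n + k"] by simp
    show "AE \<omega> in M. (\<lambda>n. (y (n + k) - y k) \<omega>) \<longlonglongrightarrow> \<gamma> \<omega> - y k \<omega>"
      using lim
    proof eventually_elim
      case (elim \<omega>)
      from tendsto_diff[OF LIMSEQ_ignore_initial_segment[OF elim, of k] tendsto_const[of "y k \<omega>"]] show ?case by simp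
    qed
  qed
  obtain g0 where g0: "g0 \<in> S" "AE \<omega> in M. g0 \<omega> = \<gamma> \<omega> - y 0 \<omega>" using g[of 0] by blast
  define z where "z = g0 + y 0"
  have zS: "z \<in> S" unfolding z_def by (rule X.S_closed(2)[OF g0(1) yS])
  have z: "AE \<omega> in M. z \<omega> = \<gamma> \<omega>" using g0(2) by eventually_elim (simp add: z_def)
  have zq: "q (y k - z) \<le> (1/2)^k" for k
  proof -
    obtain gk where gk: "gk \<in> S" "AE \<omega> in M. gk \<omega> = \<gamma> \<omega> - y k \<omega>" "q gk \<le> (1/2)^k" using g[of k] by blast
    have "AE \<omega> in M. norm ((y k - z) \<omega>) \<le> norm (gk \<omega>)"
      using gk(2) z by eventually_elim (simp add: norm_minus_commute)
    from q_mono(2)[OF gk(1) S_smeas[OF X.S_closed(4)[OF yS zS]] this] gk(3) show ?thesis by linarith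
  qed
  have "(\<lambda>n. q (x n - z)) \<longlonglongrightarrow> 0"
  proof (rule LIMSEQ_I)
    fix e :: real assume e: "0 < e"
    obtain k where k: "(1/2::real)^k < e/2" using real_arch_pow_inv[of "e/2" "1/2"] e by auto
    have "norm (q (x n - z) - 0) < e" if "r k \<le> n" for n
    proof -
      have "q (x n - y k) < (1/2)^k" unfolding y_def using that rN[of k] by (intro N) auto
      then have "q (x n - z) < e"
        using X.q_triangle[OF x[of n] yS[of k] zS] zq[of k] k by linarith
      then show ?thesis using X.q_nonneg[OF X.S_closed(4)[OF x[of n] zS]] by simp
    qed
    then show "\<exists>N. \<forall>n\<ge>N. norm (q (x n - z) - 0) < e" by blast
  qed
  then show ?thesis using zS by blast
qed

lemma const_S:
  obtains c where "0 < c" "\<And>x :: 'x::real_normed_vector. (\<lambda>_. x) \<in> S" "\<And>x :: 'x. q (\<lambda>_. x) = norm x * c"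
proof -
  have "\<exists>e. AE \<omega> in M. R e \<omega> = (1::real)" by (rule R_facts(7)[of "\<lambda>_. 1" 1]) auto
  then obtain e where e: "AE \<omega> in M. R e \<omega> = 1" by blast
  have u: "AE \<omega> in M. R (norm x *\<^sub>R e) \<omega> = norm x" for x :: 'x
    using R_facts(3)[of "norm x" e] e by eventually_elim simp
  have "e \<noteq> 0"
  proof
    assume "e = 0"
    then have "AE \<omega> in M. R e \<omega> = 0" using R_facts(3)[of 0 0] by simp
    with e have "AE \<omega> in M. False" by eventually_elim simp
    then show False by simp
  qed
  show thesis
  proof (rule that[of "norm e"])
    show "0 < norm e" using \<open>e \<noteq> 0\<close> by simp
    show "(\<lambda>_. x) \<in> S" for x :: 'x using u[of x] smeas_const[of M x] by (auto simp: S_def)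
    show "q (\<lambda>_. x) = norm x * norm e" for x :: 'x using q_eq[of _ "\<lambda>_. x", OF u] by simp
  qed
qed

text \<open>
  If \<open>L\<close> stayed away from zero on \<open>h n - g\<close>, it would do so on the restrictions to disjoint sets
  \<open>C k\<close>, as \<open>h n - g\<close> is uniformly small outside small sets. The functionals \<open>f \<mapsto> L (f \<cdot> 1_{C k})\<close>
  form a weakly unconditionally Cauchy series.
\<close>

lemma weak_null:
  fixes h :: "nat \<Rightarrow> 'w \<Rightarrow> 'x::real_normed_vector"
  assumes VK: "Vstar_set (vector_valued_space M R) (ae_class M ` K)" and K: "K \<subseteq> S"
    and h: "\<And>n. h n \<in> convex hull K" and g: "g \<in> S" and lim: "AE \<omega> in M. (\<lambda>n. h n \<omega>) \<longlonglongrightarrow> g \<omega>"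
    and L: "linear L" "\<And>f. f \<in> S \<Longrightarrow> L f \<le> q f" and \<delta>: "0 < \<delta>"
  shows "\<exists>n. L (h n - g) < \<delta>"
proof (rule ccontr)
  assume neg: "\<not> ?thesis"
  interpret X: space_rep "S :: ('w \<Rightarrow> 'x) set" q "ae_class M" "vector_valued_space M R" by (rule space_rep_S)
  have "convex hull K \<subseteq> S" by (intro hull_minimal K subspace_imp_convex X.S)
  then have hS: "h n \<in> S" for n using h by blast
  define D where "D n = h n - g" for n
  have DS: "D n \<in> S" for n unfolding D_def by (rule X.S_closed(4)[OF hS g])
  have LD: "\<delta> \<le> L (D n)" for n using neg by (auto simp: D_def not_less)
  define m where "m A f = (\<lambda>\<omega>. indicator A \<omega> *\<^sub>R f \<omega>)" for A :: "'w set" and f :: "'w \<Rightarrow> 'x"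
  have mS: "m A f \<in> S" "q (m A f) \<le> q f" if "f \<in> S" "A \<in> events" for A f
    using indicator_S[OF that] by (simp_all add: m_def)
  have Labs: "\<bar>L f\<bar> \<le> q f" if "f \<in> S" for f
    using L(2)[OF that] L(2)[OF X.S_closed(5)[OF that]] X.q_minus[OF that] linear_neg[OF L(1), of f]
    by (simp add: abs_le_iff)
  obtain c where c: "0 < c" "\<And>u C. 0 \<le> C \<Longrightarrow> AE \<omega> in M. \<bar>R u \<omega>\<bar> \<le> C \<Longrightarrow> norm u \<le> c * C"
    using R_bounded_norm by blast
  \<comment> \<open>Where the norm of \<open>D n\<close> is at most \<open>\<eta>\<close>, its
    contribution has norm at most \<open>c * \<eta> = \<delta>/4\<close>.\<close>
  define \<eta> where "\<eta> = \<delta> / (4 * c)"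
  have \<eta>: "0 < \<eta>" using \<delta> c(1) by (simp add: \<eta>_def)
  define E where "E n = {\<omega> \<in> space M. \<exists>i\<ge>n. \<eta> < norm (D i \<omega>)}" for n
  have E: "E n \<in> events" for n
  proof -
    have "E n = (\<Union>i\<in>{n..}. {\<omega> \<in> space M. \<eta> < norm (D i \<omega>)})" by (auto simp: E_def)
    also have "\<dots> \<in> events"
      using smeas_norm[OF S_smeas[OF DS]] by (intro sets.countable_UN') auto
    finally show ?thesis .
  qed
  have Emono: "E n \<subseteq> E k" if "k \<le> n" for k n unfolding E_def using order_trans[OF that] by blast
  have PE: "(\<lambda>n. prob (E n)) \<longlonglongrightarrow> 0"
  proof (rule prob_tendsto_0[OF E])
    show "AE \<omega> in M. \<forall>\<^sub>F n in sequentially. \<omega> \<notin> E n"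
      using lim
    proof eventually_elim
      case (elim \<omega>)
      obtain N where "\<And>n. N \<le> n \<Longrightarrow> norm (h n \<omega> - g \<omega>) < \<eta>" using LIMSEQ_D[OF elim \<eta>] by blast
      then have N: "\<not> \<eta> < norm (D i \<omega>)" if "N \<le> i" for i using that by (simp add: D_def not_less less_imp_le)
      have "\<omega> \<notin> E n" if n: "N \<le> n" for n
      proof
        assume "\<omega> \<in> E n"
        then obtain i where "n \<le> i" "\<eta> < norm (D i \<omega>)" unfolding E_def by blast
        then show False using N[of i] n by simp
      qed
      then show ?case unfolding eventually_sequentially by (intro exI[of _ N] allI impI)
    qed
  qed
  have off: "L (D n) - L (m (E n) (D n)) \<le> \<delta>/4" for n
  proof -
    let ?f = "D n - m (E n) (D n)"
    have fS: "?f \<in> S" by (rule X.S_closed(4)[OF DS mS(1)[OF DS E]])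
    have "norm (V ?f) \<le> c * \<eta>"
    proof (rule c(2))
      show "AE \<omega> in M. \<bar>R (V ?f) \<omega>\<bar> \<le> \<eta>"
        using V[OF fS] AE_space
      proof eventually_elim
        case (elim \<omega>)
        have "norm (?f \<omega>) \<le> \<eta>" using elim(2) \<eta> by (auto simp: m_def E_def indicator_def not_less)
        then show ?case unfolding elim(1) by simp
      qed
    qed (use \<eta> in simp)
    moreover have "c * \<eta> = \<delta>/4" using c(1) by (simp add: \<eta>_def)
    ultimately have "q ?f \<le> \<delta>/4" by (simp add: q_def)
    then show ?thesis using L(2)[OF fS] by (simp add: linear_diff[OF L(1)])
  qed
  have "\<forall>n. \<exists>\<theta>>0. \<forall>A\<in>events. prob A < \<theta> \<longrightarrow> q (m A (D n)) < \<delta>/4"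
    unfolding m_def using small_sets[OF DS, of "\<delta>/4"] \<delta> by simp
  from choice[OF this] obtain \<theta> where
    \<theta>: "\<And>n. 0 < \<theta> n" "\<And>n A. A \<in> events \<Longrightarrow> prob A < \<theta> n \<Longrightarrow> q (m A (D n)) < \<delta>/4" by blast
  have "\<forall>\<^sub>F n in sequentially. prob (E n) < \<theta> p" for p by (rule order_tendstoD(2)[OF PE \<theta>(1)])
  from sparse_sequence[of "\<lambda>p n. prob (E n) < \<theta> p" 0, OF this] obtain r :: "nat \<Rightarrow> nat"
    where r: "strict_mono r" "\<And>i j. i < j \<Longrightarrow> prob (E (r j)) < \<theta> (r i)" by blast
  \<comment> \<open>By the choice of \<open>r\<close>, the set \<open>E (r (Suc k))\<close> is
    negligible for \<open>D (r k)\<close>, so the disjoint differences \<open>C k\<close> retain the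
    essential part of \<open>D (r k)\<close>.\<close>
  define C where "C k = E (r k) - E (r (Suc k))" for k
  have C: "C k \<in> events" for k using E by (simp add: C_def)
  have indC: "(indicator (C k) \<omega> :: real) = indicator (E (r k)) \<omega> - indicator (E (r (Suc k))) \<omega>" for k \<omega>
    using Emono[of "r k" "r (Suc k)"] strict_mono_less[OF r(1), of k "Suc k"] by (auto simp: C_def indicator_def)
  have mC: "m (E (r k)) f = m (C k) f + m (E (r (Suc k))) f" for k f
    by (auto simp: m_def fun_eq_iff indC scaleR_diff_left)
  define \<zeta> where "\<zeta> k f = L (m (C k) f)" for k f
  have lin: "\<zeta> k (f + f') = \<zeta> k f + \<zeta> k f'" "\<zeta> k (a *\<^sub>R f) = a * \<zeta> k f" for k f f' a
  proof -
    have "m (C k) (f + f') = m (C k) f + m (C k) f'" "m (C k) (a *\<^sub>R f) = a *\<^sub>R m (C k) f"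
      by (auto simp: m_def fun_eq_iff scaleR_add_right)
    then show "\<zeta> k (f + f') = \<zeta> k f + \<zeta> k f'" "\<zeta> k (a *\<^sub>R f) = a * \<zeta> k f"
      by (simp_all add: \<zeta>_def linear_add[OF L(1)] linear_cmul[OF L(1)])
  qed
  have fn: "X.functional (\<zeta> k) 1" for k
    unfolding X.functional_def
  proof (intro conjI ballI allI)
    fix f :: "'w \<Rightarrow> 'x" assume f: "f \<in> S"
    show "\<bar>\<zeta> k f\<bar> \<le> 1 * q f" using Labs[OF mS(1)[OF f C]] mS(2)[OF f C] by (simp add: \<zeta>_def) (meson order_trans)
  qed (rule lin)+
  have bd: "(\<Sum>k<N. \<bar>\<zeta> k f\<bar>) \<le> 1 * q f" if f: "f \<in> S" for f N
  proof -
    \<comment> \<open>The sets \<open>C k\<close> are disjoint, so the signed sum of restrictions of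
      \<open>f\<close> is dominated pointwise by \<open>f\<close> itself; its value under
      \<open>L\<close> is the sum of the absolute values.\<close>
    define F where "F = (\<Sum>k<N. sgn (\<zeta> k f) *\<^sub>R m (C k) f)"
    have FS: "F \<in> S" unfolding F_def by (intro subspace_sum[OF X.S] X.S_closed(3) mS(1) f C)
    have "(\<Sum>k<N. \<bar>\<zeta> k f\<bar>) = L F"
      by (simp add: F_def linear_sum[OF L(1)] linear_cmul[OF L(1)] \<zeta>_def abs_sgn mult.commute)
    also have "\<dots> \<le> q F" by (rule L(2)[OF FS])
    also have "q F \<le> q f"
    proof (rule q_mono(2)[OF f S_smeas[OF FS]], rule AE_I2)
      fix \<omega>
      have "F \<omega> = (\<Sum>k<N. sgn (\<zeta> k f) * indicator (C k) \<omega>) *\<^sub>R f \<omega>"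
        by (simp only: F_def sum_fun_apply m_def scaleR_sum_left scaleR_fun_apply scaleR_scaleR)
      then have "norm (F \<omega>) = \<bar>\<Sum>k<N. sgn (\<zeta> k f) * indicator (C k) \<omega>\<bar> * norm (f \<omega>)" by (simp only: norm_scaleR)
      also have "\<dots> \<le> 1 * norm (f \<omega>)"
      proof (rule mult_right_mono)
        have "\<bar>\<Sum>k<N. sgn (\<zeta> k f) * indicator (C k) \<omega>\<bar> \<le> (\<Sum>k<N. indicator (C k) \<omega>)"
          by (rule order_trans[OF sum_abs]) (intro sum_mono, simp add: abs_mult indicator_def abs_sgn_eq)
        also have "\<dots> = indicator (E (r 0)) \<omega> - indicator (E (r N)) \<omega>"
          unfolding indC by (rule sum_lessThan_telescope')
        also have "\<dots> \<le> 1" by (simp add: indicator_def)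
        finally show "\<bar>\<Sum>k<N. sgn (\<zeta> k f) * indicator (C k) \<omega>\<bar> \<le> 1" .
      qed simp
      finally show "norm (F \<omega>) \<le> norm (f \<omega>)" by simp
    qed
    finally show ?thesis by simp
  qed
  have ev: "\<forall>\<^sub>F i in sequentially. \<bar>\<zeta> i (h (r i))\<bar> < \<delta>/4"
    by (rule X.Vstar_tendsto[of K \<zeta> "\<lambda>_. 1" 1 "\<lambda>i. h (r i)", OF VK K fn bd h]) (use \<delta> in simp_all)
  \<comment> \<open>The fixed function \<open>g\<close> is small on \<open>C i\<close> for late
    \<open>i\<close> by absolute continuity, so \<open>\<zeta> i\<close> at \<open>D (r i)\<close>
    is small together with \<open>\<zeta> i\<close> at \<open>h (r i)\<close>.\<close>
  have "\<exists>\<theta>'>0. \<forall>A\<in>events. prob A < \<theta>' \<longrightarrow> q (m A g) < \<delta>/4"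
    unfolding m_def by (rule small_sets[OF g]) (use \<delta> in simp)
  then obtain \<theta>' where \<theta>': "0 < \<theta>'" "\<And>A. A \<in> events \<Longrightarrow> prob A < \<theta>' \<Longrightarrow> q (m A g) < \<delta>/4" by blast
  have "(\<lambda>i. prob (E (r i))) \<longlonglongrightarrow> 0" using LIMSEQ_subseq_LIMSEQ[OF PE r(1)] by (simp add: comp_def)
  from order_tendstoD(2)[OF this \<theta>'(1)] ev have "\<forall>\<^sub>F i in sequentially. prob (E (r i)) < \<theta>' \<and> \<bar>\<zeta> i (h (r i))\<bar> < \<delta>/4"
    by (rule eventually_conj)
  then obtain i where i: "prob (E (r i)) < \<theta>'" "\<bar>\<zeta> i (h (r i))\<bar> < \<delta>/4" by (auto simp: eventually_sequentially)
  have "prob (C i) \<le> prob (E (r i))" by (rule finite_measure_mono[OF _ E]) (auto simp: C_def)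
  then have "q (m (C i) g) < \<delta>/4" using i(1) by (intro \<theta>'(2) C) linarith
  then have \<zeta>g: "\<bar>\<zeta> i g\<bar> < \<delta>/4" using Labs[OF mS(1)[OF g C], of i] by (simp add: \<zeta>_def)
  \<comment> \<open>The part off \<open>E (r i)\<close>, the part on \<open>E (r (Suc i))\<close>,
    and the values of \<open>\<zeta> i\<close> at \<open>h (r i)\<close> and at \<open>g\<close>
    contribute at most \<open>\<delta>/4\<close> each, some of them strictly less.\<close>
  have "L (m (E (r (Suc i))) (D (r i))) < \<delta>/4"
    using L(2)[OF mS(1)[OF DS E]] \<theta>(2)[OF E r(2)[of i "Suc i"]] by (meson lessI order.strict_trans1)
  moreover have "L (m (E (r i)) (D (r i))) = \<zeta> i (D (r i)) + L (m (E (r (Suc i))) (D (r i)))"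
    unfolding mC[of i] \<zeta>_def by (simp add: linear_add[OF L(1)])
  moreover have "\<zeta> i (h (r i)) = \<zeta> i (D (r i)) + \<zeta> i g" using lin(1)[of i "D (r i)" g] by (simp add: D_def)
  ultimately show False using off[of "r i"] LD[of "r i"] \<zeta>g i(2) by linarith
qed

text \<open>Take a cheap tensor in the hull of the elementary tensors of \<open>H\<close>. At a
  point of \<open>A N\<close>, pairing it with the contraction found there gives at least
  \<open>\<delta>\<close>, and at most the sum \<open>G\<close> of the norms of its vectors, because
  a contraction into \<open>\<ell>\<^sup>1\<close> sends each pair \<open>(c, v)\<close> to at most
  the norm of \<open>v \<omega>\<close>. Only this inequality is integrated, so the contractions may
  depend on \<open>\<omega>\<close> in any way.\<close>

lemma no_l1_sequences:
  fixes H :: "nat \<Rightarrow> 'w \<Rightarrow> 'x::real_normed_vector"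
  assumes VK: "Vstar_set (vector_valued_space M R) (ae_class M ` K)" and K: "K \<subseteq> S"
    and H: "\<And>i. H i \<in> convex hull K" and \<delta>: "0 < \<delta>" and c: "0 < c"
    and A: "\<And>k. A k \<in> events \<and> c \<le> prob (A k)"
    and T: "\<And>k. AE \<omega> in M. \<omega> \<in> A k \<longrightarrow> (\<exists>T\<in>l1_ops. \<forall>i\<le>k. \<delta> \<le> T i (H i \<omega>))"
  shows False
proof -
  interpret X: space_rep "S :: ('w \<Rightarrow> 'x) set" q "ae_class M" "vector_valued_space M R" by (rule space_rep_S)
  obtain K1 where "0 < K1 \<and> (\<forall>f\<in>(S :: ('w \<Rightarrow> 'x) set).
      integrable M (\<lambda>\<omega>. norm (f \<omega>)) \<and> expectation (\<lambda>\<omega>. norm (f \<omega>)) \<le> K1 * q f)" using S_mean ..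
  then have K1: "0 < K1" "\<And>f :: 'w \<Rightarrow> 'x. f \<in> S \<Longrightarrow> integrable M (\<lambda>\<omega>. norm (f \<omega>))"
    "\<And>f :: 'w \<Rightarrow> 'x. f \<in> S \<Longrightarrow> expectation (\<lambda>\<omega>. norm (f \<omega>)) \<le> K1 * q f" by simp_all
  \<comment> \<open>\<open>K1\<close> compares the mean norm with \<open>q\<close>; the expectation
    of \<open>G\<close> is then below \<open>\<delta> * c / 2\<close>, while it has to be at least
    \<open>\<delta> * c\<close>.\<close>
  define \<eta> where "\<eta> = \<delta> * c / (2 * K1)"
  have \<eta>: "0 < \<eta>" using \<delta> c K1(1) by (simp add: \<eta>_def)
  have "\<exists>l\<in>X.tensors. X.cost l < \<eta> \<and> X.val l \<in> convex hull (range (\<lambda>i. X.unit_seq i (H i)))"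
    by (rule X.Vstar_tensor[of K H \<eta>, OF VK K H \<eta>]) blast
  then obtain l where l: "l \<in> X.tensors" "X.cost l < \<eta>" "X.val l \<in> convex hull (range (\<lambda>i. X.unit_seq i (H i)))" by blast
  \<comment> \<open>The hull element involves finitely many slots only, so a contraction for indices
    up to \<open>N\<close> suffices.\<close>
  obtain N where N: "X.val l \<in> convex hull ((\<lambda>i. X.unit_seq i (H i)) ` {..<N})"
    by (rule convex_hull_range_finite[OF l(3)])
  define G where "G l \<omega> = (\<Sum>(c, v)\<leftarrow>l. norm (v \<omega>))" for l :: "((nat \<Rightarrow> real) \<times> ('w \<Rightarrow> 'x)) list" and \<omega>
  have G: "integrable M (G l) \<and> expectation (G l) \<le> K1 * X.cost l" if "l \<in> X.tensors" for l
    using that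
  proof (induction l)
    case Nil
    have "G [] = (\<lambda>_. 0)" by (simp add: G_def fun_eq_iff)
    then show ?case by simp
  next
    case (Cons a l)
    obtain c v where a: "a = (c, v)" by fastforce
    have v: "v \<in> S" and lt: "l \<in> X.tensors" using Cons.prems by (simp_all add: a)
    have "G (a # l) = (\<lambda>\<omega>. norm (v \<omega>) + G l \<omega>)" by (simp add: G_def a fun_eq_iff)
    then show ?case using Cons.IH[OF lt] K1(2,3)[OF v] by (simp add: a distrib_left)
  qed
  have "AE \<omega> in M. \<delta> * indicator (A N) \<omega> \<le> G l \<omega>"
    using T[of N]
  proof eventually_elim
    case (elim \<omega>)
    have G0: "0 \<le> G l \<omega>" unfolding G_def by (intro sum_list_nonneg) auto
    show ?case
    proof (cases "\<omega> \<in> A N")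
      case True
      then obtain T where T: "T \<in> l1_ops" "\<And>i. i \<le> N \<Longrightarrow> \<delta> \<le> T i (H i \<omega>)" using elim by blast
      have Tl: "linear (T i)" and Ts: "(\<Sum>i<n. \<bar>T i x\<bar>) \<le> norm x" for i n x using T(1) by (auto simp: l1_ops_def)
      define \<Phi> where "\<Phi> W = (\<Sum>i<N. T i (W i \<omega>))" for W :: "nat \<Rightarrow> 'w \<Rightarrow> 'x"
      have \<Phi>lin: "\<Phi> (a *\<^sub>R W + b *\<^sub>R W') = a * \<Phi> W + b * \<Phi> W'" for a b W W'
        by (simp add: \<Phi>_def linear_add[OF Tl] linear_cmul[OF Tl] sum.distrib sum_distrib_left)
      have "convex hull ((\<lambda>i. X.unit_seq i (H i)) ` {..<N}) \<subseteq> {W. \<delta> \<le> \<Phi> W}"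
      proof (rule hull_minimal)
        show "(\<lambda>i. X.unit_seq i (H i)) ` {..<N} \<subseteq> {W. \<delta> \<le> \<Phi> W}"
        proof clarify
          fix i assume i: "i < N"
          have "\<Phi> (X.unit_seq i (H i)) = (\<Sum>j<N. if j = i then T i (H i \<omega>) else 0)"
            unfolding \<Phi>_def X.unit_seq_def by (intro sum.cong) (auto simp: linear_0[OF Tl])
          also have "\<dots> = T i (H i \<omega>)" using i by simp
          finally show "\<delta> \<le> \<Phi> (X.unit_seq i (H i))" using T(2)[of i] i by simp
        qed
        show "convex {W. \<delta> \<le> \<Phi> W}"
        proof (rule convexI, clarify)
          fix W W' and a b :: real
          assume "\<delta> \<le> \<Phi> W" "\<delta> \<le> \<Phi> W'" "0 \<le> a" "0 \<le> b" "a + b = 1"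
          then have "a * \<delta> + b * \<delta> \<le> a * \<Phi> W + b * \<Phi> W'" by (intro add_mono mult_left_mono)
          moreover have "a * \<delta> + b * \<delta> = \<delta>" using \<open>a + b = 1\<close> by (metis distrib_right mult_1)
          ultimately show "\<delta> \<le> \<Phi> (a *\<^sub>R W + b *\<^sub>R W')" unfolding \<Phi>lin by linarith
        qed
      qed
      then have "\<delta> \<le> \<Phi> (X.val l)" using N by blast
      also have "\<Phi> (X.val l) \<le> G l \<omega>"
        using l(1)
      proof (induction l)
        case Nil
        then show ?case by (simp add: \<Phi>_def G_def linear_0[OF Tl])
      next
        case (Cons a l)
        obtain c v where a: "a = (c, v)" by fastforce
        have cv: "\<And>i. \<bar>c i\<bar> \<le> 1" and lt: "l \<in> X.tensors" using Cons.prems by (simp_all add: a)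
        have "\<Phi> (X.val (a # l)) = (\<Sum>i<N. c i * T i (v \<omega>)) + \<Phi> (X.val l)"
          by (simp add: a \<Phi>_def linear_add[OF Tl] linear_cmul[OF Tl] sum.distrib)
        moreover have "(\<Sum>i<N. c i * T i (v \<omega>)) \<le> (\<Sum>i<N. \<bar>T i (v \<omega>)\<bar>)"
        proof (rule sum_mono)
          fix i
          have "c i * T i (v \<omega>) \<le> \<bar>c i\<bar> * \<bar>T i (v \<omega>)\<bar>" by (metis abs_ge_self abs_mult)
          also have "\<dots> \<le> 1 * \<bar>T i (v \<omega>)\<bar>" by (rule mult_right_mono[OF cv]) simp
          finally show "c i * T i (v \<omega>) \<le> \<bar>T i (v \<omega>)\<bar>" by simp
        qed
        moreover have "G (a # l) \<omega> = norm (v \<omega>) + G l \<omega>" by (simp add: G_def a)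
        ultimately show ?case using Ts[of "v \<omega>" N] Cons.IH[OF lt] by linarith
      qed
      finally show ?thesis using True by simp
    qed (use G0 in simp)
  qed
  moreover have i: "integrable M (\<lambda>\<omega>. \<delta> * indicator (A N) \<omega>)"
    using A[of N] by (intro integrable_mult_right integrable_real_indicator) (auto simp: less_top[symmetric])
  ultimately have "expectation (\<lambda>\<omega>. \<delta> * indicator (A N) \<omega>) \<le> expectation (G l)"
    using G[OF l(1)] by (intro integral_mono_AE) auto
  also have "expectation (\<lambda>\<omega>. \<delta> * indicator (A N) \<omega>) = \<delta> * prob (A N)" using A[of N] by simp
  finally have 1: "\<delta> * prob (A N) \<le> expectation (G l)" .
  have 2: "\<delta> * c \<le> \<delta> * prob (A N)" using A[of N] \<delta> by (intro mult_left_mono) auto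
  have 3: "K1 * X.cost l < K1 * \<eta>" by (rule mult_strict_left_mono[OF l(2) K1(1)])
  have 4: "K1 * \<eta> = \<delta> * c / 2" using K1(1) by (simp add: \<eta>_def)
  have "0 < \<delta> * c" using \<delta> c by simp
  then show False using 1 2 3 4 G[OF l(1)] by linarith
qed

end

text \<open>The factor \<open>m \<omega>\<close> is common to all terms, so the same convex
  coefficients work on both sides.\<close>

lemma (in prob_space) convex_hull_transfer:
  fixes h h' :: "nat \<Rightarrow> 'a \<Rightarrow> 'x::real_normed_vector"
  assumes ap: "\<And>n. i \<le> n \<Longrightarrow> AE \<omega> in M. norm (h' n \<omega> - m \<omega> *\<^sub>R h n \<omega>) \<le> \<epsilon>"
    and b: "b \<in> convex hull (h' ` {i..})"
  shows "\<exists>B\<in>convex hull (h ` {i..}). AE \<omega> in M. norm (b \<omega> - m \<omega> *\<^sub>R B \<omega>) \<le> \<epsilon>"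
proof -
  define C where "C = {b. \<exists>B\<in>convex hull (h ` {i..}). AE \<omega> in M. norm (b \<omega> - m \<omega> *\<^sub>R B \<omega>) \<le> \<epsilon>}"
  have "convex C"
  proof (rule convexI)
    fix x y and u v :: real assume xy: "x \<in> C" "y \<in> C" and uv: "0 \<le> u" "0 \<le> v" "u + v = 1"
    obtain X where X: "X \<in> convex hull (h ` {i..})" "AE \<omega> in M. norm (x \<omega> - m \<omega> *\<^sub>R X \<omega>) \<le> \<epsilon>"
      using xy(1) by (auto simp: C_def)
    obtain Y where Y: "Y \<in> convex hull (h ` {i..})" "AE \<omega> in M. norm (y \<omega> - m \<omega> *\<^sub>R Y \<omega>) \<le> \<epsilon>"
      using xy(2) by (auto simp: C_def)
    have "u *\<^sub>R X + v *\<^sub>R Y \<in> convex hull (h ` {i..})" by (rule convexD[OF convex_convex_hull X(1) Y(1) uv])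
    moreover have "AE \<omega> in M. norm ((u *\<^sub>R x + v *\<^sub>R y) \<omega> - m \<omega> *\<^sub>R (u *\<^sub>R X + v *\<^sub>R Y) \<omega>) \<le> \<epsilon>"
      using X(2) Y(2)
    proof eventually_elim
      case (elim \<omega>)
      have "(u *\<^sub>R x + v *\<^sub>R y) \<omega> - m \<omega> *\<^sub>R (u *\<^sub>R X + v *\<^sub>R Y) \<omega> =
          u *\<^sub>R (x \<omega> - m \<omega> *\<^sub>R X \<omega>) + v *\<^sub>R (y \<omega> - m \<omega> *\<^sub>R Y \<omega>)"
        by (simp add: algebra_simps)
      also have "norm \<dots> \<le> u * norm (x \<omega> - m \<omega> *\<^sub>R X \<omega>) + v * norm (y \<omega> - m \<omega> *\<^sub>R Y \<omega>)"
        by (rule order_trans[OF norm_triangle_ineq]) (use uv in simp)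
      also have "\<dots> \<le> u * \<epsilon> + v * \<epsilon>" using elim uv by (intro add_mono mult_left_mono) auto
      also have "\<dots> = \<epsilon>" using uv(3) by (metis distrib_right mult_1)
      finally show ?case .
    qed
    ultimately show "u *\<^sub>R x + v *\<^sub>R y \<in> C" unfolding C_def by blast
  qed
  moreover have "h' ` {i..} \<subseteq> C"
  proof
    fix x assume "x \<in> h' ` {i..}"
    then obtain n where n: "i \<le> n" "x = h' n" by auto
    have "h n \<in> convex hull (h ` {i..})" by (rule hull_inc) (use n in auto)
    with ap[OF n(1)] show "x \<in> C" unfolding C_def n(2) by blast
  qed
  ultimately have "convex hull (h' ` {i..}) \<subseteq> C" by (intro hull_minimal)
  then show ?thesis using b by (auto simp: C_def)
qed

section \<open>Property \<open>V\<^sup>*\<close> of \<open>E(X)\<close> and of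
  \<open>X\<close>\<close>

context function_lattice
begin

text \<open>The means of the norms stay bounded because \<open>E\<close> is continuously included in
  \<open>L\<^sup>1\<close>; this is the bound that \<open>convex_selection\<close> requires.\<close>

lemma norm_convergent_blocks:
  fixes x :: "nat \<Rightarrow> 'w \<Rightarrow> 'x::real_normed_vector"
  assumes x: "\<And>n. x n \<in> S" "\<And>n. q (x n) \<le> B"
  shows "\<exists>h. (\<forall>n. h n \<in> convex hull (x ` {n..})) \<and> (AE \<omega> in M. convergent (\<lambda>n. norm (h n \<omega>)))"
proof -
  interpret X: space_rep "S :: ('w \<Rightarrow> 'x) set" q "ae_class M" "vector_valued_space M R" by (rule space_rep_S)
  obtain K1 where "0 < K1 \<and> (\<forall>f\<in>(S :: ('w \<Rightarrow> 'x) set).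
      integrable M (\<lambda>\<omega>. norm (f \<omega>)) \<and> expectation (\<lambda>\<omega>. norm (f \<omega>)) \<le> K1 * q f)" using S_mean ..
  then have K1: "0 < K1" "\<And>f :: 'w \<Rightarrow> 'x. f \<in> S \<Longrightarrow> integrable M (\<lambda>\<omega>. norm (f \<omega>))"
    "\<And>f :: 'w \<Rightarrow> 'x. f \<in> S \<Longrightarrow> expectation (\<lambda>\<omega>. norm (f \<omega>)) \<le> K1 * q f" by simp_all
  define H where "H n = midhull (x ` {n..})" for n :: nat
  have H0: "h \<in> S \<and> q h \<le> B" if "h \<in> H 0" for h
  proof -
    have "midhull (x ` {0..}) \<subseteq> {h \<in> S. q h \<le> B}"
    proof (rule midhull_minimal)
      fix f g :: "'w \<Rightarrow> 'x" assume "f \<in> {h \<in> S. q h \<le> B}" "g \<in> {h \<in> S. q h \<le> B}"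
      then have fg: "f \<in> S" "g \<in> S" "q f \<le> B" "q g \<le> B" by auto
      have s: "f + g \<in> S" by (rule X.S_closed(2)[OF fg(1,2)])
      have "q ((1/2) *\<^sub>R (f + g)) = \<bar>1/2\<bar> * q (f + g)" by (rule X.q_scale[OF s])
      then show "(1/2) *\<^sub>R (f + g) \<in> {h \<in> S. q h \<le> B}"
        using X.q_add[OF fg(1,2)] fg(3,4) X.S_closed(3)[OF s] by simp
    qed (use x in auto)
    then show ?thesis using that by (auto simp: H_def)
  qed
  define P where "P h \<omega> = norm (h \<omega>)" for h :: "'w \<Rightarrow> 'x" and \<omega>
  have Ha: "H n \<subseteq> H m" if "m \<le> n" for m n unfolding H_def by (rule midhull_tail_mono[OF that])
  have He: "H n \<noteq> {}" for n unfolding H_def using midhull.base[of "x n" "x ` {n..}"] by auto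
  have Hm: "(1/2) *\<^sub>R (f + g) \<in> H n" if "f \<in> H n" "g \<in> H n" for n f g
    using midhull.mid[of f "x ` {n..}" g] that by (simp add: H_def)
  have Pi: "integrable M (P h)" if "h \<in> H 0" for h
    using K1(2)[OF conjunct1[OF H0[OF that]]] by (simp add: P_def[abs_def])
  have P0: "0 \<le> P h \<omega>" if "h \<in> H 0" for h \<omega> by (simp add: P_def)
  have Pe: "expectation (P h) \<le> K1 * B" if "h \<in> H 0" for h
  proof -
    have "K1 * q h \<le> K1 * B" using H0[OF that] K1(1) by (intro mult_left_mono) auto
    then show ?thesis using K1(3)[OF conjunct1[OF H0[OF that]]] by (simp add: P_def[abs_def])
  qed
  have Pc: "AE \<omega> in M. P ((1/2) *\<^sub>R (f + g)) \<omega> \<le> (P f \<omega> + P g \<omega>) / 2" if "f \<in> H 0" "g \<in> H 0" for f g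
  proof (rule AE_I2)
    fix \<omega>
    show "P ((1/2) *\<^sub>R (f + g)) \<omega> \<le> (P f \<omega> + P g \<omega>) / 2"
      using norm_triangle_ineq[of "f \<omega>" "g \<omega>"] by (simp add: P_def)
  qed
  have "\<exists>h. (\<forall>n. h n \<in> H n) \<and> (AE \<omega> in M. convergent (\<lambda>n. P (h n) \<omega>))"
  proof (rule convex_selection[of H P "K1 * B", OF Ha He Hm Pi P0 Pe Pc])
    fix h assume "\<And>n. h n \<in> H n" "AE \<omega> in M. convergent (\<lambda>n. P (h n) \<omega>)"
    then show ?thesis by (intro exI[of _ h] conjI allI)
  qed
  then obtain h where h: "\<forall>n. h n \<in> H n" "AE \<omega> in M. convergent (\<lambda>n. P (h n) \<omega>)" by blast
  have "h n \<in> convex hull (x ` {n..})" for n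
    using h(1) midhull_subset_hull[of "x ` {n..}"] unfolding H_def by blast
  then show ?thesis using h(2) unfolding P_def by blast
qed

text \<open>
  A sequence with \<open>sup n \<parallel>h n \<omega>\<parallel> < \<infinity>\<close> almost everywhere becomes a uniformly bounded one after
  multiplication by \<open>m = 1 / (1 + k)\<close> with a measurable bound \<open>k\<close> of natural numbers.
\<close>

lemma unit_ball_approximation:
  fixes h :: "nat \<Rightarrow> 'w \<Rightarrow> 'x::real_normed_vector"
  assumes h: "\<And>n. h n \<in> S" and conv: "AE \<omega> in M. convergent (\<lambda>n. norm (h n \<omega>))"
  shows "\<exists>f m. (\<forall>n. cval M (f n) \<and> (\<forall>\<omega>. norm (f n \<omega>) \<le> 1)) \<and> (\<forall>\<omega>. 0 < m \<omega> \<and> m \<omega> \<le> (1::real)) \<and>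
    (\<forall>n. AE \<omega> in M. norm (f n \<omega> - m \<omega> *\<^sub>R h n \<omega>) \<le> (1/2)^n)"
proof -
  have "\<forall>n. \<exists>c. cval M c \<and> (AE \<omega> in M. norm (c \<omega> - h n \<omega>) \<le> (1/2)^n)"
  proof
    fix n
    show "\<exists>c. cval M c \<and> (AE \<omega> in M. norm (c \<omega> - h n \<omega>) \<le> (1/2)^n)"
    proof (rule strongly_measurable_cval[OF smeas_strongly_measurable[OF S_smeas[OF h]], of "(1/2)^n" n])
      fix c assume "cval M c" "AE \<omega> in M. norm (c \<omega> - h n \<omega>) \<le> (1/2)^n"
      then show ?thesis by blast
    qed simp
  qed
  from choice[OF this] obtain h' where h': "\<And>n. cval M (h' n)" "\<And>n. AE \<omega> in M. norm (h' n \<omega> - h n \<omega>) \<le> (1/2)^n" by blast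
  define kk where "kk \<omega> = (LEAST k::nat. \<forall>n. norm (h' n \<omega>) \<le> real k)" for \<omega>
  define m where "m \<omega> = 1 / (1 + real (kk \<omega>))" for \<omega>
  \<comment> \<open>The value \<open>0\<close> is taken only where the sequence \<open>h'\<close>
    has no bound, a null set. It makes the norm at most \<open>1\<close> at every point.\<close>
  define f where "f n \<omega> = (if norm (h' n \<omega>) \<le> real (kk \<omega>) then (1 / (1 + real (kk \<omega>))) *\<^sub>R h' n \<omega> else 0)" for n \<omega>
  have "kk \<in> measurable M (count_space UNIV)"
    unfolding kk_def
  proof (rule measurable_Least)
    fix k :: nat
    have "{\<omega> \<in> space M. \<forall>n. norm (h' n \<omega>) \<le> real k} = (\<Inter>n. {\<omega> \<in> space M. norm (h' n \<omega>) \<le> real k})" by auto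
    also have "\<dots> \<in> events" using cval_sets[OF h'(1), of "\<lambda>x. norm x \<le> real k"] by (intro sets.countable_INT) auto
    finally show "Measurable.pred M (\<lambda>\<omega>. \<forall>n. norm (h' n \<omega>) \<le> real k)" by (simp add: pred_def)
  qed
  then have "{\<omega> \<in> space M. kk \<omega> = k} \<in> events" for k by measurable
  then have ck: "cval M kk" by (simp add: cval_def)
  have c1: "cval M (f n)" for n
    using cval_comp2[OF ck h'(1)[of n], of "\<lambda>k x. if norm x \<le> real k then (1 / (1 + real k)) *\<^sub>R x else 0"]
    by (simp add: f_def[abs_def])
  have c2: "norm (f n \<omega>) \<le> 1" for n \<omega> by (auto simp: f_def field_simps)
  have m: "0 < m \<omega> \<and> m \<omega> \<le> 1" for \<omega> by (simp add: m_def)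
  have c4: "AE \<omega> in M. norm (f n \<omega> - m \<omega> *\<^sub>R h n \<omega>) \<le> (1/2)^n" for n
  proof -
    have "AE \<omega> in M. \<forall>n. norm (h' n \<omega> - h n \<omega>) \<le> (1/2)^n" using h'(2) by (simp add: AE_all_countable)
    with conv show ?thesis
    proof eventually_elim
      case (elim \<omega>)
      obtain K where K: "\<And>n. norm (h n \<omega>) \<le> K" using convergent_imp_Bseq[OF elim(1)] by (auto simp: Bseq_def)
      obtain k :: nat where k: "K + 1 \<le> real k" using real_arch_simple by blast
      have hk: "norm (h' n \<omega>) \<le> real k" for n
      proof -
        have "(1/2::real)^n \<le> 1" by (rule power_le_one) auto
        moreover have "norm (h' n \<omega> - h n \<omega>) \<le> (1/2)^n" using elim(2) by blast
        ultimately show ?thesis using norm_triangle_sub[of "h' n \<omega>" "h n \<omega>"] K[of n] k by linarith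
      qed
      have "\<forall>n. norm (h' n \<omega>) \<le> real (kk \<omega>)"
        unfolding kk_def by (rule LeastI[of "\<lambda>k. \<forall>n. norm (h' n \<omega>) \<le> real k" k]) (rule allI, rule hk)
      then have "f n \<omega> - m \<omega> *\<^sub>R h n \<omega> = m \<omega> *\<^sub>R (h' n \<omega> - h n \<omega>)"
        by (simp add: f_def m_def scaleR_diff_right)
      then have "norm (f n \<omega> - m \<omega> *\<^sub>R h n \<omega>) = m \<omega> * norm (h' n \<omega> - h n \<omega>)" using m[of \<omega>] by simp
      also have "\<dots> \<le> 1 * norm (h' n \<omega> - h n \<omega>)" using m[of \<omega>] by (intro mult_right_mono) auto
      finally show ?case using elim(2)[rule_format, of n] by linarith
    qed
  qed
  show ?thesis
    by (rule exI[of _ f], rule exI[of _ m], intro conjI allI) (use c1 c2 m c4 in blast)+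
qed

lemma Vstar_blocks:
  fixes x :: "nat \<Rightarrow> 'w \<Rightarrow> 'x::banach"
  assumes VX: "property_Vstar (type_space :: 'x nspace)"
    and VK: "Vstar_set (vector_valued_space M R) (ae_class M ` K)" and K: "K \<subseteq> S" and x: "\<And>n. x n \<in> K"
  shows "\<exists>y\<in>S. \<forall>n. \<forall>\<epsilon>>0. \<exists>h\<in>convex hull (x ` {n..}). q (h - y) < \<epsilon>"
proof -
  interpret X: space_rep "S :: ('w \<Rightarrow> 'x) set" q "ae_class M" "vector_valued_space M R" by (rule space_rep_S)
  obtain b where b: "\<And>x. x \<in> K \<Longrightarrow> q x \<le> b" using X.Vstar_bounded[OF VK K] by blast
  have xS: "x n \<in> S" for n using x K by blast
  from norm_convergent_blocks[of x b, OF xS b[OF x]] obtain h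
    where h: "\<And>n. h n \<in> convex hull (x ` {n..})" "AE \<omega> in M. convergent (\<lambda>n. norm (h n \<omega>))" by blast
  have hull_trans: "convex hull (u ` {n..}) \<subseteq> convex hull (v ` {n..})" if "\<And>i. u i \<in> convex hull (v ` {i..})"
    for u v :: "nat \<Rightarrow> 'w \<Rightarrow> 'x" and n
  proof (intro hull_minimal convex_convex_hull image_subsetI)
    fix i assume "i \<in> {n..}"
    then have "convex hull (v ` {i..}) \<subseteq> convex hull (v ` {n..})" by (intro hull_mono image_mono) auto
    then show "u i \<in> convex hull (v ` {n..})" using that by blast
  qed
  have xK: "convex hull (x ` {n..}) \<subseteq> convex hull K" for n by (intro hull_mono) (use x in auto)
  have KS: "convex hull K \<subseteq> S" by (intro hull_minimal K subspace_imp_convex X.S)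
  have Kb: "q f \<le> b" if "f \<in> convex hull K" for f
  proof -
    have "convex {f \<in> (S :: ('w \<Rightarrow> 'x) set). q f \<le> b}"
    proof (rule convexI)
      fix f g :: "'w \<Rightarrow> 'x" and u v :: real
      assume "f \<in> {f \<in> S. q f \<le> b}" "g \<in> {f \<in> S. q f \<le> b}" and uv: "0 \<le> u" "0 \<le> v" "u + v = 1"
      then have fg: "f \<in> S" "g \<in> S" "q f \<le> b" "q g \<le> b" by auto
      have S: "u *\<^sub>R f + v *\<^sub>R g \<in> S" by (intro X.S_closed(2,3) fg)
      have "q (u *\<^sub>R f + v *\<^sub>R g) \<le> q (u *\<^sub>R f) + q (v *\<^sub>R g)" by (intro X.q_add X.S_closed(3) fg)
      also have "\<dots> = u * q f + v * q g" using uv by (simp add: X.q_scale fg)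
      also have "\<dots> \<le> u * b + v * b" using fg uv by (intro add_mono mult_left_mono)
      also have "\<dots> = b" using uv(3) by (metis distrib_right mult_1)
      finally show "u *\<^sub>R f + v *\<^sub>R g \<in> {f \<in> S. q f \<le> b}" using S by simp
    qed
    then have "convex hull K \<subseteq> {f \<in> S. q f \<le> b}" using K b by (intro hull_minimal) auto
    then show ?thesis using that by blast
  qed
  have hS: "h n \<in> S" for n using h(1)[of n] xK[of n] KS by blast
  from unit_ball_approximation[of h, OF hS h(2)] obtain f :: "nat \<Rightarrow> 'w \<Rightarrow> 'x"
    where "\<exists>m. (\<forall>n. cval M (f n) \<and> (\<forall>\<omega>. norm (f n \<omega>) \<le> 1)) \<and>
      (\<forall>\<omega>. 0 < m \<omega> \<and> m \<omega> \<le> (1::real)) \<and> (\<forall>n. AE \<omega> in M. norm (f n \<omega> - m \<omega> *\<^sub>R h n \<omega>) \<le> (1/2)^n)" ..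
  then obtain m :: "'w \<Rightarrow> real"
    where fm: "(\<forall>n. cval M (f n) \<and> (\<forall>\<omega>. norm (f n \<omega>) \<le> 1)) \<and>
      (\<forall>\<omega>. 0 < m \<omega> \<and> m \<omega> \<le> (1::real)) \<and> (\<forall>n. AE \<omega> in M. norm (f n \<omega> - m \<omega> *\<^sub>R h n \<omega>) \<le> (1/2)^n)" ..
  have f: "cval M (f n)" "norm (f n \<omega>) \<le> 1" and m: "0 < m \<omega>" "m \<omega> \<le> 1"
    and ap: "AE \<omega> in M. norm (f n \<omega> - m \<omega> *\<^sub>R h n \<omega>) \<le> (1/2)^n" for n \<omega>
    using fm by blast+
  have ap': "AE \<omega> in M. norm (f n \<omega> - m \<omega> *\<^sub>R h n \<omega>) \<le> (1/2)^i" if "i \<le> n" for i n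
  proof -
    have le: "(1/2::real)^n \<le> (1/2)^i" by (rule power_decreasing[OF that]) auto
    show ?thesis using ap[of n] by eventually_elim (use le in linarith)
  qed
  have transfer: "\<exists>B\<in>convex hull (h ` {i..}). AE \<omega> in M. norm (u \<omega> - m \<omega> *\<^sub>R B \<omega>) \<le> (1/2)^i"
    if "u \<in> convex hull (f ` {i..})" for u i
    by (rule convex_hull_transfer[of i f m h "(1/2)^i", OF ap' that])
  have no_l1: False
    if g: "\<And>i. g i \<in> midhull (f ` {i..})" and \<delta>: "0 < \<delta>" and c: "0 < c" and A: "\<And>k. A k \<in> events \<and> c \<le> prob (A k)"
      and T: "\<And>k. AE \<omega> in M. \<omega> \<in> A k \<longrightarrow> (\<exists>T\<in>l1_ops. \<forall>i\<le>k. \<delta> < T i (g i \<omega>))" for g A \<delta> c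
  proof -
    \<comment> \<open>Discarding the first \<open>I\<close> indices brings the approximation error
      \<open>(1/2) ^ i\<close> below \<open>\<delta>/2\<close>, so half of \<open>\<delta>\<close>
      survives.\<close>
    obtain I where I: "(1/2::real)^I < \<delta>/2" using real_arch_pow_inv[of "\<delta>/2" "1/2"] \<delta> by auto
    have "\<forall>i. \<exists>B. B \<in> convex hull (h ` {i..}) \<and> (AE \<omega> in M. norm (g i \<omega> - m \<omega> *\<^sub>R B \<omega>) \<le> (1/2)^i)"
    proof
      fix i
      have "g i \<in> convex hull (f ` {i..})" using g[of i] midhull_subset_hull[of "f ` {i..}"] by blast
      from transfer[OF this] show "\<exists>B. B \<in> convex hull (h ` {i..}) \<and> (AE \<omega> in M. norm (g i \<omega> - m \<omega> *\<^sub>R B \<omega>) \<le> (1/2)^i)"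
        by (simp only: Bex_def)
    qed
    from choice[OF this] obtain G where G: "\<And>i. G i \<in> convex hull (h ` {i..})"
      "\<And>i. AE \<omega> in M. norm (g i \<omega> - m \<omega> *\<^sub>R G i \<omega>) \<le> (1/2)^i" by blast
    have GK: "G i \<in> convex hull K" for i using G(1)[of i] hull_trans[of h x i, OF h(1)] xK[of i] by blast
    have Gall: "AE \<omega> in M. \<forall>i. norm (g i \<omega> - m \<omega> *\<^sub>R G i \<omega>) \<le> (1/2)^i" using G(2) by (simp add: AE_all_countable)
    show False
    proof (rule no_l1_sequences[OF VK K, of "\<lambda>i. G (I + i)" "\<delta>/2" c "\<lambda>k. A (I + k)"])
      fix k
      show "AE \<omega> in M. \<omega> \<in> A (I + k) \<longrightarrow> (\<exists>T\<in>l1_ops. \<forall>i\<le>k. \<delta>/2 \<le> T i (G (I + i) \<omega>))"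
        using T[of "I + k"] Gall
      proof eventually_elim
        case (elim \<omega>)
        show ?case
        proof
          assume "\<omega> \<in> A (I + k)"
          then obtain T where T: "T \<in> l1_ops" "\<And>i. i \<le> I + k \<Longrightarrow> \<delta> < T i (g i \<omega>)" using elim(1) by blast
          have Tl: "linear (T i)" for i using T(1) by (simp add: l1_ops_def)
          have "\<delta>/2 \<le> T (I + i) (G (I + i) \<omega>)" if "i \<le> k" for i
          proof -
            let ?j = "I + i"
            have "(1/2::real)^?j \<le> (1/2)^I" by (rule power_decreasing) auto
            then have "norm (g ?j \<omega> - m \<omega> *\<^sub>R G ?j \<omega>) \<le> \<delta>/2" using elim(2)[rule_format, of ?j] I by linarith
            then have "T ?j (g ?j \<omega> - m \<omega> *\<^sub>R G ?j \<omega>) \<le> \<delta>/2"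
              using l1_ops_bound[OF T(1), of ?j "g ?j \<omega> - m \<omega> *\<^sub>R G ?j \<omega>"] by linarith
            then have "T ?j (g ?j \<omega>) - m \<omega> * T ?j (G ?j \<omega>) \<le> \<delta>/2"
              by (simp add: linear_diff[OF Tl] linear_cmul[OF Tl])
            \<comment> \<open>Removing the factor \<open>m \<omega>\<close>, which lies between
              \<open>0\<close> and \<open>1\<close>, can only enlarge a positive value.\<close>
            then have ge: "\<delta>/2 \<le> m \<omega> * T ?j (G ?j \<omega>)" using T(2)[of ?j] that by simp
            then have "0 < m \<omega> * T ?j (G ?j \<omega>)" using \<delta> by linarith
            then have "0 < T ?j (G ?j \<omega>)" using m(1)[of \<omega>] by (simp add: zero_less_mult_iff)
            then have "m \<omega> * T ?j (G ?j \<omega>) \<le> 1 * T ?j (G ?j \<omega>)" using m(2) by (intro mult_right_mono) auto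
            with ge show ?thesis by simp
          qed
          then have le: "\<forall>i\<le>k. \<delta>/2 \<le> T (I + i) (G (I + i) \<omega>)" by simp
          have "(\<lambda>i. T (I + i)) \<in> l1_ops" by (rule l1_ops_subseq[of T "\<lambda>i. I + i", OF T(1)]) (simp add: strict_mono_def)
          with le show "\<exists>T\<in>l1_ops. \<forall>i\<le>k. \<delta>/2 \<le> T i (G (I + i) \<omega>)"
            by (intro bexI[of _ "\<lambda>i. T (I + i)"])
        qed
      qed
    qed (use GK \<delta> c A in simp_all)
  qed
  have "\<exists>u \<gamma>. (\<forall>n. u n \<in> convex hull (f ` {n..})) \<and> (AE \<omega> in M. (\<lambda>n. u n \<omega>) \<longlonglongrightarrow> \<gamma> \<omega>)"
  proof (rule convergent_blocks[of f, OF VX f no_l1])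
    fix u :: "nat \<Rightarrow> 'w \<Rightarrow> 'x" and \<gamma>
    assume "\<And>n. u n \<in> convex hull (f ` {n..})" "AE \<omega> in M. (\<lambda>n. u n \<omega>) \<longlonglongrightarrow> \<gamma> \<omega>"
    then show ?thesis by (intro exI[of _ u] exI[of _ \<gamma>] conjI allI)
  qed
  then obtain u :: "nat \<Rightarrow> 'w \<Rightarrow> 'x"
    where "\<exists>\<gamma>. (\<forall>n. u n \<in> convex hull (f ` {n..})) \<and> (AE \<omega> in M. (\<lambda>n. u n \<omega>) \<longlonglongrightarrow> \<gamma> \<omega>)" ..
  then obtain \<gamma> where "(\<forall>n. u n \<in> convex hull (f ` {n..})) \<and> (AE \<omega> in M. (\<lambda>n. u n \<omega>) \<longlonglongrightarrow> \<gamma> \<omega>)" ..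
  then have u: "\<And>n. u n \<in> convex hull (f ` {n..})" "AE \<omega> in M. (\<lambda>n. u n \<omega>) \<longlonglongrightarrow> \<gamma> \<omega>" by blast+
  have "\<forall>n. \<exists>B. B \<in> convex hull (h ` {n..}) \<and> (AE \<omega> in M. norm (u n \<omega> - m \<omega> *\<^sub>R B \<omega>) \<le> (1/2)^n)"
  proof
    fix n
    show "\<exists>B. B \<in> convex hull (h ` {n..}) \<and> (AE \<omega> in M. norm (u n \<omega> - m \<omega> *\<^sub>R B \<omega>) \<le> (1/2)^n)"
      using transfer[OF u(1)[of n]] by (simp only: Bex_def)
  qed
  from choice[OF this] obtain B where B: "\<And>n. B n \<in> convex hull (h ` {n..})"
    "\<And>n. AE \<omega> in M. norm (u n \<omega> - m \<omega> *\<^sub>R B n \<omega>) \<le> (1/2)^n" by blast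
  have Bx: "B n \<in> convex hull (x ` {n..})" for n using B(1) hull_trans[of h x n, OF h(1)] by blast
  have BK: "B n \<in> convex hull K" for n using Bx xK by blast
  have "AE \<omega> in M. \<forall>n. norm (u n \<omega> - m \<omega> *\<^sub>R B n \<omega>) \<le> (1/2)^n" using B(2) by (simp add: AE_all_countable)
  \<comment> \<open>Division by \<open>m \<omega>\<close> undoes the normalisation: the same
    combinations of the original functions converge almost everywhere, though no longer with a
    uniform bound. Fatou's lemma then places the limit in \<open>E(X)\<close>.\<close>
  with u(2) have lim: "AE \<omega> in M. (\<lambda>n. B n \<omega>) \<longlonglongrightarrow> inverse (m \<omega>) *\<^sub>R \<gamma> \<omega>"
  proof eventually_elim
    case (elim \<omega>)
    have "(\<lambda>n. u n \<omega> - m \<omega> *\<^sub>R B n \<omega>) \<longlonglongrightarrow> 0"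
      by (rule Lim_null_comparison[OF always_eventually LIMSEQ_power_zero]) (use elim(2) in auto)
    from tendsto_diff[OF elim(1) this] have "(\<lambda>n. m \<omega> *\<^sub>R B n \<omega>) \<longlonglongrightarrow> \<gamma> \<omega>" by simp
    from tendsto_scaleR[OF tendsto_const[of "inverse (m \<omega>)"] this] show ?case using m(1)[of \<omega>] by simp
  qed
  have BS: "B n \<in> S" for n using BK KS by blast
  from fatou[of B b, OF BS Kb[OF BK] lim] obtain g where g: "g \<in> S" "AE \<omega> in M. g \<omega> = inverse (m \<omega>) *\<^sub>R \<gamma> \<omega>" by blast
  from lim g(2) have limg: "AE \<omega> in M. (\<lambda>n. B n \<omega>) \<longlonglongrightarrow> g \<omega>" by eventually_elim simp
  show ?thesis
  proof (intro bexI[OF _ g(1)] allI impI)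
    fix n and \<epsilon> :: real assume \<epsilon>: "0 < \<epsilon>"
    have limn: "AE \<omega> in M. (\<lambda>k. B (k + n) \<omega>) \<longlonglongrightarrow> g \<omega>"
      using limg by eventually_elim (rule LIMSEQ_ignore_initial_segment)
    have "\<exists>h\<in>convex hull (range (\<lambda>k. B (k + n))). q (h - g) < \<epsilon>"
    proof (rule X.mazur[OF g(1), of "\<lambda>k. B (k + n)" \<epsilon>])
      show "\<exists>k. L (B (k + n) - g) < \<delta>" if "linear L" "\<And>v. v \<in> S \<Longrightarrow> L v \<le> q v" "0 < \<delta>" for L \<delta>
        by (rule weak_null[OF VK K, of "\<lambda>k. B (k + n)" g L \<delta>]) (use BK g(1) limn that in auto)
    qed (use BS \<epsilon> in blast)+
    then obtain h' where h': "h' \<in> convex hull (range (\<lambda>k. B (k + n)))" "q (h' - g) < \<epsilon>" by blast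
    have "convex hull (range (\<lambda>k. B (k + n))) \<subseteq> convex hull (B ` {n..})" by (intro hull_mono) auto
    then have "h' \<in> convex hull (x ` {n..})" using h'(1) hull_trans[of B x n, OF Bx] by blast
    with h'(2) show "\<exists>h\<in>convex hull (x ` {n..}). q (h - g) < \<epsilon>" by blast
  qed
qed

lemma property_Vstar_vector_valued:
  assumes VX: "property_Vstar (type_space :: 'x::banach nspace)"
  shows "property_Vstar (vector_valued_space M R :: ('w \<Rightarrow> 'x) set nspace)"
  unfolding property_Vstar_def
proof (intro allI impI)
  interpret X: space_rep "S :: ('w \<Rightarrow> 'x) set" q "ae_class M" "vector_valued_space M R" by (rule space_rep_S)
  fix A :: "('w \<Rightarrow> 'x) set set" assume A: "Vstar_set (vector_valued_space M R) A"
  define K where "K = {f \<in> S. ae_class M f \<in> A}"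
  have AK: "A = ae_class M ` K"
  proof -
    have "A \<subseteq> ae_class M ` (S :: ('w \<Rightarrow> 'x) set)" using A unfolding Vstar_set_def X.carrier by blast
    then show ?thesis by (auto simp: K_def)
  qed
  have K: "K \<subseteq> S" by (auto simp: K_def)
  note VK = A[unfolded AK]
  obtain b where b: "\<And>x. x \<in> K \<Longrightarrow> q x \<le> b" using X.Vstar_bounded[OF VK K] by blast
  have "X.complete"
    unfolding X.complete_def
  proof (intro allI impI)
    fix x :: "nat \<Rightarrow> 'w \<Rightarrow> 'x"
    assume "\<forall>n. x n \<in> S" "\<forall>\<epsilon>>0. \<exists>N. \<forall>m\<ge>N. \<forall>n\<ge>N. q (x m - x n) < \<epsilon>"
    then show "\<exists>y\<in>S. (\<lambda>n. q (x n - y)) \<longlonglongrightarrow> 0" by (intro S_complete) auto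
  qed
  from X.relatively_weakly_compactI[OF K this b Vstar_blocks[OF VX VK K]]
  show "relatively_weakly_compact (vector_valued_space M R) A" unfolding AK .
qed

text \<open>The constant functions embed \<open>X\<close> by a multiple \<open>J\<close> of an
  isometry. Restriction along \<open>J\<close> turns weakly unconditionally Cauchy series in the
  dual of \<open>E(X)\<close> into such series in the dual of \<open>X\<close>, so \<open>J\<close>
  maps \<open>V\<^sup>*\<close>-sets to \<open>V\<^sup>*\<close>-sets. Norm limits of blocks of
  constant functions come back to \<open>X\<close> because \<open>X\<close> is complete.\<close>

lemma property_Vstar_constants:
  assumes VZ: "property_Vstar (vector_valued_space M R :: ('w \<Rightarrow> 'x::banach) set nspace)"
  shows "property_Vstar (type_space :: 'x nspace)"
  unfolding property_Vstar_def
proof (intro allI impI)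
  let ?Z = "vector_valued_space M R :: ('w \<Rightarrow> 'x) set nspace"
  interpret X: space_rep "S :: ('w \<Rightarrow> 'x) set" q "ae_class M" ?Z by (rule space_rep_S)
  obtain c where c: "0 < c" "\<And>x :: 'x. (\<lambda>_. x) \<in> S" "\<And>x :: 'x. q (\<lambda>_. x) = norm x * c" using const_S by blast
  define J where "J x = (\<lambda>_::'w. x)" for x :: 'x
  have J: "J x \<in> S" "q (J x) = norm x * c" for x using c(2,3) by (simp_all add: J_def)
  have Jl: "J (x + y) = J x + J y" "J (a *\<^sub>R x) = a *\<^sub>R J x" "J (x - y) = J x - J y" for x y a
    by (simp_all add: J_def fun_eq_iff)
  have linJ: "linear J" by (rule linearI) (simp_all add: Jl)
  fix K :: "'x set" assume K: "Vstar_set type_space K"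
  define A where "A = (\<lambda>x. ae_class M (J x)) ` K"
  have "Vstar_set ?Z A"
    unfolding Vstar_set_def
  proof (intro conjI allI impI)
    show "A \<subseteq> vcarrier ?Z" unfolding A_def X.carrier using J(1) by blast
    fix \<zeta> assume wuc: "wuc (dual ?Z) \<zeta>"
    define \<xi> where "\<xi> n x = \<zeta> n (ae_class M (J x))" for n x
    have bl: "bounded_linear (\<xi> n)" for n
    proof -
      have "\<zeta> n \<in> vcarrier (dual ?Z)" using wuc by (simp add: wuc_def)
      then obtain C where C: "X.functional (\<lambda>f. \<zeta> n (ae_class M f)) C" using X.dual_functional by blast
      show ?thesis
      proof (rule bounded_linear_intro)
        show "\<xi> n (x + y) = \<xi> n x + \<xi> n y" for x y
          unfolding \<xi>_def Jl by (rule X.functionalD(1)[OF C J(1) J(1)])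
        show "\<xi> n (a *\<^sub>R x) = a *\<^sub>R \<xi> n x" for a x
          unfolding \<xi>_def Jl using X.functionalD(2)[OF C J(1)] by simp
        show "norm (\<xi> n x) \<le> norm x * (c * C)" for x
          using X.functionalD(3)[OF C J(1), of x] by (simp add: \<xi>_def J(2) algebra_simps)
      qed
    qed
    have sm: "summable (\<lambda>i. \<bar>\<xi> i x\<bar>)" for x unfolding \<xi>_def by (rule X.wuc_dual_pointwise[OF wuc J(1)])
    obtain C where C: "0 < C" "\<And>x N. (\<Sum>i<N. \<bar>\<xi> i x\<bar>) \<le> C * norm x"
      using summable_functionals_uniform[of \<xi>, OF bl sm] by blast
    have fn: "\<exists>D. type_rep.functional (\<xi> i) D" for i
    proof -
      have "\<xi> i \<in> vcarrier (dual type_space)" using bl by (simp add: vcarrier_dual_type_space)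
      then show ?thesis using type_rep.dual_functional[of "\<xi> i"] by blast
    qed
    then have "\<forall>i. \<exists>D. type_rep.functional (\<xi> i) D" by blast
    from choice[OF this] obtain D where D: "\<And>i. type_rep.functional (\<xi> i) (D i)" by blast
    have "wuc (dual type_space) (\<lambda>i. type_rep.lift (\<xi> i))"
      by (rule type_rep.wuc_lift[of \<xi> D C]) (use D C(2) in auto)
    moreover have "(\<lambda>i. type_rep.lift (\<xi> i)) = \<xi>" by (intro ext type_rep.lift_rep[OF D]) simp
    ultimately have "wuc (dual type_space) \<xi>" by simp
    then have "(\<lambda>n. SUP z\<in>K. ennreal \<bar>\<xi> n z\<bar>) \<longlonglongrightarrow> 0" using K by (simp add: Vstar_set_def)
    then show "(\<lambda>n. SUP z\<in>A. ennreal \<bar>\<zeta> n z\<bar>) \<longlonglongrightarrow> 0" by (simp add: A_def \<xi>_def image_image)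
  qed
  then have wc: "relatively_weakly_compact ?Z A" using VZ by (simp add: property_Vstar_def)
  have VK: "Vstar_set type_space ((\<lambda>x. x) ` K)" using K by simp
  obtain b where b: "\<And>x. x \<in> K \<Longrightarrow> norm x \<le> b" using type_rep.Vstar_bounded[OF VK] by auto
  have "relatively_weakly_compact type_space ((\<lambda>x. x) ` K)"
  proof (rule type_rep.relatively_weakly_compactI[OF _ type_rep_complete b])
    fix x :: "nat \<Rightarrow> 'x" assume x: "\<And>n. x n \<in> K"
    have "\<exists>F\<in>S. \<forall>n. \<forall>\<epsilon>>0. \<exists>h\<in>convex hull ((\<lambda>n. J (x n)) ` {n..}). q (h - F) < \<epsilon>"
    proof (rule X.cluster_convex[OF wc, of "\<lambda>n. J (x n)"])
      show "ae_class M (J (x n)) \<in> A" for n using x by (auto simp: A_def)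
      show "J (x n) \<in> S" for n by (rule J(1))
    qed blast
    then obtain F where F: "F \<in> S" "\<And>n \<epsilon>. 0 < \<epsilon> \<Longrightarrow> \<exists>h\<in>convex hull ((\<lambda>n. J (x n)) ` {n..}). q (h - F) < \<epsilon>" by blast
    have hullJ: "convex hull ((\<lambda>n. J (x n)) ` {n..}) = J ` (convex hull (x ` {n..}))" for n
      using convex_hull_linear_image[OF linJ, of "x ` {n..}"] by (simp add: image_image)
    have "\<forall>n. \<exists>y. y \<in> convex hull (x ` {n..}) \<and> q (J y - F) < (1/2)^n"
    proof
      fix n :: nat
      have "0 < (1/2::real)^n" by simp
      from F(2)[OF this, of n] show "\<exists>y. y \<in> convex hull (x ` {n..}) \<and> q (J y - F) < (1/2)^n"
        unfolding hullJ by blast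
    qed
    from choice[OF this] obtain y where y: "\<And>n. y n \<in> convex hull (x ` {n..})" "\<And>n. q (J (y n) - F) < (1/2)^n" by blast
    \<comment> \<open>\<open>F\<close> is never identified as a constant function; closeness of the
      \<open>J (y n)\<close> to it makes \<open>y\<close> a Cauchy sequence, and its limit serves
      instead.\<close>
    have d: "norm (y m - y n) * c \<le> (1/2)^m + (1/2)^n" for m n
    proof -
      have "norm (y m - y n) * c = q (J (y m) - J (y n))" by (simp add: J(2)[symmetric] Jl)
      also have "\<dots> \<le> q (J (y m) - F) + q (F - J (y n))" by (rule X.q_triangle[OF J(1) F(1) J(1)])
      also have "q (F - J (y n)) = q (J (y n) - F)" by (rule X.q_commute[OF F(1) J(1)])
      finally show ?thesis using y(2)[of m] y(2)[of n] by linarith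
    qed
    have small: "\<exists>N. \<forall>m\<ge>N. \<forall>n\<ge>N. norm (y m - y n) < e" if e: "0 < e" for e
    proof -
      obtain N where N: "(1/2::real)^N < e * c / 2" using real_arch_pow_inv[of "e * c / 2" "1/2"] e c(1) by auto
      have "norm (y m - y n) < e" if "N \<le> m" "N \<le> n" for m n
      proof -
        have "(1/2::real)^m \<le> (1/2)^N" "(1/2::real)^n \<le> (1/2)^N" using that by (auto intro!: power_decreasing)
        then have "norm (y m - y n) * c < e * c" using d[of m n] N by linarith
        then show ?thesis using c(1) by simp
      qed
      then show ?thesis by blast
    qed
    then have "Cauchy y" unfolding Cauchy_iff by blast
    then obtain z where z: "y \<longlonglongrightarrow> z" using Cauchy_convergent_iff convergent_def by blast
    have "\<exists>h\<in>convex hull (x ` {n..}). norm (h - z) < \<epsilon>" if \<epsilon>: "0 < \<epsilon>" for n \<epsilon>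
    proof -
      obtain N where N: "\<And>k. N \<le> k \<Longrightarrow> norm (y k - z) < \<epsilon>" using LIMSEQ_D[OF z \<epsilon>] by blast
      let ?k = "max n N"
      have "convex hull (x ` {?k..}) \<subseteq> convex hull (x ` {n..})" by (intro hull_mono image_mono) auto
      then show ?thesis using y(1)[of ?k] N[of ?k] by (intro bexI[of _ "y ?k"]) auto
    qed
    then show "\<exists>y\<in>UNIV. \<forall>n. \<forall>\<epsilon>>0. \<exists>h\<in>convex hull (x ` {n..}). norm (h - y) < \<epsilon>" by blast
  qed auto
  then show "relatively_weakly_compact type_space K" by simp
qed

end

theorem theorem2:
  fixes M :: "'w measure"
    and R :: "'e::banach_lattice \<Rightarrow> 'w \<Rightarrow> real"
  assumes "\<exists>u::'e. u \<noteq> 0"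
    and "\<exists>e::'e. weak_unit e"
    and "\<not> contains_copy_of (type_space :: 'e nspace) c0_space"
    and "prob_space M"
    and "function_lattice_representation M R"
  shows "property_Vstar (type_space :: 'x::banach nspace) \<longleftrightarrow>
         property_Vstar (vector_valued_space M R :: ('w \<Rightarrow> 'x) set nspace)"
proof -
  interpret prob_space M by fact
  interpret function_lattice M R by unfold_locales (use assms in auto)
  show ?thesis using property_Vstar_vector_valued property_Vstar_constants by blast
qed

end
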